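(* There is a one-to-one correspondence between the laws of $\mathcal{I}$-invariant orderings of $\mathbb{Z}$ and the type 2 shuffles. Under this bijection, for every probability measure $\theta$ on the set of quasi-uniform measures, the law of ordering $$\int\theta(d\mu)\,\mathbb{P}^\mu$$ corresponds to the kernel $$\int\theta(d\mu)\,\hat\nu^\mu .$$
   Context: **Orderings of $\mathbb{Z}$.** $\mathcal{O}$ is the set of all strict total orderings $\lhd$ of $\mathbb{Z}$, with the measurable structure inherited as a subset of $2^{\mathbb{Z}\times\mathbb{Z}}$. For strictly increasing $f:\mathbb{Z}\to\mathbb{Z}$, $\hat f:\mathcal{O}\to\mathcal{O}$ sends $\lhd$ to the ordering in which $m$ is less than $n$ iff $f(m)\lhd f(n)$. A probability measure $\mathbb{P}$ on $\mathcal{O}$ is $\mathcal{I}$-invariant (the law of an $\mathcal{I}$-invariant ordering) if $\mathbb{P}\circ\hat f^{-1}=\mathbb{P}$ for all strictly increasing $f$. **Quasi-uniform measures and conjugate pairs.** A probability measure $\mu$ on $[0,1]$ is quasi-uniform if $\mu\{x:\mu[0,x)\le x\le\mu[0,x]\}=1$. Every quasi-uniform $\mu$ can be written, uniquely up to labelling, as $\mu=\lambda_F+\sum_i m_i\delta_{x_i}$, where $F\subseteq[0,1]$ is closed with $0,1\in F$, $\lambda_F$ has density $1_F$ with respect to Lebesgue measure, the sum is over the open components $G_i$ of $[0,1]\setminus F$, $m_i$ is the length of $G_i$, and $x_i$ is either the left or the right endpoint of $G_i$. Let $y_i$ be the other endpoint of $G_i$. A conjugate pair $(X,Y)$ with $X$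 distributed according to $\mu$ is a pair with joint law $\int_F\delta_{(x,x)}\,dx+\sum_i m_i\delta_{(x_i,y_i)}$. The set of quasi-uniform measures carries the Borel $\sigma$-algebra of the weak topology. **The law $\mathbb{P}^\mu$.** For quasi-uniform $\mu$, let $(X_n,Y_n)_{n\in\mathbb{Z}}$ be independent conjugate pairs with each $X_n$ distributed according to $\mu$. For integers $m<n$ put $m\lhd n$ iff $X_m<X_n$, or $Y_m<Y_n$, or ($X_m=X_n$, $Y_m=Y_n$ and $X_m>Y_m$); otherwise $n\lhd m$. Almost surely this is a strict total ordering of $\mathbb{Z}$; its law is $\mathbb{P}^\mu$. **Orderings of $\mathbb{N}$.** $\mathbb{N}=\{1,2,\ldots\}$; $\tilde{\mathcal{O}}$ is the space of strict total orderings of $\mathbb{N}$ (with $\sigma$-algebra inherited from $2^{\mathbb{N}\times\mathbb{N}}$); $\lambda$ is the unique probability measure on $\tilde{\mathcal{O}}$ whose restriction to orderings of $\{1,\ldots,n\}$ is uniform for every $n$. For $\lhd\in\tilde{\mathcal{O}}$, $\lhd^{(n)}$ is its restriction to $\{1,\ldots,n\}$, identified with the permutation $\rho\in\mathcal{S}_n$ satisfying $k\lhd^{(n)}k'$ iff $\rho(k)<\rho(k')$. **The kernel $\hat\nu^\mu$.** For quasi-uniform $\mu$, let $(X,Y)$ be a conjugate pair with $X$ distributed according to $\mu$, let $U$ be uniform on $[0,1]$ and independent of $(X,Y)$, let $\nu_\mu$ be the law of $(U,UX+(1-U)Y)$, and let $\nu^\mu$ be the measure on $[0,1]^2$ given by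 $\nu^\mu(dx,dy)=\nu_\mu(dy,dx)$, i.e. the law of $(UX+(1-U)Y,U)$; both marginals are uniform. For a probability measure $\nu$ on $[0,1]^2$ with uniform marginals, $\hat\nu$ denotes the transition kernel on $\tilde{\mathcal{O}}$ obtained as follows: take i.i.d. pairs $(U_k,V_k)_{k\ge1}$ with law $\nu$, let $k\lhd k'$ iff $U_k<U_{k'}$ and $k\lhd'k'$ iff $V_k<V_{k'}$, and let $\hat\nu(\lhd,\cdot)$ be a regular conditional probability for $\lhd'$ given $\lhd$. Write $\hat\nu^\mu$ for the kernel obtained from $\nu=\nu^\mu$; in mixtures, versions jointly measurable in $(\mu,\lhd)$ are used. **Type 2 shuffles.** Consider a process $(\lhd_h;h=0,1,2,\ldots)$ with values in $\tilde{\mathcal{O}}$, each $\lhd_h$ distributed according to $\lambda$, such that for each $n$ the process $(\rho^{(n)}_h;h\ge0)$ of permutations in $\mathcal{S}_n$ identified with $(\lhd_h^{(n)};h\ge0)$ is a random walk on $\mathcal{S}_n$ started from the uniform law, i.e. $\rho^{(n)}_{h+1}=S^{(n)}_{h+1}\rho^{(n)}_h$ with $S^{(n)}_1,S^{(n)}_2,\ldots$ i.i.d. in $\mathcal{S}_n$ and independent of $\rho_0^{(n)}$. Such a process is Markov. It is of type 2 if, for every $m<n$ and every $h\ge1$, $\lhd^{(m)}_{h-1}$ is conditionally independent of $\lhd^{(n)}_h$ given $\lhd^{(m)}_h$. The transition kernel of a type 2 process is called a type 2 shuffle. Kernels on $\tilde{\mathcal{O}}$ that agree for $\lambda$-almost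 all $\lhd$ are identified. *)

theory Defs
  imports "HOL-Probability.Probability" "HOL-Combinatorics.Permutations"
begin

section \<open>Spaces of strict total orderings\<close>

definition orderings :: "'a set \<Rightarrow> 'a rel set" where
  "orderings A = {r. r \<subseteq> A \<times> A \<and> strict_linear_order_on A r}"

text \<open>The trace of the product sigma-algebra of \<open>2\<^bsup>A \<times> A\<^esup>\<close>. Here and below the measure
  carried by a bare measurable space is irrelevant.\<close>

definition ordering_space :: "'a set \<Rightarrow> 'a rel measure" where
  "ordering_space A =
     vimage_algebra (orderings A) (\<lambda>r. \<lambda>p\<in>A \<times> A. p \<in> r) (PiM (A \<times> A) (\<lambda>_. count_space UNIV))"

abbreviation Z_orderings :: "int rel measure" where
  "Z_orderings \<equiv> ordering_space UNIV"

abbreviation N_orderings :: "nat rel measure" where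
  "N_orderings \<equiv> ordering_space {1..}"

text \<open>Random relations that are orderings only almost surely are changed to the usual order on
  the exceptional null event, so that they become random elements of the space of orderings.\<close>

definition to_ordering :: "'a::linorder set \<Rightarrow> 'a rel \<Rightarrow> 'a rel" where
  "to_ordering A r = (if r \<in> orderings A then r else {(a, b) \<in> A \<times> A. a < b})"

definition hat_map :: "(int \<Rightarrow> int) \<Rightarrow> int rel \<Rightarrow> int rel" where
  "hat_map f r = {(m, n). (f m, f n) \<in> r}"

definition I_invariant :: "int rel measure \<Rightarrow> bool" where
  "I_invariant P \<longleftrightarrow> P \<in> space (prob_algebra Z_orderings) \<and>
     (\<forall>f. strict_mono f \<longrightarrow> distr P Z_orderings (hat_map f) = P)"

section \<open>Quasi-uniform measures and conjugate pairs\<close>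

definition unit_borel :: "real measure" where
  "unit_borel = restrict_space borel {0..1}"

definition unit_lebesgue :: "real measure" where
  "unit_lebesgue = restrict_space lborel {0..1}"

definition quasi_uniform :: "real measure \<Rightarrow> bool" where
  "quasi_uniform \<mu> \<longleftrightarrow> \<mu> \<in> space (prob_algebra unit_borel) \<and>
     measure \<mu> {x \<in> {0..1}. measure \<mu> {0..<x} \<le> x \<and> x \<le> measure \<mu> {0..x}} = 1"

definition weak_topology_QU :: "real measure topology" where
  "weak_topology_QU = topology_generated_by
     {{\<mu>. quasi_uniform \<mu> \<and> (\<integral>x. f x \<partial>\<mu>) \<in> U} | (f :: real \<Rightarrow> real) (U :: real set).
        continuous_on {0..1} f \<and> open U}"

definition QU_space :: "real measure measure" where
  "QU_space = sigma {\<mu>. quasi_uniform \<mu>} {V. openin weak_topology_QU V}"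

text \<open>\<open>\<mu> = \<lambda>\<^sub>F + \<Sum>\<^sub>i m\<^sub>i \<delta>(x\<^sub>i)\<close>, where the sum runs over the components \<open>G\<close> of \<open>[0,1] - F\<close>; as
  \<open>0\<close> and \<open>1\<close> belong to the closed set \<open>F\<close>, these are the open intervals from \<open>Inf G\<close> to
  \<open>Sup G\<close>. The function \<open>x\<close> selects an endpoint of each component.\<close>

definition qu_decomposition :: "real measure \<Rightarrow> real set \<Rightarrow> (real set \<Rightarrow> real) \<Rightarrow> bool" where
  "qu_decomposition \<mu> F x \<longleftrightarrow>
     F \<subseteq> {0..1} \<and> closed F \<and> 0 \<in> F \<and> 1 \<in> F \<and>
     (\<forall>G\<in>components ({0..1} - F). x G = Inf G \<or> x G = Sup G) \<and>
     sets \<mu> = sets unit_borel \<and>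
     (\<forall>A\<in>sets unit_borel. emeasure \<mu> A =
        emeasure (density unit_lebesgue (indicator F)) A +
        (\<integral>\<^sup>+G. ennreal (Sup G - Inf G) * indicator A (x G) \<partial>count_space (components ({0..1} - F))))"

definition other_endpoint :: "real set \<Rightarrow> real \<Rightarrow> real" where
  "other_endpoint G a = (if a = Inf G then Sup G else Inf G)"

definition conjugate_law_of :: "real set \<Rightarrow> (real set \<Rightarrow> real) \<Rightarrow> (real \<times> real) measure \<Rightarrow> bool" where
  "conjugate_law_of F x N \<longleftrightarrow>
     sets N = sets (unit_borel \<Otimes>\<^sub>M unit_borel) \<and>
     (\<forall>A\<in>sets (unit_borel \<Otimes>\<^sub>M unit_borel). emeasure N A =
        (\<integral>\<^sup>+t\<in>F. indicator A (t, t) \<partial>unit_lebesgue) +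
        (\<integral>\<^sup>+G. ennreal (Sup G - Inf G) * indicator A (x G, other_endpoint G (x G))
           \<partial>count_space (components ({0..1} - F))))"

definition conjugate_law :: "real measure \<Rightarrow> (real \<times> real) measure" where
  "conjugate_law \<mu> = (THE N. \<exists>F x. qu_decomposition \<mu> F x \<and> conjugate_law_of F x N)"

section \<open>The law of the ordering of the integers induced by a quasi-uniform measure\<close>

definition pair_less :: "real \<times> real \<Rightarrow> real \<times> real \<Rightarrow> bool" where
  "pair_less = (\<lambda>(x, y) (x', y'). x < x' \<or> y < y' \<or> (x = x' \<and> y = y' \<and> x > y))"

definition Z_relation :: "(int \<Rightarrow> real \<times> real) \<Rightarrow> int rel" where
  "Z_relation \<omega> = {(m, n). (m < n \<and> pair_less (\<omega> m) (\<omega> n)) \<or> (n < m \<and> \<not> pair_less (\<omega> n) (\<omega> m))}"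

definition P_mu :: "real measure \<Rightarrow> int rel measure" where
  "P_mu \<mu> = distr (PiM UNIV (\<lambda>_. conjugate_law \<mu>)) Z_orderings (\<lambda>\<omega>. to_ordering UNIV (Z_relation \<omega>))"

section \<open>Kernels on the orderings of the positive integers\<close>

definition restr :: "nat \<Rightarrow> nat rel \<Rightarrow> nat rel" where
  "restr n r = r \<inter> ({1..n} \<times> {1..n})"

definition uniform_ordering :: "nat rel measure" where
  "uniform_ordering = (THE L. L \<in> space (prob_algebra N_orderings) \<and>
     (\<forall>n. distr L (count_space (orderings {1..n})) (restr n) =
          uniform_count_measure (orderings {1..n})))"

definition is_kernel :: "(nat rel \<Rightarrow> nat rel measure) \<Rightarrow> bool" where
  "is_kernel K \<longleftrightarrow> K \<in> N_orderings \<rightarrow>\<^sub>M prob_algebra N_orderings"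

text \<open>Equality of kernels almost everywhere; its equivalence classes are the kernels up to
  identification.\<close>

definition kernel_eq :: "(nat rel \<Rightarrow> nat rel measure) rel" where
  "kernel_eq = {(K, K'). is_kernel K \<and> is_kernel K' \<and> (AE r in uniform_ordering. K r = K' r)}"

text \<open>\<open>K(T, \<cdot>)\<close> is a version of the conditional distribution of the random ordering \<open>Y\<close> given the
  random element \<open>X\<close> of \<open>E\<close>; here \<open>T\<close> is a random ordering which is a function of \<open>X\<close>.\<close>

definition conditional_kernel ::
  "'w measure \<Rightarrow> 'e measure \<Rightarrow> ('w \<Rightarrow> 'e) \<Rightarrow> ('w \<Rightarrow> nat rel) \<Rightarrow> ('w \<Rightarrow> nat rel) \<Rightarrow>
   (nat rel \<Rightarrow> nat rel measure) \<Rightarrow> bool" where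
  "conditional_kernel M E X T Y K \<longleftrightarrow> is_kernel K \<and>
     (\<forall>A\<in>sets N_orderings. AE \<omega> in M.
        real_cond_exp M (vimage_algebra (space M) X E) (indicator {\<omega>\<in>space M. Y \<omega> \<in> A}) \<omega> =
        measure (K (T \<omega>)) A)"

definition N_relation :: "(nat \<Rightarrow> real) \<Rightarrow> nat rel" where
  "N_relation u = {(k, k') \<in> {1..} \<times> {1..}. u k < u k'}"

definition is_hat_kernel :: "(real \<times> real) measure \<Rightarrow> (nat rel \<Rightarrow> nat rel measure) \<Rightarrow> bool" where
  "is_hat_kernel \<nu> K \<longleftrightarrow>
     (let M = PiM {1..} (\<lambda>_. \<nu>);
          R = (\<lambda>\<omega>. to_ordering {1..} (N_relation (\<lambda>k. fst (\<omega> k))));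
          R' = (\<lambda>\<omega>. to_ordering {1..} (N_relation (\<lambda>k. snd (\<omega> k))))
      in conditional_kernel M N_orderings R R R' K)"

definition nu_lower :: "real measure \<Rightarrow> (real \<times> real) measure" where
  "nu_lower \<mu> = distr (unit_lebesgue \<Otimes>\<^sub>M conjugate_law \<mu>) (unit_borel \<Otimes>\<^sub>M unit_borel)
     (\<lambda>(u, (x, y)). (u, u * x + (1 - u) * y))"

definition nu_upper :: "real measure \<Rightarrow> (real \<times> real) measure" where
  "nu_upper \<mu> = distr (nu_lower \<mu>) (unit_borel \<Otimes>\<^sub>M unit_borel) (\<lambda>(x, y). (y, x))"

definition jointly_measurable_version :: "(real measure \<Rightarrow> nat rel \<Rightarrow> nat rel measure) \<Rightarrow> bool" where
  "jointly_measurable_version \<kappa> \<longleftrightarrow>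
     (\<lambda>(\<mu>, r). \<kappa> \<mu> r) \<in> QU_space \<Otimes>\<^sub>M N_orderings \<rightarrow>\<^sub>M prob_algebra N_orderings \<and>
     (\<forall>\<mu>. quasi_uniform \<mu> \<longrightarrow> is_hat_kernel (nu_upper \<mu>) (\<kappa> \<mu>))"

section \<open>Type 2 shuffles\<close>

definition perm_of :: "nat \<Rightarrow> nat rel \<Rightarrow> nat \<Rightarrow> nat" where
  "perm_of n r = (THE \<rho>. \<rho> permutes {1..n} \<and>
     (\<forall>k\<in>{1..n}. \<forall>k'\<in>{1..n}. (k, k') \<in> restr n r \<longleftrightarrow> \<rho> k < \<rho> k'))"

text \<open>The initial permutation and the steps \<open>S 1, S 2, \<dots>\<close> form one independent family, with the
  initial permutation at index \<open>0\<close>.\<close>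

definition random_walk_on_perms :: "nat \<Rightarrow> 'w measure \<Rightarrow> (nat \<Rightarrow> 'w \<Rightarrow> nat \<Rightarrow> nat) \<Rightarrow> bool" where
  "random_walk_on_perms n M \<rho> \<longleftrightarrow>
     (let Sn = {p. p permutes {1..n}} in
      distr M (count_space Sn) (\<rho> 0) = uniform_count_measure Sn \<and>
      (\<exists>S :: nat \<Rightarrow> 'w \<Rightarrow> nat \<Rightarrow> nat.
         prob_space.indep_vars M (\<lambda>_. count_space Sn) (\<lambda>h. if h = 0 then \<rho> 0 else S h) UNIV \<and>
         (\<forall>h\<ge>1. distr M (count_space Sn) (S h) = distr M (count_space Sn) (S 1)) \<and>
         (\<forall>h. \<forall>\<omega>\<in>space M. \<rho> (Suc h) \<omega> = S (Suc h) \<omega> \<circ> \<rho> h \<omega>)))"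

definition shuffle_process :: "'w measure \<Rightarrow> (nat \<Rightarrow> 'w \<Rightarrow> nat rel) \<Rightarrow> bool" where
  "shuffle_process M L \<longleftrightarrow> prob_space M \<and>
     (\<forall>h. L h \<in> M \<rightarrow>\<^sub>M N_orderings \<and> distr M N_orderings (L h) = uniform_ordering) \<and>
     (\<forall>n. random_walk_on_perms n M (\<lambda>h \<omega>. perm_of n (L h \<omega>)))"

text \<open>Conditional independence of discrete random elements, given through elementary conditional
  probabilities; conditioning on a null event yields \<open>0 = 0\<close>.\<close>

definition type2_process :: "'w measure \<Rightarrow> (nat \<Rightarrow> 'w \<Rightarrow> nat rel) \<Rightarrow> bool" where
  "type2_process M L \<longleftrightarrow> shuffle_process M L \<and>
     (\<forall>m n h a b c. m < n \<longrightarrow> h \<ge> 1 \<longrightarrow>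
        \<P>(\<omega> in M. restr m (L (h - 1) \<omega>) = a \<and> restr n (L h \<omega>) = b \<bar> restr m (L h \<omega>) = c) =
        \<P>(\<omega> in M. restr m (L (h - 1) \<omega>) = a \<bar> restr m (L h \<omega>) = c) *
        \<P>(\<omega> in M. restr n (L h \<omega>) = b \<bar> restr m (L h \<omega>) = c))"

definition transition_kernel ::
  "'w measure \<Rightarrow> (nat \<Rightarrow> 'w \<Rightarrow> nat rel) \<Rightarrow> (nat rel \<Rightarrow> nat rel measure) \<Rightarrow> bool" where
  "transition_kernel M L K \<longleftrightarrow>
     (\<forall>h. conditional_kernel M (PiM {..h} (\<lambda>_. N_orderings)) (\<lambda>\<omega>. \<lambda>i\<in>{..h}. L i \<omega>)
            (L h) (L (Suc h)) K)"

text \<open>Only the law of the process matters, so the underlying probability space may be taken to live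
  on the type of paths.\<close>

definition type2_shuffle :: "(nat rel \<Rightarrow> nat rel measure) \<Rightarrow> bool" where
  "type2_shuffle K \<longleftrightarrow> (\<exists>(M :: (nat \<Rightarrow> nat rel) measure) L. type2_process M L \<and> transition_kernel M L K)"

end

theory Submission
 imports Defs
begin

text \<open>Invariant orderings of the integers and type 2 shuffles are both encoded by the same data: families of
  laws on the symmetric groups that are compatible under restriction. An invariant ordering yields the laws of its
  restrictions to initial segments, a shuffle the laws of its steps, and the type 2 property is the
  compatibility condition; conversely, a compatible family determines a process by running it backwards in time.
  For a quasi-uniform measure, the points \<open>U X + (1 - U) Y\<close> with indices arranged in the order of \<open>U\<close> are
  ordered exactly as the conjugate pairs \<open>(X, Y)\<close> order the integers, so both constructions yield the same family.
  A jointly measurable version of the kernels exists because independent uniform variables are recovered from their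
  relative order by the law of large numbers.\<close>

section \<open>Projective limits of discrete distributions\<close>

text \<open>A step multiplies the rank permutation on the left. So if the ordering at time
  \<open>h + 1\<close> has ranks \<beta>, the one at time \<open>h\<close> has ranks \<tau> \<circ>
  \<beta>, where \<tau> is the inverse of the step. Its restriction to \<open>{1..m}\<close> reads
  \<tau> at the places \<beta> 1, ..., \<beta> m only, and these can be any m distinct places.
  Compatibility of the backward steps therefore says that \<tau>, pulled back along any increasing
  injection of \<open>{1..m}\<close> into \<open>{1..n}\<close>, has the law belonging to m. For an
  ordering of the integers this is invariance under increasing maps. Hence \<open>step\<close>,
  \<open>consistent\<close> and \<open>path_law\<close> run from the later time to the earlier one,
  and the families consist of laws of inverse steps. Kernels matter up to null sets only. They are
  compared through their integrals over cells, the sets of orderings with a given restriction to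
  \<open>{1..n}\<close>: cells form a countable generating class closed under intersection, so
  finite restrictions decide every identity of measures. \<open>corresponds\<close> ties a family to
  a kernel in this way.\<close>

lemma (in Ionescu_Tulcea) emeasure_lim_atMost:
 assumes "A \<in> sets (PiM {0..<n} M)"
 shows "emeasure PF.lim {x\<in>space PF.lim. restrict x {0..<n} \<in> A} = emeasure (C 0 n (%x. undefined)) A"
proof -
 have "emeasure PF.lim {x\<in>space PF.lim. restrict x {0..<n} \<in> A} =
   emeasure (distr PF.lim (PiM {0..<n} M) (%x. restrict x {0..<n})) A"
  using assms by (subst emeasure_distr)
   (auto intro!: arg_cong2[where f=emeasure] measurable_restrict_subset simp: measurable_cong_sets[OF PF.sets_lim refl])
 also have "... = emeasure (CI {0..<n}) A"
  by (subst distr_lim) auto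
 also have "... = emeasure (C 0 n (%x. undefined)) A"
  using assms sets.sets_into_space[OF assms]
  by (subst emeasure_CI[of _ n]) (auto simp: prod_emb_def space_PiM intro!: arg_cong2[where f=emeasure])
 finally show ?thesis .
qed

text \<open>The sequence is a Markov chain that climbs the tower: given \<open>x n\<close>, the next
  entry is drawn from \<open>p (Suc n)\<close> conditioned on being projected to \<open>x n\<close>.
  By compatibility the normaliser of this conditioning is \<open>pmf (p n) (x n)\<close>, so the
  factors cancel and the n-th entry has law \<open>p n\<close>.\<close>

lemma projective_limit_pmf:
 fixes p :: "nat => 'd pmf" and \<pi> :: "nat => 'd => 'd"
 assumes proj: "\<And>n. map_pmf (\<pi> n) (p (Suc n)) = p n"
 obtains M :: "(nat => 'd) measure"
 where "prob_space M" "sets M = sets (PiM UNIV (%_. count_space UNIV))"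
  "\<And>n. AE x in M. x n = \<pi> n (x (Suc n))"
  "\<And>n d. measure M {x. x n = d} = pmf (p n) d"
proof -
 \<comment> \<open>Off the support of \<open>p (i - 1)\<close> the conditional law is undefined;
   \<open>p 0\<close> is a filler that keeps every kernel a probability measure.\<close>
 define P where "P i \<omega> = measure_pmf (if i = 0 then p 0 else
   if \<omega> (i - 1) \<in> set_pmf (p (i - 1)) then cond_pmf (p i) {y. \<pi> (i - 1) y = \<omega> (i - 1)} else p 0)" for i \<omega>
 let ?S = "%_::nat. count_space (UNIV :: 'd set)"
 have meas: "P i \<in> measurable (PiM {0..<i} ?S) (subprob_algebra (count_space UNIV))" for i
 proof (cases i)
  case 0
  show ?thesis unfolding 0
   by (rule measurable_cong[THEN iffD2, OF _ measurable_const[of "measure_pmf (p 0)"]])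
    (auto simp: P_def measure_pmf_in_subprob_algebra)
 next
  case (Suc k)
  have "(%y. measure_pmf (if y \<in> set_pmf (p k) then cond_pmf (p i) {z. \<pi> k z = y} else p 0))
    \<in> count_space UNIV \<rightarrow>\<^sub>M subprob_algebra (count_space UNIV)"
   by (auto simp: measure_pmf_in_subprob_algebra)
  moreover have "(%\<omega>. \<omega> k) \<in> PiM {0..<i} ?S \<rightarrow>\<^sub>M count_space UNIV"
   by (rule measurable_component_singleton) (simp add: Suc)
  ultimately have "(%\<omega>. measure_pmf (if \<omega> k \<in> set_pmf (p k) then cond_pmf (p i) {z. \<pi> k z = \<omega> k} else p 0))
    \<in> PiM {0..<i} ?S \<rightarrow>\<^sub>M subprob_algebra (count_space UNIV)"
   by (rule measurable_compose[rotated])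
  moreover have "P i = (%\<omega>. measure_pmf (if \<omega> k \<in> set_pmf (p k) then cond_pmf (p i) {z. \<pi> k z = \<omega> k} else p 0))"
   unfolding P_def by (rule ext) (simp add: Suc)
  ultimately show ?thesis by (simp only:)
 qed
 interpret IT: Ionescu_Tulcea P ?S
 proof (rule Ionescu_Tulcea.intro)
  show "P i \<in> measurable (PiM {0..<i} ?S) (subprob_algebra (count_space UNIV))" for i by (rule meas)
  show "prob_space (P i x)" for i x unfolding P_def by (rule measure_pmf.prob_space_axioms)
 qed
 have pos: "measure (p (Suc n)) {y. \<pi> n y = d} = pmf (p n) d" for n d
  unfolding proj[of n, symmetric] by (simp add: pmf_map vimage_def)
 have ne: "set_pmf (p (Suc n)) \<inter> {y. \<pi> n y = d} ~= {}" if "d \<in> set_pmf (p n)" for n d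
  using that unfolding proj[of n, symmetric] by auto
 \<comment> \<open>\<open>path n d\<close> is the history of \<open>d\<close>: its successive
   projections down to index 0. The last entry determines the history, so the partial laws need to
   be known on the atoms \<open>A n d\<close> only.\<close>
 define path where "path = rec_nat (%d _. d) (%n f d. (f (\<pi> n d))(Suc n := d))"
 have path: "path 0 d = (%_. d)" "path (Suc n) d = (path n (\<pi> n d))(Suc n := d)" for n d
  by (auto simp: path_def)
 have path_last: "path n d n = d" for n d by (cases n) (auto simp: path)
 define A where "A n d = {x \<in> space (PiM {0..<Suc n} ?S). \<forall>i\<le>n. x i = path n d i}" for n d
 have A[measurable]: "A n d \<in> sets (PiM {0..<Suc n} ?S)" for n d
 proof -
  have "A n d = (\<Inter>i\<in>{..n}. {x \<in> space (PiM {0..<Suc n} ?S). x i = path n d i})"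
   by (auto simp: A_def)
  also have "... \<in> sets (PiM {0..<Suc n} ?S)"
   by (intro sets.finite_INT) (auto intro!: sets_Collect_single')
  finally show ?thesis .
 qed
 have main: "emeasure (IT.C 0 (Suc n) (%_. undefined)) (A n d) = pmf (p n) d" for n d
 proof (induction n arbitrary: d)
  case 0
  have "emeasure (IT.C 0 (Suc 0) (%_. undefined)) (A 0 d) = emeasure (IT.eP 0 (%_. undefined)) (A 0 d)"
   using bind_return[OF IT.measurable_eP[of 0], of "%_. undefined"] by (simp add: space_PiM)
  also have "... = emeasure (P 0 (%_. undefined)) {d}"
   by (subst IT.emeasure_eP) (auto simp: A_def space_PiM path fun_upd_def extensional_def
     split: if_splits intro!: arg_cong2[where f=emeasure])
  also have "... = pmf (p 0) d"
   by (simp add: P_def emeasure_pmf_single)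
  finally show ?case .
 next
  case (Suc n)
  let ?C = "IT.C 0 (Suc n) (%_. undefined)"
  have sp: "space ?C = space (PiM {0..<Suc n} ?S)" and st: "sets ?C = sets (PiM {0..<Suc n} ?S)"
   using IT.space_C[of "%_. undefined" 0 "Suc n"] IT.sets_C[of "%_. undefined" 0 "Suc n"] 
   by (auto simp: space_PiM)
  have un: "(%_. undefined) \<in> space (PiM {0..<0} ?S)" by (simp add: space_PiM)
  have step: "emeasure (IT.eP (Suc n) \<omega>) (A (Suc n) d)
    = ennreal (pmf (if \<pi> n d \<in> set_pmf (p n) then cond_pmf (p (Suc n)) {y. \<pi> n y = \<pi> n d} else p 0) d)
     * indicator (A n (\<pi> n d)) \<omega>" if w: "\<omega> \<in> space (PiM {0..<Suc n} ?S)" for \<omega>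
  proof -
   have eq: "fun_upd \<omega> (Suc n) -` A (Suc n) d = (if \<omega> \<in> A n (\<pi> n d) then {d} else {})"
    using w by (auto simp: A_def path space_PiM PiE_iff extensional_def le_Suc_eq)
   show ?thesis
   proof (cases "\<omega> \<in> A n (\<pi> n d)")
    case False
    then show ?thesis using w by (subst IT.emeasure_eP) (auto simp: eq)
   next
    case True
    then have wn: "\<omega> n = \<pi> n d" by (auto simp: A_def path_last)
    have "emeasure (IT.eP (Suc n) \<omega>) (A (Suc n) d) = emeasure (P (Suc n) \<omega>) {d}"
     using w True by (subst IT.emeasure_eP) (auto simp: eq)
    then show ?thesis using True by (auto simp: P_def wn emeasure_pmf_single)
   qed
  qed
  have "emeasure (IT.C 0 (Suc (Suc n)) (%_. undefined)) (A (Suc n) d)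
    = (\<integral>\<^sup>+\<omega>. emeasure (IT.eP (Suc n) \<omega>) (A (Suc n) d) \<partial>?C)"
   using IT.measurable_eP[of "Suc n"] IT.prob_space_C[OF un, of "Suc n"]
   by (subst IT.C.simps, subst emeasure_bind[where N="PiM {0..<Suc (Suc n)} ?S"])
    (auto simp: prob_space.not_empty measurable_cong_sets[OF st refl] simp del: IT.C.simps)
  also have "... = (\<integral>\<^sup>+\<omega>. ennreal (pmf (if \<pi> n d \<in> set_pmf (p n) then cond_pmf (p (Suc n)) {y. \<pi> n y = \<pi> n d} else p 0) d)
     * indicator (A n (\<pi> n d)) \<omega> \<partial>?C)"
   by (intro nn_integral_cong step) (simp add: sp del: IT.C.simps)
  also have "... = ennreal (pmf (if \<pi> n d \<in> set_pmf (p n) then cond_pmf (p (Suc n)) {y. \<pi> n y = \<pi> n d} else p 0) d)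
    * pmf (p n) (\<pi> n d)"
   by (subst nn_integral_cmult_indicator) (simp_all only: st A Suc)
  also have "... = pmf (p (Suc n)) d"
  proof (cases "\<pi> n d \<in> set_pmf (p n)")
   case True
   then have "pmf (p n) (\<pi> n d) ~= 0" by (simp add: pmf_eq_0_set_pmf)
   then show ?thesis using True
    by (simp add: pmf_cond[OF ne] pos ennreal_mult''[symmetric])
  next
   case False
   then have "d \<notin> set_pmf (p (Suc n))" unfolding proj[of n, symmetric] by auto
   then show ?thesis using False by (simp add: pmf_eq_0_set_pmf[THEN iffD2])
  qed
  finally show ?case .
 qed
 have PS: "prob_space IT.PF.lim"
 proof
  have "emeasure IT.PF.lim {x\<in>space IT.PF.lim. restrict x {0..<0} \<in> space (PiM {0..<0} ?S)} = 1"
   by (subst IT.emeasure_lim_atMost)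
    (auto intro!: emeasure_return simp: space_PiM sets_PiM_empty)
  also have "{x\<in>space IT.PF.lim. restrict x {0..<0} \<in> space (PiM {0..<0} ?S)} = space IT.PF.lim"
   by (auto simp: space_PiM)
  finally show "emeasure IT.PF.lim (space IT.PF.lim) = 1" .
 qed
 interpret L: prob_space IT.PF.lim by fact
 have sp: "space IT.PF.lim = UNIV" by (simp add: space_PiM)
 have B: "measure IT.PF.lim {x. \<forall>i\<le>n. x i = path n d i} = pmf (p n) d"
  "{x. \<forall>i\<le>n. x i = path n d i} \<in> sets IT.PF.lim" for n d
 proof -
  have eq: "{x. \<forall>i\<le>n. x i = path n d i} = {x \<in> space IT.PF.lim. restrict x {0..<Suc n} \<in> A n d}"
   unfolding sp by (auto simp: A_def space_PiM)
  have "emeasure IT.PF.lim {x. \<forall>i\<le>n. x i = path n d i} = pmf (p n) d"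
   unfolding eq by (subst IT.emeasure_lim_atMost) (auto simp: main simp del: IT.C.simps)
  then show "measure IT.PF.lim {x. \<forall>i\<le>n. x i = path n d i} = pmf (p n) d"
   by (simp add: measure_def)
  have "(%x. restrict x {0..<Suc n}) \<in> IT.PF.lim \<rightarrow>\<^sub>M PiM {0..<Suc n} ?S"
   by (subst measurable_cong_sets[OF IT.PF.sets_lim refl]) (rule measurable_restrict_subset, simp)
  from measurable_sets[OF this A[of n d]]
  show "{x. \<forall>i\<le>n. x i = path n d i} \<in> sets IT.PF.lim" 
   unfolding eq by (simp add: vimage_def Int_def conj_commute)
 qed
 \<comment> \<open>The support of \<open>p n\<close> is countable and the histories of its points
   have total mass 1, so almost every sequence follows such a history up to
   \<open>n\<close>.\<close>
 have AEp: "AE x in IT.PF.lim. \<exists>d. \<forall>i\<le>n. x i = path n d i" for n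
 proof -
  let ?X = "%d. {x. \<forall>i\<le>n. x i = path n d i}"
  have "emeasure IT.PF.lim (\<Union>d\<in>set_pmf (p n). ?X d) = (\<integral>\<^sup>+d. emeasure IT.PF.lim (?X d) \<partial>count_space (set_pmf (p n)))"
  proof (rule emeasure_UN_countable)
   show "disjoint_family_on ?X (set_pmf (p n))"
    unfolding disjoint_family_on_def using path_last by fastforce
  qed (rule B(2), rule countable_set_pmf)
  also have "... = (\<integral>\<^sup>+d. pmf (p n) d \<partial>count_space (set_pmf (p n)))"
   by (simp add: L.emeasure_eq_measure B)
  also have "... = 1"
   by (subst nn_integral_pmf) (simp add: measure_pmf.emeasure_eq_measure measure_pmf.prob_eq_1 AE_measure_pmf)
  finally have "AE x in IT.PF.lim. x \<in> (\<Union>d\<in>set_pmf (p n). ?X d)"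
   by (intro L.AE_prob_1) (simp add: L.emeasure_eq_measure)
  then show ?thesis by eventually_elim auto
 qed
 show ?thesis
 proof
  show "prob_space IT.PF.lim" "sets IT.PF.lim = sets (PiM UNIV ?S)" by (auto simp: PS)
  show "AE x in IT.PF.lim. x n = \<pi> n (x (Suc n))" for n
   using AEp[of "Suc n"]
  proof eventually_elim
   case (elim x)
   then obtain d where d: "\<forall>i\<le>Suc n. x i = path (Suc n) d i" by blast
   then have "x (Suc n) = d" "x n = path n (\<pi> n d) n" by (auto simp: path)
   then show ?case by (simp add: path_last)
  qed
  show "measure IT.PF.lim {x. x n = d} = pmf (p n) d" for n d
  proof -
   have "measure IT.PF.lim {x. x n = d} = measure IT.PF.lim {x. \<forall>i\<le>n. x i = path n d i}"
   proof (rule L.finite_measure_eq_AE)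
    show "AE x in IT.PF.lim. (x \<in> {x. x n = d}) = (x \<in> {x. \<forall>i\<le>n. x i = path n d i})"
     using AEp[of n] by eventually_elim (auto simp: path_last)
    show "{x. x n = d} \<in> sets IT.PF.lim"
     using measurable_sets[OF measurable_component_singleton[of n UNIV ?S], of "{d}"]
     by (simp add: space_PiM vimage_def)
   qed (rule B)
   then show ?thesis by (simp add: B)
  qed
 qed
qed

section \<open>Spaces generated by a sequence of finite-valued maps\<close>

text \<open>A sigma-algebra generated by a refining sequence of finite partitions, the level sets of
  \<open>c n\<close>, starting from the trivial one. Two cells are nested or disjoint, so they form
  a pi-system: finite measures and measurable maps into the space can be tested on cells.\<close>

definition filtered :: "'e measure => (nat => 'e => 'd) => bool" where
 "filtered E c \<longleftrightarrow> sets E = sigma_sets (space E) {{x\<in>space E. c n x = d} | n d. True} \<and>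
  (\<forall>n. finite (c n ` space E)) & (\<forall>x\<in>space E. \<forall>y\<in>space E. c 0 x = c 0 y) \<and>
  (\<forall>n m. n <= m --> (\<forall>x\<in>space E. \<forall>y\<in>space E. c m x = c m y --> c n x = c n y))"

text \<open>The empty set is included so that the intersection of two disjoint cells stays in the
  family.\<close>

definition cells :: "'e measure => (nat => 'e => 'd) => 'e set set" where
 "cells E c = insert {} {{x\<in>space E. c n x = d} | n d. True}"

lemma filtered_mono:
 "filtered E c ==> n <= m ==> x \<in> space E ==> y \<in> space E ==> c m x = c m y ==> c n x = c n y"
 unfolding filtered_def by blast

lemma filtered_zero: "filtered E c ==> x \<in> space E ==> y \<in> space E ==> c 0 x = c 0 y"
 unfolding filtered_def by blast

lemma filtered_finite: "filtered E c ==> finite (c n ` space E)"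
 unfolding filtered_def by blast

lemma cells_sub: "cells E c \<subseteq> Pow (space E)"
 by (auto simp: cells_def)

lemma sets_filtered: assumes "filtered E c" shows "sets E = sigma_sets (space E) (cells E c)"
proof -
 have "sigma_sets (space E) (insert {} {{x\<in>space E. c n x = d} | n d. True}) = 
  sigma_sets (space E) {{x\<in>space E. c n x = d} | n d. True}" 
  by (intro sigma_sets_eqI) (auto intro: sigma_sets.intros)
 with assms show ?thesis by (simp add: filtered_def cells_def)
qed

lemma cell_in_sets: "filtered E c ==> {x\<in>space E. c n x = d} \<in> sets E"
 by (subst sets_filtered) (auto simp: cells_def)

lemma Int_stable_cells: assumes f: "filtered E c" shows "Int_stable (cells E c)"
proof -
 have *: "{x\<in>space E. c n x = d} \<inter> {x\<in>space E. c m x = d'} \<in> cells E c" if "n <= m" for n m d d'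
 proof (cases "\<exists>x\<in>space E. c n x = d & c m x = d'")
  case True
  then obtain x where x: "x \<in> space E" "c n x = d" "c m x = d'" by blast
  have "c n y = d" if "y \<in> space E" "c m y = d'" for y
   using filtered_mono[OF f \<open>n <= m\<close> that(1) x(1)] that(2) x by simp
  then have "{x\<in>space E. c n x = d} \<inter> {x\<in>space E. c m x = d'} = {x\<in>space E. c m x = d'}"
   by blast
  then show ?thesis by (auto simp: cells_def)
 qed (auto simp: cells_def)
 have **: "{x\<in>space E. c n x = d} \<inter> {x\<in>space E. c m x = d'} \<in> cells E c" for n m d d'
 proof (cases "n <= m")
  case False
  then show ?thesis using *[of m n d' d] by (subst Int_commute) simp
 qed (rule *)
 show ?thesis
 proof (rule Int_stableI)
  fix X Y assume XY: "X \<in> cells E c" "Y \<in> cells E c"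
  show "X \<inter> Y \<in> cells E c"
  proof (cases "X = {} \<or> Y = {}")
   case True
   then show ?thesis by (auto simp: cells_def)
  next
   case False
   then obtain n d m d' where "X = {x\<in>space E. c n x = d}" "Y = {x\<in>space E. c m x = d'}"
    using XY unfolding cells_def by blast
   then show ?thesis using **[of n d m d'] by simp
  qed
 qed
qed

lemma filtered_space_cell: 
 assumes "filtered E c" "x0 \<in> space E" shows "{x\<in>space E. c 0 x = c 0 x0} = space E"
proof -
 have "\<forall>x\<in>space E. \<forall>y\<in>space E. c 0 x = c 0 y" using assms(1) unfolding filtered_def by blast
 then have "c 0 x = c 0 x0" if "x \<in> space E" for x using that assms(2) by blast
 then show ?thesis by blast
qed

lemma measure_eq_filtered:
 assumes f: "filtered E c" and s: "sets M = sets E" "sets N = sets E"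
  and fin: "finite_measure M" 
  and eq: "\<And>n x. x \<in> space E ==> emeasure M {y\<in>space E. c n y = c n x} = emeasure N {y\<in>space E. c n y = c n x}"
 shows "M = N"
proof (cases "space E = {}")
 case True
 show ?thesis
 proof (rule measure_eqI)
  fix X assume "X \<in> sets M"
  then have "X = {}" using sets.sets_into_space[of X E] True s(1) by simp
  then show "emeasure M X = emeasure N X" by simp
 qed (simp add: s)
next
 case False
 then obtain x0 where x0: "x0 \<in> space E" by auto
 interpret finite_measure M by fact
 show ?thesis
 proof (rule measure_eqI_generator_eq[OF Int_stable_cells[OF f] cells_sub, where A="%_. space E"])
  fix X assume "X \<in> cells E c"
  then consider "X = {}" | n d where "X = {x\<in>space E. c n x = d}" by (auto simp: cells_def)
  then show "emeasure M X = emeasure N X"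
  proof cases
   case 2
   show ?thesis
   proof (cases "X = {}")
    case False
    then obtain x where "x \<in> space E" "c n x = d" using 2 by auto
    with eq[of x n] 2 show ?thesis by simp
   qed simp
  qed simp
 next
  show "sets M = sigma_sets (space E) (cells E c)" "sets N = sigma_sets (space E) (cells E c)"
   using s sets_filtered[OF f] by auto
  show "range (%_::nat. space E) \<subseteq> cells E c"
   using filtered_space_cell[OF f x0] unfolding cells_def by blast
  show "(\<Union>i::nat. space E) = space E" by simp
  show "emeasure M (space E) ~= \<infinity>" for i :: nat by simp
 qed
qed

text \<open>The second assumption is generation in a form convenient to check: every sigma-algebra
  on the same space that contains the level sets contains that of \<open>E\<close>. In applications
  this is measurability of the identity.\<close>

lemma filteredI:
 assumes "\<And>n d. {x\<in>space E. c n x = d} \<in> sets E"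
  and "\<And>N. space N = space E ==> (\<And>n d. {x\<in>space N. c n x = d} \<in> sets N) ==> sets E \<subseteq> sets (N :: 'e measure)"
  and "\<And>n. finite (c n ` space E)" 
  and "\<And>x y. x \<in> space E ==> y \<in> space E ==> c 0 x = c 0 y"
  and "\<And>n m x y. n <= m ==> x \<in> space E ==> y \<in> space E ==> c m x = c m y ==> c n x = c n y"
 shows "filtered (E :: 'e measure) c"
proof -
 let ?N = "sigma (space E) {{x\<in>space E. c n x = d} | n d. True}"
 have sp: "space ?N = space E" by (rule space_measure_of) auto
 have "sets E \<subseteq> sets ?N"
 proof (rule assms(2)[OF sp])
  show "{x\<in>space ?N. c n x = d} \<in> sets ?N" for n d
   unfolding sp by (subst sets_measure_of) (auto intro!: sigma_sets.Basic)
 qed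
 also have "sets ?N = sigma_sets (space E) {{x\<in>space E. c n x = d} | n d. True}" by (rule sets_measure_of) auto
 finally have "sets E = sigma_sets (space E) {{x\<in>space E. c n x = d} | n d. True}"
  using assms(1) by (intro antisym sets.sigma_sets_subset) auto
 with assms(3-5) show ?thesis unfolding filtered_def by blast
qed

lemma finite_valued_measurable:
 assumes "finite (c ` space N)" "\<And>d. {x\<in>space N. c x = d} \<in> sets N"
 shows "c \<in> N \<rightarrow>\<^sub>M count_space UNIV"
proof (rule measurableI)
 fix A
 have "c -` A \<inter> space N = (\<Union>d\<in>c ` space N \<inter> A. {x\<in>space N. c x = d})" by auto
 also have "... \<in> sets N" using assms by (intro sets.finite_UN) auto
 finally show "c -` A \<inter> space N \<in> sets N" .
qed simp

lemma filtered_measurable: "filtered E c ==> c n \<in> E \<rightarrow>\<^sub>M count_space UNIV"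
 by (rule finite_valued_measurable) (auto simp: filtered_finite cell_in_sets)

lemma measurable_into_filtered:
 assumes f: "filtered E c" "g \<in> space N \<rightarrow> space E" and g: "\<And>n d. {x\<in>space N. c n (g x) = d} \<in> sets N"
 shows "g \<in> N \<rightarrow>\<^sub>M E"
proof (rule measurable_sigma_sets[OF sets_filtered[OF f(1)] cells_sub f(2)])
 fix A assume "A \<in> cells E c"
 then consider "A = {}" | n d where "A = {x\<in>space E. c n x = d}" by (auto simp: cells_def)
 then show "g -` A \<inter> space N \<in> sets N"
 proof cases
  case 2
  then have "g -` A \<inter> space N = {x\<in>space N. c n (g x) = d}" using f(2) by auto
  with g show ?thesis by simp
 qed simp
qed

lemma sets_le_measurable_id:
 assumes "(%x. x) \<in> N \<rightarrow>\<^sub>M E" "space N = space E" shows "sets E \<subseteq> sets N"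
proof
 fix A assume A: "A \<in> sets E"
 have "(%x. x) -` A \<inter> space N = A" using sets.sets_into_space[OF A] assms(2) by auto
 with measurable_sets[OF assms(1) A] show "A \<in> sets N" by simp
qed

lemma filtered_pair:
 assumes E: "filtered E c" and F: "filtered F d"
 shows "filtered (E \<Otimes>\<^sub>M F) (%n (x, y). (c n x, d n y))"
proof (rule filteredI)
 have *: "{x \<in> space (E \<Otimes>\<^sub>M F). (case x of (x, y) => (c n x, d n y)) = z} =
  {x\<in>space E. c n x = fst z} \<times> {y\<in>space F. d n y = snd z}" for n z
  by (auto simp: space_pair_measure)
 show "{x \<in> space (E \<Otimes>\<^sub>M F). (case x of (x, y) => (c n x, d n y)) = z} \<in> sets (E \<Otimes>\<^sub>M F)" for n z
  unfolding * by (intro pair_measureI cell_in_sets E F)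
 show "finite ((%(x, y). (c n x, d n y)) ` space (E \<Otimes>\<^sub>M F))" for n
  by (rule finite_subset[of _ "c n ` space E \<times> d n ` space F"])
   (auto simp: space_pair_measure filtered_finite E F)
 show "(case x of (x, y) => (c 0 x, d 0 y)) = (case y of (x, y) => (c 0 x, d 0 y))"
  if "x \<in> space (E \<Otimes>\<^sub>M F)" "y \<in> space (E \<Otimes>\<^sub>M F)" for x y
  using that filtered_zero[OF E, of "fst x" "fst y"] filtered_zero[OF F, of "snd x" "snd y"]
  by (simp add: space_pair_measure split_beta' mem_Times_iff)
 show "(case x of (x, y) => (c n x, d n y)) = (case y of (x, y) => (c n x, d n y))"
  if "n <= m" "x \<in> space (E \<Otimes>\<^sub>M F)" "y \<in> space (E \<Otimes>\<^sub>M F)" 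
  "(case x of (x, y) => (c m x, d m y)) = (case y of (x, y) => (c m x, d m y))" for n m x y
  using that(2-) filtered_mono[OF E that(1), of "fst x" "fst y"] filtered_mono[OF F that(1), of "snd x" "snd y"]
  by (simp add: space_pair_measure split_beta' mem_Times_iff)
 fix N assume N: "space N = space (E \<Otimes>\<^sub>M F)" and
  m: "\<And>n z. {x \<in> space N. (case x of (x, y) => (c n x, d n y)) = z} \<in> sets N"
 have cm: "(%(x, y). (c n x, d n y)) \<in> N \<rightarrow>\<^sub>M count_space UNIV" for n
  by (rule finite_valued_measurable[OF _ m]) 
   (rule finite_subset[of _ "c n ` space E \<times> d n ` space F"], auto simp: N space_pair_measure filtered_finite E F)
 have f: "fst \<in> N \<rightarrow>\<^sub>M E"
 proof (rule measurable_into_filtered[OF E])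
  show "{x \<in> space N. c n (fst x) = z} \<in> sets N" for n z
   using measurable_sets[OF cm[of n], of "{z} \<times> UNIV"] by (simp add: vimage_def Int_def conj_commute split_beta')
 qed (auto simp: N space_pair_measure)
 have s: "snd \<in> N \<rightarrow>\<^sub>M F"
 proof (rule measurable_into_filtered[OF F])
  show "{x \<in> space N. d n (snd x) = z} \<in> sets N" for n z
   using measurable_sets[OF cm[of n], of "UNIV \<times> {z}"] by (simp add: vimage_def Int_def conj_commute split_beta')
 qed (auto simp: N space_pair_measure)
 have "(%x. x) \<in> N \<rightarrow>\<^sub>M E \<Otimes>\<^sub>M F" using measurable_Pair[OF f s] by simp
 then show "sets (E \<Otimes>\<^sub>M F) \<subseteq> sets N"
  by (rule sets_le_measurable_id[OF _ N])
qed

lemma filtered_PiM: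
 assumes E: "filtered E c" and I: "finite I"
 shows "filtered (PiM I (%_. E)) (%n x. \<lambda>i\<in>I. c n (x i))"
proof (rule filteredI)
 have el: "x i \<in> space E" if "x \<in> space (PiM I (%_. E))" "i \<in> I" for x i using that by (auto simp: space_PiM)
 show "{x \<in> space (PiM I (%_. E)). (\<lambda>i\<in>I. c n (x i)) = z} \<in> sets (PiM I (%_. E))" for n z
 proof (cases "z \<in> extensional I")
  case True
  have "{x \<in> space (PiM I (%_. E)). (\<lambda>i\<in>I. c n (x i)) = z} = {x \<in> space (PiM I (%_. E)). \<forall>i\<in>I. c n (x i) = z i}"
   using True by (auto simp: fun_eq_iff extensional_def)
  also have "... \<in> sets (PiM I (%_. E))"
  proof (rule sets.sets_Collect_finite_All[OF _ I])
   show "{x \<in> space (PiM I (%_. E)). c n (x i) = z i} \<in> sets (PiM I (%_. E))" if "i \<in> I" for i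
    using measurable_sets[OF measurable_component_singleton[OF that] cell_in_sets[OF E, of n "z i"]] el that
    by (auto simp: vimage_def Int_def conj_commute cong: conj_cong)
  qed
  finally show ?thesis .
 next
  case False
  then have "{x \<in> space (PiM I (%_. E)). (\<lambda>i\<in>I. c n (x i)) = z} = {}" by auto
  then show ?thesis by (simp only: sets.empty_sets)
 qed
 show fin: "finite ((%x. \<lambda>i\<in>I. c n (x i)) ` space (PiM I (%_. E)))" for n
  by (rule finite_subset[of _ "PiE I (%_. c n ` space E)"])
   (auto simp: filtered_finite E I el intro!: finite_PiE)
 show "(\<lambda>i\<in>I. c 0 (x i)) = (\<lambda>i\<in>I. c 0 (y i))"
  if "x \<in> space (PiM I (%_. E))" "y \<in> space (PiM I (%_. E))" for x y
  using that by (intro restrict_ext filtered_zero[OF E]) (auto simp: el)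
 show "(\<lambda>i\<in>I. c n (x i)) = (\<lambda>i\<in>I. c n (y i))"
  if nm: "n <= m" and xy: "x \<in> space (PiM I (%_. E))" "y \<in> space (PiM I (%_. E))" 
   and eq: "(\<lambda>i\<in>I. c m (x i)) = (\<lambda>i\<in>I. c m (y i))" for n m x y
 proof (rule restrict_ext)
  fix i assume "i \<in> I"
  then show "c n (x i) = c n (y i)" using fun_cong[OF eq, of i] el xy by (intro filtered_mono[OF E nm]) auto
 qed
 fix N assume N: "space N = space (PiM I (%_. E))" and
  m: "\<And>n z. {x \<in> space N. (\<lambda>i\<in>I. c n (x i)) = z} \<in> sets N"
 have cm: "(%x. \<lambda>i\<in>I. c n (x i)) \<in> N \<rightarrow>\<^sub>M count_space UNIV" for n
  using fin[of n] by (intro finite_valued_measurable[OF _ m]) (simp add: N)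
 have "(%x. x) \<in> N \<rightarrow>\<^sub>M PiM I (%_. E)"
 proof (rule measurable_PiM_single')
  show "(%x. x i) \<in> N \<rightarrow>\<^sub>M E" if i: "i \<in> I" for i
  proof (rule measurable_into_filtered[OF E])
   show "{x \<in> space N. c n (x i) = z} \<in> sets N" for n z
    using measurable_sets[OF cm[of n], of "{f. f i = z}"] i by (simp add: vimage_def Int_def conj_commute)
  qed (auto simp: N el i)
 qed (auto simp: N space_PiM)
 then show "sets (PiM I (%_. E)) \<subseteq> sets N"
  by (rule sets_le_measurable_id[OF _ N])
qed

section \<open>Spaces of orderings\<close>

text \<open>The clause \<open>B 0 = {}\<close> yields the trivial partition that
  \<open>filtered\<close> demands at level 0.\<close>

definition exhausts :: "(nat => 'a set) => 'a set => bool" where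
 "exhausts B A \<longleftrightarrow> incseq B & (\<forall>n. finite (B n)) & B 0 = {} & (\<Union>n. B n) = A"

lemma exhausts_nat: "exhausts (%n. {1..n}) {1..}"
 by (auto simp: exhausts_def incseq_def)

lemma exhausts_int: "exhausts (%n. {- int n..<int n}) UNIV"
proof -
 have "x \<in> (\<Union>n. {- int n..<int n})" for x
  by (rule UN_I[of "nat \<bar>x\<bar> + 1"]) auto
 then show ?thesis by (auto simp: exhausts_def incseq_def)
qed

lemma space_ordering_space [simp]: "space (ordering_space A) = orderings A"
 by (simp add: ordering_space_def)

lemma orderings_irrefl: "r \<in> orderings A ==> (x, x) \<notin> r"
 by (auto simp: orderings_def strict_linear_order_on_def irrefl_def)

lemma orderings_trans: "r \<in> orderings A ==> (x, y) \<in> r ==> (y, z) \<in> r ==> (x, z) \<in> r"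
 by (auto simp: orderings_def strict_linear_order_on_def dest: transD)

lemma orderings_total: "r \<in> orderings A ==> x \<in> A ==> y \<in> A ==> x ~= y ==> (x, y) \<in> r \<or> (y, x) \<in> r"
 by (auto simp: orderings_def strict_linear_order_on_def total_on_def)

lemma orderings_sub: "r \<in> orderings A ==> r \<subseteq> A \<times> A"
 by (auto simp: orderings_def)

lemma finite_orderings: "finite A ==> finite (orderings A)"
 by (rule finite_subset[of _ "Pow (A \<times> A)"]) (use orderings_sub in blast, simp)

lemma orderings_asym: "r \<in> orderings A ==> (x, y) \<in> r ==> (y, x) \<notin> r"
 using orderings_trans orderings_irrefl by metis

lemma orderingsI:
 assumes "r \<subseteq> A \<times> A" "\<And>x. x \<in> A ==> (x, x) \<notin> r"
  "\<And>x y z. (x, y) \<in> r ==> (y, z) \<in> r ==> (x, z) \<in> r"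
  "\<And>x y. x \<in> A ==> y \<in> A ==> x ~= y ==> (x, y) \<in> r \<or> (y, x) \<in> r"
 shows "r \<in> orderings A"
 unfolding orderings_def strict_linear_order_on_def trans_def irrefl_def total_on_def
 using assms by blast

lemma orderings_Int: "r \<in> orderings A ==> B \<subseteq> A ==> r \<inter> (B \<times> B) \<in> orderings B"
proof (rule orderingsI)
 assume r: "r \<in> orderings A" and B: "B \<subseteq> A"
 show "(x, x) \<notin> r \<inter> (B \<times> B)" for x using orderings_irrefl[OF r] by blast
 show "(x, z) \<in> r \<inter> (B \<times> B)" if "(x, y) \<in> r \<inter> (B \<times> B)" "(y, z) \<in> r \<inter> (B \<times> B)" for x y z
  using that orderings_trans[OF r, of x y z] by blast
 show "(x, y) \<in> r \<inter> (B \<times> B) \<or> (y, x) \<in> r \<inter> (B \<times> B)" if "x \<in> B" "y \<in> B" "x ~= y" for x y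
  using orderings_total[OF r, of x y] that B by blast
qed auto

lemma orderings_less_image:
 fixes u :: "'a => 'b::linorder"
 shows "inj_on u A ==> {(i, j) \<in> A \<times> A. u i < u j} \<in> orderings A"
 by (rule orderingsI) (auto simp: inj_on_def not_less_iff_gr_or_eq)

lemma to_ordering_in: "to_ordering A r \<in> orderings A"
 using orderings_less_image[of id A] by (auto simp: to_ordering_def)

lemma to_ordering_id: "r \<in> orderings A ==> to_ordering A r = r"
 by (simp add: to_ordering_def)

lemma sets_mem_ordering [measurable]: "{r \<in> orderings A. p \<in> r} \<in> sets (ordering_space A)"
proof (cases "p \<in> A \<times> A")
 case True
 let ?P = "PiM (A \<times> A) (%_. count_space (UNIV :: bool set))"
 have 1: "(%r. \<lambda>p\<in>A \<times> A. p \<in> r) \<in> ordering_space A \<rightarrow>\<^sub>M ?P"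
  unfolding ordering_space_def by (rule measurable_vimage_algebra1) (auto simp: space_PiM)
 have 2: "(%f. f p) \<in> ?P \<rightarrow>\<^sub>M count_space UNIV"
  by (rule measurable_component_singleton) fact
 from measurable_sets[OF measurable_compose[OF 1 2], of "{True}"] True
 show ?thesis by (simp add: vimage_def Int_def conj_commute)
next
 case False
 then have "{r \<in> orderings A. p \<in> r} = {}" using orderings_sub by blast
 then show ?thesis by (simp only: sets.empty_sets)
qed

lemma measurable_into_orderings:
 assumes f: "f \<in> space N \<rightarrow> orderings A"
  and m: "\<And>p. p \<in> A \<times> A ==> {x\<in>space N. p \<in> f x} \<in> sets N"
 shows "f \<in> N \<rightarrow>\<^sub>M ordering_space A"
 unfolding ordering_space_def
proof (rule measurable_vimage_algebra2[OF f], rule measurable_restrict)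
 fix p assume "p \<in> A \<times> A"
 from m[OF this] show "(%x. p \<in> f x) \<in> N \<rightarrow>\<^sub>M count_space UNIV" by (simp add: pred_def[symmetric])
qed

text \<open>On a countable set, being a strict total ordering is a countable Boolean combination of
  memberships of single pairs.\<close>

lemma measurable_to_ordering:
 fixes f :: "'x => 'a::linorder rel"
 assumes A: "countable A" and f: "\<And>x. x \<in> space N ==> f x \<subseteq> A \<times> A"
  and m: "\<And>p. p \<in> A \<times> A ==> {x\<in>space N. p \<in> f x} \<in> sets N"
 shows "(%x. to_ordering A (f x)) \<in> N \<rightarrow>\<^sub>M ordering_space A"
proof (rule measurable_into_orderings)
 have [measurable]: "Measurable.pred N (%x. (a, b) \<in> f x)" if "a \<in> A" "b \<in> A" for a b
  using m[of "(a, b)"] that by (simp add: pred_def)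
 have eq: "f x \<in> orderings A \<longleftrightarrow> (\<forall>a\<in>A. (a, a) \<notin> f x) & (\<forall>a\<in>A. \<forall>b\<in>A. \<forall>c\<in>A. (a, b) \<in> f x --> (b, c) \<in> f x --> (a, c) \<in> f x)
  & (\<forall>a\<in>A. \<forall>b\<in>A. a ~= b --> (a, b) \<in> f x \<or> (b, a) \<in> f x)" if "x \<in> space N" for x
 proof
  assume fx: "f x \<in> orderings A"
  show "(\<forall>a\<in>A. (a, a) \<notin> f x) & (\<forall>a\<in>A. \<forall>b\<in>A. \<forall>c\<in>A. (a, b) \<in> f x --> (b, c) \<in> f x --> (a, c) \<in> f x)
  & (\<forall>a\<in>A. \<forall>b\<in>A. a ~= b --> (a, b) \<in> f x \<or> (b, a) \<in> f x)"
   using orderings_irrefl[OF fx] orderings_total[OF fx] orderings_trans[OF fx] by blast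
 next
  assume *: "(\<forall>a\<in>A. (a, a) \<notin> f x) & (\<forall>a\<in>A. \<forall>b\<in>A. \<forall>c\<in>A. (a, b) \<in> f x --> (b, c) \<in> f x --> (a, c) \<in> f x)
  & (\<forall>a\<in>A. \<forall>b\<in>A. a ~= b --> (a, b) \<in> f x \<or> (b, a) \<in> f x)"
  show "f x \<in> orderings A"
  proof (rule orderingsI[OF f[OF that]])
   show "(x', x') \<notin> f x" if "x' \<in> A" for x' using conjunct1[OF *] that by blast
   show "(x', z) \<in> f x" if "(x', y) \<in> f x" "(y, z) \<in> f x" for x' y z
   proof -
    have "x' \<in> A" "y \<in> A" "z \<in> A" using that f[OF \<open>x \<in> space N\<close>] by auto
    then show ?thesis using conjunct1[OF conjunct2[OF *]] that by metis
   qed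
   show "(x', y) \<in> f x \<or> (y, x') \<in> f x" if "x' \<in> A" "y \<in> A" "x' ~= y" for x' y
    using conjunct2[OF conjunct2[OF *]] that by metis
  qed
 qed
 have "{x\<in>space N. f x \<in> orderings A} = {x\<in>space N. (\<forall>a\<in>A. (a, a) \<notin> f x) & (\<forall>a\<in>A. \<forall>b\<in>A. \<forall>c\<in>A. (a, b) \<in> f x --> (b, c) \<in> f x --> (a, c) \<in> f x)
  & (\<forall>a\<in>A. \<forall>b\<in>A. a ~= b --> (a, b) \<in> f x \<or> (b, a) \<in> f x)}"
  by (rule Collect_cong) (simp only: eq cong: conj_cong)
 also have "... \<in> sets N"
  using A by (intro sets.sets_Collect_conj sets.sets_Collect_countable_Ball sets.sets_Collect_imp sets.sets_Collect_neg
   sets.sets_Collect_const sets.sets_Collect_disj m) auto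
 finally have [measurable]: "{x\<in>space N. f x \<in> orderings A} \<in> sets N" .
 fix p assume p: "p \<in> A \<times> A"
 have "{x\<in>space N. p \<in> to_ordering A (f x)} = ({x\<in>space N. f x \<in> orderings A} \<inter> {x\<in>space N. p \<in> f x}) \<union>
   ((space N - {x\<in>space N. f x \<in> orderings A}) \<inter> {x\<in>space N. fst p < snd p})"
  using p by (auto simp: to_ordering_def)
 also have "... \<in> sets N"
  using m[OF p] by (intro sets.Un sets.Int sets.Diff sets.sets_Collect_const) auto
 finally show "{x\<in>space N. p \<in> to_ordering A (f x)} \<in> sets N" .
qed (auto simp: to_ordering_in)

lemma exhausts_pair: 
 assumes "exhausts B A" "x \<in> A" "y \<in> A" obtains n where "x \<in> B n" "y \<in> B n"
proof -
 from assms obtain i j where "x \<in> B i" "y \<in> B j" unfolding exhausts_def by blast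
 moreover have "B i \<subseteq> B (max i j)" "B j \<subseteq> B (max i j)" using assms by (auto simp: exhausts_def incseq_def)
 ultimately show ?thesis using that by blast
qed

lemma filtered_orderings:
 fixes A :: "'a set"
 assumes B: "exhausts B A"
 shows "filtered (ordering_space A) (%n r. r \<inter> (B n \<times> B n))"
proof (rule filteredI)
 have sub: "B n \<subseteq> A" and fin: "finite (B n)" for n using B by (auto simp: exhausts_def)
 let ?O = "ordering_space A"
 show "{x\<in>space ?O. x \<inter> (B n \<times> B n) = d} \<in> sets ?O" for n d
 proof (cases "d \<subseteq> B n \<times> B n")
  case True
  have "{x\<in>space ?O. x \<inter> (B n \<times> B n) = d} = {x\<in>space ?O. \<forall>p\<in>B n \<times> B n. p \<in> x \<longleftrightarrow> p \<in> d}"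
   using True by auto
  also have "... \<in> sets ?O"
  proof (rule sets.sets_Collect_finite_All)
   show "{x \<in> space ?O. (p \<in> x) = (p \<in> d)} \<in> sets ?O" for p
    using sets_mem_ordering[of A p] sets.Diff[OF sets.top sets_mem_ordering[of A p]]
    by (cases "p \<in> d") (auto simp: set_diff_eq conj_commute cong: conj_cong)
  qed (auto simp: fin)
  finally show ?thesis .
 next
  case False
  then have "{x\<in>space ?O. x \<inter> (B n \<times> B n) = d} = {}" by auto
  then show ?thesis by (simp only: sets.empty_sets)
 qed
 show "finite ((%r. r \<inter> (B n \<times> B n)) ` space ?O)" for n
  by (rule finite_subset[of _ "Pow (B n \<times> B n)"]) (auto simp: fin)
 show "x \<inter> (B 0 \<times> B 0) = y \<inter> (B 0 \<times> B 0)" for x y using B by (simp add: exhausts_def)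
 show "x \<inter> (B n \<times> B n) = y \<inter> (B n \<times> B n)" if "n <= m" "x \<inter> (B m \<times> B m) = y \<inter> (B m \<times> B m)" for n m x y
 proof -
  have "B n \<subseteq> B m" using B that by (auto simp: exhausts_def incseq_def)
  with that(2) show ?thesis by blast
 qed
 fix N :: "'a rel measure" assume N: "space N = space ?O" and m: "\<And>n d. {x\<in>space N. x \<inter> (B n \<times> B n) = d} \<in> sets N"
 have "(%x. x) \<in> N \<rightarrow>\<^sub>M ?O"
 proof (rule measurable_into_orderings)
  fix p assume "p \<in> A \<times> A"
  then obtain n where n: "p \<in> B n \<times> B n" using exhausts_pair[OF B] by (metis mem_Sigma_iff prod.collapse)
  have "(%r. r \<inter> (B n \<times> B n)) \<in> N \<rightarrow>\<^sub>M count_space UNIV"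
   by (rule finite_valued_measurable[OF _ m]) (rule finite_subset[of _ "Pow (B n \<times> B n)"], auto simp: fin)
  from measurable_sets[OF this, of "{d. p \<in> d}"] n
  show "{x\<in>space N. p \<in> x} \<in> sets N" by (simp add: vimage_def Int_def conj_commute)
 qed (simp add: N)
 then show "sets ?O \<subseteq> sets N"
  by (rule sets_le_measurable_id[OF _ N])
qed

text \<open>Any three elements lie in a common \<open>B k\<close>, so each axiom of an ordering is
  inherited from a single \<open>b k\<close>.\<close>

lemma orderings_Union:
 assumes B: "exhausts B A" and b: "\<And>n. b n \<in> orderings (B n)" "\<And>n. b (Suc n) \<inter> (B n \<times> B n) = b n"
 shows "(\<Union>n. b n) \<in> orderings A" "(\<Union>n. b n) \<inter> (B m \<times> B m) = b m"
proof -
 have inc: "B n \<subseteq> B m" if "n <= m" for n m using B that by (auto simp: exhausts_def incseq_def)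
 have res: "b m \<inter> (B n \<times> B n) = b n" if "n <= m" for n m
  using that
 proof (induction rule: dec_induct)
  case base show ?case using orderings_sub[OF b(1)] by blast
 next
  case (step k) then show ?case using b(2)[of k] inc[of n k] by auto
 qed
 show *: "(\<Union>n. b n) \<inter> (B m \<times> B m) = b m" for m
 proof -
  have "b n \<inter> (B m \<times> B m) \<subseteq> b m" for n
   using res[of n m] res[of m n] orderings_sub[OF b(1), of m] by (cases "n <= m") auto
  moreover have "b m \<subseteq> B m \<times> B m" by (rule orderings_sub[OF b(1)])
  ultimately show ?thesis by blast
 qed
 have 3: "\<exists>k. x \<in> B k & y \<in> B k & z \<in> B k" if "x \<in> A" "y \<in> A" "z \<in> A" for x y z
 proof -
  from that B obtain i j k where "x \<in> B i" "y \<in> B j" "z \<in> B k" unfolding exhausts_def by blast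
  moreover have "B i \<subseteq> B (i + j + k)" "B j \<subseteq> B (i + j + k)" "B k \<subseteq> B (i + j + k)" by (auto intro!: inc)
  ultimately show ?thesis by blast
 qed
 have sub: "(\<Union>n. b n) \<subseteq> A \<times> A" using orderings_sub[OF b(1)] B by (fastforce simp: exhausts_def)
 show "(\<Union>n. b n) \<in> orderings A"
 proof (rule orderingsI[OF sub])
  fix x assume "x \<in> A" show "(x, x) \<notin> (\<Union>n. b n)" using orderings_irrefl[OF b(1)] by auto
 next
  fix x y z assume xy: "(x, y) \<in> (\<Union>n. b n)" "(y, z) \<in> (\<Union>n. b n)"
  with sub have "x \<in> A" "y \<in> A" "z \<in> A" by auto
  from 3[OF this] obtain k where "x \<in> B k" "y \<in> B k" "z \<in> B k" by auto
  with xy have "(x, y) \<in> (\<Union>n. b n) \<inter> (B k \<times> B k)" "(y, z) \<in> (\<Union>n. b n) \<inter> (B k \<times> B k)" by auto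
  then have "(x, y) \<in> b k" "(y, z) \<in> b k" unfolding * .
  from orderings_trans[OF b(1) this] show "(x, z) \<in> (\<Union>n. b n)" by blast
 next
  fix x y assume "x \<in> A" "y \<in> A" "x ~= y"
  moreover from 3[of x y y] this obtain k where "x \<in> B k" "y \<in> B k" by auto
  ultimately show "(x, y) \<in> (\<Union>n. b n) \<or> (y, x) \<in> (\<Union>n. b n)"
   using orderings_total[OF b(1), of x k y] by blast
 qed
qed

lemma sequence_space_cylinder:
 assumes "sets M = sets (PiM UNIV (%_::nat. count_space UNIV))"
 shows "space M = UNIV" "{x. P (x (n::nat))} \<in> sets M"
proof -
 show sp: "space M = UNIV" using sets_eq_imp_space_eq[OF assms] by (simp add: space_PiM)
 have "(%x. x n) \<in> M \<rightarrow>\<^sub>M count_space UNIV"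
  using measurable_cong_sets[OF assms refl] measurable_component_singleton[of n UNIV "%_. count_space UNIV"] by blast
 from measurable_sets[OF this, of "Collect P"] sp
 show "{x. P (x n)} \<in> sets M" by (simp add: vimage_def)
qed

text \<open>The limit of the laws is a random sequence in which, almost surely, each entry is an
  ordering of \<open>B n\<close> and the restriction of the next entry. The union of the entries is
  the random ordering; \<open>to_ordering\<close> repairs the null event.\<close>

lemma projective_limit_orderings:
 fixes A :: "'a::linorder set"
 assumes B: "exhausts B A" and A: "countable A"
  and p: "\<And>n. set_pmf (p n) \<subseteq> orderings (B n)"
  and proj: "\<And>n. map_pmf (%r. r \<inter> (B n \<times> B n)) (p (Suc n)) = p n"
 obtains M where "M \<in> space (prob_algebra (ordering_space A))"
  "\<And>n b. measure M {r\<in>orderings A. r \<inter> (B n \<times> B n) = b} = pmf (p n) b"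
proof -
 from projective_limit_pmf[where p=p and \<pi>="%n r. r \<inter> (B n \<times> B n)", OF proj]
 obtain M :: "(nat => 'a rel) measure" where M: "prob_space M" "sets M = sets (PiM UNIV (%_. count_space UNIV))"
  "\<And>n. AE x in M. x n = x (Suc n) \<inter> (B n \<times> B n)" "\<And>n d. measure M {x. x n = d} = pmf (p n) d"
  by blast
 interpret prob_space M by fact
 note cyl = sequence_space_cylinder[OF M(2)]
 have supp: "AE x in M. x n \<in> orderings (B n)" for n
 proof -
  have fin: "finite (orderings (B n))"
   using B by (simp add: exhausts_def finite_orderings)
  have "measure M (\<Union>d\<in>orderings (B n). {x. x n = d}) = (\<Sum>d\<in>orderings (B n). pmf (p n) d)"
   unfolding M(4)[symmetric] by (intro finite_measure_finite_Union fin) (auto simp: disjoint_family_on_def intro: cyl(2)[of "%y. y = _"])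
  also have "... = 1" using p fin by (intro sum_pmf_eq_1)
  finally have "AE x in M. x \<in> (\<Union>d\<in>orderings (B n). {x. x n = d})" by (rule AE_prob_1)
  then show ?thesis by simp
 qed
 define g where "g x = to_ordering A ((\<Union>n. x n) \<inter> (A \<times> A))" for x :: "nat => 'a rel"
 have g[measurable]: "g \<in> M \<rightarrow>\<^sub>M ordering_space A"
  unfolding g_def
 proof (rule measurable_to_ordering[OF A])
  fix p assume "p \<in> A \<times> A"
  have "{x\<in>space M. p \<in> (\<Union>n. x n) \<inter> (A \<times> A)} = (\<Union>n. {x. p \<in> x n})"
   using \<open>p \<in> A \<times> A\<close> by (auto simp: cyl)
  also have "... \<in> sets M" by (intro sets.countable_UN) (auto intro!: cyl)
  finally show "{x\<in>space M. p \<in> (\<Union>n. x n) \<inter> (A \<times> A)} \<in> sets M" .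
 qed auto
 have good: "AE x in M. \<forall>n. x n \<in> orderings (B n) & x n = x (Suc n) \<inter> (B n \<times> B n)"
  using supp M(3) by (simp add: AE_all_countable)
 show ?thesis
 proof
  show "distr M (ordering_space A) g \<in> space (prob_algebra (ordering_space A))"
   by (auto simp: space_prob_algebra intro!: prob_space_distr g)
  fix n b
  have "measure (distr M (ordering_space A) g) {r\<in>orderings A. r \<inter> (B n \<times> B n) = b}
    = measure M (g -` {r\<in>orderings A. r \<inter> (B n \<times> B n) = b} \<inter> space M)"
   using cell_in_sets[OF filtered_orderings[OF B], of n b] by (intro measure_distr g) simp
  also have "... = measure M {x. x n = b}"
  proof (rule finite_measure_eq_AE)
   show "AE x in M. (x \<in> g -` {r\<in>orderings A. r \<inter> (B n \<times> B n) = b} \<inter> space M) = (x \<in> {x. x n = b})"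
    using good
   proof eventually_elim
    case (elim x)
    then have "x n \<in> orderings (B n)" "x (Suc n) \<inter> (B n \<times> B n) = x n" for n by blast+
    note orderings_Union[OF B this]
    moreover from this have "g x = (\<Union>n. x n)"
     using orderings_sub[of "\<Union>n. x n" A] by (simp add: g_def to_ordering_id Int_absorb2)
    ultimately show ?case by (simp add: cyl)
   qed
   show "g -` {r\<in>orderings A. r \<inter> (B n \<times> B n) = b} \<inter> space M \<in> sets M"
    using cell_in_sets[OF filtered_orderings[OF B], of n b] by (intro measurable_sets[OF g]) simp
  qed (rule cyl)
  finally show "measure (distr M (ordering_space A) g) {r\<in>orderings A. r \<inter> (B n \<times> B n) = b} = pmf (p n) b"
   by (simp add: M(4))
 qed
qed

section \<open>Orderings of initial segments and permutations\<close>

abbreviation cell :: "nat => nat rel => nat rel set" where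
 "cell n a \<equiv> {r\<in>orderings {1..}. restr n r = a}"

definition perm_order :: "nat => (nat => nat) => nat rel" where
 "perm_order n \<sigma> = {(i, j) \<in> {1..n} \<times> {1..n}. \<sigma> i < \<sigma> j}"

abbreviation perms :: "nat => (nat => nat) set" where
 "perms n \<equiv> {\<sigma>. \<sigma> permutes {1..n}}"

lemma perms_range: "\<sigma> permutes {1..n} ==> i \<in> {1..n} ==> \<sigma> i \<in> {1..n}"
 using permutes_in_image by metis

lemma perm_order_in: "\<sigma> permutes {1..n} ==> perm_order n \<sigma> \<in> orderings {1..n}"
 unfolding perm_order_def by (intro orderings_less_image permutes_inj_on)

lemma restr_in: "r \<in> orderings {1..} ==> restr n r \<in> orderings {1..n}"
 unfolding restr_def by (rule orderings_Int) auto

lemma restr_restr: "m <= n ==> restr m (restr n r) = restr m r"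
 by (auto simp: restr_def)

lemma restr_in': "m <= n ==> r \<in> orderings {1..n} ==> restr m r \<in> orderings {1..m}"
 unfolding restr_def by (rule orderings_Int) auto

lemma restr_id: "r \<in> orderings {1..n} ==> restr n r = r"
 using orderings_sub[of r "{1..n}"] by (auto simp: restr_def)

lemma restr_perm_order: "m <= n ==> restr m (perm_order n \<sigma>) = perm_order m \<sigma>"
 by (auto simp: restr_def perm_order_def)

text \<open>The values of a permutation are recovered from comparisons alone, which makes
  \<open>perm_order n\<close> injective.\<close>

lemma perm_eq_card:
 assumes \<sigma>: "\<sigma> permutes {1..n}" and k: "k \<in> {1..n}"
 shows "\<sigma> k = card {j\<in>{1..n}. \<sigma> j <= \<sigma> k}"
proof -
 have "\<sigma> ` {j\<in>{1..n}. \<sigma> j <= \<sigma> k} = {1..\<sigma> k}"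
 proof
  show "\<sigma> ` {j\<in>{1..n}. \<sigma> j <= \<sigma> k} \<subseteq> {1..\<sigma> k}"
  proof
   fix x assume "x \<in> \<sigma> ` {j\<in>{1..n}. \<sigma> j <= \<sigma> k}"
   then obtain j where "j \<in> {1..n}" "\<sigma> j <= \<sigma> k" "x = \<sigma> j" by blast
   with perms_range[OF \<sigma>, of j] show "x \<in> {1..\<sigma> k}" by simp
  qed
  show "{1..\<sigma> k} \<subseteq> \<sigma> ` {j\<in>{1..n}. \<sigma> j <= \<sigma> k}"
  proof
   fix x assume x: "x \<in> {1..\<sigma> k}"
   then have "x \<in> {1..n}" using perms_range[OF \<sigma> k] by simp
   then obtain j where "j \<in> {1..n}" "x = \<sigma> j" using permutes_image[OF \<sigma>] by blast
   with x show "x \<in> \<sigma> ` {j\<in>{1..n}. \<sigma> j <= \<sigma> k}" by auto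
  qed
 qed
 moreover have "card (\<sigma> ` {j\<in>{1..n}. \<sigma> j <= \<sigma> k}) = card {j\<in>{1..n}. \<sigma> j <= \<sigma> k}"
  by (rule card_image) (rule permutes_inj_on[OF \<sigma>])
 ultimately show ?thesis by simp
qed

lemma perm_order_inj:
 assumes \<sigma>: "\<sigma> permutes {1..n}" and \<tau>: "\<tau> permutes {1..n}" and eq: "perm_order n \<sigma> = perm_order n \<tau>"
 shows "\<sigma> = \<tau>"
proof
 fix k
 show "\<sigma> k = \<tau> k"
 proof (cases "k \<in> {1..n}")
  case True
  have "(\<sigma> j <= \<sigma> k) = (\<tau> j <= \<tau> k)" if "j \<in> {1..n}" for j
  proof -
   have "(k, j) \<in> perm_order n \<sigma> \<longleftrightarrow> (k, j) \<in> perm_order n \<tau>" using eq by simp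
   then show ?thesis using that True by (auto simp: perm_order_def)
  qed
  then have "{j\<in>{1..n}. \<sigma> j <= \<sigma> k} = {j\<in>{1..n}. \<tau> j <= \<tau> k}" by auto
  then show ?thesis using perm_eq_card[OF \<sigma> True] perm_eq_card[OF \<tau> True] by simp
 next
  case False
  then show ?thesis using \<sigma> \<tau> by (simp add: permutes_not_in)
 qed
qed

lemma perm_order_surj:
 assumes b: "b \<in> orderings {1..n}" obtains \<sigma> where "\<sigma> permutes {1..n}" "perm_order n \<sigma> = b"
proof -
 \<comment> \<open>The rank of \<open>k\<close> is the number of elements weakly below it; inserting
   \<open>k\<close> itself makes ranks start at 1.\<close>
 define S where "S k = insert k {j\<in>{1..n}. (j, k) \<in> b}" for k
 define \<sigma> where "\<sigma> k = (if k \<in> {1..n} then card (S k) else k)" for k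
 have fS: "finite (S k)" for k by (simp add: S_def)
 have less: "\<sigma> i < \<sigma> j" if ij: "i \<in> {1..n}" "j \<in> {1..n}" "(i, j) \<in> b" for i j
 proof -
  have "S i \<subseteq> S j" using ij orderings_trans[OF b, of _ i j] by (auto simp: S_def)
  moreover have "j \<in> S j" "j \<notin> S i" using ij orderings_asym[OF b, of i j] orderings_irrefl[OF b]
   by (auto simp: S_def)
  ultimately have "S i \<subset> S j" by blast
  then show ?thesis using ij fS by (simp add: \<sigma>_def psubset_card_mono)
 qed
 have iff: "\<sigma> i < \<sigma> j \<longleftrightarrow> (i, j) \<in> b" if ij: "i \<in> {1..n}" "j \<in> {1..n}" for i j
  using less[OF ij] less[OF ij(2,1)] orderings_total[OF b ij] by (cases "i = j") (auto simp: orderings_irrefl[OF b])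
 have inj: "inj_on \<sigma> {1..n}"
 proof (rule inj_onI, rule ccontr)
  fix i j assume "i \<in> {1..n}" "j \<in> {1..n}" "\<sigma> i = \<sigma> j" "i ~= j"
  then show False using less[of i j] less[of j i] orderings_total[OF b, of i j] by auto
 qed
 have "\<sigma> ` {1..n} \<subseteq> {1..n}"
 proof
  fix x assume "x \<in> \<sigma> ` {1..n}"
  then obtain k where k: "k \<in> {1..n}" "x = card (S k)" by (auto simp: \<sigma>_def)
  have "S k \<subseteq> {1..n}" using k by (auto simp: S_def)
  then have "card (S k) <= n" using card_mono[of "{1..n}" "S k"] by simp
  moreover have "card (S k) > 0" using fS[of k] by (auto simp: card_gt_0_iff S_def)
  ultimately show "x \<in> {1..n}" using k by auto
 qed
 then have "\<sigma> ` {1..n} = {1..n}" by (intro endo_inj_surj inj) auto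
 then have "\<sigma> permutes {1..n}" using inj by (intro bij_imp_permutes) (auto simp: bij_betw_def \<sigma>_def)
 moreover have "perm_order n \<sigma> = b"
  using iff orderings_sub[OF b] by (auto simp: perm_order_def)
 ultimately show ?thesis by (rule that)
qed

lemma perm_of_perm_order:
 assumes \<sigma>: "\<sigma> permutes {1..n}" and r: "restr n r = perm_order n \<sigma>" shows "perm_of n r = \<sigma>"
 unfolding perm_of_def r
proof (rule the_equality)
 show "\<sigma> permutes {1..n} & (\<forall>k\<in>{1..n}. \<forall>k'\<in>{1..n}. ((k, k') \<in> perm_order n \<sigma>) = (\<sigma> k < \<sigma> k'))"
  using \<sigma> by (auto simp: perm_order_def)
 fix p assume p: "p permutes {1..n} & (\<forall>k\<in>{1..n}. \<forall>k'\<in>{1..n}. ((k, k') \<in> perm_order n \<sigma>) = (p k < p k'))"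
 then have "perm_order n p = perm_order n \<sigma>" by (auto simp: perm_order_def)
 with p \<sigma> show "p = \<sigma>" by (intro perm_order_inj) auto
qed

lemma perm_of:
 assumes "restr n r \<in> orderings {1..n}"
 shows "perm_of n r permutes {1..n}" "perm_order n (perm_of n r) = restr n r"
 using perm_order_surj[OF assms] perm_of_perm_order by metis+

lemma perm_of':
 assumes "b \<in> orderings {1..n}"
 shows "perm_of n b permutes {1..n}" "perm_order n (perm_of n b) = b"
 using perm_of[of n b] assms restr_id[OF assms] by auto

lemma perm_of_restr: "perm_of n (restr n r) = perm_of n r"
 by (simp add: perm_of_def restr_restr)

lemma perm_of_order: "\<sigma> permutes {1..n} ==> perm_of n (perm_order n \<sigma>) = \<sigma>"
 by (rule perm_of_perm_order) (auto simp: restr_perm_order)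

lemma perm_of_eq_iff:
 "r \<in> orderings {1..} ==> \<sigma> permutes {1..n} ==> perm_of n r = \<sigma> \<longleftrightarrow> restr n r = perm_order n \<sigma>"
 using perm_of_perm_order perm_of(2)[OF restr_in] by metis

lemma bij_perm_order: "bij_betw (perm_order n) (perms n) (orderings {1..n})"
 unfolding bij_betw_def inj_on_def using perm_order_inj perm_order_in perm_order_surj by (auto simp: image_iff) metis+

lemma card_orderings: "card (orderings {1..n}) = fact n"
 using bij_betw_same_card[OF bij_perm_order] card_permutations[of "{1..n}" n] by simp

lemma orderings_nonempty: "orderings {1..n::nat} ~= {}"
 using perm_order_in[OF permutes_id] by blast

lemma finite_orderings_nat [simp]: "finite (orderings {1..n::nat})"
 by (rule finite_orderings) simp

lemma filtered_N: "filtered N_orderings restr"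
 using filtered_orderings[OF exhausts_nat] unfolding restr_def[abs_def] .

lemma restr_0: "restr 0 r = {}"
 by (simp add: restr_def)

lemma measurable_restr: "restr n \<in> N_orderings \<rightarrow>\<^sub>M count_space UNIV"
 by (rule filtered_measurable[OF filtered_N])

lemma sets_restr: "(cell n a) \<in> sets N_orderings"
 using cell_in_sets[OF filtered_N, of n a] by simp

lemma measure_eq_N:
 assumes M: "M \<in> space (prob_algebra N_orderings)" and N: "N \<in> space (prob_algebra N_orderings)"
  and eq: "\<And>n b. b \<in> orderings {1..n} ==> measure M (cell n b) = measure N (cell n b)"
 shows "M = N"
proof -
 interpret M: prob_space M using M by (simp add: space_prob_algebra)
 interpret N: prob_space N using N by (simp add: space_prob_algebra)
 show ?thesis
 proof (rule measure_eq_filtered[OF filtered_N])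
  show "emeasure M {y \<in> space N_orderings. restr n y = restr n x} = emeasure N {y \<in> space N_orderings. restr n y = restr n x}"
   if "x \<in> space N_orderings" for n x
   using eq[of "restr n x" n] that restr_in[of x n] by (simp add: M.emeasure_eq_measure N.emeasure_eq_measure)
 qed (use M N M.finite_measure_axioms in \<open>auto simp: space_prob_algebra\<close>)
qed

section \<open>The uniform ordering\<close>

declare One_nat_def [simp del]

lemma space_unit_lebesgue [simp]: "space unit_lebesgue = {0..1}"
 by (simp add: unit_lebesgue_def space_restrict_space)

lemma space_unit_borel [simp]: "space unit_borel = {0..1}"
 by (simp add: unit_borel_def space_restrict_space)

lemma sets_unit_lebesgue [measurable_cong]: "sets unit_lebesgue = sets unit_borel"
 by (simp add: unit_lebesgue_def unit_borel_def sets_restrict_space)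

lemma prob_space_unit_lebesgue: "prob_space unit_lebesgue"
 by standard (simp add: unit_lebesgue_def emeasure_restrict_space space_restrict_space)

lemma measurable_unit_borel_borel [measurable]: "(%x. x) \<in> borel_measurable unit_borel"
 unfolding unit_borel_def by (rule measurable_restrict_space1) simp

lemma sets_unit_lebesgueI: "A \<in> sets borel ==> A \<subseteq> {0..1} ==> A \<in> sets unit_borel"
 unfolding unit_borel_def by (subst sets_restrict_space_iff) auto

lemma emeasure_unit_lebesgue: "A \<in> sets borel ==> A \<subseteq> {0..1} ==> emeasure unit_lebesgue A = emeasure lborel A"
 unfolding unit_lebesgue_def by (rule emeasure_restrict_space) auto

lemma AE_unit_lebesgue_neq: "AE y in unit_lebesgue. y ~= x"
proof (cases "x \<in> {0..1}")
 case True
 then have "{x} \<in> null_sets unit_lebesgue"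
  by (auto simp: null_sets_def emeasure_unit_lebesgue sets_unit_lebesgue intro: sets_unit_lebesgueI)
 then show ?thesis by (rule AE_I') auto
next
 case False
 show ?thesis by (rule AE_I2) (use False in auto)
qed

lemma distr_PiM_pair:
 assumes M: "prob_space M" and ij: "i \<in> I" "j \<in> I" "i ~= j"
 shows "distr (PiM I (%_. M)) (M \<Otimes>\<^sub>M M) (%x. (x i, x j)) = M \<Otimes>\<^sub>M M"
proof -
 interpret M: prob_space M by fact
 interpret P: product_prob_space "%_. M" I by standard
 show ?thesis
 proof (rule pair_measure_eqI[symmetric])
  show "sigma_finite_measure M" "sigma_finite_measure M" by unfold_locales
  fix A B assume A: "A \<in> sets M" and B: "B \<in> sets M"
  have m: "(%x. (x i, x j)) \<in> PiM I (%_. M) \<rightarrow>\<^sub>M M \<Otimes>\<^sub>M M" using ij by simp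
  have "emeasure (PiM I (%_. M)) {x\<in>space (PiM I (%_. M)). \<forall>k\<in>{i, j}. x k \<in> (if k = i then A else B)}
   = (\<Prod>k\<in>{i, j}. emeasure M (if k = i then A else B))"
   using ij A B by (intro P.emeasure_PiM_Collect) auto
  also have "{x\<in>space (PiM I (%_. M)). \<forall>k\<in>{i, j}. x k \<in> (if k = i then A else B)} = (%x. (x i, x j)) -` (A \<times> B) \<inter> space (PiM I (%_. M))"
   using ij by auto
  finally show "emeasure M A * emeasure M B = emeasure (distr (PiM I (%_. M)) (M \<Otimes>\<^sub>M M) (%x. (x i, x j))) (A \<times> B)"
   using ij A B by (simp add: emeasure_distr[OF m])
 qed simp
qed

lemma distr_PiM_bij:
 assumes M: "prob_space M" and f: "bij_betw f I I"
 shows "distr (PiM I (%_. M)) (PiM I (%_. M)) (%\<omega>. \<lambda>n\<in>I. \<omega> (f n)) = PiM I (%_. M)"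
 using distr_PiM_reindex[of I "%_. M" f I] M f by (auto simp: bij_betw_def)

abbreviation unit_seq :: "'i set => ('i => real) measure" where
 "unit_seq I \<equiv> PiM I (%_. unit_lebesgue)"

lemma prob_space_unit_seq: "prob_space (unit_seq I)"
 by (intro prob_space_PiM prob_space_unit_lebesgue)

lemma measurable_unit_seq_nth [measurable]: "i \<in> I ==> (%x. x i) \<in> borel_measurable (unit_seq I)"
proof -
 assume i: "i \<in> I"
 have "(%x. x) \<in> borel_measurable unit_lebesgue"
  using measurable_unit_borel_borel measurable_cong_sets[OF sets_unit_lebesgue refl] by blast
 from measurable_compose[OF measurable_component_singleton[OF i, of "%_. unit_lebesgue"] this]
 show ?thesis .
qed

lemma AE_unit_seq_neq:
 assumes "i \<in> I" "j \<in> I" "i ~= j" shows "AE x in unit_seq I. x i ~= x j"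
proof -
 interpret prob_space unit_lebesgue by (rule prob_space_unit_lebesgue)
 interpret pair_prob_space unit_lebesgue unit_lebesgue by unfold_locales
 have id: "(%x. x) \<in> borel_measurable unit_lebesgue"
  using measurable_unit_borel_borel measurable_cong_sets[OF sets_unit_lebesgue refl] by blast
 have "{x \<in> space (unit_lebesgue \<Otimes>\<^sub>M unit_lebesgue). fst x ~= snd x} \<in> sets (unit_lebesgue \<Otimes>\<^sub>M unit_lebesgue)"
  by (rule borel_measurable_neq[OF measurable_compose[OF measurable_fst id] measurable_compose[OF measurable_snd id]])
 then have "AE x in unit_lebesgue \<Otimes>\<^sub>M unit_lebesgue. fst x ~= snd x"
 proof (rule AE_pair_measure)
  have "AE y in unit_lebesgue. fst (x, y) ~= snd (x, y)" for x
   using AE_unit_lebesgue_neq[of x] by eventually_elim (simp only: fst_conv snd_conv not_sym)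
  then show "AE x in unit_lebesgue. AE y in unit_lebesgue. fst (x, y) ~= snd (x, y)" by (rule AE_I2)
 qed
 then have "AE x in distr (unit_seq I) (unit_lebesgue \<Otimes>\<^sub>M unit_lebesgue) (%x. (x i, x j)). fst x ~= snd x"
  by (subst distr_PiM_pair[OF prob_space_unit_lebesgue assms])
 moreover have "(%x. (x i, x j)) \<in> unit_seq I \<rightarrow>\<^sub>M unit_lebesgue \<Otimes>\<^sub>M unit_lebesgue" using assms by simp
 ultimately show ?thesis by (auto dest: AE_distrD)
qed

lemma AE_unit_seq_inj:
 assumes "countable I" shows "AE x in unit_seq I. inj_on x I"
proof -
 have "AE x in unit_seq I. \<forall>i\<in>I. \<forall>j\<in>I. i ~= j --> x i ~= x j"
  by (intro AE_ball_countable'[OF _ assms] AE_impI AE_unit_seq_neq)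
 then show ?thesis by eventually_elim (auto simp: inj_on_def)
qed

definition rank_order :: "(nat => real) => nat rel" where
 "rank_order u = to_ordering {1..} (N_relation u)"

lemma rank_order_eq: "inj_on u {1..} ==> rank_order u = {(i, j) \<in> {1..} \<times> {1..}. u i < u j}"
 unfolding rank_order_def N_relation_def by (intro to_ordering_id orderings_less_image)

lemma rank_order_in: "rank_order u \<in> orderings {1..}"
 unfolding rank_order_def by (rule to_ordering_in)

lemma measurable_rank_order:
 assumes "\<And>i. i \<in> {1..} ==> (%x. f x i) \<in> borel_measurable N"
 shows "(%x. rank_order (f x)) \<in> N \<rightarrow>\<^sub>M N_orderings"
 unfolding rank_order_def
proof (rule measurable_to_ordering)
 fix p :: "nat \<times> nat" assume p: "p \<in> {1..} \<times> {1..}"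
 have "{x \<in> space N. p \<in> N_relation (f x)} = {x\<in>space N. f x (fst p) < f x (snd p)}"
  using p by (auto simp: N_relation_def)
 also have "... \<in> sets N"
  using p by (intro borel_measurable_less assms) auto
 finally show "{x \<in> space N. p \<in> N_relation (f x)} \<in> sets N" .
qed (auto simp: N_relation_def)

lemma rank_order_restr_iff:
 assumes "inj_on u {1..}"
 shows "restr n (rank_order u) = perm_order n \<sigma> \<longleftrightarrow> (\<forall>i\<in>{1..n}. \<forall>j\<in>{1..n}. u i < u j \<longleftrightarrow> \<sigma> i < \<sigma> j)"
proof -
 have "restr n (rank_order u) = {(i, j) \<in> {1..n} \<times> {1..n}. u i < u j}"
  unfolding rank_order_eq[OF assms] restr_def by auto
 then show ?thesis unfolding perm_order_def by blast
qed

lemma measurable_rank_order_unit_seq: "rank_order \<in> unit_seq {1..} \<rightarrow>\<^sub>M N_orderings"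
 by (rule measurable_rank_order[of "%x. x"]) (rule measurable_unit_seq_nth)

lemma permutes_bij_atLeast: 
 assumes "\<sigma> permutes {1..n::nat}" shows "bij_betw \<sigma> {1..} {1..}"
proof -
 have "\<sigma> permutes {1..}" using assms by (rule permutes_subset) auto
 then show ?thesis by (rule permutes_imp_bij)
qed

text \<open>Permuting the first \<open>n\<close> coordinates by \<open>inv \<sigma>\<close>
  preserves the product law and turns the ranks \<sigma> into the identity. Hence all
  \<open>fact n\<close> orderings of \<open>{1..n}\<close> are equally likely.\<close>

lemma measure_rank_order:
 assumes b: "b \<in> orderings {1..n}"
 shows "measure (unit_seq {1..}) {u\<in>space (unit_seq {1..}). restr n (rank_order u) = b} = 1 / fact n"
proof -
 let ?M = "unit_seq {1::nat..}"
 interpret prob_space ?M by (rule prob_space_unit_seq)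
 have cell: "{u\<in>space ?M. restr n (rank_order u) = c} \<in> sets ?M" for c
  using measurable_sets[OF measurable_compose[OF measurable_rank_order_unit_seq measurable_restr], of "{c}" n]
  by (simp add: vimage_def Int_def conj_commute)
 have inj: "AE u in ?M. inj_on u {1..}" by (rule AE_unit_seq_inj) auto
 have eq: "measure ?M {u\<in>space ?M. restr n (rank_order u) = perm_order n \<sigma>} = measure ?M {u\<in>space ?M. restr n (rank_order u) = perm_order n id}"
  if \<sigma>: "\<sigma> permutes {1..n}" for \<sigma>
 proof -
  let ?f = "%u. \<lambda>k\<in>{1..}. u (inv \<sigma> k)"
  have inv: "inv \<sigma> permutes {1..n}" by (rule permutes_inv[OF \<sigma>])
  note bij = permutes_bij_atLeast[OF inv]
  have f: "?f \<in> ?M \<rightarrow>\<^sub>M ?M"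
   by (intro measurable_restrict measurable_component_singleton) (use bij in \<open>auto dest: bij_betwE\<close>)
  have "measure ?M {u\<in>space ?M. restr n (rank_order u) = perm_order n id}
   = measure (distr ?M ?M ?f) {u\<in>space ?M. restr n (rank_order u) = perm_order n id}"
   by (subst distr_PiM_bij[OF prob_space_unit_lebesgue bij]) simp
  also have "... = measure ?M (?f -` {u\<in>space ?M. restr n (rank_order u) = perm_order n id} \<inter> space ?M)"
   by (rule measure_distr[OF f cell])
  also have "... = measure ?M {u\<in>space ?M. restr n (rank_order u) = perm_order n \<sigma>}"
  proof (rule finite_measure_eq_AE)
   show "AE u in ?M. (u \<in> ?f -` {u\<in>space ?M. restr n (rank_order u) = perm_order n id} \<inter> space ?M) =
     (u \<in> {u\<in>space ?M. restr n (rank_order u) = perm_order n \<sigma>})"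
    using inj AE_space
   proof eventually_elim
    case (elim u)
    have inj': "inj_on (?f u) {1..}"
    proof (rule inj_onI)
     fix x y :: nat assume xy: "x \<in> {1..}" "y \<in> {1..}" "?f u x = ?f u y"
     then have "inv \<sigma> x = inv \<sigma> y" using bij_betwE[OF bij] by (intro inj_onD[OF elim(1)]) auto
     with xy show "x = y" using bij by (auto simp: bij_betw_def dest: inj_onD)
    qed
    have fu: "?f u \<in> space ?M" by (rule measurable_space[OF f elim(2)])
    have "restr n (rank_order (?f u)) = perm_order n id \<longleftrightarrow> (\<forall>i\<in>{1..n}. \<forall>j\<in>{1..n}. u (inv \<sigma> i) < u (inv \<sigma> j) \<longleftrightarrow> i < j)"
     unfolding rank_order_restr_iff[OF inj'] by auto
    also have "... \<longleftrightarrow> (\<forall>i\<in>\<sigma> ` {1..n}. \<forall>j\<in>\<sigma> ` {1..n}. u (inv \<sigma> i) < u (inv \<sigma> j) \<longleftrightarrow> i < j)"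
     by (simp only: permutes_image[OF \<sigma>])
    also have "... \<longleftrightarrow> restr n (rank_order u) = perm_order n \<sigma>"
     unfolding rank_order_restr_iff[OF elim(1)] by (simp add: permutes_inverses[OF \<sigma>])
    finally show ?case using elim(2) fu by blast
   qed
  qed (use measurable_sets[OF f cell] cell in auto)
  finally show ?thesis by simp
 qed
 obtain \<sigma> where \<sigma>: "\<sigma> permutes {1..n}" "b = perm_order n \<sigma>" using perm_order_surj[OF b] by metis
 define q where "q = measure ?M {u\<in>space ?M. restr n (rank_order u) = perm_order n id}"
 have "1 = measure ?M (\<Union>c\<in>orderings {1..n}. {u\<in>space ?M. restr n (rank_order u) = c})"
 proof -
  have "(\<Union>c\<in>orderings {1..n}. {u\<in>space ?M. restr n (rank_order u) = c}) = space ?M"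
   using restr_in[OF rank_order_in] by auto
  then show ?thesis by (simp add: prob_space)
 qed
 also have "... = (\<Sum>c\<in>orderings {1..n}. measure ?M {u\<in>space ?M. restr n (rank_order u) = c})"
  by (rule finite_measure_finite_Union) (use cell in \<open>auto simp: disjoint_family_on_def\<close>)
 also have "... = (\<Sum>c\<in>orderings {1..n}. q)"
 proof (rule sum.cong[OF refl])
  fix c assume "c \<in> orderings {1..n}"
  then obtain \<tau> where "\<tau> permutes {1..n}" "c = perm_order n \<tau>" using perm_order_surj by metis
  with eq[OF this(1)] show "measure ?M {u\<in>space ?M. restr n (rank_order u) = c} = q"
   unfolding q_def by (simp only:)
 qed
 also have "... = fact n * q" by (simp only: sum_constant card_orderings of_nat_fact)
 finally have "q = 1 / fact n" by (simp add: field_simps)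
 with eq[OF \<sigma>(1)] \<sigma>(2) show ?thesis unfolding q_def by (simp only:)
qed

text \<open>Shows that the definite description has a witness, the order of i.i.d. uniform
  variables, and that cells leave no other. This realisation is used again when the variables are
  recovered from their order.\<close>

lemma uniform_ordering_eq: "uniform_ordering = distr (unit_seq {1..}) N_orderings rank_order"
proof -
 interpret U: prob_space "unit_seq {1::nat..}" by (rule prob_space_unit_seq)
 let ?L = "distr (unit_seq {1..}) N_orderings rank_order"
 have L: "?L \<in> space (prob_algebra N_orderings)"
  by (auto simp: space_prob_algebra intro!: U.prob_space_distr measurable_rank_order_unit_seq)
 have cellL: "measure ?L (cell n b) = 1 / fact n" if "b \<in> orderings {1..n}" for n b
 proof -
  have "rank_order -` (cell n b) \<inter> space (unit_seq {1..}) = {u\<in>space (unit_seq {1..}). restr n (rank_order u) = b}"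
   using rank_order_in by auto
  then show ?thesis
   using measure_distr[OF measurable_rank_order_unit_seq sets_restr[of n b]] measure_rank_order[OF that] by simp
 qed
 have iff: "distr L (count_space (orderings {1..n})) (restr n) = uniform_count_measure (orderings {1..n})
   \<longleftrightarrow> (\<forall>b\<in>orderings {1..n}. measure L (cell n b) = 1 / fact n)"
  if "L \<in> space (prob_algebra N_orderings)" for L n
 proof -
  have sL: "sets L = sets N_orderings" and pL: "prob_space L" using that by (auto simp: space_prob_algebra)
  interpret L: prob_space L by (rule pL)
  have spL: "space L = orderings {1..}" using sets_eq_imp_space_eq[OF sL] by simp
  have m: "restr n \<in> L \<rightarrow>\<^sub>M count_space (orderings {1..n})"
   using finite_orderings_nat[of n] sets_restr[of n] sL spL restr_in
   by (subst measurable_count_space_eq2[OF finite_orderings_nat])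
    (auto simp: vimage_def Int_def conj_commute)
  have c: "emeasure (distr L (count_space (orderings {1..n})) (restr n)) {b} = ennreal (measure L (cell n b))"
   if "b \<in> orderings {1..n}" for b
   using that spL by (subst emeasure_distr[OF m]) (auto simp: L.emeasure_eq_measure vimage_def Int_def conj_commute)
  have u: "emeasure (uniform_count_measure (orderings {1..n})) {b} = ennreal (1 / fact n)" if "b \<in> orderings {1..n}" for b
   using that by (subst emeasure_uniform_count_measure) (auto simp: card_orderings divide_ennreal)
  show ?thesis
  proof
   assume eq: "distr L (count_space (orderings {1..n})) (restr n) = uniform_count_measure (orderings {1..n})"
   show "\<forall>b\<in>orderings {1..n}. measure L (cell n b) = 1 / fact n"
   proof
    fix b assume "b \<in> orderings {1..n}"
    from c[OF this] u[OF this] have "ennreal (measure L (cell n b)) = ennreal (1 / fact n)" by (simp only: eq)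
    then show "measure L (cell n b) = 1 / fact n" by (subst (asm) ennreal_inj) auto
   qed
  next
   assume "\<forall>b\<in>orderings {1..n}. measure L (cell n b) = 1 / fact n"
   then show "distr L (count_space (orderings {1..n})) (restr n) = uniform_count_measure (orderings {1..n})"
    using c u by (intro measure_eqI_finite[where A="orderings {1..n}"]) (auto simp: sets_uniform_count_measure)
  qed
 qed
 show ?thesis unfolding uniform_ordering_def
 proof (rule the_equality)
  show "?L \<in> space (prob_algebra N_orderings) & (\<forall>n. distr ?L (count_space (orderings {1..n})) (restr n) = uniform_count_measure (orderings {1..n}))"
   using L iff[OF L] cellL by blast
  fix L assume *: "L \<in> space (prob_algebra N_orderings) & (\<forall>n. distr L (count_space (orderings {1..n})) (restr n) = uniform_count_measure (orderings {1..n}))"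
  show "L = ?L"
   using * L iff[of L] cellL by (intro measure_eq_N) auto
 qed
qed

lemma uniform_ordering_prob: "uniform_ordering \<in> space (prob_algebra N_orderings)"
 unfolding uniform_ordering_eq
 by (auto simp: space_prob_algebra intro!: prob_space.prob_space_distr prob_space_unit_seq measurable_rank_order_unit_seq)

lemma measure_uniform_ordering:
 assumes "b \<in> orderings {1..n}"
 shows "measure uniform_ordering (cell n b) = 1 / fact n"
proof -
 have "rank_order -` (cell n b) \<inter> space (unit_seq {1..}) = {u\<in>space (unit_seq {1..}). restr n (rank_order u) = b}"
  using rank_order_in by auto
 then show ?thesis unfolding uniform_ordering_eq
  using measure_distr[OF measurable_rank_order_unit_seq sets_restr[of n b]] measure_rank_order[OF assms] by simp
qed

section \<open>Conditional kernels\<close>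

lemma is_kernelD:
 assumes "is_kernel K" "r \<in> orderings {1..}"
 shows "prob_space (K r)" "sets (K r) = sets N_orderings" "space (K r) = orderings {1..}"
proof -
 have "K r \<in> space (prob_algebra N_orderings)"
  using assms measurable_space[of K N_orderings "prob_algebra N_orderings" r] by (simp add: is_kernel_def)
 then show "prob_space (K r)" "sets (K r) = sets N_orderings" by (auto simp: space_prob_algebra)
 from sets_eq_imp_space_eq[OF this(2)] show "space (K r) = orderings {1..}" by simp
qed

lemma is_kernel_measure: 
 assumes "is_kernel K" "A \<in> sets N_orderings"
 shows "(%r. measure (K r) A) \<in> borel_measurable N_orderings"
 using assms by (intro measurable_compose[OF _ measurable_measure_prob_algebra]) (auto simp: is_kernel_def)

text \<open>\<open>Q\<close> is the joint law of \<open>X\<close> and an ordering drawn from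
  \<open>K (T \<omega>)\<close>. With it the integral that defines a conditional law becomes the
  measure of a rectangle, so identities for such integrals become equalities of measures.\<close>

lemma kernel_pair_measure:
 assumes M: "prob_space M" and X: "X \<in> M \<rightarrow>\<^sub>M E" and T: "T \<in> M \<rightarrow>\<^sub>M N_orderings" and K: "is_kernel K"
 defines "Q \<equiv> M \<bind> (%\<omega>. distr (K (T \<omega>)) (E \<Otimes>\<^sub>M N_orderings) (%y. (X \<omega>, y)))"
 shows "Q \<in> space (prob_algebra (E \<Otimes>\<^sub>M N_orderings))"
  "B \<in> sets E ==> A \<in> sets N_orderings ==> measure Q (B \<times> A) = (\<integral>\<omega>. indicator B (X \<omega>) * measure (K (T \<omega>)) A \<partial>M)"
proof -
 interpret M: prob_space M by fact
 have KT: "(%\<omega>. K (T \<omega>)) \<in> M \<rightarrow>\<^sub>M prob_algebra N_orderings"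
  using measurable_compose[OF T] K by (simp add: is_kernel_def)
 have pm: "(%(\<omega>, y). (X \<omega>, y)) \<in> M \<Otimes>\<^sub>M N_orderings \<rightarrow>\<^sub>M E \<Otimes>\<^sub>M N_orderings"
  using X by measurable
 have D: "(%\<omega>. distr (K (T \<omega>)) (E \<Otimes>\<^sub>M N_orderings) (%y. (X \<omega>, y))) \<in> M \<rightarrow>\<^sub>M prob_algebra (E \<Otimes>\<^sub>M N_orderings)"
  by (rule measurable_distr_prob_space2[OF KT pm])
 have M': "M \<in> space (prob_algebra M)" by (simp add: space_prob_algebra M.prob_space_axioms)
 show Q: "Q \<in> space (prob_algebra (E \<Otimes>\<^sub>M N_orderings))"
  using prob_space_bind'[OF M' D] sets_bind'[OF M' D] by (simp add: Q_def space_prob_algebra)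
 assume B: "B \<in> sets E" and A: "A \<in> sets N_orderings"
 have KTm: "(%\<omega>. measure (K (T \<omega>)) A) \<in> borel_measurable M"
  using measurable_compose[OF T is_kernel_measure[OF K A]] .
 have "emeasure Q (B \<times> A) = (\<integral>\<^sup>+\<omega>. emeasure (distr (K (T \<omega>)) (E \<Otimes>\<^sub>M N_orderings) (%y. (X \<omega>, y))) (B \<times> A) \<partial>M)"
  unfolding Q_def using A B by (intro emeasure_bind_prob_algebra[OF M' D]) auto
 also have "... = (\<integral>\<^sup>+\<omega>. ennreal (indicator B (X \<omega>) * measure (K (T \<omega>)) A) \<partial>M)"
 proof (rule nn_integral_cong)
  fix \<omega> assume w: "\<omega> \<in> space M"
  note k = is_kernelD[OF K, of "T \<omega>"]
  have Tw: "T \<omega> \<in> orderings {1..}" using measurable_space[OF T w] by simp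
  interpret K: prob_space "K (T \<omega>)" by (rule k(1)[OF Tw])
  have "(%y. (X \<omega>, y)) \<in> K (T \<omega>) \<rightarrow>\<^sub>M E \<Otimes>\<^sub>M N_orderings"
   using measurable_space[OF X w] by (subst measurable_cong_sets[OF k(2)[OF Tw] refl]) simp
  moreover have "(%y. (X \<omega>, y)) -` (B \<times> A) \<inter> space (K (T \<omega>)) = (if X \<omega> \<in> B then A else {})"
   using sets.sets_into_space[OF A] k(3)[OF Tw] by auto
  ultimately show "emeasure (distr (K (T \<omega>)) (E \<Otimes>\<^sub>M N_orderings) (%y. (X \<omega>, y))) (B \<times> A) = ennreal (indicator B (X \<omega>) * measure (K (T \<omega>)) A)"
   using A B by (subst emeasure_distr) (auto simp: K.emeasure_eq_measure)
 qed
 also have "... = ennreal (\<integral>\<omega>. indicator B (X \<omega>) * measure (K (T \<omega>)) A \<partial>M)"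
 proof (rule nn_integral_eq_integral)
  have "(%\<omega>. indicator B (X \<omega>) :: real) \<in> borel_measurable M" using X B by measurable
  then show "integrable M (%\<omega>. indicator B (X \<omega>) * measure (K (T \<omega>)) A)"
  proof (intro M.integrable_const_bound[where B=1] AE_I2 borel_measurable_times KTm)
   fix \<omega> assume "\<omega> \<in> space M"
   then have "T \<omega> \<in> orderings {1..}" using measurable_space[OF T] by simp
   from prob_space.prob_le_1[OF is_kernelD(1)[OF K this]]
   show "norm (indicator B (X \<omega>) * measure (K (T \<omega>)) A) <= 1" by (simp add: indicator_def)
  qed
 qed auto
 finally show "measure Q (B \<times> A) = (\<integral>\<omega>. indicator B (X \<omega>) * measure (K (T \<omega>)) A \<partial>M)"
  by (simp add: measure_def integral_nonneg_AE)
qed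

text \<open>Replaces \<open>real_cond_exp\<close> by its characterising integrals over the events of
  \<open>X\<close>, the only form used afterwards. Writing \<open>T\<close> as a measurable function
  \<open>g\<close> of \<open>X\<close> makes \<open>measure (K (T \<omega>)) A\<close> measurable
  for the sigma-algebra of \<open>X\<close>.\<close>

lemma conditional_kernel_iff:
 assumes M: "prob_space M" and X: "X \<in> M \<rightarrow>\<^sub>M E" and Y: "Y \<in> M \<rightarrow>\<^sub>M N_orderings"
  and g: "g \<in> E \<rightarrow>\<^sub>M N_orderings" and T: "\<And>\<omega>. \<omega> \<in> space M ==> T \<omega> = g (X \<omega>)"
 shows "conditional_kernel M E X T Y K \<longleftrightarrow> is_kernel K \<and>
  (\<forall>B\<in>sets E. \<forall>A\<in>sets N_orderings. measure M {\<omega>\<in>space M. X \<omega> \<in> B & Y \<omega> \<in> A} = (\<integral>\<omega>. indicator B (X \<omega>) * measure (K (T \<omega>)) A \<partial>M))"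
proof -
 interpret M: prob_space M by fact
 let ?F = "vimage_algebra (space M) X E"
 have sF: "sets ?F = {X -` A \<inter> space M | A. A \<in> sets E}"
  using measurable_space[OF X] by (intro sets_vimage_algebra2) auto
 have sub: "subalgebra M ?F"
  unfolding subalgebra_def sF using measurable_sets[OF X] by auto
 interpret F: finite_measure_subalgebra M ?F
  by unfold_locales (rule sub)
 have XF: "X \<in> ?F \<rightarrow>\<^sub>M E" using measurable_space[OF X] by (intro measurable_vimage_algebra1) auto
 have TM: "T \<in> M \<rightarrow>\<^sub>M N_orderings"
  using measurable_compose[OF X g] T by (subst measurable_cong[where g="%\<omega>. g (X \<omega>)"])
 have YA: "{\<omega>\<in>space M. Y \<omega> \<in> A} \<in> sets M" if "A \<in> sets N_orderings" for A
  using measurable_sets[OF Y that] by (simp add: vimage_def Int_def conj_commute)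
 have ind: "integrable M (indicator {\<omega>\<in>space M. Y \<omega> \<in> A} :: _ => real)" if "A \<in> sets N_orderings" for A
  using YA[OF that] by (simp add: M.emeasure_eq_measure)
 have lhs: "(\<integral>\<omega>\<in>X -` B \<inter> space M. indicator {\<omega>\<in>space M. Y \<omega> \<in> A} \<omega> \<partial>M) = measure M {\<omega>\<in>space M. X \<omega> \<in> B & Y \<omega> \<in> A}"
  if "A \<in> sets N_orderings" "B \<in> sets E" for A B
 proof -
  have "(\<integral>\<omega>\<in>X -` B \<inter> space M. indicator {\<omega>\<in>space M. Y \<omega> \<in> A} \<omega> \<partial>M) = (\<integral>\<omega>. indicator {\<omega>\<in>space M. X \<omega> \<in> B & Y \<omega> \<in> A} \<omega> \<partial>M)"
   unfolding set_lebesgue_integral_def by (intro Bochner_Integration.integral_cong) (auto simp: indicator_def)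
  also have "... = measure M ({\<omega>\<in>space M. X \<omega> \<in> B & Y \<omega> \<in> A} \<inter> space M)" by (rule Bochner_Integration.integral_indicator)
  finally show ?thesis by (simp add: Int_def conj_commute cong: conj_cong)
 qed
 have rhs: "(\<integral>\<omega>\<in>X -` B \<inter> space M. f \<omega> \<partial>M) = (\<integral>\<omega>. indicator B (X \<omega>) * f \<omega> \<partial>M)" for B and f :: "_ => real"
  unfolding set_lebesgue_integral_def by (intro Bochner_Integration.integral_cong) (auto simp: indicator_def)
 show ?thesis
 proof (intro iffI conjI ballI)
  assume ck: "conditional_kernel M E X T Y K"
  then show K: "is_kernel K" by (simp add: conditional_kernel_def)
  fix B A assume B: "B \<in> sets E" and A: "A \<in> sets N_orderings"
  have ae: "AE \<omega> in M. real_cond_exp M ?F (indicator {\<omega>\<in>space M. Y \<omega> \<in> A}) \<omega> = measure (K (T \<omega>)) A"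
   using ck A by (simp add: conditional_kernel_def)
  have BF: "X -` B \<inter> space M \<in> sets ?F" using B by (auto simp: sF)
  have "measure M {\<omega>\<in>space M. X \<omega> \<in> B & Y \<omega> \<in> A} = (\<integral>\<omega>\<in>X -` B \<inter> space M. indicator {\<omega>\<in>space M. Y \<omega> \<in> A} \<omega> \<partial>M)"
   by (rule lhs[OF A B, symmetric])
  also have "... = (\<integral>\<omega>\<in>X -` B \<inter> space M. real_cond_exp M ?F (indicator {\<omega>\<in>space M. Y \<omega> \<in> A}) \<omega> \<partial>M)"
   by (rule F.real_cond_exp_intA[OF ind[OF A] BF])
  also have "... = (\<integral>\<omega>. indicator B (X \<omega>) * real_cond_exp M ?F (indicator {\<omega>\<in>space M. Y \<omega> \<in> A}) \<omega> \<partial>M)"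
   by (rule rhs)
  also have "... = (\<integral>\<omega>. indicator B (X \<omega>) * measure (K (T \<omega>)) A \<partial>M)"
  proof (rule integral_cong_AE)
   have i: "(%\<omega>. indicator B (X \<omega>) :: real) \<in> borel_measurable M" using X B by measurable
   show "(%\<omega>. indicator B (X \<omega>) * real_cond_exp M ?F (indicator {\<omega>\<in>space M. Y \<omega> \<in> A}) \<omega>) \<in> borel_measurable M"
    by (intro borel_measurable_times i borel_measurable_cond_exp2)
   show "(%\<omega>. indicator B (X \<omega>) * measure (K (T \<omega>)) A) \<in> borel_measurable M"
    by (intro borel_measurable_times i measurable_compose[OF TM is_kernel_measure[OF K A]])
   show "AE \<omega> in M. indicator B (X \<omega>) * real_cond_exp M ?F (indicator {\<omega>\<in>space M. Y \<omega> \<in> A}) \<omega> = indicator B (X \<omega>) * measure (K (T \<omega>)) A"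
    using ae by eventually_elim simp
  qed
  finally show "measure M {\<omega>\<in>space M. X \<omega> \<in> B & Y \<omega> \<in> A} = (\<integral>\<omega>. indicator B (X \<omega>) * measure (K (T \<omega>)) A \<partial>M)" .
 next
  assume *: "is_kernel K \<and>
   (\<forall>B\<in>sets E. \<forall>A\<in>sets N_orderings. measure M {\<omega>\<in>space M. X \<omega> \<in> B & Y \<omega> \<in> A} = (\<integral>\<omega>. indicator B (X \<omega>) * measure (K (T \<omega>)) A \<partial>M))"
  then have K: "is_kernel K" by simp
  show "conditional_kernel M E X T Y K" unfolding conditional_kernel_def
  proof (intro conjI ballI K)
   fix A assume A: "A \<in> sets N_orderings"
   have mF: "(%\<omega>. measure (K (T \<omega>)) A) \<in> borel_measurable ?F"
   proof (rule measurable_cong[THEN iffD2])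
    show "(%\<omega>. measure (K (g (X \<omega>))) A) \<in> borel_measurable ?F"
     by (rule measurable_compose[OF XF measurable_compose[OF g is_kernel_measure[OF K A]]])
    show "measure (K (T \<omega>)) A = measure (K (g (X \<omega>))) A" if "\<omega> \<in> space ?F" for \<omega>
     using that T by simp
   qed
   show "AE \<omega> in M. real_cond_exp M ?F (indicator {\<omega>\<in>space M. Y \<omega> \<in> A}) \<omega> = measure (K (T \<omega>)) A"
   proof (rule F.real_cond_exp_charact[OF _ ind[OF A] _ mF])
    fix C assume "C \<in> sets ?F"
    then obtain B where B: "B \<in> sets E" "C = X -` B \<inter> space M" by (auto simp: sF)
    show "(\<integral>\<omega>\<in>C. indicator {\<omega>\<in>space M. Y \<omega> \<in> A} \<omega> \<partial>M) = (\<integral>\<omega>\<in>C. measure (K (T \<omega>)) A \<partial>M)"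
     unfolding B(2) lhs[OF A B(1)] rhs[of B "%\<omega>. measure (K (T \<omega>)) A"] using * B(1) A by blast
   next
    show "integrable M (%\<omega>. measure (K (T \<omega>)) A)"
    proof (intro M.integrable_const_bound[where B=1] AE_I2 measurable_compose[OF TM is_kernel_measure[OF K A]])
     fix \<omega> assume "\<omega> \<in> space M"
     then have "T \<omega> \<in> orderings {1..}" using measurable_space[OF TM] by simp
     from prob_space.prob_le_1[OF is_kernelD(1)[OF K this]]
     show "norm (measure (K (T \<omega>)) A) <= 1" by simp
    qed
   qed
  qed
 qed
qed

text \<open>The two sides are the values on \<open>B \<times> A\<close> of the law of
  \<open>(X, Y)\<close> and of the measure \<open>Q\<close> of \<open>kernel_pair_measure\<close>;
  these measures agree on products of cells.\<close>

lemma kernel_integral_from_cells: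
 assumes M: "prob_space M" and X: "X \<in> M \<rightarrow>\<^sub>M E" and Y: "Y \<in> M \<rightarrow>\<^sub>M N_orderings"
  and T: "T \<in> M \<rightarrow>\<^sub>M N_orderings" and K: "is_kernel K" and f: "filtered E c"
  and eq: "\<And>n x b. x \<in> space E ==> b \<in> orderings {1..n} ==>
   measure M {\<omega>\<in>space M. c n (X \<omega>) = c n x & restr n (Y \<omega>) = b} =
   (\<integral>\<omega>. indicator {y\<in>space E. c n y = c n x} (X \<omega>) * measure (K (T \<omega>)) (cell n b) \<partial>M)"
  and BA: "B \<in> sets E" "A \<in> sets N_orderings"
 shows "measure M {\<omega>\<in>space M. X \<omega> \<in> B & Y \<omega> \<in> A} = (\<integral>\<omega>. indicator B (X \<omega>) * measure (K (T \<omega>)) A \<partial>M)"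
proof -
 interpret M: prob_space M by fact
 define Q where "Q = M \<bind> (%\<omega>. distr (K (T \<omega>)) (E \<Otimes>\<^sub>M N_orderings) (%y. (X \<omega>, y)))"
 note Q = kernel_pair_measure[OF M X T K, folded Q_def]
 interpret Q: prob_space Q using Q(1) by (simp add: space_prob_algebra)
 have sQ: "sets Q = sets (E \<Otimes>\<^sub>M N_orderings)" using Q(1) by (simp add: space_prob_algebra)
 have XY: "(%\<omega>. (X \<omega>, Y \<omega>)) \<in> M \<rightarrow>\<^sub>M E \<Otimes>\<^sub>M N_orderings" using X Y by simp
 let ?D = "distr M (E \<Otimes>\<^sub>M N_orderings) (%\<omega>. (X \<omega>, Y \<omega>))"
 interpret D: prob_space ?D by (rule M.prob_space_distr[OF XY])
 have D: "measure ?D (B \<times> A) = measure M {\<omega>\<in>space M. X \<omega> \<in> B & Y \<omega> \<in> A}" if "B \<in> sets E" "A \<in> sets N_orderings" for A B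
  using that by (subst measure_distr[OF XY]) (auto intro!: arg_cong2[where f=measure])
 have "?D = Q"
 proof (rule measure_eq_filtered[OF filtered_pair[OF f filtered_N]])
  fix n and x assume x: "x \<in> space (E \<Otimes>\<^sub>M N_orderings)"
  obtain e b where xe: "x = (e, b)" by (cases x)
  with x have e: "e \<in> space E" and b: "b \<in> orderings {1..}" by (auto simp: space_pair_measure)
  let ?C = "{y\<in>space E. c n y = c n e}" and ?A = "(cell n (restr n b))"
  have C: "?C \<in> sets E" by (rule cell_in_sets[OF f])
  have *: "{y \<in> space (E \<Otimes>\<^sub>M N_orderings). (case y of (x, y) => (c n x, restr n y)) = (case x of (x, y) => (c n x, restr n y))} = ?C \<times> ?A"
   by (auto simp: xe space_pair_measure)
  have "{\<omega>\<in>space M. X \<omega> \<in> ?C & Y \<omega> \<in> ?A} = {\<omega>\<in>space M. c n (X \<omega>) = c n e & restr n (Y \<omega>) = restr n b}"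
   using measurable_space[OF X] measurable_space[OF Y] by auto
  then have "measure ?D (?C \<times> ?A) = measure Q (?C \<times> ?A)"
   unfolding Q(2)[OF C sets_restr] D[OF C sets_restr] using eq[OF e restr_in[OF b]] by simp
  then show "emeasure ?D {y \<in> space (E \<Otimes>\<^sub>M N_orderings). (case y of (x, y) => (c n x, restr n y)) = (case x of (x, y) => (c n x, restr n y))} =
   emeasure Q {y \<in> space (E \<Otimes>\<^sub>M N_orderings). (case y of (x, y) => (c n x, restr n y)) = (case x of (x, y) => (c n x, restr n y))}"
   unfolding * by (simp add: D.emeasure_eq_measure Q.emeasure_eq_measure)
 qed (auto simp: sQ D.finite_measure_axioms)
 with D[OF BA] Q(2)[OF BA] show ?thesis by simp
qed

section \<open>Consistent families of laws on permutations\<close>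

text \<open>Law of the ordering one time unit earlier when the present one is \<open>b\<close>. The
  walk multiplies ranks on the left, so going back multiplies by the inverse step, and
  \<open>T n\<close> is the law of that inverse.\<close>

definition step :: "(nat => (nat => nat) pmf) => nat => nat rel => nat rel pmf" where
 "step T n b = map_pmf (%\<tau>. perm_order n (\<tau> \<circ> perm_of n b)) (T n)"

definition perm_family :: "(nat => (nat => nat) pmf) => bool" where
 "perm_family T \<longleftrightarrow> (\<forall>n. set_pmf (T n) \<subseteq> perms n)"

lemma perm_familyD: "perm_family T ==> set_pmf (T n) \<subseteq> perms n"
 by (simp add: perm_family_def)

text \<open>The type 2 property as a condition on laws: given the present ordering \<open>b\<close>
  of \<open>{1..n}\<close>, the past on \<open>{1..m}\<close> depends on \<open>b\<close> through
  \<open>restr m b\<close> only.\<close>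

definition consistent :: "(nat => (nat => nat) pmf) => bool" where
 "consistent T \<longleftrightarrow> perm_family T \<and>
  (\<forall>m n b. m <= n --> b \<in> orderings {1..n} --> map_pmf (restr m) (step T n b) = step T m (restr m b))"

abbreviation unif :: "nat => nat rel pmf" where
 "unif n \<equiv> pmf_of_set (orderings {1..n})"

lemma set_step: 
 assumes "perm_family T" "b \<in> orderings {1..n}" shows "set_pmf (step T n b) \<subseteq> orderings {1..n}"
 using perm_familyD[OF assms(1), of n] perm_of'[OF assms(2)]
 by (auto simp: step_def intro!: perm_order_in permutes_compose)

lemma consistent_set: "consistent T ==> perm_family T"
 by (simp add: consistent_def)

lemma consistent_step: 
 "consistent T ==> m <= n ==> b \<in> orderings {1..n} ==> map_pmf (restr m) (step T n b) = step T m (restr m b)"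
 by (simp add: consistent_def)

lemma pmf_step:
 assumes T: "perm_family T" and a: "a \<in> orderings {1..n}" and b: "b \<in> orderings {1..n}"
 shows "pmf (step T n b) a = pmf (T n) (perm_of n a \<circ> inv (perm_of n b))"
proof -
 note A = perm_of'[OF a] and B = perm_of'[OF b]
 have iff: "perm_order n (\<tau> \<circ> perm_of n b) = a \<longleftrightarrow> \<tau> = perm_of n a \<circ> inv (perm_of n b)" if "\<tau> permutes {1..n}" for \<tau>
 proof
  assume "perm_order n (\<tau> \<circ> perm_of n b) = a"
  then have "perm_of n a = \<tau> \<circ> perm_of n b"
   using perm_of_order[OF permutes_compose[OF B(1) that]] by simp
  then show "\<tau> = perm_of n a \<circ> inv (perm_of n b)" using permutes_inv_o(1)[OF B(1)] by (simp add: comp_assoc)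
 next
  assume "\<tau> = perm_of n a \<circ> inv (perm_of n b)"
  then show "perm_order n (\<tau> \<circ> perm_of n b) = a"
   using permutes_inv_o(2)[OF B(1)] A(2) by (simp add: comp_assoc)
 qed
 have "pmf (step T n b) a = measure (T n) ((%\<tau>. perm_order n (\<tau> \<circ> perm_of n b)) -` {a})"
  by (simp add: step_def pmf_map)
 also have "... = measure (T n) {perm_of n a \<circ> inv (perm_of n b)}"
 proof (rule measure_prob_cong_0)
  fix x assume x: "x \<in> (%\<tau>. perm_order n (\<tau> \<circ> perm_of n b)) -` {a} - {perm_of n a \<circ> inv (perm_of n b)}"
  then have "x \<notin> set_pmf (T n)" using perm_familyD[OF T, of n] iff by auto
  then show "pmf (T n) x = 0" by (simp add: pmf_eq_0_set_pmf)
 next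
  fix x assume x: "x \<in> {perm_of n a \<circ> inv (perm_of n b)} - (%\<tau>. perm_order n (\<tau> \<circ> perm_of n b)) -` {a}"
  then have "x \<notin> set_pmf (T n)" using perm_familyD[OF T, of n] iff by auto
  then show "pmf (T n) x = 0" by (simp add: pmf_eq_0_set_pmf)
 qed
 finally show ?thesis by (simp add: measure_pmf_single)
qed

lemma set_unif: "set_pmf (unif n) = orderings {1..n}"
 by (rule set_pmf_of_set) (simp_all add: orderings_nonempty)

lemma pmf_unif: "b \<in> orderings {1..n} ==> pmf (unif n) b = 1 / fact n"
 by (subst pmf_of_set) (auto simp: orderings_nonempty card_orderings)

text \<open>Both laws are restrictions of the same \<open>uniform_ordering\<close>; this takes the
  place of counting the extensions of an ordering.\<close>

lemma unif_restr:
 assumes "m <= n" shows "map_pmf (restr m) (unif n) = unif m"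
proof (rule pmf_eqI)
 fix a :: "nat rel"
 have sub: "set_pmf (map_pmf (restr m) (unif n)) \<subseteq> orderings {1..m}"
  using assms by (auto simp: set_unif intro: restr_in')
 show "pmf (map_pmf (restr m) (unif n)) a = pmf (unif m) a"
 proof (cases "a \<in> orderings {1..m}")
  case False
  then show ?thesis using sub set_unif[of m] by (metis pmf_eq_0_set_pmf subsetD)
 next
  case True
  interpret U: prob_space uniform_ordering using uniform_ordering_prob by (simp add: space_prob_algebra)
  have sU: "sets uniform_ordering = sets N_orderings" using uniform_ordering_prob by (simp add: space_prob_algebra)
  let ?B = "{b\<in>orderings {1..n}. restr m b = a}"
  have "pmf (map_pmf (restr m) (unif n)) a = measure (unif n) (restr m -` {a})" by (simp add: pmf_map)
  also have "... = measure (unif n) ?B"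
   by (rule measure_prob_cong_0) (auto simp: pmf_eq_0_set_pmf set_unif)
  also have "... = (\<Sum>b\<in>?B. pmf (unif n) b)" by (rule measure_measure_pmf_finite) simp
  also have "... = (\<Sum>b\<in>?B. measure uniform_ordering (cell n b))"
   by (rule sum.cong) (auto simp: pmf_unif measure_uniform_ordering)
  also have "... = measure uniform_ordering (\<Union>b\<in>?B. (cell n b))"
   by (rule U.finite_measure_finite_Union[symmetric]) (auto simp: disjoint_family_on_def sU intro: sets_restr)
  also have "(\<Union>b\<in>?B. (cell n b)) = (cell m a)"
   using restr_in[of _ n] restr_restr[OF assms] by auto
  finally show ?thesis by (simp add: measure_uniform_ordering[OF True] pmf_unif[OF True])
 qed
qed

lemma bij_left_mult:
 assumes \<tau>: "\<tau> permutes {1..n}"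
 shows "bij_betw (%b. perm_order n (\<tau> \<circ> perm_of n b)) (orderings {1..n}) (orderings {1..n})"
proof (rule bij_betwI[where g="%b. perm_order n (inv \<tau> \<circ> perm_of n b)"])
 have in_ord: "perm_order n (\<sigma> \<circ> perm_of n b) \<in> orderings {1..n}" if "\<sigma> permutes {1..n}" "b \<in> orderings {1..n}" for \<sigma> b
  using that perm_of'(1)[OF that(2)] by (intro perm_order_in permutes_compose)
 have cancel: "perm_order n (\<sigma>' \<circ> perm_of n (perm_order n (\<sigma> \<circ> perm_of n b))) = b"
  if "\<sigma> permutes {1..n}" "\<sigma>' \<circ> \<sigma> = id" "b \<in> orderings {1..n}" for \<sigma> \<sigma>' b
  using that perm_of'[OF that(3)] by (simp add: perm_of_order permutes_compose comp_assoc[symmetric])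
 show "(%b. perm_order n (\<tau> \<circ> perm_of n b)) \<in> orderings {1..n} \<rightarrow> orderings {1..n}"
  "(%b. perm_order n (inv \<tau> \<circ> perm_of n b)) \<in> orderings {1..n} \<rightarrow> orderings {1..n}"
  using in_ord \<tau> permutes_inv[OF \<tau>] by auto
 show "perm_order n (inv \<tau> \<circ> perm_of n (perm_order n (\<tau> \<circ> perm_of n b))) = b" if "b \<in> orderings {1..n}" for b
  using cancel[OF \<tau> permutes_inv_o(2)[OF \<tau>] that] .
 show "perm_order n (\<tau> \<circ> perm_of n (perm_order n (inv \<tau> \<circ> perm_of n b))) = b" if "b \<in> orderings {1..n}" for b
  using cancel[OF permutes_inv[OF \<tau>] permutes_inv_o(1)[OF \<tau>] that] .
qed

text \<open>Every left translation permutes the orderings of \<open>{1..n}\<close>, so the uniform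
  law is also stationary for the backward steps.\<close>

lemma unif_step:
 assumes "perm_family T" shows "bind_pmf (unif n) (step T n) = unif n"
proof -
 have "bind_pmf (unif n) (step T n) = bind_pmf (T n) (%\<tau>. map_pmf (%b. perm_order n (\<tau> \<circ> perm_of n b)) (unif n))"
  unfolding step_def map_pmf_def by (rule bind_commute_pmf)
 also have "... = bind_pmf (T n) (%\<tau>. unif n)"
  using perm_familyD[OF assms, of n] by (intro bind_pmf_cong refl map_pmf_of_set_bij_betw bij_left_mult) (auto simp: orderings_nonempty)
 finally show ?thesis by simp
qed

text \<open>The path law is built backwards in time: conditionally on the whole ordering at time \<open>h + 1\<close>
  the restriction to \<open>{1..n}\<close> at time \<open>h\<close> depends on the restriction at time \<open>h + 1\<close> only.\<close>

primrec back_path :: "(nat => (nat => nat) pmf) => nat => nat => nat rel => (nat => nat rel) pmf" where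
 "back_path T n 0 b = return_pmf ((%_. {})(0 := b))"
| "back_path T n (Suc H) b = bind_pmf (step T n b) (%a. map_pmf (%f. f(Suc H := b)) (back_path T n H a))"

definition path_pmf :: "(nat => (nat => nat) pmf) => nat => nat => (nat => nat rel) pmf" where
 "path_pmf T n H = bind_pmf (unif n) (back_path T n H)"

lemma set_back_path:
 assumes T: "perm_family T" and b: "b \<in> orderings {1..n}" and f: "f \<in> set_pmf (back_path T n H b)"
 shows "f H = b" "h <= H ==> f h \<in> orderings {1..n}" "h > H ==> f h = {}"
proof -
 have "f H = b & (\<forall>h\<le>H. f h \<in> orderings {1..n}) & (\<forall>h>H. f h = {})"
  using b f
 proof (induction H arbitrary: b f)
  case 0 then show ?case by auto
 next
  case (Suc H)
  from Suc.prems(2) obtain a g where a: "a \<in> set_pmf (step T n b)" and g: "g \<in> set_pmf (back_path T n H a)" "f = g(Suc H := b)"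
   by (auto simp: set_bind_pmf)
  have "a \<in> orderings {1..n}" using set_step[OF T Suc.prems(1)] a by auto
  from Suc.IH[OF this g(1)] g(2) Suc.prems(1) show ?case by (auto simp: le_Suc_eq)
 qed
 then show "f H = b" "h <= H ==> f h \<in> orderings {1..n}" "h > H ==> f h = {}" by auto
qed

lemma set_path_pmf:
 assumes T: "perm_family T" and f: "f \<in> set_pmf (path_pmf T n H)"
 shows "h <= H ==> f h \<in> orderings {1..n}" "h > H ==> f h = {}"
proof -
 from f obtain b where "b \<in> orderings {1..n}" "f \<in> set_pmf (back_path T n H b)"
  by (auto simp: path_pmf_def set_bind_pmf set_unif)
 from set_back_path[OF T this]
 show "h <= H ==> f h \<in> orderings {1..n}" "h > H ==> f h = {}" by blast+
qed

lemma back_path_restr: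
 assumes T: "consistent T" and mn: "m <= n" and b: "b \<in> orderings {1..n}"
 shows "map_pmf (%f h. restr m (f h)) (back_path T n H b) = back_path T m H (restr m b)"
 using b
proof (induction H arbitrary: b)
 case 0
 have "(%h. restr m (((%_. {})(0 := b)) h)) = (%_. {})(0 := restr m b)" by (rule ext) (simp add: restr_def)
 then show ?case by simp
next
 case (Suc H)
 have "map_pmf (%f h. restr m (f h)) (back_path T n (Suc H) b)
   = bind_pmf (step T n b) (%a. map_pmf (%f. f(Suc H := restr m b)) (map_pmf (%f h. restr m (f h)) (back_path T n H a)))"
  by (simp add: map_bind_pmf map_pmf_comp fun_upd_def if_distrib cong: if_cong)
 also have "... = bind_pmf (step T n b) (%a. map_pmf (%f. f(Suc H := restr m b)) (back_path T m H (restr m a)))"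
  using set_step[OF consistent_set[OF T] Suc.prems] by (intro bind_pmf_cong refl) (auto simp: Suc.IH)
 also have "... = bind_pmf (map_pmf (restr m) (step T n b)) (%a. map_pmf (%f. f(Suc H := restr m b)) (back_path T m H a))"
  by (simp add: bind_map_pmf)
 finally show ?case by (simp add: consistent_step[OF T mn Suc.prems])
qed

lemma path_pmf_restr:
 assumes T: "consistent T" and mn: "m <= n"
 shows "map_pmf (%f h. restr m (f h)) (path_pmf T n H) = path_pmf T m H"
proof -
 have "map_pmf (%f h. restr m (f h)) (path_pmf T n H) = bind_pmf (unif n) (%b. back_path T m H (restr m b))"
  unfolding path_pmf_def map_bind_pmf
  by (intro bind_pmf_cong refl back_path_restr[OF T mn]) (simp add: set_unif)
 also have "... = bind_pmf (map_pmf (restr m) (unif n)) (back_path T m H)" by (simp add: bind_map_pmf)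
 finally show ?thesis by (simp add: unif_restr[OF mn] path_pmf_def)
qed

text \<open>By stationarity the ordering before the last step is again uniform, so forgetting the
  last time leaves a path of the same kind. Times beyond the horizon hold \<open>{}\<close>, which
  keeps paths of all lengths in one type.\<close>

lemma path_pmf_drop:
 assumes T: "perm_family T"
 shows "map_pmf (%f. f(Suc H := {})) (path_pmf T n (Suc H)) = path_pmf T n H"
proof -
 have "map_pmf (%f. f(Suc H := {})) (path_pmf T n (Suc H)) =
  bind_pmf (unif n) (%b. bind_pmf (step T n b) (%a. map_pmf (%f. f(Suc H := {})) (back_path T n H a)))"
  by (simp add: path_pmf_def map_bind_pmf map_pmf_comp)
 also have "... = bind_pmf (unif n) (%b. bind_pmf (step T n b) (%a. back_path T n H a))"
 proof (intro bind_pmf_cong refl)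
  fix b a assume "b \<in> set_pmf (unif n)" "a \<in> set_pmf (step T n b)"
  then have "a \<in> orderings {1..n}" using set_step[OF T, of b] by (auto simp: set_unif)
  then have "map_pmf (%f. f(Suc H := {})) (back_path T n H a) = map_pmf (%f. f) (back_path T n H a)"
   by (intro map_pmf_cong refl fun_upd_idem set_back_path(3)[OF T]) auto
  then show "map_pmf (%f. f(Suc H := {})) (back_path T n H a) = back_path T n H a" by simp
 qed
 also have "... = bind_pmf (bind_pmf (unif n) (step T n)) (back_path T n H)" by (simp add: bind_assoc_pmf)
 finally show ?thesis by (simp add: unif_step[OF T] path_pmf_def)
qed

lemma path_pmf_trunc:
 assumes T: "perm_family T" and "H <= H'"
 shows "map_pmf (%f h. if h <= H then f h else {}) (path_pmf T n H') = path_pmf T n H"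
 using assms(2)
proof (induction rule: dec_induct)
 case base
 have "map_pmf (%f h. if h <= H then f h else {}) (path_pmf T n H) = map_pmf (%f. f) (path_pmf T n H)"
 proof (intro map_pmf_cong refl ext)
  fix f h assume "f \<in> set_pmf (path_pmf T n H)"
  from set_path_pmf(2)[OF T this, of h] show "(if h <= H then f h else {}) = f h" by (simp add: not_le)
 qed
 then show ?case by simp
next
 case (step k)
 have "map_pmf (%f h. if h <= H then f h else {}) (path_pmf T n (Suc k)) =
  map_pmf (%f h. if h <= H then f h else {}) (map_pmf (%f. f(Suc k := {})) (path_pmf T n (Suc k)))"
  using step by (simp add: map_pmf_comp) (intro map_pmf_cong refl ext, auto)
 then show ?case by (simp add: path_pmf_drop[OF T] step.IH)
qed

lemma measure_bind_pmf_finite: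
 assumes "finite A" "set_pmf p \<subseteq> A"
 shows "measure (bind_pmf p q) S = (\<Sum>a\<in>A. pmf p a * measure (q a) S)"
proof -
 have "measure (bind_pmf p q) S = (\<integral>a. measure (q a) S \<partial>p)"
  by (simp add: measure_pmf_bind measure_pmf.measure_bind[where N="count_space UNIV"] measure_pmf_in_subprob_algebra)
 also have "... = (\<Sum>a\<in>A. pmf p a * measure (q a) S)"
  using assms by (subst integral_measure_pmf[of A]) auto
 finally show ?thesis .
qed

lemma measure_path_pmf_last:
 assumes T: "perm_family T" and b: "b \<in> orderings {1..n}"
 shows "measure (path_pmf T n H) {f. f \<in> S & f H = b} = measure (back_path T n H b) S / fact n"
proof -
 have "measure (path_pmf T n H) {f. f \<in> S & f H = b} = 
  (\<Sum>a\<in>orderings {1..n}. pmf (unif n) a * measure (back_path T n H a) {f. f \<in> S & f H = b})"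
  unfolding path_pmf_def by (rule measure_bind_pmf_finite) (auto simp: set_unif)
 also have "... = (\<Sum>a\<in>orderings {1..n}. if a = b then measure (back_path T n H b) S / fact n else 0)"
 proof (rule sum.cong[OF refl])
  fix a assume a: "a \<in> orderings {1..n}"
  have "measure (back_path T n H a) {f. f \<in> S & f H = b} = (if a = b then measure (back_path T n H b) S else 0)"
  proof (cases "a = b")
   case True
   have "f \<notin> set_pmf (back_path T n H b)" if "f H ~= b" for f
    using set_back_path(1)[OF T b, of f H] that by blast
   then have "measure (back_path T n H b) {f. f \<in> S & f H = b} = measure (back_path T n H b) S"
    by (intro measure_prob_cong_0) (auto simp: pmf_eq_0_set_pmf)
   then show ?thesis using True by simp
  next
   case False
   have "measure (back_path T n H a) {f. f \<in> S & f H = b} = measure (back_path T n H a) {}"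
   proof (rule measure_prob_cong_0)
    fix f assume "f \<in> {f. f \<in> S & f H = b} - {}"
    then have "f \<notin> set_pmf (back_path T n H a)"
     using set_back_path(1)[OF T a, of f H] False by blast
    then show "pmf (back_path T n H a) f = 0" by (simp add: pmf_eq_0_set_pmf)
   qed simp
   then show ?thesis using False by simp
  qed
  then show "pmf (unif n) a * measure (back_path T n H a) {f. f \<in> S & f H = b} = (if a = b then measure (back_path T n H b) S / fact n else 0)"
   using a by (simp add: pmf_unif)
 qed
 also have "... = measure (back_path T n H b) S / fact n" using b by simp
 finally show ?thesis .
qed

text \<open>Markov property of the backward path: once its value \<open>a\<close> at time
  \<open>H\<close> is fixed, the part up to \<open>H\<close> no longer depends on
  \<open>b\<close>.\<close>

lemma measure_back_path_Suc:
 assumes T: "perm_family T" and b: "b \<in> orderings {1..n}"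
 shows "measure (back_path T n (Suc H) b) {f. (%h. if h <= H then f h else {}) \<in> S & f H = a}
  = pmf (step T n b) a * measure (back_path T n H a) S"
proof -
 let ?A = "{f. (%h. if h <= H then f h else {}) \<in> S & f H = a}"
 have "measure (back_path T n (Suc H) b) ?A =
  (\<Sum>a'\<in>orderings {1..n}. pmf (step T n b) a' * measure (map_pmf (%f. f(Suc H := b)) (back_path T n H a')) ?A)"
  unfolding back_path.simps by (rule measure_bind_pmf_finite) (use set_step[OF T b] in auto)
 also have "... = (\<Sum>a'\<in>orderings {1..n}. if a' = a then pmf (step T n b) a * measure (back_path T n H a) S else 0)"
 proof (rule sum.cong[OF refl])
  fix a' assume a': "a' \<in> orderings {1..n}"
  have tr: "(%h. if h <= H then f h else {}) = f" if "f \<in> set_pmf (back_path T n H a')" for f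
  proof
   fix h show "(if h <= H then f h else {}) = f h" using set_back_path(3)[OF T a' that, of h] by (simp add: not_le)
  qed
  have tr': "(%h. if h <= H then (f(Suc H := b)) h else {}) = f" if "f \<in> set_pmf (back_path T n H a')" for f
  proof -
   have "(%h. if h <= H then (f(Suc H := b)) h else {}) = (%h. if h <= H then f h else {})" by (rule ext) simp
   then show ?thesis using tr[OF that] by simp
  qed
  have "measure (map_pmf (%f. f(Suc H := b)) (back_path T n H a')) ?A = measure (back_path T n H a') {f. f(Suc H := b) \<in> ?A}"
   by (simp add: vimage_def)
  also have "... = measure (back_path T n H a') (if a' = a then S else {})"
  proof (rule measure_prob_cong_0)
   have iff: "f(Suc H := b) \<in> ?A \<longleftrightarrow> f \<in> (if a' = a then S else {})" if "f \<in> set_pmf (back_path T n H a')" for f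
    using set_back_path(1)[OF T a' that] unfolding mem_Collect_eq tr'[OF that] by simp
   show "pmf (back_path T n H a') f = 0" if "f \<in> {f. f(Suc H := b) \<in> ?A} - (if a' = a then S else {})" for f
    using iff[of f] that unfolding pmf_eq_0_set_pmf by blast
   show "pmf (back_path T n H a') f = 0" if "f \<in> (if a' = a then S else {}) - {f. f(Suc H := b) \<in> ?A}" for f
    using iff[of f] that unfolding pmf_eq_0_set_pmf by blast
  qed
  finally show "pmf (step T n b) a' * measure (map_pmf (%f. f(Suc H := b)) (back_path T n H a')) ?A =
   (if a' = a then pmf (step T n b) a * measure (back_path T n H a) S else 0)" by simp
 qed
 also have "... = pmf (step T n b) a * measure (back_path T n H a) S"
 proof (cases "a \<in> orderings {1..n}")
  case False
  then have "pmf (step T n b) a = 0" using set_step[OF T b] by (auto simp: pmf_eq_0_set_pmf)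
  then show ?thesis by simp
 qed simp
 finally show ?thesis .
qed

section \<open>The process with given finite-dimensional laws\<close>

lemma sequence_space_pmf:
 fixes M :: "(nat => 'd) measure"
 assumes M: "prob_space M" "sets M = sets (PiM UNIV (%_. count_space UNIV))"
  and p: "\<And>d. measure M {x. x n = d} = pmf p d"
 shows "AE x in M. x n \<in> set_pmf p" "measure M {x. x n \<in> S} = measure p S"
proof -
 interpret prob_space M by fact
 note cyl = sequence_space_cylinder[OF M(2)]
 have eq: "emeasure M {x. x n \<in> S \<inter> set_pmf p} = emeasure p (S \<inter> set_pmf p)" for S
 proof -
  have "emeasure M (\<Union>d\<in>S \<inter> set_pmf p. {x. x n = d}) = (\<integral>\<^sup>+d. emeasure M {x. x n = d} \<partial>count_space (S \<inter> set_pmf p))"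
  proof (rule emeasure_UN_countable)
   show "{x. x n = d} \<in> sets M" for d by (rule cyl(2)[of "%y. y = d"])
   show "disjoint_family_on (%d. {x. x n = d}) (S \<inter> set_pmf p)" by (auto simp: disjoint_family_on_def)
  qed auto
  also have "(\<Union>d\<in>S \<inter> set_pmf p. {x. x n = d}) = {x. x n \<in> S \<inter> set_pmf p}" by auto
  finally show ?thesis by (simp add: emeasure_eq_measure p nn_integral_pmf)
 qed
 have "emeasure M {x. x n \<in> set_pmf p} = 1"
  using eq[of UNIV] by (simp add: measure_pmf.emeasure_eq_measure measure_measure_pmf_not_zero measure_pmf.prob_eq_1 AE_measure_pmf)
 then have "AE x in M. x \<in> {x. x n \<in> set_pmf p}" by (intro AE_prob_1) (simp add: emeasure_eq_measure)
 then show ae: "AE x in M. x n \<in> set_pmf p" by simp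
 have "measure M {x. x n \<in> S} = measure M {x. x n \<in> S \<inter> set_pmf p}"
 proof (rule finite_measure_eq_AE)
  show "AE x in M. (x \<in> {x. x n \<in> S}) = (x \<in> {x. x n \<in> S \<inter> set_pmf p})"
   using ae by eventually_elim simp
 qed (rule cyl)+
 also have "... = measure p (S \<inter> set_pmf p)" using eq[of S] by (simp add: measure_def)
 finally show "measure M {x. x n \<in> S} = measure p S" by (simp add: measure_Int_set_pmf)
qed

text \<open>The law of the infinite process is fixed by its restrictions to finitely many points and
  times. The padding by \<open>{}\<close> after \<open>H\<close> matches
  \<open>back_path\<close>.\<close>

definition path_law :: "(nat => (nat => nat) pmf) => (nat => nat rel) measure => bool" where
 "path_law T M \<longleftrightarrow> prob_space M & sets M = sets (PiM UNIV (%_. N_orderings)) \<and>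
  (\<forall>n H S. measure M {x\<in>space M. (%h. if h <= H then restr n (x h) else {}) \<in> S} = measure (path_pmf T n H) S)"

lemma sets_path_cylinder:
 "{x\<in>space (PiM UNIV (%_::nat. N_orderings)). (%h. if h <= H then restr n (x h) else {}) \<in> S}
  \<in> sets (PiM UNIV (%_::nat. N_orderings))"
proof -
 let ?P = "PiM UNIV (%_::nat. N_orderings)"
 have m1: "(%x. restrict x {..H}) \<in> ?P \<rightarrow>\<^sub>M PiM {..H} (%_. N_orderings)"
  by (rule measurable_restrict_subset) simp
 have m2: "(%x. \<lambda>h\<in>{..H}. restr n (x h)) \<in> PiM {..H} (%_. N_orderings) \<rightarrow>\<^sub>M count_space UNIV"
  by (rule filtered_measurable[OF filtered_PiM[OF filtered_N]]) simp
 have "(\<lambda>h\<in>{..H}. restr n (restrict x {..H} h)) = (\<lambda>h\<in>{..H}. restr n (x h))" for x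
  by (rule restrict_ext) simp
 then have "(%x. \<lambda>h\<in>{..H}. restr n (x h)) \<in> ?P \<rightarrow>\<^sub>M count_space UNIV"
  using measurable_compose[OF m1 m2] by simp
 from measurable_sets[OF this, of "{f. (%h. if h <= H then f h else {}) \<in> S}"]
 show ?thesis by (simp add: vimage_def Int_def conj_commute cong: if_cong)
qed

text \<open>The laws \<open>path_pmf T n n\<close> are compatible when space and time are cut
  together: consistency handles the restriction, stationarity the truncation. A single sequential
  limit along this diagonal therefore produces the whole process.\<close>

lemma exists_path_law:
 assumes T: "consistent T"
 shows "\<exists>M. path_law T M"
proof -
 note PF = consistent_set[OF T]
 define pr where "pr n f = (%h. if h <= n then restr n (f h) else {})" for n :: nat and f :: "nat => nat rel"
 have proj: "map_pmf (pr n) (path_pmf T (Suc n) (Suc n)) = path_pmf T n n" for n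
 proof -
  have "map_pmf (pr n) (path_pmf T (Suc n) (Suc n)) = 
   map_pmf (%f h. if h <= n then f h else {}) (map_pmf (%f h. restr n (f h)) (path_pmf T (Suc n) (Suc n)))"
   by (simp add: map_pmf_comp pr_def[abs_def])
  also have "... = map_pmf (%f h. if h <= n then f h else {}) (path_pmf T n (Suc n))"
   by (simp add: path_pmf_restr[OF T])
  finally show ?thesis by (simp add: path_pmf_trunc[OF PF])
 qed
 from projective_limit_pmf[where p="%n. path_pmf T n n" and \<pi>=pr, OF proj]
 obtain M :: "(nat => nat => nat rel) measure" where M: "prob_space M" "sets M = sets (PiM UNIV (%_. count_space UNIV))"
  "\<And>n. AE x in M. x n = pr n (x (Suc n))" "\<And>n d. measure M {x. x n = d} = pmf (path_pmf T n n) d"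
  by blast
 interpret prob_space M by fact
 note cyl = sequence_space_cylinder[OF M(2)]
 note law = sequence_space_pmf[OF M(1,2) M(4)]
 \<comment> \<open>Entry \<open>n\<close> of the limit sequence carries time \<open>h\<close> only
   if \<open>h \<le> n\<close>, hence the union over \<open>{h..}\<close>.\<close>
 define L where "L x h = to_ordering {1..} ((\<Union>n\<in>{h..}. x n h) \<inter> ({1..} \<times> {1..}))" for x :: "nat => nat => nat rel" and h
 have Lm: "(%x. L x h) \<in> M \<rightarrow>\<^sub>M N_orderings" for h
  unfolding L_def
 proof (rule measurable_to_ordering)
  fix p :: "nat \<times> nat" assume p: "p \<in> {1..} \<times> {1..}"
  have "{x \<in> space M. p \<in> (\<Union>n\<in>{h..}. x n h) \<inter> {1..} \<times> {1..}} = (\<Union>n\<in>{h..}. {x. p \<in> x n h})"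
   using p by (auto simp: cyl)
  also have "... \<in> sets M" by (rule sets.countable_UN') (auto intro: cyl(2)[of "%f. p \<in> f h"])
  finally show "{x \<in> space M. p \<in> (\<Union>n\<in>{h..}. x n h) \<inter> {1..} \<times> {1..}} \<in> sets M" .
 qed auto
 have good: "AE x in M. \<forall>n. x n \<in> set_pmf (path_pmf T n n) & x n = pr n (x (Suc n))"
  using law(1) M(3) by (simp add: AE_all_countable)
 have L_restr: "restr n (L x h) = x n h" 
  if x: "\<forall>n. x n \<in> set_pmf (path_pmf T n n) & x n = pr n (x (Suc n))" and nh: "h <= n" for x n h
 proof -
  have ord: "x k h \<in> orderings {1..k}" if "h <= k" for k
   using set_path_pmf(1)[OF PF, of "x k" k k h] x that by blast
  have pr: "restr k (x (Suc k) h) = x k h" if "h <= k" for k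
  proof -
   have "x k = pr k (x (Suc k))" using x by blast
   from fun_cong[OF this, of h] that show ?thesis by (simp add: pr_def)
  qed
  \<comment> \<open>Below level \<open>h\<close> the sequence does not carry time \<open>h\<close>;
    those levels are filled by restricting the entry with index \<open>h\<close>.\<close>
  define b where "b k = restr k (x (max k h) h)" for k
  have b_ge: "b k = x k h" if "h <= k" for k using ord[OF that] that by (simp add: b_def max_def restr_id)
  have b1: "b k \<in> orderings {1..k}" for k
   unfolding b_def using ord[of "max k h"] by (intro restr_in') auto
  have b2: "b (Suc k) \<inter> ({1..k} \<times> {1..k}) = b k" for k
  proof (cases "h <= k")
   case True then show ?thesis using pr[OF True] b_ge[of k] b_ge[of "Suc k"] by (simp add: restr_def)
  next
   case False
   then have "max (Suc k) h = h" "max k h = h" by auto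
   then show ?thesis unfolding b_def by (auto simp: restr_def)
  qed
  note U = orderings_Union[OF exhausts_nat b1 b2]
  have "(\<Union>k. b k) = (\<Union>k\<in>{h..}. x k h)"
  proof
   show "(\<Union>k. b k) \<subseteq> (\<Union>k\<in>{h..}. x k h)" by (auto simp: b_def restr_def intro!: bexI[of _ "max _ h"])
   show "(\<Union>k\<in>{h..}. x k h) \<subseteq> (\<Union>k. b k)" using b_ge by auto
  qed
  with U(1) have "L x h = (\<Union>k. b k)"
   using orderings_sub[OF U(1)] by (simp add: L_def to_ordering_id Int_absorb2)
  with U(2)[of n] b_ge[OF nh] show ?thesis by (simp add: restr_def)
 qed
 let ?P = "PiM UNIV (%_::nat. N_orderings)"
 have LP: "L \<in> M \<rightarrow>\<^sub>M ?P"
  by (rule measurable_PiM_single'[OF Lm]) (auto simp: L_def to_ordering_in)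
 have spP: "space ?P = UNIV \<rightarrow> orderings {1..}" by (auto simp: space_PiM PiE_def)
 have "path_law T (distr M ?P L)"
  unfolding path_law_def
 proof (intro conjI allI)
  show "prob_space (distr M ?P L)" by (rule prob_space_distr[OF LP])
  fix n H :: nat and S :: "(nat => nat rel) set"
  let ?N = "max n H"
  let ?E = "{x\<in>space (distr M ?P L). (%h. if h <= H then restr n (x h) else {}) \<in> S}"
  let ?S = "(%f h. if h <= H then restr n (f h) else {}) -` S"
  have "measure (distr M ?P L) ?E = measure M (L -` ?E \<inter> space M)"
   using sets_path_cylinder[of H n S] by (intro measure_distr[OF LP]) simp
  also have "... = measure M {x. x ?N \<in> ?S}"
  proof (rule finite_measure_eq_AE)
   show "AE x in M. (x \<in> L -` ?E \<inter> space M) = (x \<in> {x. x ?N \<in> ?S})"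
    using good AE_space
   proof eventually_elim
    case (elim x)
    have "(%h. if h <= H then restr n (L x h) else {}) = (%h. if h <= H then restr n (x ?N h) else {})"
    proof
     fix h
     have "restr n (L x h) = restr n (x ?N h)" if "h <= H"
      using L_restr[OF elim(1), of h ?N] that restr_restr[of n ?N "L x h"] by simp
     then show "(if h <= H then restr n (L x h) else {}) = (if h <= H then restr n (x ?N h) else {})" by simp
    qed
    then show ?case using measurable_space[OF LP elim(2)] elim(2) by simp
   qed
   show "L -` ?E \<inter> space M \<in> sets M" using sets_path_cylinder[of H n S] by (intro measurable_sets[OF LP]) simp
  qed (rule cyl)
  also have "... = measure (path_pmf T ?N ?N) ?S" by (rule law)
  also have "... = measure (map_pmf (%f h. if h <= H then restr n (f h) else {}) (path_pmf T ?N ?N)) S" by simp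
  also have "map_pmf (%f h. if h <= H then restr n (f h) else {}) (path_pmf T ?N ?N) =
   map_pmf (%f h. if h <= H then f h else {}) (map_pmf (%f h. restr n (f h)) (path_pmf T ?N ?N))"
   by (simp add: map_pmf_comp)
  also have "... = path_pmf T n H" by (simp add: path_pmf_restr[OF T] path_pmf_trunc[OF PF])
  finally show "measure (distr M ?P L) ?E = measure (path_pmf T n H) S" .
 qed simp
 then show ?thesis by blast
qed

text \<open>Coarse cells are finite disjoint unions of fine ones, so testing may start at any level
  \<open>k\<close>.\<close>

lemma measure_eq_filtered_ge:
 assumes f: "filtered E c" and s: "sets M = sets E" "sets N = sets E"
  and fin: "finite_measure M"
  and eq: "\<And>n x. k <= n ==> x \<in> space E ==> emeasure M {y\<in>space E. c n y = c n x} = emeasure N {y\<in>space E. c n y = c n x}"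
 shows "M = N"
proof (rule measure_eq_filtered[OF f s fin])
 fix n x assume x: "x \<in> space E"
 show "emeasure M {y\<in>space E. c n y = c n x} = emeasure N {y\<in>space E. c n y = c n x}"
 proof (cases "k <= n")
  case False
  let ?D = "c k ` {y\<in>space E. c n y = c n x}"
  have fD: "finite ?D" by (rule finite_subset[OF _ filtered_finite[OF f, of k]]) auto
  have U: "{y\<in>space E. c n y = c n x} = (\<Union>d\<in>?D. {y\<in>space E. c k y = d})"
  proof
   show "(\<Union>d\<in>?D. {y\<in>space E. c k y = d}) \<subseteq> {y\<in>space E. c n y = c n x}"
   proof
    fix y assume "y \<in> (\<Union>d\<in>?D. {y\<in>space E. c k y = d})"
    then obtain z where z: "z \<in> space E" "c n z = c n x" "y \<in> space E" "c k y = c k z" by auto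
    have "c n y = c n z" by (rule filtered_mono[OF f _ z(3,1,4)]) (use False in simp)
    with z show "y \<in> {y\<in>space E. c n y = c n x}" by simp
   qed
  qed auto
  have sum: "emeasure L {y\<in>space E. c n y = c n x} = (\<Sum>d\<in>?D. emeasure L {y\<in>space E. c k y = d})"
   if "sets L = sets E" for L
  proof -
   have "(\<Sum>d\<in>?D. emeasure L {y\<in>space E. c k y = d}) = emeasure L (\<Union>d\<in>?D. {y\<in>space E. c k y = d})"
    by (rule sum_emeasure) (use that cell_in_sets[OF f] fD in \<open>auto simp: disjoint_family_on_def\<close>)
   then show ?thesis by (simp only: U[symmetric])
  qed
  show ?thesis unfolding sum[OF s(1)] sum[OF s(2)]
   by (rule sum.cong[OF refl]) (use eq[of k] in auto)
 qed (use eq x in auto)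
qed

section \<open>Type 2 processes from consistent families\<close>

text \<open>Both sides are the probability that successive orderings of the stationary process
  restrict to \<open>a\<close> and then to \<open>b\<close>: computed forwards by \<open>K\<close>
  from a uniform start, and backwards by \<open>step\<close> from a uniform end.\<close>

definition corresponds :: "(nat => (nat => nat) pmf) => (nat rel => nat rel measure) => bool" where
 "corresponds T K \<longleftrightarrow> is_kernel K \<and>
  (\<forall>n. \<forall>a\<in>orderings {1..n}. \<forall>b\<in>orderings {1..n}.
    (\<integral>r. indicator (cell n a) r * measure (K r) (cell n b) \<partial>uniform_ordering)
    = pmf (step T n b) a / fact n)"

context
 fixes T M assumes T: "consistent T" and M: "path_law T M"
begin

lemma path_law_prob: "prob_space M"
 using M by (simp add: path_law_def)

lemma path_law_sets: "sets M = sets (PiM UNIV (%_. N_orderings))"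
 using M by (simp add: path_law_def)

lemma path_law_space: "space M = space (PiM UNIV (%_::nat. N_orderings))"
 by (rule sets_eq_imp_space_eq[OF path_law_sets])

lemma path_law_in: "x \<in> space M ==> x h \<in> orderings {1..}"
 by (auto simp: path_law_space space_PiM PiE_iff)

lemma path_law_nth: "(%x. x h) \<in> M \<rightarrow>\<^sub>M N_orderings"
 by (subst measurable_cong_sets[OF path_law_sets refl]) (rule measurable_component_singleton, simp)

lemma path_law_cyl: "{x\<in>space M. (%h. if h <= H then restr n (x h) else {}) \<in> S} \<in> sets M"
 unfolding path_law_sets path_law_space by (rule sets_path_cylinder)

lemma path_law_measure: "measure M {x\<in>space M. (%h. if h <= H then restr n (x h) else {}) \<in> S} = measure (path_pmf T n H) S"
 using M by (simp add: path_law_def)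

text \<open>Knowing the last ordering on the larger set \<open>{1..N}\<close> tells no more about
  the past on \<open>{1..n}\<close> than its restriction does. This is where consistency enters the
  process.\<close>

lemma path_law_last:
 assumes nN: "n <= N" and c: "c \<in> orderings {1..N}"
 shows "measure M {x\<in>space M. (%i. if i <= h then restr n (x i) else {}) \<in> S & restr N (x h) = c}
  = measure (back_path T n h (restr n c)) S / fact N"
proof -
 have tr: "(%i. restr n (if i <= h then restr N (x i) else {})) = (%i. if i <= h then restr n (x i) else {})" for x
  by (rule ext) (simp add: restr_restr[OF nN], simp add: restr_def)
 have "{x\<in>space M. (%i. if i <= h then restr n (x i) else {}) \<in> S & restr N (x h) = c}
  = {x\<in>space M. (%i. if i <= h then restr N (x i) else {}) \<in> {f. f \<in> {f. (%i. restr n (f i)) \<in> S} & f h = c}}"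
  by (simp add: tr)
 then have "measure M {x\<in>space M. (%i. if i <= h then restr n (x i) else {}) \<in> S & restr N (x h) = c} =
  measure (path_pmf T N h) {f. f \<in> {f. (%i. restr n (f i)) \<in> S} & f h = c}"
  by (simp only: path_law_measure)
 also have "... = measure (back_path T N h c) {f. (%i. restr n (f i)) \<in> S} / fact N"
  by (rule measure_path_pmf_last[OF consistent_set[OF T] c])
 also have "measure (back_path T N h c) {f. (%i. restr n (f i)) \<in> S} = measure (map_pmf (%f i. restr n (f i)) (back_path T N h c)) S"
  by (simp add: vimage_def)
 finally show ?thesis by (simp add: back_path_restr[OF T nN c])
qed

lemma path_law_cell:
 assumes "c \<in> orderings {1..N}" shows "measure M {x\<in>space M. restr N (x h) = c} = 1 / fact N"
 using path_law_last[OF le_refl assms, of h UNIV] by simp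

lemma path_law_distr: "distr M N_orderings (%x. x h) = uniform_ordering"
proof (rule measure_eq_N)
 interpret prob_space M by (rule path_law_prob)
 show "distr M N_orderings (%x. x h) \<in> space (prob_algebra N_orderings)"
  by (simp add: space_prob_algebra prob_space_distr[OF path_law_nth])
 fix n :: nat and b assume b: "b \<in> orderings {1..n}"
 have "(%x. x h) -` (cell n b) \<inter> space M = {x\<in>space M. restr n (x h) = b}"
  using path_law_in by auto
 then show "measure (distr M N_orderings (%x. x h)) (cell n b) = measure uniform_ordering (cell n b)"
  by (simp add: measure_distr[OF path_law_nth sets_restr] path_law_cell[OF b] measure_uniform_ordering[OF b])
qed (rule uniform_ordering_prob)

lemma uniform_prob: "prob_space uniform_ordering" and uniform_sets: "sets uniform_ordering = sets N_orderings"
 using uniform_ordering_prob by (auto simp: space_prob_algebra)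

lemma uniform_space: "space uniform_ordering = orderings {1..}"
 using sets_eq_imp_space_eq[OF uniform_sets] by simp

text \<open>\<open>path_law_last\<close> with the complete last ordering in place of a finite
  restriction. Both sides are finite measures of that ordering and agree on the cells of level at
  least \<open>n\<close>, which suffices by \<open>measure_eq_filtered_ge\<close>.\<close>

lemma path_law_reverse:
 "distr (density M (%x. ennreal (indicator S (%i. if i <= h then restr n (x i) else {})))) N_orderings (%x. x h)
 = density uniform_ordering (%r. ennreal (measure (back_path T n h (restr n r)) S))"
proof -
 interpret prob_space M by (rule path_law_prob)
 interpret U: prob_space uniform_ordering by (rule uniform_prob)
 let ?tr = "%x i. if i <= h then restr n (x i) else {}"
 let ?i = "%x. ennreal (indicator S (?tr x))"
 have im: "?i \<in> borel_measurable M"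
 proof -
  have "(indicator {x\<in>space M. ?tr x \<in> S} :: _ => ennreal) \<in> borel_measurable M" using path_law_cyl by simp
  then show ?thesis by (rule measurable_cong[THEN iffD1, rotated]) (auto simp: indicator_def)
 qed
 have gm: "(%r. ennreal (measure (back_path T n h (restr n r)) S)) \<in> borel_measurable uniform_ordering"
  by (subst measurable_cong_sets[OF uniform_sets refl])
   (rule measurable_compose[OF measurable_restr, of "%b. ennreal (measure (back_path T n h b) S)"], simp)
 have nth: "(%x. x h) \<in> density M ?i \<rightarrow>\<^sub>M N_orderings" using path_law_nth by simp
 show ?thesis
 proof (rule measure_eq_filtered_ge[OF filtered_N, where k=n])
  fix N r assume nN: "n <= N" and r: "r \<in> space N_orderings"
  let ?c = "restr N r"
  have c: "?c \<in> orderings {1..N}" using r restr_in by simp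
  have ev: "{x\<in>space M. ?tr x \<in> S & restr N (x h) = ?c} \<in> sets M"
   using sets.Int[OF path_law_cyl[of h n S] measurable_sets[OF measurable_compose[OF path_law_nth measurable_restr, of N h], of "{?c}"]]
   by (simp add: Int_def vimage_def conj_commute conj_left_commute)
  have cell: "(%x. x h) -` {y \<in> space N_orderings. restr N y = ?c} \<inter> space M = {x\<in>space M. restr N (x h) = ?c}"
   using path_law_in by auto
  have cs: "{x\<in>space M. restr N (x h) = ?c} \<in> sets M"
   using measurable_sets[OF path_law_nth cell_in_sets[OF filtered_N]] unfolding cell[symmetric] .
  have "emeasure (distr (density M ?i) N_orderings (%x. x h)) {y \<in> space N_orderings. restr N y = ?c}
    = emeasure (density M ?i) {x\<in>space M. restr N (x h) = ?c}"
   by (subst emeasure_distr[OF nth cell_in_sets[OF filtered_N]]) (simp only: space_density cell)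
  also have "... = (\<integral>\<^sup>+x. ?i x * indicator {x\<in>space M. restr N (x h) = ?c} x \<partial>M)"
   by (rule emeasure_density[OF im cs])
  also have "... = (\<integral>\<^sup>+x. indicator {x\<in>space M. ?tr x \<in> S & restr N (x h) = ?c} x \<partial>M)"
   by (rule nn_integral_cong) (auto simp: indicator_def)
  also have "... = ennreal (measure (back_path T n h (restr n ?c)) S / fact N)"
   using path_law_last[OF nN c, of h S] ev by (simp add: emeasure_eq_measure)
  also have "... = (\<integral>\<^sup>+r'. ennreal (measure (back_path T n h (restr n ?c)) S) * indicator {y \<in> space N_orderings. restr N y = ?c} r' \<partial>uniform_ordering)"
   using measure_uniform_ordering[OF c] uniform_sets sets_restr[of N ?c]
   by (subst nn_integral_cmult_indicator) (auto simp: U.emeasure_eq_measure ennreal_mult''[symmetric])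
  also have "... = (\<integral>\<^sup>+r'. ennreal (measure (back_path T n h (restr n r')) S) * indicator {y \<in> space N_orderings. restr N y = ?c} r' \<partial>uniform_ordering)"
  proof (rule nn_integral_cong)
   fix r' assume "r' \<in> space uniform_ordering"
   have "restr n r' = restr n ?c" if "restr N r' = ?c" using restr_restr[OF nN, of r'] that by simp
   then show "ennreal (measure (back_path T n h (restr n ?c)) S) * indicator {y \<in> space N_orderings. restr N y = ?c} r' = 
    ennreal (measure (back_path T n h (restr n r')) S) * indicator {y \<in> space N_orderings. restr N y = ?c} r'"
    by (auto simp: indicator_def)
  qed
  also have "... = emeasure (density uniform_ordering (%r. ennreal (measure (back_path T n h (restr n r)) S))) {y \<in> space N_orderings. restr N y = ?c}"
   by (rule emeasure_density[symmetric, OF gm]) (simp add: uniform_sets sets_restr)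
  finally show "emeasure (distr (density M ?i) N_orderings (%x. x h)) {y \<in> space N_orderings. restr N y = restr N r} =
   emeasure (density uniform_ordering (%r. ennreal (measure (back_path T n h (restr n r)) S))) {y \<in> space N_orderings. restr N y = restr N r}" .
 next
  have "emeasure (density M ?i) (space M) <= (\<integral>\<^sup>+x. 1 \<partial>M)"
   unfolding emeasure_density[OF im sets.top] by (rule nn_integral_mono) (auto simp: indicator_def)
  then have "emeasure (density M ?i) (space M) ~= \<infinity>" by (auto simp: emeasure_space_1 top_unique)
  then have "finite_measure (density M ?i)" by (intro finite_measureI) simp
  then show "finite_measure (distr (density M ?i) N_orderings (%x. x h))"
   by (rule finite_measure.finite_measure_distr[OF _ nth])
 qed (simp_all add: uniform_sets)
qed

lemma path_law_integral:
 fixes g :: "nat rel => real"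
 assumes g: "g \<in> borel_measurable N_orderings"
 shows "(\<integral>x. indicator S (%i. if i <= h then restr n (x i) else {}) * g (x h) \<partial>M) =
  (\<integral>r. measure (back_path T n h (restr n r)) S * g r \<partial>uniform_ordering)"
proof -
 let ?tr = "%x i. if i <= h then restr n (x i) else {}"
 have im: "(%x. indicator S (?tr x) :: real) \<in> borel_measurable M"
 proof -
  have "(indicator {x\<in>space M. ?tr x \<in> S} :: _ => real) \<in> borel_measurable M" using path_law_cyl by simp
  then show ?thesis by (rule measurable_cong[THEN iffD1, rotated]) (auto simp: indicator_def)
 qed
 have gm: "(%r. measure (back_path T n h (restr n r)) S) \<in> borel_measurable uniform_ordering"
  by (subst measurable_cong_sets[OF uniform_sets refl])
   (rule measurable_compose[OF measurable_restr, of "%b. measure (back_path T n h b) S"], simp)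
 have gu: "g \<in> borel_measurable uniform_ordering" by (subst measurable_cong_sets[OF uniform_sets refl]) (rule g)
 have gx: "(%x. g (x h)) \<in> borel_measurable M" by (rule measurable_compose[OF path_law_nth g])
 have nth: "(%x. x h) \<in> density M (%x. ennreal (indicator S (?tr x))) \<rightarrow>\<^sub>M N_orderings" using path_law_nth by simp
 have "(\<integral>x. indicator S (?tr x) * g (x h) \<partial>M) = (\<integral>x. g (x h) \<partial>density M (%x. ennreal (indicator S (?tr x))))"
  by (subst integral_density[OF gx im]) simp_all
 also have "... = (\<integral>r. g r \<partial>distr (density M (%x. ennreal (indicator S (?tr x)))) N_orderings (%x. x h))"
  by (rule integral_distr[OF nth g, symmetric])
 also have "... = (\<integral>r. g r \<partial>density uniform_ordering (%r. ennreal (measure (back_path T n h (restr n r)) S)))"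
  by (simp only: path_law_reverse)
 also have "... = (\<integral>r. measure (back_path T n h (restr n r)) S * g r \<partial>uniform_ordering)"
  by (subst integral_density[OF gu gm]) simp_all
 finally show ?thesis .
qed

text \<open>The forward Markov property, extracted from the backward one. On cells the joint
  probability splits into the past given \<open>a h\<close> and the backward step from
  \<open>b\<close> to \<open>a h\<close>. \<open>corresponds\<close> rewrites that step as an
  integral of \<open>K\<close> against the uniform law, and \<open>path_law_integral\<close>
  restores the past.\<close>

lemma path_law_transition:
 assumes K: "corresponds T K"
 shows "transition_kernel M (%h x. x h) K"
 unfolding transition_kernel_def
proof
 fix h :: nat
 have iK: "is_kernel K" using K by (simp add: corresponds_def)
 let ?E = "PiM {..h} (%_. N_orderings)"
 let ?X = "%x. \<lambda>i\<in>{..h}. x i"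
 have X: "?X \<in> M \<rightarrow>\<^sub>M ?E" by (intro measurable_restrict path_law_nth)
 have T': "(%e. e h) \<in> ?E \<rightarrow>\<^sub>M N_orderings" by (rule measurable_component_singleton) simp
 show "conditional_kernel M ?E ?X (%x. x h) (%x. x (Suc h)) K"
 proof (rule conditional_kernel_iff[THEN iffD2, OF path_law_prob X path_law_nth T'], goal_cases)
  case 2
  show ?case
  proof (intro conjI ballI iK, rule kernel_integral_from_cells[OF path_law_prob X path_law_nth path_law_nth iK filtered_PiM[OF filtered_N]])
   fix n :: nat and e :: "nat => nat rel" and b assume e: "e \<in> space ?E" and b: "b \<in> orderings {1..n}"
   define a where "a i = restr n (e i)" for i
   have a: "a i \<in> orderings {1..n}" if "i <= h" for i
    using e that unfolding a_def by (intro restr_in) (auto simp: space_PiM)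
   let ?S = "{f. \<forall>i\<le>h. f i = a i}"
   let ?B = "(cell n b)"
   have iff: "(\<lambda>i\<in>{..h}. restr n (?X x i)) = (\<lambda>i\<in>{..h}. restr n (e i)) \<longleftrightarrow> (\<forall>i\<le>h. restr n (x i) = a i)" for x
    by (auto simp: a_def restrict_def fun_eq_iff)
   have "measure M {x\<in>space M. (\<lambda>i\<in>{..h}. restr n (?X x i)) = (\<lambda>i\<in>{..h}. restr n (e i)) & restr n (x (Suc h)) = b}
    = measure M {x\<in>space M. (%i. if i <= Suc h then restr n (x i) else {}) \<in> {f. (%i. if i <= h then f i else {}) \<in> ?S & f h = a h} & restr n (x (Suc h)) = b}"
    unfolding iff by (intro arg_cong[where f="measure M"]) auto
   also have "... = measure (back_path T n (Suc h) b) {f. (%i. if i <= h then f i else {}) \<in> ?S & f h = a h} / fact n"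
    by (subst path_law_last[OF le_refl b]) (simp only: restr_id[OF b])
   also have "... = pmf (step T n b) (a h) * measure (back_path T n h (a h)) ?S / fact n"
    by (simp only: measure_back_path_Suc[OF consistent_set[OF T] b])
   also have "... = measure (back_path T n h (a h)) ?S * (\<integral>r. indicator (cell n (a h)) r * measure (K r) ?B \<partial>uniform_ordering)"
    using K a[of h] b by (simp add: corresponds_def)
   also have "... = (\<integral>r. measure (back_path T n h (a h)) ?S * (indicator (cell n (a h)) r * measure (K r) ?B) \<partial>uniform_ordering)"
    by simp
   \<comment> \<open>The indicator of the cell can be absorbed: a backward path ends at its starting
     value, so \<open>?S\<close> has probability 0 unless \<open>restr n r = a h\<close>.\<close>
   also have "... = (\<integral>r. measure (back_path T n h (restr n r)) ?S * measure (K r) ?B \<partial>uniform_ordering)"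
   proof (rule Bochner_Integration.integral_cong[OF refl])
    fix r assume "r \<in> space uniform_ordering"
    then have r: "r \<in> orderings {1..}" by (simp add: uniform_space)
    show "measure (back_path T n h (a h)) ?S * (indicator (cell n (a h)) r * measure (K r) ?B) =
     measure (back_path T n h (restr n r)) ?S * measure (K r) ?B"
    proof (cases "restr n r = a h")
     case False
     have "measure (back_path T n h (restr n r)) ?S = measure (back_path T n h (restr n r)) {}"
     proof (rule measure_prob_cong_0)
      fix f assume "f \<in> ?S - {}"
      then have "f h ~= restr n r" using False by auto
      then have "f \<notin> set_pmf (back_path T n h (restr n r))"
       using set_back_path(1)[OF consistent_set[OF T] restr_in[OF r, of n], of f h] by blast
      then show "pmf (back_path T n h (restr n r)) f = 0" by (simp add: pmf_eq_0_set_pmf)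
     qed simp
     then show ?thesis using False by simp
    qed (use r in simp)
   qed
   also have "... = (\<integral>x. indicator ?S (%i. if i <= h then restr n (x i) else {}) * measure (K (x h)) ?B \<partial>M)"
    by (rule path_law_integral[symmetric]) (rule is_kernel_measure[OF iK sets_restr])
   also have "... = (\<integral>x. indicator {y \<in> space ?E. (\<lambda>i\<in>{..h}. restr n (y i)) = (\<lambda>i\<in>{..h}. restr n (e i))} (?X x) * measure (K (x h)) ?B \<partial>M)"
   proof (rule Bochner_Integration.integral_cong[OF refl])
    fix x assume x: "x \<in> space M"
    have "?X x \<in> {y \<in> space ?E. (\<lambda>i\<in>{..h}. restr n (y i)) = (\<lambda>i\<in>{..h}. restr n (e i))} \<longleftrightarrow> (%i. if i <= h then restr n (x i) else {}) \<in> ?S"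
     using measurable_space[OF X x] iff[of x] by simp
    then show "indicator ?S (%i. if i <= h then restr n (x i) else {}) * measure (K (x h)) ?B =
     indicator {y \<in> space ?E. (\<lambda>i\<in>{..h}. restr n (y i)) = (\<lambda>i\<in>{..h}. restr n (e i))} (?X x) * measure (K (x h)) ?B"
     by (simp only: indicator_def)
   qed
   finally show "measure M {x\<in>space M. (\<lambda>i\<in>{..h}. restr n (?X x i)) = (\<lambda>i\<in>{..h}. restr n (e i)) & restr n (x (Suc h)) = b} =
    (\<integral>x. indicator {y \<in> space ?E. (\<lambda>i\<in>{..h}. restr n (y i)) = (\<lambda>i\<in>{..h}. restr n (e i))} (?X x) * measure (K (x h)) ?B \<partial>M)" .
  qed auto
 qed simp
qed

end

text \<open>A product formula for the points of the initial segments of indices implies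
  independence: an arbitrary finite index set is reached by letting the remaining coordinates range
  over \<open>D\<close>, where the weights sum to 1.\<close>

lemma (in prob_space) discrete_joint_law:
 fixes X :: "nat => 'a => 'd" and q :: "nat => 'd => real"
 assumes D: "finite D" and X: "\<And>h. X h \<in> M \<rightarrow>\<^sub>M count_space D"
  and q: "\<And>h. (\<Sum>d\<in>D. q h d) = 1"
  and law: "\<And>H d. (\<And>i. i <= H ==> d i \<in> D) ==> prob {x\<in>space M. \<forall>i\<le>H. X i x = d i} = (\<Prod>i\<le>H. q i (d i))"
 shows "d \<in> D ==> prob {x\<in>space M. X h x = d} = q h d" "indep_vars (%_. count_space D) X UNIV"
proof -
 have XD: "X h x \<in> D" if "x \<in> space M" for h x using measurable_space[OF X that] by simp
 have ev: "{x\<in>space M. X i x \<in> A} \<in> events" if "A \<subseteq> D" for i A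
  using measurable_sets[OF X, of A i] that by (simp add: vimage_def Int_def conj_commute)
 have joint: "prob {x\<in>space M. \<forall>i\<le>H. X i x \<in> A i} = (\<Prod>i\<le>H. \<Sum>d\<in>A i. q i d)" if A: "\<And>i. i <= H ==> A i \<subseteq> D" for H A
 proof -
  have fA: "finite (A i)" if "i <= H" for i using A[OF that] D by (rule finite_subset)
  have fin: "finite (PiE {..H} A)" by (rule finite_PiE) (auto intro: fA)
  have ev': "{x\<in>space M. \<forall>i\<le>H. X i x = d i} \<in> events" if "d \<in> PiE {..H} A" for d
  proof -
   have "{x\<in>space M. \<forall>i\<in>{..H}. X i x \<in> {d i}} \<in> events"
   proof (rule sets.sets_Collect_finite_All)
    fix i assume i: "i \<in> {..H}"
    have "d i \<in> A i" using PiE_mem[OF that i] .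
    then have "{d i} \<subseteq> D" using A[of i] i by auto
    then show "{x\<in>space M. X i x \<in> {d i}} \<in> events" by (rule ev)
   qed simp
   then show ?thesis by (simp only: singleton_iff Ball_def atMost_iff)
  qed
  have "{x\<in>space M. \<forall>i\<le>H. X i x \<in> A i} = (\<Union>d\<in>PiE {..H} A. {x\<in>space M. \<forall>i\<le>H. X i x = d i})"
  proof
   show "{x\<in>space M. \<forall>i\<le>H. X i x \<in> A i} \<subseteq> (\<Union>d\<in>PiE {..H} A. {x\<in>space M. \<forall>i\<le>H. X i x = d i})"
   proof
    fix x assume w: "x \<in> {x\<in>space M. \<forall>i\<le>H. X i x \<in> A i}"
    show "x \<in> (\<Union>d\<in>PiE {..H} A. {x\<in>space M. \<forall>i\<le>H. X i x = d i})"
     by (rule UN_I[where a="\<lambda>i\<in>{..H}. X i x"]) (use w in auto)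
   qed
  qed (auto simp: PiE_iff)
  moreover have "prob (\<Union>d\<in>PiE {..H} A. {x\<in>space M. \<forall>i\<le>H. X i x = d i}) = (\<Sum>d\<in>PiE {..H} A. prob {x\<in>space M. \<forall>i\<le>H. X i x = d i})"
  proof (rule finite_measure_finite_Union[OF fin])
   show "disjoint_family_on (%d. {x\<in>space M. \<forall>i\<le>H. X i x = d i}) (PiE {..H} A)"
    unfolding disjoint_family_on_def
   proof (intro ballI impI)
    fix d d' assume d: "d \<in> PiE {..H} A" "d' \<in> PiE {..H} A" "d ~= d'"
    then obtain i where "i <= H" "d i ~= d' i" using PiE_ext[of d "{..H}" A d'] by auto
    then show "{x\<in>space M. \<forall>i\<le>H. X i x = d i} \<inter> {x\<in>space M. \<forall>i\<le>H. X i x = d' i} = {}" by fastforce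
   qed
  qed (use ev' in blast)
  moreover have "... = (\<Sum>d\<in>PiE {..H} A. \<Prod>i\<le>H. q i (d i))"
   using A by (intro sum.cong refl law) (auto simp: PiE_iff)
  ultimately show ?thesis using prod_sum_PiE[of "{..H}" A q] fA by auto
 qed
 have joint_J: "prob {x\<in>space M. \<forall>i\<in>J. X i x \<in> B i} = (\<Prod>i\<in>J. \<Sum>d\<in>B i. q i d)"
  if J: "finite J" "\<And>i. i \<in> J ==> B i \<subseteq> D" for J B
 proof -
  obtain H where H: "J \<subseteq> {..H}" using finite_nat_iff_bounded_le J(1) by blast
  define A where "A i = (if i \<in> J then B i else D)" for i
  have "{x\<in>space M. \<forall>i\<in>J. X i x \<in> B i} = {x\<in>space M. \<forall>i\<le>H. X i x \<in> A i}"
   using H XD by (auto simp: A_def)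
  then have "prob {x\<in>space M. \<forall>i\<in>J. X i x \<in> B i} = (\<Prod>i\<le>H. \<Sum>d\<in>A i. q i d)"
   using joint[of H A] J by (simp add: A_def)
  also have "... = (\<Prod>i\<in>J. \<Sum>d\<in>A i. q i d)"
   using H q by (intro prod.mono_neutral_right) (auto simp: A_def)
  also have "... = (\<Prod>i\<in>J. \<Sum>d\<in>B i. q i d)" by (simp add: A_def)
  finally show ?thesis .
 qed
 show "prob {x\<in>space M. X h x = d} = q h d" if "d \<in> D"
  using joint_J[of "{h}" "%_. {d}"] that by simp
 show "indep_vars (%_. count_space D) X UNIV"
  unfolding indep_vars_def2
 proof (intro conjI ballI X indep_setsI)
  show "{X i -` A \<inter> space M |A. A \<in> sets (count_space D)} \<subseteq> events" for i
   using measurable_sets[OF X] by auto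
  fix A J assume J: "finite J" "J ~= {}" and A: "\<forall>j\<in>J. A j \<in> {X j -` B \<inter> space M |B. B \<in> sets (count_space D)}"
  then have "\<forall>j\<in>J. \<exists>B. B \<subseteq> D & A j = X j -` B \<inter> space M"
   unfolding sets_count_space by blast
  then obtain B where B: "\<And>j. j \<in> J ==> B j \<subseteq> D" "\<And>j. j \<in> J ==> A j = X j -` B j \<inter> space M" by metis
  have "(\<Inter>j\<in>J. A j) = {x\<in>space M. \<forall>i\<in>J. X i x \<in> B i}" using B(2) J(2) by auto
  then have "prob (\<Inter>j\<in>J. A j) = (\<Prod>j\<in>J. \<Sum>d\<in>B j. q j d)" using joint_J[OF J(1) B(1)] by simp
  also have "... = (\<Prod>j\<in>J. prob (A j))"
  proof (rule prod.cong[OF refl])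
   fix j assume j: "j \<in> J"
   have "A j = {x\<in>space M. \<forall>i\<in>{j}. X i x \<in> B i}" using B(2)[OF j] by auto
   then show "(\<Sum>d\<in>B j. q j d) = prob (A j)" using joint_J[of "{j}" B] B(1)[OF j] by simp
  qed
  finally show "prob (\<Inter>j\<in>J. A j) = (\<Prod>j\<in>J. prob (A j))" .
 qed
qed

lemma measure_back_path_path:
 assumes T: "perm_family T" and b: "\<And>i. i <= H ==> b i \<in> orderings {1..n}"
 shows "measure (back_path T n H (b H)) {f. \<forall>i\<le>H. f i = b i} = (\<Prod>i<H. pmf (step T n (b (Suc i))) (b i))"
 using b
proof (induction H)
 case 0
 then show ?case by simp
next
 case (Suc H)
 let ?S = "{f. \<forall>i\<le>H. f i = b i}"
 have bS: "b (Suc H) \<in> orderings {1..n}" using Suc.prems by simp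
 have "measure (back_path T n (Suc H) (b (Suc H))) {f. \<forall>i\<le>Suc H. f i = b i}
   = measure (back_path T n (Suc H) (b (Suc H))) {f. (%h. if h <= H then f h else {}) \<in> ?S & f H = b H}"
 proof (rule measure_prob_cong_0)
  fix f assume "f \<in> {f. (%h. if h <= H then f h else {}) \<in> ?S & f H = b H} - {f. \<forall>i\<le>Suc H. f i = b i}"
  then have "f (Suc H) ~= b (Suc H)" by (auto simp: le_Suc_eq)
  then have "f \<notin> set_pmf (back_path T n (Suc H) (b (Suc H)))"
   using set_back_path(1)[OF T bS, of f "Suc H"] by blast
  then show "pmf (back_path T n (Suc H) (b (Suc H))) f = 0" by (simp add: pmf_eq_0_set_pmf)
 qed auto
 also have "... = pmf (step T n (b (Suc H))) (b H) * measure (back_path T n H (b H)) ?S"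
  by (rule measure_back_path_Suc[OF T bS])
 finally show ?case using Suc by simp
qed

context
 fixes T M assumes T: "consistent T" and M: "path_law T M"
begin

lemma path_law_path:
 assumes b: "\<And>i. i <= H ==> b i \<in> orderings {1..n}"
 shows "measure M {x\<in>space M. \<forall>i\<le>H. restr n (x i) = b i} = (\<Prod>i<H. pmf (step T n (b (Suc i))) (b i)) / fact n"
proof -
 have "{x\<in>space M. \<forall>i\<le>H. restr n (x i) = b i} = {x\<in>space M. (%i. if i <= H then restr n (x i) else {}) \<in> {f. \<forall>i\<le>H. f i = b i} & restr n (x H) = b H}"
  by auto
 then show ?thesis
  using path_law_last[OF T M le_refl b[OF le_refl], of H "{f. \<forall>i\<le>H. f i = b i}"]
   measure_back_path_path[OF consistent_set[OF T] b] restr_id[OF b[OF le_refl]] by simp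
qed

lemma path_law_pair:
 assumes mn: "m <= n" and b: "b \<in> orderings {1..n}"
 shows "measure M {x\<in>space M. restr m (x h) = a & restr n (x (Suc h)) = b} = pmf (step T m (restr m b)) a / fact n"
proof -
 have "{x\<in>space M. restr m (x h) = a & restr n (x (Suc h)) = b} =
  {x\<in>space M. (%i. if i <= Suc h then restr m (x i) else {}) \<in> {f. (%i. if i <= h then f i else {}) \<in> UNIV & f h = a} & restr n (x (Suc h)) = b}"
  by auto
 then have "measure M {x\<in>space M. restr m (x h) = a & restr n (x (Suc h)) = b} =
  measure (back_path T m (Suc h) (restr m b)) {f. (%i. if i <= h then f i else {}) \<in> UNIV & f h = a} / fact n"
  by (simp only: path_law_last[OF T M mn b])
 also have "... = pmf (step T m (restr m b)) a * measure (back_path T m h a) UNIV / fact n"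
  by (simp only: measure_back_path_Suc[OF consistent_set[OF T] restr_in'[OF mn b]])
 finally show ?thesis by simp
qed

text \<open>The increments are read off the path. A prescribed initial permutation and prescribed
  increments determine the path, whose probability by \<open>path_law_path\<close> is a product of
  one factor per increment.\<close>

lemma path_law_random_walk: "random_walk_on_perms n M (%h x. perm_of n (x h))"
proof -
 interpret prob_space M by (rule path_law_prob[OF T M])
 note in_ord = path_law_in[OF T M]
 let ?D = "perms n"
 let ?r = "%h x. perm_of n (x h)"
 define S where "S h x = ?r h x \<circ> inv (?r (h - 1) x)" for h and x :: "nat => nat rel"
 define X where "X h = (if h = 0 then ?r 0 else S h)" for h
 \<comment> \<open>The increment is the forward step while \<open>T n\<close> is the law of backward
   steps, hence \<open>inv d\<close>.\<close>
 define q where "q h d = (if h = 0 then 1 / fact n else pmf (T n) (inv d))" for h :: nat and d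
 have fD: "finite ?D" by (rule finite_permutations) simp
 have cardD: "card ?D = fact n" by (rule card_permutations) auto
 have rD: "?r h x \<in> ?D" if "x \<in> space M" for h x using perm_of(1)[OF restr_in[OF in_ord[OF that]]] by simp
 have rm: "?r h \<in> M \<rightarrow>\<^sub>M count_space ?D" for h
 proof -
  have "(%x. perm_of n (restr n (x h))) \<in> M \<rightarrow>\<^sub>M count_space UNIV"
   by (rule measurable_compose[OF measurable_compose[OF path_law_nth[OF T M] measurable_restr]]) simp
  then have m: "?r h \<in> M \<rightarrow>\<^sub>M count_space UNIV" by (simp add: perm_of_restr)
  show ?thesis
  proof (rule measurableI)
   show "?r h -` A \<inter> space M \<in> sets M" for A using measurable_sets[OF m, of A] by simp
  qed (use rD in simp)
 qed
 have SD: "S h x \<in> ?D" if "x \<in> space M" for h x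
  using rD[OF that] unfolding S_def by (auto intro!: permutes_compose permutes_inv)
 have Sm: "S h \<in> M \<rightarrow>\<^sub>M count_space ?D" for h
 proof (rule measurableI)
  fix A :: "(nat => nat) set"
  have eq: "S h -` A \<inter> space M = (\<Union>s\<in>?D. \<Union>t\<in>{t\<in>?D. t \<circ> inv s \<in> A}. (?r (h - 1) -` {s} \<inter> space M) \<inter> (?r h -` {t} \<inter> space M))"
   using rD by (auto simp: S_def)
  show "S h -` A \<inter> space M \<in> sets M"
   unfolding eq using fD by (intro sets.finite_UN sets.Int measurable_sets[OF rm]) auto
 qed (use SD in simp)
 have Xm: "X h \<in> M \<rightarrow>\<^sub>M count_space ?D" for h using rm[of 0] Sm by (simp add: X_def)
 have law: "prob {x\<in>space M. \<forall>i\<le>H. X i x = d i} = (\<Prod>i\<le>H. q i (d i))" if d: "\<And>i. i <= H ==> d i \<in> ?D" for H d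
 proof -
  \<comment> \<open>\<open>\<beta> i\<close> is the permutation reached at time \<open>i\<close>
    from the initial value \<open>d 0\<close> and the increments \<open>d 1\<close>, ...,
    \<open>d i\<close>.\<close>
  define \<beta> where "\<beta> = rec_nat (d 0) (%i s. d (Suc i) \<circ> s)"
  have \<beta>: "\<beta> 0 = d 0" "\<beta> (Suc i) = d (Suc i) \<circ> \<beta> i" for i by (simp_all add: \<beta>_def)
  have \<beta>D: "\<beta> i permutes {1..n}" if "i <= H" for i
   using that d by (induction i) (auto simp: \<beta> intro!: permutes_compose)
  have X\<beta>: "(\<forall>i\<le>k. X i x = d i) \<longleftrightarrow> (\<forall>i\<le>k. ?r i x = \<beta> i)" if x: "x \<in> space M" and "k <= H" for x k
   using that(2)
  proof (induction k)
   case 0 then show ?case by (simp add: X_def \<beta>)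
  next
   case (Suc k)
   have "X (Suc k) x = d (Suc k) \<longleftrightarrow> ?r (Suc k) x = \<beta> (Suc k)" if "?r k x = \<beta> k"
   proof -
    note p = \<beta>D[of k]
    have "X (Suc k) x = ?r (Suc k) x \<circ> inv (\<beta> k)" using that by (simp add: X_def S_def)
    moreover have "?r (Suc k) x \<circ> inv (\<beta> k) = d (Suc k) \<longleftrightarrow> ?r (Suc k) x = d (Suc k) \<circ> \<beta> k"
     using permutes_inv_o[OF p] Suc.prems by (metis Suc_leD comp_assoc comp_id)
    ultimately show ?thesis by (simp add: \<beta>)
   qed
   with Suc show ?case by (auto simp: le_Suc_eq)
  qed
  define b where "b i = perm_order n (\<beta> i)" for i
  have b: "b i \<in> orderings {1..n}" if "i <= H" for i unfolding b_def by (rule perm_order_in[OF \<beta>D[OF that]])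
  have pb: "perm_of n (b i) = \<beta> i" if "i <= H" for i unfolding b_def by (rule perm_of_order[OF \<beta>D[OF that]])
  have "{x\<in>space M. \<forall>i\<le>H. X i x = d i} = {x\<in>space M. \<forall>i\<le>H. restr n (x i) = b i}"
   using X\<beta>[OF _ le_refl] perm_of_eq_iff[OF in_ord \<beta>D] unfolding b_def by blast
  then have "prob {x\<in>space M. \<forall>i\<le>H. X i x = d i} = (\<Prod>i<H. pmf (step T n (b (Suc i))) (b i)) / fact n"
   using path_law_path[of H b n] b by simp
  also have "(\<Prod>i<H. pmf (step T n (b (Suc i))) (b i)) = (\<Prod>i<H. q (Suc i) (d (Suc i)))"
  proof (rule prod.cong[OF refl])
   fix i assume "i \<in> {..<H}"
   then have i: "i <= H" "Suc i <= H" by auto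
   have "pmf (step T n (b (Suc i))) (b i) = pmf (T n) (\<beta> i \<circ> inv (\<beta> (Suc i)))"
    using pmf_step[OF consistent_set[OF T] b[OF i(1)] b[OF i(2)]] pb i by simp
   also have "\<beta> i \<circ> inv (\<beta> (Suc i)) = inv (d (Suc i))"
   proof -
    have dp: "d (Suc i) permutes {1..n}" using d[OF i(2)] by simp
    have "inv (\<beta> (Suc i)) = inv (\<beta> i) \<circ> inv (d (Suc i))"
     unfolding \<beta>(2) by (rule o_inv_distrib) (use dp \<beta>D[OF i(1)] in \<open>auto intro: permutes_bij\<close>)
    then show ?thesis using permutes_inv_o(1)[OF \<beta>D[OF i(1)]] by (simp add: comp_assoc[symmetric])
   qed
   finally show "pmf (step T n (b (Suc i))) (b i) = q (Suc i) (d (Suc i))" by (simp add: q_def)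
  qed
  also have "(\<Prod>i<H. q (Suc i) (d (Suc i))) / fact n = (\<Prod>i\<le>H. q i (d i))"
   by (simp add: prod.atMost_shift q_def)
  finally show ?thesis .
 qed
 have qsum: "(\<Sum>d\<in>?D. q h d) = 1" for h
 proof (cases "h = 0")
  case True then show ?thesis by (simp add: q_def cardD)
 next
  case False
  have "(\<Sum>d\<in>?D. pmf (T n) (inv d)) = (\<Sum>d\<in>?D. pmf (T n) d)"
   by (rule sum_permutations_inverse[symmetric])
  also have "... = 1" using consistent_set[OF T, THEN perm_familyD] fD by (intro sum_pmf_eq_1)
  finally show ?thesis using False by (simp add: q_def)
 qed
 note J = discrete_joint_law[OF fD Xm qsum law]
 have distrX: "distr M (count_space ?D) (X h) = distr M (count_space ?D) (X h')" if "q h = q h'" for h h'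
 proof (rule measure_eqI_finite[where A="?D"])
  fix d assume d: "d \<in> ?D"
  have "X k -` {d} \<inter> space M = {x\<in>space M. X k x = d}" for k by auto
  then show "emeasure (distr M (count_space ?D) (X h)) {d} = emeasure (distr M (count_space ?D) (X h')) {d}"
   using J(1)[OF _ d] that d by (simp add: emeasure_distr[OF Xm] emeasure_eq_measure)
 qed (use fD in auto)
 have "distr M (count_space ?D) (?r 0) = uniform_count_measure ?D"
 proof (rule measure_eqI_finite[where A="?D"])
  fix d assume d: "d \<in> ?D"
  have "?r 0 -` {d} \<inter> space M = {x\<in>space M. X 0 x = d}" by (auto simp: X_def)
  then show "emeasure (distr M (count_space ?D) (?r 0)) {d} = emeasure (uniform_count_measure ?D) {d}"
   using J(1)[OF _ d, of 0] d fD
   by (simp add: emeasure_distr[OF rm] emeasure_eq_measure q_def emeasure_uniform_count_measure cardD divide_ennreal)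
 qed (use fD in \<open>auto simp: sets_uniform_count_measure\<close>)
 moreover have "indep_vars (%_. count_space ?D) (%h. if h = 0 then ?r 0 else S h) UNIV"
  using J(2) by (simp add: X_def[abs_def])
 moreover have "distr M (count_space ?D) (S h) = distr M (count_space ?D) (S 1)" if "1 <= h" for h
  using distrX[of h 1] that by (simp add: X_def q_def fun_eq_iff)
 moreover have "?r (Suc h) x = S (Suc h) x \<circ> ?r h x" if "x \<in> space M" for h x
 proof -
  have "inv (?r h x) \<circ> ?r h x = id" using rD[OF that, of h] by (intro permutes_inv_o(2)) simp
  then show ?thesis by (simp add: S_def comp_assoc)
 qed
 ultimately show ?thesis unfolding random_walk_on_perms_def Let_def by blast
qed

text \<open>By \<open>path_law_pair\<close> the past on \<open>{1..m}\<close> given the present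
  \<open>b\<close> on \<open>{1..n}\<close> has law \<open>step T m (restr m b)\<close>, a function
  of the conditioning value \<open>c\<close>. If \<open>b\<close> does not restrict to
  \<open>c\<close>, both sides vanish.\<close>

lemma path_law_type2: "type2_process M (%h x. x h)"
 unfolding type2_process_def shuffle_process_def
proof (intro conjI allI impI)
 interpret prob_space M by (rule path_law_prob[OF T M])
 show "prob_space M" by (rule path_law_prob[OF T M])
 show "(%x. x h) \<in> M \<rightarrow>\<^sub>M N_orderings" for h by (rule path_law_nth[OF T M])
 show "distr M N_orderings (%x. x h) = uniform_ordering" for h by (rule path_law_distr[OF T M])
 show "random_walk_on_perms n M (%h x. perm_of n (x h))" for n by (rule path_law_random_walk)
 fix m n h :: nat and a b c assume mn: "m < n" and h: "1 <= h"
 define k where "k = h - 1"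
 have hk: "h = Suc k" using h by (simp add: k_def)
 note in_ord = path_law_in[OF T M]
 have c0: "measure M {x\<in>space M. restr m (x h) = c} = 0" if "c \<notin> orderings {1..m}"
 proof -
  have "{x\<in>space M. restr m (x h) = c} = {}" using restr_in[OF in_ord] that by auto
  then show ?thesis by (simp only: measure_empty)
 qed
 show "\<P>(x in M. restr m (x (h - 1)) = a & restr n (x h) = b \<bar> restr m (x h) = c) =
    \<P>(x in M. restr m (x (h - 1)) = a \<bar> restr m (x h) = c) * \<P>(x in M. restr n (x h) = b \<bar> restr m (x h) = c)"
 proof (cases "b \<in> orderings {1..n} & c = restr m b")
  case True
  then have b: "b \<in> orderings {1..n}" and c: "c = restr m b" "c \<in> orderings {1..m}" using restr_in'[of m n b] mn by auto
  have rr: "restr m (x h) = c" if "restr n (x h) = b" for x :: "nat => nat rel"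
   using restr_restr[of m n "x h"] mn that c by simp
  have "{x\<in>space M. (restr m (x (h - 1)) = a & restr n (x h) = b) & restr m (x h) = c} = {x\<in>space M. restr m (x k) = a & restr n (x (Suc k)) = b}"
   "{x\<in>space M. restr n (x h) = b & restr m (x h) = c} = {x\<in>space M. restr n (x h) = b}"
   "{x\<in>space M. restr m (x (h - 1)) = a & restr m (x h) = c} = {x\<in>space M. restr m (x k) = a & restr m (x (Suc k)) = c}"
   using rr by (auto simp: hk)
  then show ?thesis unfolding cond_prob_def
   using path_law_pair[of m n b k a] path_law_pair[of m m c k a] path_law_cell[OF T M b, of h] path_law_cell[OF T M c(2), of h] mn b c restr_id[OF c(2)]
   by simp
 next
  case False
  have "{x\<in>space M. restr n (x h) = b & restr m (x h) = c} = {}"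
  proof -
   have False if "x \<in> space M" "restr n (x h) = b" "restr m (x h) = c" for x
    using restr_restr[of m n "x h"] mn that restr_in[OF in_ord[OF that(1)], of n h] False by auto
   then show ?thesis by auto
  qed
  moreover from this have "{x\<in>space M. (restr m (x (h - 1)) = a & restr n (x h) = b) & restr m (x h) = c} = {}" by auto
  ultimately show ?thesis unfolding cond_prob_def
   by (simp only: measure_empty)
 qed
qed

end

lemma corresponds_type2_shuffle:
 assumes T: "consistent T" and K: "corresponds T K" shows "type2_shuffle K"
proof -
 obtain M where M: "path_law T M" using exists_path_law[OF T] by blast
 show ?thesis unfolding type2_shuffle_def
  using path_law_type2[OF T M] path_law_transition[OF T M K] by blast
qed

section \<open>Regular conditional distributions of random orderings\<close>

lemma finite_pmf_exists:
 fixes f :: "'a => real"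
 assumes A: "finite A" and f: "\<And>a. a \<in> A ==> 0 <= f a" "(\<Sum>a\<in>A. f a) = 1"
 obtains p where "set_pmf p \<subseteq> A" "\<And>a. a \<in> A ==> pmf p a = f a"
proof -
 define g where "g a = (if a \<in> A then f a else 0)" for a
 have "(\<integral>\<^sup>+a. ennreal (g a) \<partial>count_space UNIV) = (\<integral>\<^sup>+a. ennreal (f a) \<partial>count_space A)"
  by (subst nn_integral_count_space_indicator) (auto intro!: nn_integral_cong simp: g_def indicator_def)
 also have "... = (\<Sum>a\<in>A. ennreal (f a))" using A by (rule nn_integral_count_space_finite)
 also have "... = 1" using f by (subst sum_ennreal) auto
 finally have 1: "(\<integral>\<^sup>+a. ennreal (g a) \<partial>count_space UNIV) = 1" .
 have 0: "g a \<ge> 0" for a using f by (simp add: g_def)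
 show ?thesis
 proof
  show "set_pmf (embed_pmf g) \<subseteq> A" unfolding set_embed_pmf[OF 0 1] by (auto simp: g_def)
  show "pmf (embed_pmf g) a = f a" if "a \<in> A" for a using that by (simp add: pmf_embed_pmf[OF 0 1] g_def)
 qed
qed

lemma ordering_from_weights:
 fixes k :: "nat => nat rel => real"
 assumes k: "\<And>n b. b \<in> orderings {1..n} ==> 0 <= k n b" and k0: "k 0 {} = 1"
  and proj: "\<And>n b. b \<in> orderings {1..n} ==> (\<Sum>b'\<in>{b'\<in>orderings {1..Suc n}. restr n b' = b}. k (Suc n) b') = k n b"
 obtains M where "M \<in> space (prob_algebra N_orderings)"
  "\<And>n b. b \<in> orderings {1..n} ==> measure M (cell n b) = k n b"
proof -
 have sum1: "(\<Sum>b\<in>orderings {1..n}. k n b) = 1" for n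
 proof (induction n)
  case 0
  have "orderings {1..0::nat} = {{}}" using orderings_nonempty[of 0] orderings_sub[of _ "{1..0::nat}"] by auto
  then show ?case by (simp add: k0)
 next
  case (Suc n)
  have "(\<Sum>b'\<in>orderings {1..Suc n}. k (Suc n) b') = (\<Sum>b\<in>orderings {1..n}. \<Sum>b'\<in>{b'\<in>orderings {1..Suc n}. restr n b' = b}. k (Suc n) b')"
   by (rule sum.group[symmetric]) (auto intro: restr_in'[of n "Suc n"])
  also have "... = (\<Sum>b\<in>orderings {1..n}. k n b)" by (rule sum.cong[OF refl proj])
  finally show ?case using Suc by simp
 qed
 have "\<exists>p. set_pmf p \<subseteq> orderings {1..n} & (\<forall>b\<in>orderings {1..n}. pmf p b = k n b)" for n
  using finite_pmf_exists[of "orderings {1..n}" "k n"] k sum1 by (metis finite_orderings_nat)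
 then obtain p where p: "\<And>n. set_pmf (p n) \<subseteq> orderings {1..n}" "\<And>n b. b \<in> orderings {1..n} ==> pmf (p n) b = k n b"
  by metis
 have "map_pmf (%r. r \<inter> ({1..n} \<times> {1..n})) (p (Suc n)) = p n" for n
 proof (rule pmf_eqI)
  fix a
  show "pmf (map_pmf (%r. r \<inter> ({1..n} \<times> {1..n})) (p (Suc n))) a = pmf (p n) a"
  proof (cases "a \<in> orderings {1..n}")
   case True
   have "pmf (map_pmf (%r. r \<inter> ({1..n} \<times> {1..n})) (p (Suc n))) a = measure (p (Suc n)) {r. restr n r = a}"
    by (simp add: pmf_map restr_def vimage_def)
   also have "... = measure (p (Suc n)) {r\<in>orderings {1..Suc n}. restr n r = a}"
    using p(1)[of "Suc n"] by (intro measure_prob_cong_0) (auto simp: pmf_eq_0_set_pmf)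
   also have "... = (\<Sum>r\<in>{r\<in>orderings {1..Suc n}. restr n r = a}. pmf (p (Suc n)) r)"
    by (rule measure_measure_pmf_finite) simp
   also have "... = k n a" unfolding proj[OF True, symmetric] by (rule sum.cong) (auto simp: p(2))
   finally show ?thesis by (simp add: p(2) True)
  next
   case False
   have "a \<notin> set_pmf (map_pmf (%r. r \<inter> ({1..n} \<times> {1..n})) (p (Suc n)))"
    using p(1)[of "Suc n"] restr_in'[of n "Suc n"] False unfolding restr_def by auto
   moreover have "a \<notin> set_pmf (p n)" using p(1)[of n] False by auto
   ultimately show ?thesis by (simp add: pmf_eq_0_set_pmf[THEN iffD2])
  qed
 qed
 from projective_limit_orderings[OF exhausts_nat _ p(1) this]
 obtain M where M: "M \<in> space (prob_algebra N_orderings)"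
  "\<And>n b. measure M {r\<in>orderings {1..}. r \<inter> ({1..n} \<times> {1..n}) = b} = pmf (p n) b" by auto
 then show ?thesis using that p(2) by (simp add: restr_def)
qed

text \<open>The conditional probability of each cell is a Radon-Nikodym derivative with respect to
  the law of \<open>X\<close>. The countably many relations that make these numbers the cell weights
  of a probability measure hold off one null set; there they are extended to a measure, and
  elsewhere the uniform law is inserted.\<close>

lemma regular_conditional_kernel:
 assumes M: "prob_space M" and X: "X \<in> M \<rightarrow>\<^sub>M N_orderings" and Y: "Y \<in> M \<rightarrow>\<^sub>M N_orderings"
 obtains K where "is_kernel K"
  "\<And>B A. B \<in> sets N_orderings ==> A \<in> sets N_orderings ==>
   measure M {\<omega>\<in>space M. X \<omega> \<in> B & Y \<omega> \<in> A} = (\<integral>\<omega>. indicator B (X \<omega>) * measure (K (X \<omega>)) A \<partial>M)"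
proof -
 interpret M: prob_space M by fact
 define L where "L = distr M N_orderings X"
 interpret L: prob_space L unfolding L_def by (rule M.prob_space_distr[OF X])
 have sL: "sets L = sets N_orderings" by (simp add: L_def)
 have spL: "space L = orderings {1..}" by (simp add: L_def)
 define E where "E n b = {\<omega>\<in>space M. restr n (Y \<omega>) = b}" for n b
 have E[measurable]: "E n b \<in> sets M" for n b
  using measurable_sets[OF measurable_compose[OF Y measurable_restr], of "{b}" n]
  by (simp add: E_def vimage_def Int_def conj_commute)
 define \<nu> where "\<nu> n b = distr (density M (indicator (E n b))) N_orderings X" for n b
 have \<nu>: "emeasure (\<nu> n b) B = emeasure M (X -` B \<inter> space M \<inter> E n b)" if B: "B \<in> sets N_orderings" for n b B
 proof -
  have "emeasure (\<nu> n b) B = emeasure (density M (indicator (E n b))) (X -` B \<inter> space M)"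
   unfolding \<nu>_def using X B by (subst emeasure_distr) auto
  also have "... = (\<integral>\<^sup>+\<omega>. indicator (E n b) \<omega> * indicator (X -` B \<inter> space M) \<omega> \<partial>M)"
   using measurable_sets[OF X B] E by (intro emeasure_density borel_measurable_indicator)
  also have "... = (\<integral>\<^sup>+\<omega>. indicator (E n b \<inter> (X -` B \<inter> space M)) \<omega> \<partial>M)"
   by (simp only: indicator_inter_arith)
  also have "... = emeasure M (E n b \<inter> (X -` B \<inter> space M))"
   using measurable_sets[OF X B] by (intro nn_integral_indicator) auto
  finally show ?thesis by (simp add: Int_commute)
 qed
 define k where "k n b = RN_deriv L (\<nu> n b)" for n b
 have km[measurable]: "k n b \<in> borel_measurable L" for n b by (simp add: k_def)
 have dk: "density L (k n b) = \<nu> n b" for n b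
  unfolding k_def
 proof (rule L.density_RN_deriv)
  show "absolutely_continuous L (\<nu> n b)"
   unfolding absolutely_continuous_def
  proof
   fix B assume B: "B \<in> null_sets L"
   then have Bs: "B \<in> sets N_orderings" by (auto simp: sL)
   have "emeasure M (X -` B \<inter> space M) = 0" using null_setsD1[OF B] emeasure_distr[OF X Bs] by (simp add: L_def)
   then have "emeasure M (X -` B \<inter> space M \<inter> E n b) = 0"
    using emeasure_mono[OF Int_lower1 measurable_sets[OF X Bs], of "E n b"] by (simp only: le_zero_eq)
   then show "B \<in> null_sets (\<nu> n b)" using Bs \<nu>[OF Bs] by (intro null_setsI) (simp_all add: \<nu>_def)
  qed
 qed (simp add: \<nu>_def sL)
 have ik: "(\<integral>\<^sup>+r. k n b r * indicator B r \<partial>L) = emeasure M (X -` B \<inter> space M \<inter> E n b)" if B: "B \<in> sets N_orderings" for n b B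
  using emeasure_density[OF km, of B n b] B \<nu>[OF B] by (simp add: dk sL)
 have fin: "(\<integral>\<^sup>+r. k n b r \<partial>L) ~= \<infinity>" for n b
 proof -
  have "(\<integral>\<^sup>+r. k n b r \<partial>L) = (\<integral>\<^sup>+r. k n b r * indicator (space L) r \<partial>L)" by (rule nn_integral_cong) simp
  also have "... = emeasure M (X -` space L \<inter> space M \<inter> E n b)" by (rule ik) (simp add: spL sets.top[of N_orderings, simplified])
  also have "... < \<infinity>" by (simp add: M.emeasure_eq_measure)
  finally show ?thesis by simp
 qed
 have uniq: "AE r in L. f r = k n b r"
  if f: "f \<in> borel_measurable L" and eq: "\<And>B. B \<in> sets N_orderings ==> (\<integral>\<^sup>+r. f r * indicator B r \<partial>L) = emeasure M (X -` B \<inter> space M \<inter> E n b)" for f n b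
 proof -
  have "density L (k n b) = density L f"
  proof (rule measure_eqI)
   fix B assume "B \<in> sets (density L (k n b))"
   then have B: "B \<in> sets N_orderings" by (simp add: sL)
   then show "emeasure (density L (k n b)) B = emeasure (density L f) B"
    using f eq[OF B] ik[OF B, of n b] by (subst (1 2) emeasure_density) (auto simp: sL)
  qed simp
  then have "AE r in L. k n b r = f r"
   by (subst finite_density_unique[symmetric]) (use f fin in \<open>auto intro: L.sigma_finite_measure_axioms\<close>)
  then show ?thesis by eventually_elim simp
 qed
 \<comment> \<open>At a good point the derivatives satisfy exactly the relations needed for
   \<open>ordering_from_weights\<close>.\<close>
 define good where "good r \<longleftrightarrow> k 0 {} r = 1 & (\<forall>n. \<forall>b\<in>orderings {1..n}.
  (\<Sum>b'\<in>{b'\<in>orderings {1..Suc n}. restr n b' = b}. k (Suc n) b' r) = k n b r)" for r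
 have good_AE: "AE r in L. good r"
 proof -
  have 1: "AE r in L. 1 = k 0 {} r"
  proof (rule uniq)
   fix B assume B: "B \<in> sets N_orderings"
   have "X -` B \<inter> space M \<inter> E 0 {} = X -` B \<inter> space M" by (auto simp: E_def restr_0)
   then show "(\<integral>\<^sup>+r. 1 * indicator B r \<partial>L) = emeasure M (X -` B \<inter> space M \<inter> E 0 {})"
    using B emeasure_distr[OF X B] by (simp add: L_def)
  qed simp
  have 2: "AE r in L. (\<Sum>b'\<in>{b'\<in>orderings {1..Suc n}. restr n b' = b}. k (Suc n) b' r) = k n b r" for n b
  proof (rule uniq)
   fix B assume B: "B \<in> sets N_orderings"
   let ?F = "{b'\<in>orderings {1..Suc n}. restr n b' = b}"
   have "(\<integral>\<^sup>+r. (\<Sum>b'\<in>?F. k (Suc n) b' r) * indicator B r \<partial>L) = (\<integral>\<^sup>+r. (\<Sum>b'\<in>?F. k (Suc n) b' r * indicator B r) \<partial>L)"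
    by (simp add: sum_distrib_right)
   also have "... = (\<Sum>b'\<in>?F. \<integral>\<^sup>+r. k (Suc n) b' r * indicator B r \<partial>L)"
    using B by (intro nn_integral_sum borel_measurable_times_ennreal km borel_measurable_indicator) (simp add: sL)
   also have "... = (\<Sum>b'\<in>?F. emeasure M (X -` B \<inter> space M \<inter> E (Suc n) b'))" by (simp add: ik[OF B])
   also have "... = emeasure M (\<Union>b'\<in>?F. X -` B \<inter> space M \<inter> E (Suc n) b')"
   proof (rule sum_emeasure)
    show "(%b'. X -` B \<inter> space M \<inter> E (Suc n) b') ` ?F \<subseteq> sets M"
     using measurable_sets[OF X B] E by auto
    show "disjoint_family_on (%b'. X -` B \<inter> space M \<inter> E (Suc n) b') ?F"
     by (auto simp: disjoint_family_on_def E_def)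
   qed simp
   also have "(\<Union>b'\<in>?F. X -` B \<inter> space M \<inter> E (Suc n) b') = X -` B \<inter> space M \<inter> E n b"
    using restr_in[of _ "Suc n"] measurable_space[OF Y] restr_restr[of n "Suc n"] by (auto simp: E_def)
   finally show "(\<integral>\<^sup>+r. (\<Sum>b'\<in>?F. k (Suc n) b' r) * indicator B r \<partial>L) = emeasure M (X -` B \<inter> space M \<inter> E n b)" .
  qed simp
  have "AE r in L. \<forall>n. \<forall>b\<in>orderings {1..n}. (\<Sum>b'\<in>{b'\<in>orderings {1..Suc n}. restr n b' = b}. k (Suc n) b' r) = k n b r"
   using 2 by (intro AE_all_countable[THEN iffD2] allI AE_finite_allI) auto
  with 1 show ?thesis unfolding good_def by eventually_elim simp
 qed
 have good_m: "{r\<in>space L. good r} \<in> sets L"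
  unfolding good_def
  by (intro sets.sets_Collect_conj sets.sets_Collect_countable_All sets.sets_Collect_finite_All measurable_equality_set borel_measurable_sum) auto
 \<comment> \<open>Finiteness at a good point comes from the relations themselves: the weight at
   level 0 is 1, and each refinement only splits weights.\<close>
 have fink: "k n b r ~= \<infinity>" if r: "good r" and b: "b \<in> orderings {1..n}" for n b r
  using b
 proof (induction n arbitrary: b)
  case 0
  have "b = {}" using orderings_sub[OF 0] by auto
  then show ?case using r by (simp add: good_def)
 next
  case (Suc n)
  have "k (Suc n) b r <= (\<Sum>b'\<in>{b'\<in>orderings {1..Suc n}. restr n b' = restr n b}. k (Suc n) b' r)"
   by (rule sum_nonneg_leq_bound[OF _ _ refl]) (use Suc.prems in auto)
  also have "... = k n (restr n b) r" using r restr_in'[of n "Suc n" b] Suc.prems by (auto simp: good_def)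
  finally have "k (Suc n) b r <= k n (restr n b) r" .
  moreover have "k n (restr n b) r ~= \<infinity>" using Suc.IH[of "restr n b"] restr_in'[of n "Suc n" b] Suc.prems by auto
  ultimately show ?case by (auto simp: top_unique)
 qed
 have ex: "\<exists>Q. Q \<in> space (prob_algebra N_orderings) & (\<forall>n. \<forall>b\<in>orderings {1..n}. measure Q (cell n b) = enn2real (k n b r))"
  if r: "good r" for r
 proof (rule ordering_from_weights[of "%n b. enn2real (k n b r)"])
  show "enn2real (k 0 {} r) = 1" using r by (simp add: good_def)
  fix n :: nat and b assume b: "b \<in> orderings {1..n}"
  have "(\<Sum>b'\<in>{b'\<in>orderings {1..Suc n}. restr n b' = b}. enn2real (k (Suc n) b' r)) = enn2real (\<Sum>b'\<in>{b'\<in>orderings {1..Suc n}. restr n b' = b}. k (Suc n) b' r)"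
   by (subst enn2real_sum) (use fink[OF r] in \<open>auto simp: less_top comp_def\<close>)
  then show "(\<Sum>b'\<in>{b'\<in>orderings {1..Suc n}. restr n b' = b}. enn2real (k (Suc n) b' r)) = enn2real (k n b r)"
   using r b by (simp add: good_def)
 qed (simp_all, blast)
 \<comment> \<open>The arbitrary choice does not endanger measurability: the values on cells are
   prescribed, and measurability of \<open>K\<close> is tested on cells.\<close>
 define K where "K r = (if good r then SOME Q. Q \<in> space (prob_algebra N_orderings) & (\<forall>n. \<forall>b\<in>orderings {1..n}. measure Q (cell n b) = enn2real (k n b r))
   else uniform_ordering)" for r
 have Kgood: "K r \<in> space (prob_algebra N_orderings)" "\<And>n b. b \<in> orderings {1..n} ==> measure (K r) (cell n b) = enn2real (k n b r)"
  if "good r" for r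
  using someI_ex[OF ex[OF that]] that unfolding K_def by auto
 have Kp: "K r \<in> space (prob_algebra N_orderings)" for r
  using Kgood(1)[of r] uniform_ordering_prob by (cases "good r") (auto simp: K_def)
 have Kcell: "emeasure (K r) (cell n b) = (if good r then k n b r else emeasure uniform_ordering (cell n b))"
  if b: "b \<in> orderings {1..n}" for n b r
 proof -
  interpret K: prob_space "K r" using Kp[of r] by (simp add: space_prob_algebra)
  show ?thesis
  proof (cases "good r")
   case True
   then show ?thesis using Kgood(2)[OF True b] fink[OF True b] by (simp add: K.emeasure_eq_measure less_top)
  qed (simp add: K_def)
 qed
 have K: "is_kernel K"
  unfolding is_kernel_def
 proof (rule measurable_prob_algebra_generated[OF sets_filtered[OF filtered_N] Int_stable_cells[OF filtered_N] cells_sub])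
  show "prob_space (K r)" "sets (K r) = sets N_orderings" for r using Kp[of r] by (auto simp: space_prob_algebra)
  fix A assume "A \<in> cells N_orderings restr"
  then consider "A = {}" | n b where "A = (cell n b)" by (auto simp: cells_def)
  then show "(%r. emeasure (K r) A) \<in> borel_measurable N_orderings"
  proof cases
   case 1 then show ?thesis by simp
  next
   case 2
   show ?thesis
   proof (cases "b \<in> orderings {1..n}")
    case True
    have kmN: "k n b \<in> borel_measurable N_orderings" using km by (simp add: measurable_cong_sets[OF sL refl])
    have gN: "{r \<in> space N_orderings. good r} \<in> sets N_orderings" using good_m by (simp add: sL spL)
    show ?thesis unfolding 2 Kcell[OF True]
     by (rule measurable_If[OF kmN measurable_const gN]) simp
   next
    case False
    then have "A = {}" using 2 restr_in by auto
    then show ?thesis by simp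
   qed
  qed
 qed
 show ?thesis
 proof (rule that[OF K])
  fix B A assume BA: "B \<in> sets N_orderings" "A \<in> sets N_orderings"
  show "measure M {\<omega>\<in>space M. X \<omega> \<in> B & Y \<omega> \<in> A} = (\<integral>\<omega>. indicator B (X \<omega>) * measure (K (X \<omega>)) A \<partial>M)"
  proof (rule kernel_integral_from_cells[OF M X Y X K filtered_N _ BA])
   fix n :: nat and x b assume x: "x \<in> space N_orderings" and b: "b \<in> orderings {1..n}"
   let ?C = "{y \<in> space N_orderings. restr n y = restr n x}"
   have C: "?C \<in> sets N_orderings" by (rule cell_in_sets[OF filtered_N])
   have mK: "(%r. measure (K r) (cell n b)) \<in> borel_measurable N_orderings"
    by (rule is_kernel_measure[OF K sets_restr])
   have "ennreal (\<integral>\<omega>. indicator ?C (X \<omega>) * measure (K (X \<omega>)) (cell n b) \<partial>M)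
    = ennreal (\<integral>r. indicator ?C r * measure (K r) (cell n b) \<partial>L)"
    unfolding L_def using C mK by (subst integral_distr[OF X]) auto
   also have "... = (\<integral>\<^sup>+r. ennreal (indicator ?C r * measure (K r) (cell n b)) \<partial>L)"
   proof (rule nn_integral_eq_integral[symmetric])
    show "integrable L (%r. indicator ?C r * measure (K r) (cell n b))"
    proof (rule L.integrable_const_bound[where B=1])
     show "AE r in L. norm (indicator ?C r * measure (K r) (cell n b)) <= 1"
     proof (rule AE_I2)
      fix r
      interpret K: prob_space "K r" using Kp[of r] by (simp add: space_prob_algebra)
      show "norm (indicator ?C r * measure (K r) (cell n b)) <= 1"
       by (simp add: indicator_def)
     qed
     show "(%r. indicator ?C r * measure (K r) (cell n b)) \<in> borel_measurable L"
      using C mK by (intro borel_measurable_times) (auto simp: measurable_cong_sets[OF sL refl] sL)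
    qed
   qed auto
   also have "... = (\<integral>\<^sup>+r. k n b r * indicator ?C r \<partial>L)"
   proof (rule nn_integral_cong_AE)
    show "AE r in L. ennreal (indicator ?C r * measure (K r) (cell n b)) = k n b r * indicator ?C r"
     using good_AE
    proof eventually_elim
     case (elim r)
     interpret K: prob_space "K r" using Kp[of r] by (simp add: space_prob_algebra)
     show ?case using Kcell[OF b, of r] elim by (auto simp: indicator_def K.emeasure_eq_measure)
    qed
   qed
   also have "... = emeasure M (X -` ?C \<inter> space M \<inter> E n b)" by (rule ik[OF C])
   also have "X -` ?C \<inter> space M \<inter> E n b = {\<omega>\<in>space M. restr n (X \<omega>) = restr n x & restr n (Y \<omega>) = b}"
    using measurable_space[OF X] by (auto simp: E_def)
   finally show "measure M {\<omega>\<in>space M. restr n (X \<omega>) = restr n x & restr n (Y \<omega>) = b} =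
    (\<integral>\<omega>. indicator ?C (X \<omega>) * measure (K (X \<omega>)) (cell n b) \<partial>M)"
    by (subst (asm) M.emeasure_eq_measure, subst (asm) ennreal_inj) (auto intro!: integral_nonneg_AE)
  qed
 qed
qed

text \<open>Equal integrals over cells give equal joint laws, hence for each cell almost everywhere
  equal probabilities. There are countably many cells, and they determine a measure.\<close>

lemma kernel_AE_unique:
 assumes L: "prob_space L" "sets L = sets N_orderings" and K: "is_kernel K" and K': "is_kernel K'"
  and eq: "\<And>n a b. a \<in> orderings {1..n} ==> b \<in> orderings {1..n} ==>
   (\<integral>r. indicator (cell n a) r * measure (K r) (cell n b) \<partial>L) =
   (\<integral>r. indicator (cell n a) r * measure (K' r) (cell n b) \<partial>L)"
 shows "AE r in L. K r = K' r"
proof -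
 interpret L: prob_space L by fact
 have spL: "space L = orderings {1..}" using sets_eq_imp_space_eq[OF L(2)] by simp
 have id: "(%r. r) \<in> L \<rightarrow>\<^sub>M N_orderings" by (subst measurable_cong_sets[OF L(2) refl]) simp
 define Q where "Q K = L \<bind> (%r. distr (K r) (N_orderings \<Otimes>\<^sub>M N_orderings) (%y. (r, y)))" for K :: "nat rel => nat rel measure"
 note QK = kernel_pair_measure[OF L(1) id id K, folded Q_def]
 note QK' = kernel_pair_measure[OF L(1) id id K', folded Q_def]
 interpret Q: prob_space "Q K" using QK(1) by (simp add: space_prob_algebra)
 interpret Q': prob_space "Q K'" using QK'(1) by (simp add: space_prob_algebra)
 have "Q K = Q K'"
 proof (rule measure_eq_filtered[OF filtered_pair[OF filtered_N filtered_N]])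
  fix n :: nat and x assume x: "x \<in> space (N_orderings \<Otimes>\<^sub>M N_orderings)"
  obtain r s where xe: "x = (r, s)" by (cases x)
  with x have r: "r \<in> orderings {1..}" and s: "s \<in> orderings {1..}" by (auto simp: space_pair_measure)
  let ?C = "(cell n (restr n r))" and ?A = "(cell n (restr n s))"
  have *: "{y \<in> space (N_orderings \<Otimes>\<^sub>M N_orderings). (case y of (x, y) => (restr n x, restr n y)) = (case x of (x, y) => (restr n x, restr n y))} = ?C \<times> ?A"
   by (auto simp: xe space_pair_measure)
  have "measure (Q K) (?C \<times> ?A) = measure (Q K') (?C \<times> ?A)"
   unfolding QK(2)[OF sets_restr sets_restr] QK'(2)[OF sets_restr sets_restr]
   using eq[OF restr_in[OF r] restr_in[OF s]] .
  then show "emeasure (Q K) {y \<in> space (N_orderings \<Otimes>\<^sub>M N_orderings). (case y of (x, y) => (restr n x, restr n y)) = (case x of (x, y) => (restr n x, restr n y))} =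
    emeasure (Q K') {y \<in> space (N_orderings \<Otimes>\<^sub>M N_orderings). (case y of (x, y) => (restr n x, restr n y)) = (case x of (x, y) => (restr n x, restr n y))}"
   unfolding * by (simp add: Q.emeasure_eq_measure Q'.emeasure_eq_measure)
 qed (use QK(1) QK'(1) Q.finite_measure_axioms in \<open>auto simp: space_prob_algebra\<close>)
 have ae: "AE r in L. measure (K r) (cell n b) = measure (K' r) (cell n b)" for n b
 proof -
  let ?A = "(cell n b)"
  have int: "integrable L (%r. measure (K r) ?A)" if K: "is_kernel K" for K
  proof (rule L.integrable_const_bound[where B=1])
   show "AE r in L. norm (measure (K r) ?A) <= 1"
    by (rule AE_I2) (use prob_space.prob_le_1[OF is_kernelD(1)[OF K]] spL in auto)
   show "(%r. measure (K r) ?A) \<in> borel_measurable L"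
    by (rule measurable_compose[OF id is_kernel_measure[OF K sets_restr]])
  qed
  show ?thesis
  proof (rule density_unique_real[OF int[OF K] int[OF K']])
   fix B assume "B \<in> sets L"
   then have B: "B \<in> sets N_orderings" by (simp add: L(2))
   show "(\<integral>r\<in>B. measure (K r) ?A \<partial>L) = (\<integral>r\<in>B. measure (K' r) ?A \<partial>L)"
    using QK(2)[OF B sets_restr, of n b] QK'(2)[OF B sets_restr, of n b] \<open>Q K = Q K'\<close>
    by (simp add: set_lebesgue_integral_def)
  qed
 qed
 have "AE r in L. \<forall>n. \<forall>b\<in>orderings {1..n}. measure (K r) (cell n b) = measure (K' r) (cell n b)"
  using ae by (intro AE_all_countable[THEN iffD2] allI AE_finite_allI) auto
 with AE_space show ?thesis
 proof eventually_elim
  case (elim r)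
  then have r: "r \<in> orderings {1..}" by (simp add: spL)
  show ?case
   by (rule measure_eq_N) (use is_kernelD[OF K r] is_kernelD[OF K' r] elim in \<open>auto simp: space_prob_algebra\<close>)
 qed
qed

section \<open>Type 2 shuffles and consistent families\<close>

lemma finite_pmf_ex:
 fixes f :: "'a => real"
 assumes "finite A" "\<And>a. a \<in> A ==> 0 <= f a" "(\<Sum>a\<in>A. f a) = 1"
 shows "\<exists>p. set_pmf p \<subseteq> A & (\<forall>a\<in>A. pmf p a = f a)"
 by (rule finite_pmf_exists[OF assms]) blast+

lemma measurable_eq_sets: "sets M = sets N ==> f \<in> N \<rightarrow>\<^sub>M L ==> f \<in> M \<rightarrow>\<^sub>M L"
 using measurable_cong_sets[of M N L L] by blast

lemma kernel_integrand_measurable: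
 assumes "is_kernel K" "C \<in> sets N_orderings" "A \<in> sets N_orderings"
 shows "(%r. indicator C r * measure (K r) A :: real) \<in> borel_measurable N_orderings"
 by (intro borel_measurable_times is_kernel_measure borel_measurable_indicator assms)

text \<open>\<open>T n\<close> is the law of the inverse of the step from time 0 to time 1, and its
  consistency is the type 2 identity at \<open>h = 1\<close>.\<close>

lemma type2_process_consistent:
 assumes P: "type2_process M L"
 obtains T where "consistent T"
  "\<And>n a b. a \<in> orderings {1..n} ==> b \<in> orderings {1..n} ==>
   measure M {w\<in>space M. restr n (L 0 w) = a & restr n (L 1 w) = b} = pmf (step T n b) a / fact n"
proof -
 have SP: "shuffle_process M L" using P by (simp add: type2_process_def)
 then interpret prob_space M by (simp add: shuffle_process_def)
 have Lm: "L h \<in> M \<rightarrow>\<^sub>M N_orderings" for h using SP by (simp add: shuffle_process_def)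
 have Ld: "distr M N_orderings (L h) = uniform_ordering" for h using SP by (simp add: shuffle_process_def)
 have RW: "random_walk_on_perms n M (%h w. perm_of n (L h w))" for n using SP by (simp add: shuffle_process_def)
 have in_ord: "L h w \<in> orderings {1..}" if "w \<in> space M" for h w using measurable_space[OF Lm that] by simp
 let ?q = "%n h w. perm_of n (L h w)"
 have cell: "measure M {w\<in>space M. restr n (L h w) = b} = 1 / fact n" if "b \<in> orderings {1..n}" for n h b
 proof -
  have "L h -` (cell n b) \<inter> space M = {w\<in>space M. restr n (L h w) = b}" using in_ord by auto
  then show ?thesis using measure_distr[OF Lm sets_restr, of h n b] measure_uniform_ordering[OF that] by (simp add: Ld)
 qed
 have ev: "{w\<in>space M. restr n (L h w) = b} \<in> sets M" for n h b
  using measurable_sets[OF measurable_compose[OF Lm measurable_restr], of "{b}" n h]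
  by (simp add: vimage_def Int_def conj_commute)
 \<comment> \<open>The walk provides its step variables for each \<open>n\<close> separately.
   \<open>JP\<close> keeps only what is needed of the law \<open>Q\<close> of the first one, so that
   a single choice can be made for all \<open>n\<close>.\<close>
 define JP where "JP n Q \<longleftrightarrow> (\<forall>\<alpha>\<in>perms n. \<forall>\<beta>\<in>perms n. measure M {w\<in>space M. ?q n 0 w = \<alpha> & ?q n 1 w = \<beta>} = Q (\<beta> \<circ> inv \<alpha>) / fact n)
  & (\<forall>s. 0 <= Q s) & (\<Sum>s\<in>perms n. Q s) = 1" for n Q
 have joint: "\<exists>Q. JP n Q" for n
 proof -
  let ?D = "perms n"
  have fD: "finite ?D" by (rule finite_permutations) simp
  have cD: "card ?D = fact n" by (rule card_permutations) auto
  from RW[of n] obtain S where d0: "distr M (count_space ?D) (?q n 0) = uniform_count_measure ?D"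
   and ind: "indep_vars (%_. count_space ?D) (%h. if h = 0 then ?q n 0 else S h) UNIV"
   and S: "\<And>h w. w \<in> space M ==> ?q n (Suc h) w = S (Suc h) w \<circ> ?q n h w"
   unfolding random_walk_on_perms_def Let_def by blast
  let ?X = "%h. if h = 0 then ?q n 0 else S h"
  have Xm: "?X h \<in> M \<rightarrow>\<^sub>M count_space ?D" for h
   using ind unfolding indep_vars_def2 by blast
  have S1m: "S 1 \<in> M \<rightarrow>\<^sub>M count_space ?D" and r0m: "?q n 0 \<in> M \<rightarrow>\<^sub>M count_space ?D" using Xm[of 1] Xm[of 0] by simp_all
  define Q where "Q s = measure M {w\<in>space M. S 1 w = s}" for s
  have m0: "measure M {w\<in>space M. ?q n 0 w = \<alpha>} = 1 / fact n" if "\<alpha> \<in> ?D" for \<alpha>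
  proof -
   have "?q n 0 -` {\<alpha>} \<inter> space M = {w\<in>space M. ?q n 0 w = \<alpha>}" by auto
   then have "measure M {w\<in>space M. ?q n 0 w = \<alpha>} = measure (distr M (count_space ?D) (?q n 0)) {\<alpha>}"
    using measure_distr[OF r0m, of "{\<alpha>}"] that by simp
   also have "... = 1 / fact n" unfolding d0 using that fD by (subst measure_uniform_count_measure) (auto simp: cD)
   finally show ?thesis .
  qed
  have "measure M {w\<in>space M. ?q n 0 w = \<alpha> & ?q n 1 w = \<beta>} = Q (\<beta> \<circ> inv \<alpha>) / fact n"
   if \<alpha>: "\<alpha> \<in> ?D" and \<beta>: "\<beta> \<in> ?D" for \<alpha> \<beta>
  proof -
   let ?s = "\<beta> \<circ> inv \<alpha>"
   have s: "?s \<in> ?D" using \<alpha> \<beta> by (auto intro!: permutes_compose permutes_inv)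
   have inv: "\<alpha> \<circ> inv \<alpha> = id" "inv \<alpha> \<circ> \<alpha> = id" using \<alpha> by (auto intro: permutes_inv_o)
   have "{w\<in>space M. ?q n 0 w = \<alpha> & ?q n 1 w = \<beta>} = {w\<in>space M. ?q n 0 w = \<alpha> & S 1 w = ?s}"
   proof -
    have "?q n 1 w = \<beta> \<longleftrightarrow> S 1 w = ?s" if "w \<in> space M" "?q n 0 w = \<alpha>" for w
    proof -
     have "?q n 1 w = S 1 w \<circ> \<alpha>" using S[OF that(1), of 0] that(2) by (simp add: One_nat_def)
     moreover have "S 1 w \<circ> \<alpha> = \<beta> \<longleftrightarrow> S 1 w = ?s" using inv by (metis comp_assoc comp_id)
     ultimately show ?thesis by simp
    qed
    then show ?thesis by blast
   qed
   also have "... = (\<Inter>h\<in>{0,1}. ?X h -` (if h = 0 then {\<alpha>} else {?s}) \<inter> space M)" by auto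
   finally have ev1: "{w\<in>space M. ?q n 0 w = \<alpha> & ?q n 1 w = \<beta>} = (\<Inter>h\<in>{0,1}. ?X h -` (if h = 0 then {\<alpha>} else {?s}) \<inter> space M)" .
   have "measure M {w\<in>space M. ?q n 0 w = \<alpha> & ?q n 1 w = \<beta>} = (\<Prod>h\<in>{0,1::nat}. measure M (?X h -` (if h = 0 then {\<alpha>} else {?s}) \<inter> space M))"
    unfolding ev1
   proof (rule indep_setsD)
    show "indep_sets (%i. {?X i -` A \<inter> space M |A. A \<in> sets (count_space ?D)}) UNIV"
     using ind unfolding indep_vars_def2 by blast
    show "\<forall>h\<in>{0, 1}. ?X h -` (if h = 0 then {\<alpha>} else {?s}) \<inter> space M \<in> {?X h -` A \<inter> space M |A. A \<in> sets (count_space ?D)}"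
    proof
     fix h :: nat
     have "(if h = 0 then {\<alpha>} else {?s}) \<in> sets (count_space ?D)" using \<alpha> s by simp
     then show "?X h -` (if h = 0 then {\<alpha>} else {?s}) \<inter> space M \<in> {?X h -` A \<inter> space M |A. A \<in> sets (count_space ?D)}" by blast
    qed
   qed simp_all
   moreover have "... = measure M {w\<in>space M. ?q n 0 w = \<alpha>} * Q ?s"
    by (simp add: Q_def vimage_def Int_def conj_commute)
   ultimately show ?thesis by (simp add: m0[OF \<alpha>])
  qed
  moreover have "(\<Sum>s\<in>?D. Q s) = 1"
  proof -
   have "(\<Sum>s\<in>?D. Q s) = measure M (\<Union>s\<in>?D. {w\<in>space M. S 1 w = s})"
    unfolding Q_def
   proof (rule finite_measure_finite_Union[symmetric, OF fD])
    show "(%s. {w\<in>space M. S 1 w = s}) ` ?D \<subseteq> sets M"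
    proof (rule image_subsetI)
     fix s assume "s \<in> ?D"
     then have "S 1 -` {s} \<inter> space M \<in> sets M" by (intro measurable_sets[OF S1m]) simp
     then show "{w\<in>space M. S 1 w = s} \<in> sets M" by (simp add: vimage_def Int_def conj_commute)
    qed
   qed (auto simp: disjoint_family_on_def)
   also have "(\<Union>s\<in>?D. {w\<in>space M. S 1 w = s}) = space M"
    using measurable_space[OF S1m] by auto
   finally show ?thesis by (simp add: prob_space)
  qed
  ultimately have "JP n Q" by (simp add: JP_def Q_def)
  then show ?thesis by blast
 qed
 then obtain Q where JQ: "\<And>n. JP n (Q n)" by metis
 have Q: "\<And>n \<alpha> \<beta>. \<alpha> \<in> perms n ==> \<beta> \<in> perms n ==>
   measure M {w\<in>space M. ?q n 0 w = \<alpha> & ?q n 1 w = \<beta>} = Q n (\<beta> \<circ> inv \<alpha>) / fact n"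
  "\<And>n s. 0 <= Q n s" "\<And>n. (\<Sum>s\<in>perms n. Q n s) = 1"
  using JQ unfolding JP_def by blast+
 \<comment> \<open>The weights are those of the inverse step because \<open>step\<close> goes back
   in time.\<close>
 have "\<exists>p. set_pmf p \<subseteq> perms n & (\<forall>s\<in>perms n. pmf p s = Q n (inv s))" for n
 proof -
  have "(\<Sum>s\<in>perms n. Q n (inv s)) = 1" using Q(3)[of n] sum_permutations_inverse[of "Q n" "{1..n}"] by simp
  then show ?thesis by (intro finite_pmf_ex finite_permutations Q(2)) simp
 qed
 then obtain T where T: "\<And>n. set_pmf (T n) \<subseteq> perms n" "\<And>n s. s \<in> perms n ==> pmf (T n) s = Q n (inv s)" by metis
 have PF: "perm_family T" using T(1) by (simp add: perm_family_def)
 have J: "measure M {w\<in>space M. restr n (L 0 w) = a & restr n (L 1 w) = b} = pmf (step T n b) a / fact n"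
  if a: "a \<in> orderings {1..n}" and b: "b \<in> orderings {1..n}" for n a b
 proof -
  note A = perm_of'[OF a] and B = perm_of'[OF b]
  have iff: "restr n (L h w) = c \<longleftrightarrow> ?q n h w = perm_of n c" if "w \<in> space M" "c \<in> orderings {1..n}" for w h c
   using perm_of_eq_iff[OF in_ord[OF that(1)] perm_of'(1)[OF that(2)]] perm_of'(2)[OF that(2)] by simp
  have "measure M {w\<in>space M. restr n (L 0 w) = a & restr n (L 1 w) = b} =
   measure M {w\<in>space M. ?q n 0 w = perm_of n a & ?q n 1 w = perm_of n b}"
   using iff a b by (intro arg_cong[where f="measure M"]) blast
  also have "... = Q n (perm_of n b \<circ> inv (perm_of n a)) / fact n" using A B by (intro Q(1)) auto
  also have "perm_of n b \<circ> inv (perm_of n a) = inv (perm_of n a \<circ> inv (perm_of n b))"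
   using permutes_bij[OF A(1)] permutes_bij[OF permutes_inv[OF B(1)]] permutes_inv_inv[OF B(1)]
   by (simp add: o_inv_distrib)
  also have "Q n (inv (perm_of n a \<circ> inv (perm_of n b))) = pmf (step T n b) a"
   using A B by (subst pmf_step[OF PF a b]) (auto intro!: T(2)[symmetric] permutes_compose permutes_inv)
  finally show ?thesis .
 qed
 have "consistent T" unfolding consistent_def
 proof (intro conjI allI impI PF)
  fix m n :: nat and b assume mn: "m <= n" and b: "b \<in> orderings {1..n}"
  note c = restr_in'[OF mn b]
  show "map_pmf (restr m) (step T n b) = step T m (restr m b)"
  proof (cases "m = n")
   case True
   have "map_pmf (restr n) (step T n b) = map_pmf (%x. x) (step T n b)"
    using set_step[OF PF b] by (intro map_pmf_cong refl restr_id) auto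
   then show ?thesis using True restr_id[OF b] by simp
  next
   case False
   then have mn': "m < n" using mn by simp
   show ?thesis
   proof (rule pmf_eqI)
    fix a
    show "pmf (map_pmf (restr m) (step T n b)) a = pmf (step T m (restr m b)) a"
    proof (cases "a \<in> orderings {1..m}")
     case True
     let ?A = "{a'\<in>orderings {1..n}. restr m a' = a}"
     have "\<P>(w in M. restr m (L 0 w) = a & restr n (L 1 w) = b \<bar> restr m (L 1 w) = restr m b) =
       \<P>(w in M. restr m (L 0 w) = a \<bar> restr m (L 1 w) = restr m b) *
       \<P>(w in M. restr n (L 1 w) = b \<bar> restr m (L 1 w) = restr m b)"
     proof -
      have "\<forall>m n h a b c. m < n --> h \<ge> 1 \<longrightarrow>
       \<P>(w in M. restr m (L (h - 1) w) = a & restr n (L h w) = b \<bar> restr m (L h w) = c) =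
       \<P>(w in M. restr m (L (h - 1) w) = a \<bar> restr m (L h w) = c) *
       \<P>(w in M. restr n (L h w) = b \<bar> restr m (L h w) = c)"
       using P unfolding type2_process_def by (rule conjunct2)
      from this[rule_format, OF mn' le_refl[of 1], of a b "restr m b"] show ?thesis by simp
     qed
     moreover have "{w\<in>space M. (restr m (L 0 w) = a & restr n (L 1 w) = b) & restr m (L 1 w) = restr m b} = {w\<in>space M. restr m (L 0 w) = a & restr n (L 1 w) = b}"
      "{w\<in>space M. restr n (L 1 w) = b & restr m (L 1 w) = restr m b} = {w\<in>space M. restr n (L 1 w) = b}"
      using restr_restr[OF mn] by metis+
     \<comment> \<open>The factor \<open>fact m\<close> is the reciprocal of the probability of the
       conditioning cell; the cell of \<open>b\<close> contributes
       \<open>1 / fact n\<close>.\<close>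
     ultimately have "measure M {w\<in>space M. restr m (L 0 w) = a & restr n (L 1 w) = b} * fact m = (pmf (step T m (restr m b)) a / fact n) * fact m"
      using J[OF True c] cell[OF c] cell[OF b] by (simp add: cond_prob_def)
     then have "measure M {w\<in>space M. restr m (L 0 w) = a & restr n (L 1 w) = b} = pmf (step T m (restr m b)) a / fact n"
      by (subst (asm) mult_right_cancel) simp_all
     \<comment> \<open>The same probability, now summed over the orderings of \<open>{1..n}\<close>
       that restrict to \<open>a\<close>; comparing the two values yields consistency.\<close>
     moreover have "measure M {w\<in>space M. restr m (L 0 w) = a & restr n (L 1 w) = b} = (\<Sum>a'\<in>?A. pmf (step T n b) a' / fact n)"
     proof -
      have "{w\<in>space M. restr m (L 0 w) = a & restr n (L 1 w) = b} = (\<Union>a'\<in>?A. {w\<in>space M. restr n (L 0 w) = a' & restr n (L 1 w) = b})"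
       using restr_restr[OF mn] restr_in[OF in_ord] by auto
      then have "measure M {w\<in>space M. restr m (L 0 w) = a & restr n (L 1 w) = b} = (\<Sum>a'\<in>?A. measure M {w\<in>space M. restr n (L 0 w) = a' & restr n (L 1 w) = b})"
       using sets.sets_Collect_conj[OF ev ev] by (simp only:) (intro finite_measure_finite_Union, auto simp: disjoint_family_on_def)
      then show ?thesis using J b by simp
     qed
     moreover have "pmf (map_pmf (restr m) (step T n b)) a = (\<Sum>a'\<in>?A. pmf (step T n b) a')"
     proof -
      have "pmf (map_pmf (restr m) (step T n b)) a = measure (step T n b) {a'. restr m a' = a}" by (simp add: pmf_map vimage_def)
      also have "... = measure (step T n b) ?A"
       using set_step[OF PF b] by (intro measure_prob_cong_0) (auto simp: pmf_eq_0_set_pmf)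
      finally show ?thesis by (simp add: measure_measure_pmf_finite)
     qed
     ultimately show ?thesis by (simp add: sum_divide_distrib[symmetric])
    next
     case False
     have "a \<notin> set_pmf (map_pmf (restr m) (step T n b))" using False set_step[OF PF b] restr_in'[OF mn] by auto
     moreover have "a \<notin> set_pmf (step T m (restr m b))" using False set_step[OF PF c] by auto
     ultimately show ?thesis by (simp add: pmf_eq_0_set_pmf[THEN iffD2])
    qed
   qed
  qed
 qed
 then show ?thesis using J that by blast
qed

text \<open>At \<open>h = 0\<close> the history is a single uniform ordering, so the kernel property
  of the first transition is already the identity in \<open>corresponds\<close>.\<close>

lemma type2_shuffle_corresponds:
 assumes "type2_shuffle K" obtains T where "consistent T" "corresponds T K"
proof -
 from assms obtain M :: "(nat => nat rel) measure" and L where P: "type2_process M L" and TK: "transition_kernel M L K"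
  unfolding type2_shuffle_def by blast
 from type2_process_consistent[OF P] obtain T where T: "consistent T"
  "\<And>n a b. a \<in> orderings {1..n} ==> b \<in> orderings {1..n} ==>
   measure M {\<omega>\<in>space M. restr n (L 0 \<omega>) = a & restr n (L 1 \<omega>) = b} = pmf (step T n b) a / fact n" by blast
 have SP: "shuffle_process M L" using P by (simp add: type2_process_def)
 then have M: "prob_space M" and Lm: "\<And>h. L h \<in> M \<rightarrow>\<^sub>M N_orderings" and Ld: "\<And>h. distr M N_orderings (L h) = uniform_ordering"
  by (simp_all add: shuffle_process_def)
 let ?E = "PiM {..0::nat} (%_. N_orderings)" and ?X = "%\<omega>. \<lambda>i\<in>{..0}. L i \<omega>"
 have X: "?X \<in> M \<rightarrow>\<^sub>M ?E" by (intro measurable_restrict Lm)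
 have g: "(%e. e 0) \<in> ?E \<rightarrow>\<^sub>M N_orderings" by (rule measurable_component_singleton) simp
 have "conditional_kernel M ?E ?X (L 0) (L 1) K"
  using TK unfolding transition_kernel_def by (metis One_nat_def)
 then have K: "is_kernel K" and int: "\<And>B A. B \<in> sets ?E ==> A \<in> sets N_orderings ==>
   measure M {\<omega>\<in>space M. ?X \<omega> \<in> B & L 1 \<omega> \<in> A} = (\<integral>\<omega>. indicator B (?X \<omega>) * measure (K (L 0 \<omega>)) A \<partial>M)"
  using conditional_kernel_iff[OF M X Lm g, of "L 0" 1 K] by auto
 have "corresponds T K" unfolding corresponds_def
 proof (intro conjI allI ballI K)
  fix n :: nat and a b assume a: "a \<in> orderings {1..n}" and b: "b \<in> orderings {1..n}"
  let ?C = "(cell n a)" and ?A = "(cell n b)"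
  let ?B = "(%e. e 0) -` ?C \<inter> space ?E"
  have B: "?B \<in> sets ?E" by (rule measurable_sets[OF g sets_restr])
  have "(\<integral>r. indicator ?C r * measure (K r) ?A \<partial>uniform_ordering) = (\<integral>\<omega>. indicator ?C (L 0 \<omega>) * measure (K (L 0 \<omega>)) ?A \<partial>M)"
   unfolding Ld[of 0, symmetric] by (rule integral_distr[OF Lm kernel_integrand_measurable[OF K sets_restr sets_restr]])
  also have "... = (\<integral>\<omega>. indicator ?B (?X \<omega>) * measure (K (L 0 \<omega>)) ?A \<partial>M)"
   using measurable_space[OF X] by (intro Bochner_Integration.integral_cong refl) (simp add: indicator_def)
  also have "... = measure M {\<omega>\<in>space M. ?X \<omega> \<in> ?B & L 1 \<omega> \<in> ?A}" by (rule int[OF B sets_restr, symmetric])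
  also have "{\<omega>\<in>space M. ?X \<omega> \<in> ?B & L 1 \<omega> \<in> ?A} = {\<omega>\<in>space M. restr n (L 0 \<omega>) = a & restr n (L 1 \<omega>) = b}"
   using measurable_space[OF X] measurable_space[OF Lm, of _ 0] measurable_space[OF Lm, of _ 1] by auto
  finally show "(\<integral>r. indicator ?C r * measure (K r) ?A \<partial>uniform_ordering) = pmf (step T n b) a / fact n"
   by (simp add: T(2)[OF a b])
 qed
 with T(1) show ?thesis by (rule that)
qed

lemma correspondsD:
 "corresponds T K ==> a \<in> orderings {1..n} ==> b \<in> orderings {1..n} ==>
  (\<integral>r. indicator (cell n a) r * measure (K r) (cell n b) \<partial>uniform_ordering)
    = pmf (step T n b) a / fact n"
 unfolding corresponds_def by blast

lemma corresponds_unique: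
 assumes "corresponds T K" "corresponds T K'" shows "(K, K') \<in> kernel_eq"
 unfolding kernel_eq_def
 using assms kernel_AE_unique[of uniform_ordering K K'] uniform_ordering_prob
 by (auto simp: corresponds_def space_prob_algebra)

lemma corresponds_cong:
 assumes c: "corresponds T K" and e: "(K, K') \<in> kernel_eq" shows "corresponds T K'"
proof -
 have K: "is_kernel K" "is_kernel K'" and ae: "AE r in uniform_ordering. K r = K' r" using e by (auto simp: kernel_eq_def)
 have sU: "sets uniform_ordering = sets N_orderings" using uniform_ordering_prob by (simp add: space_prob_algebra)
 have "(\<integral>r. indicator (cell n a) r * measure (K r) (cell n b) \<partial>uniform_ordering)
   = (\<integral>r. indicator (cell n a) r * measure (K' r) (cell n b) \<partial>uniform_ordering)" for n a b
 proof (rule integral_cong_AE)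
  have "(%r. indicator (cell n a) r * measure (K r) (cell n b) :: real) \<in> borel_measurable uniform_ordering"
   if "is_kernel K" for K
   by (rule measurable_eq_sets[OF sU kernel_integrand_measurable[OF that sets_restr sets_restr]])
  from this[OF K(1)] this[OF K(2)]
  show "(%r. indicator (cell n a) r * measure (K r) (cell n b)) \<in> borel_measurable uniform_ordering"
   "(%r. indicator (cell n a) r * measure (K' r) (cell n b)) \<in> borel_measurable uniform_ordering" .
  show "AE r in uniform_ordering. indicator (cell n a) r * measure (K r) (cell n b) =
   indicator (cell n a) r * measure (K' r) (cell n b)"
   using ae by eventually_elim simp
 qed
 with c K(2) show ?thesis unfolding corresponds_def by simp
qed

text \<open>With the identity ordering for \<open>b\<close>, the law \<open>step T n b\<close> is
  \<open>T n\<close> read as a law of orderings.\<close>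

lemma corresponds_inj:
 assumes PF: "perm_family T" "perm_family T'" and c: "corresponds T K" "corresponds T' K" shows "T n = T' n"
proof (rule pmf_eqI)
 fix \<tau>
 let ?b = "perm_order n id"
 have b: "?b \<in> orderings {1..n}" by (rule perm_order_in[OF permutes_id])
 have p: "perm_of n ?b = id" by (rule perm_of_order[OF permutes_id])
 show "pmf (T n) \<tau> = pmf (T' n) \<tau>"
 proof (cases "\<tau> \<in> perms n")
  case True
  then have a: "perm_order n \<tau> \<in> orderings {1..n}" and pa: "perm_of n (perm_order n \<tau>) = \<tau>"
   by (auto intro: perm_order_in perm_of_order)
  have "pmf (step T n ?b) (perm_order n \<tau>) / fact n = pmf (step T' n ?b) (perm_order n \<tau>) / fact n"
   using correspondsD[OF c(1) a b] correspondsD[OF c(2) a b] by (rule trans[OF sym])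
  then show ?thesis using pmf_step[OF PF(1) a b] pmf_step[OF PF(2) a b] by (simp add: p pa)
 next
  case False
  then have "\<tau> \<notin> set_pmf (T n)" "\<tau> \<notin> set_pmf (T' n)" using PF[THEN perm_familyD, of n] by auto
  then show ?thesis by (simp add: pmf_eq_0_set_pmf[THEN iffD2])
 qed
qed

text \<open>The kernel is the regular conditional law of the ordering at time 1 given that at time
  0, under the path law of \<open>T\<close>.\<close>

lemma exists_corresponds:
 assumes T: "consistent T" obtains K where "corresponds T K"
proof -
 obtain M where M: "path_law T M" using exists_path_law[OF T] by blast
 from regular_conditional_kernel[OF path_law_prob[OF T M] path_law_nth[OF T M] path_law_nth[OF T M], of 0 1]
 obtain K where K: "is_kernel K"
  "\<And>B A. B \<in> sets N_orderings ==> A \<in> sets N_orderings ==>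
   measure M {x\<in>space M. x 0 \<in> B & x 1 \<in> A} = (\<integral>x. indicator B (x 0) * measure (K (x 0)) A \<partial>M)" by blast
 have "corresponds T K" unfolding corresponds_def
 proof (intro conjI allI ballI K)
  fix n :: nat and a b assume a: "a \<in> orderings {1..n}" and b: "b \<in> orderings {1..n}"
  let ?C = "(cell n a)" and ?A = "(cell n b)"
  have "(\<integral>r. indicator ?C r * measure (K r) ?A \<partial>uniform_ordering) = (\<integral>x. indicator ?C (x 0) * measure (K (x 0)) ?A \<partial>M)"
   unfolding path_law_distr[OF T M, of 0, symmetric]
   by (rule integral_distr[OF path_law_nth[OF T M] kernel_integrand_measurable[OF K(1) sets_restr sets_restr]])
  also have "... = measure M {x\<in>space M. x 0 \<in> ?C & x 1 \<in> ?A}" by (rule K(2)[OF sets_restr sets_restr, symmetric])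
  also have "{x\<in>space M. x 0 \<in> ?C & x 1 \<in> ?A} = {x\<in>space M. restr n (x 0) = a & restr n (x (Suc 0)) = b}"
   using path_law_in[OF T M] by (auto simp: One_nat_def)
  finally show "(\<integral>r. indicator ?C r * measure (K r) ?A \<partial>uniform_ordering) = pmf (step T n b) a / fact n"
   using path_law_pair[OF T M le_refl b, of 0 a] restr_id[OF b] by simp
 qed
 then show ?thesis by (rule that)
qed

section \<open>Invariant orderings of the integers\<close>

text \<open>One operation that covers restriction, \<open>hat_map\<close> and composition of a
  permutation with a map of indices. Both consistency and invariance become statements about laws of
  pulled-back orderings.\<close>

definition pull :: "nat => (nat => 'a) => 'a rel => nat rel" where
 "pull n g t = {(i, j) \<in> {1..n} \<times> {1..n}. (g i, g j) \<in> t}"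

abbreviation pull_cell :: "nat => (nat => 'a) => nat rel => 'a rel set" where
 "pull_cell n g a \<equiv> {t\<in>orderings UNIV. pull n g t = a}"

lemma pull_in: "inj_on g {1..n} ==> t \<in> orderings UNIV ==> pull n g t \<in> orderings {1..n}"
proof (rule orderingsI)
 assume g: "inj_on g {1..n}" and t: "t \<in> orderings UNIV"
 show "(i, i) \<notin> pull n g t" for i using orderings_irrefl[OF t] by (auto simp: pull_def)
 show "(i, k) \<in> pull n g t" if "(i, j) \<in> pull n g t" "(j, k) \<in> pull n g t" for i j k
  using that orderings_trans[OF t, of "g i" "g j" "g k"] by (simp add: pull_def)
 show "(i, j) \<in> pull n g t \<or> (j, i) \<in> pull n g t" if "i \<in> {1..n}" "j \<in> {1..n}" "i ~= j" for i j
  using orderings_total[OF t, of "g i" "g j"] that inj_onD[OF g, of i j] by (auto simp: pull_def)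
qed (auto simp: pull_def)

lemma pull_cong: "(\<And>i. i \<in> {1..n} ==> g i = h i) ==> pull n g t = pull n h t"
 by (auto simp: pull_def)

lemma pull_perm_order: "perm_order m (\<tau> \<circ> \<gamma>) = pull m \<gamma> (perm_order n \<tau>)" if "\<gamma> ` {1..m} \<subseteq> {1..n}"
 using that by (force simp: perm_order_def pull_def)

lemma pull_pull: "\<gamma> ` {1..m} \<subseteq> {1..n} ==> pull m \<gamma> (pull n g t) = pull m (g \<circ> \<gamma>) t"
 by (force simp: pull_def)

lemma pull_hat_map: "pull n g (hat_map f t) = pull n (f \<circ> g) t"
 by (auto simp: pull_def hat_map_def)

lemma filtered_Z: "filtered Z_orderings (%n r. r \<inter> ({- int n..<int n} \<times> {- int n..<int n}))"
 by (rule filtered_orderings[OF exhausts_int])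

lemma sets_pull: "(pull_cell n g a) \<in> sets (ordering_space UNIV)"
proof (cases "a \<subseteq> {1..n} \<times> {1..n}")
 case True
 have "(pull_cell n g a) = {t\<in>space (ordering_space UNIV). \<forall>p\<in>{1..n} \<times> {1..n}. (g (fst p), g (snd p)) \<in> t \<longleftrightarrow> p \<in> a}"
  using True by (auto simp: pull_def)
 also have "... \<in> sets (ordering_space UNIV)"
 proof (rule sets.sets_Collect_finite_All)
  fix p :: "nat \<times> nat"
  let ?q = "(g (fst p), g (snd p))"
  have "{t\<in>space (ordering_space UNIV). ?q \<in> t} \<in> sets (ordering_space UNIV)" using sets_mem_ordering[of UNIV ?q] by simp
  then show "{t\<in>space (ordering_space UNIV). ?q \<in> t \<longleftrightarrow> p \<in> a} \<in> sets (ordering_space UNIV)"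
   using sets.sets_Collect_neg[of "ordering_space UNIV" "%t. ?q \<in> t"] by (cases "p \<in> a") simp_all
 qed simp
 finally show ?thesis .
next
 case False
 then have "(pull_cell n g a) = {}" by (auto simp: pull_def)
 then show ?thesis by (simp only: sets.empty_sets)
qed

lemma measurable_hat_map:
 assumes "inj f" shows "hat_map f \<in> Z_orderings \<rightarrow>\<^sub>M Z_orderings"
proof (rule measurable_into_orderings)
 show "hat_map f \<in> space Z_orderings \<rightarrow> orderings UNIV"
 proof
  fix t assume "t \<in> space Z_orderings"
  then have t: "t \<in> orderings UNIV" by simp
  show "hat_map f t \<in> orderings UNIV"
  proof (rule orderingsI)
   show "(x, x) \<notin> hat_map f t" for x using orderings_irrefl[OF t] by (simp add: hat_map_def)
   show "(x, z) \<in> hat_map f t" if "(x, y) \<in> hat_map f t" "(y, z) \<in> hat_map f t" for x y z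
    using that orderings_trans[OF t, of "f x" "f y" "f z"] by (simp add: hat_map_def)
   show "(x, y) \<in> hat_map f t \<or> (y, x) \<in> hat_map f t" if "x ~= y" for x y
    using orderings_total[OF t, of "f x" "f y"] that injD[OF assms, of x y] by (auto simp: hat_map_def)
  qed auto
 qed
 fix p :: "int \<times> int"
 show "{t \<in> space Z_orderings. p \<in> hat_map f t} \<in> sets Z_orderings"
  using sets_mem_ordering[of UNIV "(f (fst p), f (snd p))"] by (simp add: hat_map_def case_prod_beta')
qed

definition represents :: "int rel measure => (nat => (nat => nat) pmf) => bool" where
 "represents P T \<longleftrightarrow> (\<forall>n. \<forall>a\<in>orderings {1..n}. measure P (pull_cell n int a) = pmf (T n) (perm_of n a))"

lemma represents_measure:
 assumes P: "P \<in> space (prob_algebra Z_orderings)" and T: "perm_family T"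
  and g: "inj_on g {1..n}"
  and rep: "\<And>a. a \<in> orderings {1..n} ==> measure P (pull_cell n g a) = pmf (T n) (perm_of n a)"
 shows "measure P {t\<in>orderings UNIV. pull n g t \<in> S} = measure (T n) {\<tau>. perm_order n \<tau> \<in> S}"
proof -
 interpret prob_space P using P by (simp add: space_prob_algebra)
 have sP: "sets P = sets Z_orderings" using P by (simp add: space_prob_algebra)
 have "{t\<in>orderings UNIV. pull n g t \<in> S} = (\<Union>a\<in>orderings {1..n} \<inter> S. (pull_cell n g a))"
  using pull_in[OF g] by auto
 then have "measure P {t\<in>orderings UNIV. pull n g t \<in> S} = (\<Sum>a\<in>orderings {1..n} \<inter> S. measure P (pull_cell n g a))"
  by (simp only:) (intro finite_measure_finite_Union, auto simp: disjoint_family_on_def sP intro: sets_pull)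
 also have "... = (\<Sum>a\<in>orderings {1..n} \<inter> S. pmf (T n) (perm_of n a))" by (rule sum.cong) (auto simp: rep)
 also have "... = (\<Sum>\<tau>\<in>{\<tau>\<in>perms n. perm_order n \<tau> \<in> S}. pmf (T n) \<tau>)"
  by (rule sum.reindex_bij_witness[where i="perm_order n" and j="perm_of n"])
   (auto simp: perm_of' perm_of_order perm_order_in)
 also have "... = measure (T n) {\<tau>\<in>perms n. perm_order n \<tau> \<in> S}"
  by (rule measure_measure_pmf_finite[symmetric]) (simp add: finite_permutations)
 also have "... = measure (T n) {\<tau>. perm_order n \<tau> \<in> S}"
  using perm_familyD[OF T, of n] by (intro measure_prob_cong_0) (auto simp: pmf_eq_0_set_pmf)
 finally show ?thesis .
qed

text \<open>Invariance speaks of increasing maps on all integers. An increasing map on a finite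
  segment is continued with slope 1 on both sides.\<close>

lemma strict_mono_extension:
 fixes g :: "nat => int"
 assumes g: "strict_mono_on {1..n} g" obtains f :: "int => int" where "strict_mono f" "\<And>i. i \<in> {1..n} ==> f (int i) = g i"
proof (cases "n = 0")
 case True
 show ?thesis by (rule that[of id]) (use True in \<open>auto simp: strict_mono_def\<close>)
next
 case False
 define f where "f z = (if z < 1 then g 1 + (z - 1) else if z > int n then g n + (z - int n) else g (nat z))" for z
 have gm: "g i < g j" if "1 <= i" "i < j" "j <= n" for i j
  using g that by (auto simp: strict_mono_on_def)
 have gm': "g i <= g j" if "1 <= i" "i <= j" "j <= n" for i j
  using gm[of i j] that by (cases "i = j") auto
 have "f x < f y" if xy: "x < y" for x y
 proof -
  have 1: "g 1 <= g (nat y)" if "1 <= y" "y <= int n" using gm'[of 1 "nat y"] that by auto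
  have 2: "g (nat x) <= g n" if "1 <= x" "x <= int n" using gm'[of "nat x" n] that by auto
  have 3: "g 1 <= g n" using gm'[of 1 n] False by auto
  have 4: "g (nat x) < g (nat y)" if "1 <= x" "y <= int n" using gm[of "nat x" "nat y"] that xy by auto
  show ?thesis using xy 1 2 3 4 unfolding f_def by (auto split: if_splits)
 qed
 then have "strict_mono f" by (rule strict_monoI)
 moreover have "f (int i) = g i" if "i \<in> {1..n}" for i using that by (auto simp: f_def)
 ultimately show ?thesis by (rule that)
qed

lemma I_invariant_pull:
 assumes P: "I_invariant P" and g: "strict_mono_on {1..n} g"
 shows "measure P (pull_cell n g a) = measure P (pull_cell n int a)"
proof -
 have sP: "sets P = sets Z_orderings" using P by (simp add: I_invariant_def space_prob_algebra)
 have spP: "space P = orderings UNIV" using sets_eq_imp_space_eq[OF sP] by simp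
 from strict_mono_extension[OF g] obtain f where f: "strict_mono f" "\<And>i. i \<in> {1..n} ==> f (int i) = g i" by blast
 have hm: "hat_map f \<in> P \<rightarrow>\<^sub>M Z_orderings"
  by (rule measurable_eq_sets[OF sP measurable_hat_map[OF strict_mono_imp_inj_on[OF f(1)]]])
 have fg: "pull n (f \<circ> int) t = pull n g t" for t by (rule pull_cong) (simp add: f(2))
 have "measure P (pull_cell n int a) = measure (distr P Z_orderings (hat_map f)) (pull_cell n int a)"
  using P f(1) by (simp add: I_invariant_def)
 also have "... = measure P (hat_map f -` (pull_cell n int a) \<inter> space P)"
  by (rule measure_distr[OF hm sets_pull])
 also have "hat_map f -` (pull_cell n int a) \<inter> space P = (pull_cell n g a)"
  using measurable_space[OF hm] by (auto simp: spP pull_hat_map fg)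
 finally show ?thesis by simp
qed

text \<open>With \<beta> the ranks of \<open>b\<close>, the ordering \<tau> \<circ> \<beta>
  restricted to \<open>{1..m}\<close> compares the integers \<beta> 1, ..., \<beta> m. Listed
  increasingly, these integers are ordered in law like 1, ..., m, by invariance. What remains of
  \<open>b\<close> is the order \<gamma> in which they are listed, that is
  \<open>restr m b\<close>.\<close>

lemma I_invariant_represents:
 assumes P: "I_invariant P" obtains T where "consistent T" "represents P T"
proof -
 have Pp: "P \<in> space (prob_algebra Z_orderings)" using P by (simp add: I_invariant_def)
 then interpret prob_space P by (simp add: space_prob_algebra)
 have sP: "sets P = sets Z_orderings" using Pp by (simp add: space_prob_algebra)
 have spP: "space P = orderings UNIV" using sets_eq_imp_space_eq[OF sP] by simp
 have inj: "inj_on int {1..n}" for n by (simp add: inj_on_def)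
 have ex: "\<exists>p. set_pmf p \<subseteq> perms n & (\<forall>\<tau>\<in>perms n. pmf p \<tau> = measure P (pull_cell n int (perm_order n \<tau>)))" for n
 proof -
  have "(\<Sum>\<tau>\<in>perms n. measure P (pull_cell n int (perm_order n \<tau>))) = (\<Sum>a\<in>orderings {1..n}. measure P (pull_cell n int a))"
   by (rule sum.reindex_bij_betw[OF bij_perm_order])
  also have "... = measure P (\<Union>a\<in>orderings {1..n}. (pull_cell n int a))"
   by (rule finite_measure_finite_Union[symmetric]) (auto simp: disjoint_family_on_def sP intro: sets_pull)
  also have "(\<Union>a\<in>orderings {1..n}. (pull_cell n int a)) = space P"
   using pull_in[OF inj] by (auto simp: spP)
  finally have "(\<Sum>\<tau>\<in>perms n. measure P (pull_cell n int (perm_order n \<tau>))) = 1" by (simp add: prob_space)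
  then show ?thesis by (intro finite_pmf_ex finite_permutations measure_nonneg) simp
 qed
 have "\<exists>T. \<forall>n. set_pmf (T n) \<subseteq> perms n \<and>
   (\<forall>\<tau>\<in>perms n. pmf (T n) \<tau> = measure P (pull_cell n int (perm_order n \<tau>)))"
  by (rule choice, rule allI, rule ex)
 then obtain T where T': "\<forall>n. set_pmf (T n) \<subseteq> perms n \<and>
   (\<forall>\<tau>\<in>perms n. pmf (T n) \<tau> = measure P (pull_cell n int (perm_order n \<tau>)))" by blast
 then have T: "\<And>n. set_pmf (T n) \<subseteq> perms n"
  "\<And>n \<tau>. \<tau> \<in> perms n ==> pmf (T n) \<tau> = measure P (pull_cell n int (perm_order n \<tau>))" by blast+
 have PF: "perm_family T" using T by (simp add: perm_family_def)
 have rep: "measure P (pull_cell n int a) = pmf (T n) (perm_of n a)" if "a \<in> orderings {1..n}" for n a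
  using T(2)[of "perm_of n a" n] perm_of'[OF that] by simp
 have "consistent T" unfolding consistent_def
 proof (intro conjI allI impI PF)
  fix m n :: nat and b assume mn: "m <= n" and b: "b \<in> orderings {1..n}"
  define \<beta> where "\<beta> = perm_of n b"
  define \<gamma> where "\<gamma> = perm_of m (restr m b)"
  note \<beta> = perm_of'[OF b, folded \<beta>_def] and \<gamma> = perm_of'[OF restr_in'[OF mn b], folded \<gamma>_def]
  have sub: "\<beta> ` {1..m} \<subseteq> {1..n}" using \<beta>(1) mn perms_range[OF \<beta>(1)] by fastforce
  have subg: "\<gamma> ` {1..m} \<subseteq> {1..m}" using permutes_image[OF \<gamma>(1)] by simp
  have less: "\<beta> i < \<beta> j \<longleftrightarrow> \<gamma> i < \<gamma> j" if "i \<in> {1..m}" "j \<in> {1..m}" for i j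
  proof -
   have "(i, j) \<in> perm_order m \<beta> \<longleftrightarrow> (i, j) \<in> perm_order m \<gamma>"
    using \<beta>(2) \<gamma>(2) restr_perm_order[OF mn, of \<beta>] by simp
   then show ?thesis using that by (simp add: perm_order_def)
  qed
  \<comment> \<open>The increasing enumeration of \<beta> 1, ..., \<beta> m: \<gamma> has the same
    comparisons as \<beta> on \<open>{1..m}\<close>, so undoing \<gamma> sorts them.\<close>
  define g where "g = int \<circ> \<beta> \<circ> inv \<gamma>"
  have gmono: "strict_mono_on {1..m} g"
  proof (rule strict_mono_onI)
   fix r s assume rs: "r \<in> {1..m}" "s \<in> {1..m}" "r < s"
   have "inv \<gamma> r \<in> {1..m}" "inv \<gamma> s \<in> {1..m}" using perms_range[OF permutes_inv[OF \<gamma>(1)]] rs by blast+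
   then show "g r < g s" using less[of "inv \<gamma> r" "inv \<gamma> s"] rs permutes_inverses(1)[OF \<gamma>(1)] by (simp add: g_def)
  qed
  have g\<gamma>: "g \<circ> \<gamma> = int \<circ> \<beta>" using permutes_inv_o(2)[OF \<gamma>(1)] by (simp add: g_def comp_assoc)
  show "map_pmf (restr m) (step T n b) = step T m (restr m b)"
  proof (rule pmf_eqI)
   fix a
   have "pmf (map_pmf (restr m) (step T n b)) a = measure (T n) {\<tau>. perm_order n \<tau> \<in> {r. pull m \<beta> r = a}}"
    using pull_perm_order[OF sub] by (simp add: step_def pmf_map map_pmf_comp restr_perm_order[OF mn] vimage_def \<beta>_def[symmetric])
   also have "... = measure P {t\<in>orderings UNIV. pull n int t \<in> {r. pull m \<beta> r = a}}"
    by (rule represents_measure[symmetric, OF Pp PF inj rep])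
   also have "... = measure P {t\<in>orderings UNIV. pull m g t \<in> {r. pull m \<gamma> r = a}}"
    by (simp add: pull_pull[OF sub] pull_pull[OF subg] g\<gamma>)
   also have "... = measure (T m) {\<tau>. perm_order m \<tau> \<in> {r. pull m \<gamma> r = a}}"
   proof (rule represents_measure[OF Pp PF])
    show "inj_on g {1..m}" using gmono by (rule strict_mono_on_imp_inj_on)
    show "measure P (pull_cell m g a) = pmf (T m) (perm_of m a)" if "a \<in> orderings {1..m}" for a
     using I_invariant_pull[OF P gmono] rep[OF that] by simp
   qed
   also have "... = pmf (step T m (restr m b)) a"
    using pull_perm_order[OF subg] by (simp add: step_def pmf_map vimage_def \<gamma>_def[symmetric])
   finally show "pmf (map_pmf (restr m) (step T n b)) a = pmf (step T m (restr m b)) a" .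
  qed
 qed
 moreover have "represents P T" using rep by (simp add: represents_def)
 ultimately show ?thesis by (rule that)
qed

lemma represents_inj:
 assumes "perm_family T" "perm_family T'" "represents P T" "represents P T'" shows "T n = T' n"
proof (rule pmf_eqI)
 fix \<tau>
 show "pmf (T n) \<tau> = pmf (T' n) \<tau>"
 proof (cases "\<tau> \<in> perms n")
  case True
  then have a: "perm_order n \<tau> \<in> orderings {1..n}" "perm_of n (perm_order n \<tau>) = \<tau>"
   by (auto intro: perm_order_in perm_of_order)
  have "measure P (pull_cell n int (perm_order n \<tau>)) = pmf (T n) (perm_of n (perm_order n \<tau>))"
   "measure P (pull_cell n int (perm_order n \<tau>)) = pmf (T' n) (perm_of n (perm_order n \<tau>))"
   using assms(3,4) a(1) unfolding represents_def by blast+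
  then show ?thesis by (simp add: a(2))
 next
  case False
  then have "\<tau> \<notin> set_pmf (T n)" "\<tau> \<notin> set_pmf (T' n)" using assms(1,2)[THEN perm_familyD, of n] by auto
  then show ?thesis by (simp add: pmf_eq_0_set_pmf[THEN iffD2])
 qed
qed

lemma extend_to_perm:
 assumes g: "inj_on g {1..m}" "g ` {1..m} \<subseteq> {1..n::nat}" and mn: "m <= n"
 obtains \<beta> where "\<beta> permutes {1..n}" "\<And>i. i \<in> {1..m} ==> \<beta> i = g i"
proof -
 have "card ({1..n} - {1..m}) = card ({1..n} - g ` {1..m})"
  using g mn by (simp add: card_Diff_subset card_image)
 then obtain h where h: "bij_betw h ({1..n} - {1..m}) ({1..n} - g ` {1..m})"
  by (metis finite_Diff finite_atLeastAtMost finite_same_card_bij)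
 define \<beta> where "\<beta> i = (if i \<in> {1..m} then g i else if i \<in> {1..n} then h i else i)" for i
 have "bij_betw \<beta> {1..m} (g ` {1..m})"
  using inj_on_imp_bij_betw[OF g(1)] by (rule bij_betw_cong[THEN iffD1, rotated]) (simp add: \<beta>_def)
 moreover have "bij_betw \<beta> ({1..n} - {1..m}) ({1..n} - g ` {1..m})"
  using h by (rule bij_betw_cong[THEN iffD1, rotated]) (auto simp: \<beta>_def)
 ultimately have "bij_betw \<beta> ({1..m} \<union> ({1..n} - {1..m})) (g ` {1..m} \<union> ({1..n} - g ` {1..m}))"
  by (rule bij_betw_combine) auto
 moreover have "{1..m} \<union> ({1..n} - {1..m}) = {1..n}" "g ` {1..m} \<union> ({1..n} - g ` {1..m}) = {1..n}" using mn g by auto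
 ultimately have "\<beta> permutes {1..n}" using mn by (intro bij_imp_permutes) (auto simp: \<beta>_def)
 then show ?thesis using that by (simp add: \<beta>_def)
qed

text \<open>Consistency is applied to a permutation \<beta> that extends \<open>g\<close>. Because
  \<open>g\<close> increases, the order given by \<beta> restricts to the identity order on
  \<open>{1..m}\<close>.\<close>

lemma consistent_increasing:
 assumes T: "consistent T" and g: "strict_mono_on {1..m} g" "g ` {1..m} \<subseteq> {1..n::nat}"
 shows "map_pmf (%\<tau>. perm_order m (\<tau> \<circ> g)) (T n) = map_pmf (perm_order m) (T m)"
proof -
 have inj: "inj_on g {1..m}" using g(1) by (rule strict_mono_on_imp_inj_on)
 have mn: "m <= n" using card_inj_on_le[OF inj g(2)] by simp
 obtain \<beta> where \<beta>: "\<beta> permutes {1..n}" "\<And>i. i \<in> {1..m} ==> \<beta> i = g i" using extend_to_perm[OF inj g(2) mn] by blast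
 let ?b = "perm_order n \<beta>"
 have b: "?b \<in> orderings {1..n}" by (rule perm_order_in[OF \<beta>(1)])
 have pb: "perm_of n ?b = \<beta>" by (rule perm_of_order[OF \<beta>(1)])
 have "restr m ?b = perm_order m id"
  using \<beta>(2) strict_mono_on_less[OF g(1)] unfolding restr_perm_order[OF mn] by (auto simp: perm_order_def)
 then have pm: "perm_of m (restr m ?b) = id" by (simp add: perm_of_order[OF permutes_id])
 have "perm_order m (\<tau> \<circ> g) = restr m (perm_order n (\<tau> \<circ> \<beta>))" for \<tau>
  unfolding restr_perm_order[OF mn] using \<beta>(2) by (auto simp: perm_order_def)
 then have "map_pmf (%\<tau>. perm_order m (\<tau> \<circ> g)) (T n) = map_pmf (restr m) (step T n ?b)"
  by (simp add: step_def map_pmf_comp pb)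
 also have "... = step T m (restr m ?b)" by (rule consistent_step[OF T mn b])
 finally show ?thesis by (simp add: step_def pm)
qed

text \<open>The map i - n - 1 lists the window from -n to n - 1 increasingly over
  \<open>{1..2 * n}\<close>, so cells of orderings of the integers are expressed by
  \<open>pull\<close>.\<close>

lemma Z_cell_eq:
 assumes b: "b \<subseteq> {- int n..<int n} \<times> {- int n..<int n}"
 shows "r \<inter> ({- int n..<int n} \<times> {- int n..<int n}) = b \<longleftrightarrow>
  pull (2 * n) (%i. int i - int n - 1) r = pull (2 * n) (%i. int i - int n - 1) b"
proof
 let ?e = "%i. int i - int n - 1" and ?B = "{- int n..<int n}"
 assume eq: "r \<inter> (?B \<times> ?B) = b"
 have e: "?e i \<in> ?B" if "i \<in> {1..2*n}" for i using that by auto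
 show "pull (2 * n) ?e r = pull (2 * n) ?e b"
  unfolding pull_def eq[symmetric] using e by blast
next
 let ?e = "%i. int i - int n - 1" and ?B = "{- int n..<int n}"
 assume eq: "pull (2 * n) ?e r = pull (2 * n) ?e b"
 have "(x, y) \<in> r \<longleftrightarrow> (x, y) \<in> b" if "x \<in> ?B" "y \<in> ?B" for x y
 proof -
  let ?i = "nat (x + int n + 1)" and ?j = "nat (y + int n + 1)"
  have ij: "?i \<in> {1..2*n}" "?j \<in> {1..2*n}" "?e ?i = x" "?e ?j = y" using that by auto
  have "(?i, ?j) \<in> pull (2 * n) ?e r \<longleftrightarrow> (?i, ?j) \<in> pull (2 * n) ?e b" by (simp only: eq)
  then show ?thesis using ij by (simp add: pull_def)
 qed
 then show "r \<inter> (?B \<times> ?B) = b" using b by blast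
qed

lemma I_invariant_eqI:
 assumes P: "P \<in> space (prob_algebra Z_orderings)" and P': "P' \<in> space (prob_algebra Z_orderings)"
  and eq: "\<And>n a. a \<in> orderings {1..2 * n} ==>
   measure P (pull_cell (2 * n) (%i. int i - int n - 1) a) = measure P' (pull_cell (2 * n) (%i. int i - int n - 1) a)"
 shows "P = P'"
proof (rule measure_eq_filtered[OF filtered_Z])
 interpret P: prob_space P using P by (simp add: space_prob_algebra)
 interpret P': prob_space P' using P' by (simp add: space_prob_algebra)
 show "finite_measure P" by (rule P.finite_measure_axioms)
 show "sets P = sets Z_orderings" "sets P' = sets Z_orderings" using P P' by (simp_all add: space_prob_algebra)
 fix n :: nat and x :: "int rel" assume "x \<in> space Z_orderings"
 then have x: "x \<in> orderings UNIV" by simp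
 let ?B = "{- int n..<int n}"
 have "{y \<in> space Z_orderings. y \<inter> (?B \<times> ?B) = x \<inter> (?B \<times> ?B)} =
  (pull_cell (2 * n) (%i. int i - int n - 1) (pull (2 * n) (%i. int i - int n - 1) (x \<inter> (?B \<times> ?B))))"
  using Z_cell_eq[of "x \<inter> (?B \<times> ?B)" n] by simp
 also have "pull (2 * n) (%i. int i - int n - 1) (x \<inter> (?B \<times> ?B)) = pull (2 * n) (%i. int i - int n - 1) x"
  using Z_cell_eq[of "x \<inter> (?B \<times> ?B)" n x] by simp
 finally have *: "{y \<in> space Z_orderings. y \<inter> (?B \<times> ?B) = x \<inter> (?B \<times> ?B)} =
  (pull_cell (2 * n) (%i. int i - int n - 1) (pull (2 * n) (%i. int i - int n - 1) x))" .
 show "emeasure P {y \<in> space Z_orderings. y \<inter> (?B \<times> ?B) = x \<inter> (?B \<times> ?B)} = emeasure P' {y \<in> space Z_orderings. y \<inter> (?B \<times> ?B) = x \<inter> (?B \<times> ?B)}"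
  unfolding * P.emeasure_eq_measure P'.emeasure_eq_measure
  by (intro arg_cong[where f=ennreal] eq pull_in x) (simp add: inj_on_def)
qed

lemma represents_unique:
 assumes P: "I_invariant P" "I_invariant P'" and rep: "represents P T" "represents P' T"
 shows "P = P'"
proof (rule I_invariant_eqI)
 show "P \<in> space (prob_algebra Z_orderings)" "P' \<in> space (prob_algebra Z_orderings)" using P by (simp_all add: I_invariant_def)
 fix n :: nat and a assume a: "a \<in> orderings {1..2 * n}"
 have m: "strict_mono_on {1..2 * n} (%i. int i - int n - 1)" by (auto simp: strict_mono_on_def)
 show "measure P (pull_cell (2 * n) (%i. int i - int n - 1) a) = measure P' (pull_cell (2 * n) (%i. int i - int n - 1) a)"
  unfolding I_invariant_pull[OF P(1) m] I_invariant_pull[OF P(2) m] using rep a by (simp add: represents_def)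
qed

text \<open>The window from -n to n - 1 is ordered by a permutation drawn from
  \<open>T (2 * n)\<close>. By \<open>consistent_increasing\<close> every increasing list of
  \<open>k\<close> integers in the window is then ordered with law \<open>T k\<close>. Compatibility
  of the windows and invariance of the limit are both instances of this.\<close>

lemma exists_represented:
 assumes T: "consistent T" obtains P where "I_invariant P" "represents P T"
proof -
 note PF = consistent_set[OF T]
 let ?B = "%n. {- int n..<int n}"
 \<comment> \<open>Number of \<open>x\<close> in the window \<open>?B n\<close>, counted from 1; the
   map \<open>?e n\<close> introduced below is its inverse.\<close>
 define ix where "ix n x = nat (x + int n + 1)" for n and x :: int
 have ix_range: "ix n x \<in> {1..2 * n}" if "x \<in> ?B n" for n x using that by (auto simp: ix_def)
 have ix_less: "ix n x < ix n y \<longleftrightarrow> x < y" if "x \<in> ?B n" "y \<in> ?B n" for n x y using that by (auto simp: ix_def)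
 define ord where "ord n \<tau> = {(x, y) \<in> ?B n \<times> ?B n. \<tau> (ix n x) < \<tau> (ix n y)}" for n and \<tau> :: "nat => nat"
 define p where "p n = map_pmf (ord n) (T (2 * n))" for n
 have pull_ord: "pull k g (ord n \<tau>) = perm_order k (\<tau> \<circ> (ix n \<circ> g))" if "g ` {1..k} \<subseteq> ?B n" for k n \<tau> and g :: "nat => int"
  using that by (force simp: pull_def ord_def perm_order_def)
 have law: "measure (p n) {r. pull k g r \<in> S} = measure (T k) {\<tau>. perm_order k \<tau> \<in> S}"
  if g: "strict_mono_on {1..k} g" "g ` {1..k} \<subseteq> ?B n" for k n S and g :: "nat => int"
 proof -
  have "strict_mono_on {1..k} (ix n \<circ> g)"
  proof (rule strict_mono_onI)
   fix r s assume rs: "r \<in> {1..k}" "s \<in> {1..k}" "r < s"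
   then have "g r < g s" using g(1) by (auto simp: strict_mono_on_def)
   moreover have gr: "g r \<in> ?B n" "g s \<in> ?B n" using g(2) rs by blast+
   ultimately show "(ix n \<circ> g) r < (ix n \<circ> g) s" using ix_less[OF gr] by simp
  qed
  moreover have "(ix n \<circ> g) ` {1..k} \<subseteq> {1..2 * n}"
  proof (rule image_subsetI)
   fix i assume "i \<in> {1..k}"
   then have "g i \<in> ?B n" using g(2) by blast
   from ix_range[OF this] show "(ix n \<circ> g) i \<in> {1..2 * n}" by simp
  qed
  ultimately have eq: "map_pmf (%\<tau>. perm_order k (\<tau> \<circ> (ix n \<circ> g))) (T (2 * n)) = map_pmf (perm_order k) (T k)"
   by (rule consistent_increasing[OF T])
  have "measure (p n) {r. pull k g r \<in> S} = measure (map_pmf (%\<tau>. perm_order k (\<tau> \<circ> (ix n \<circ> g))) (T (2 * n))) S"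
   by (simp add: p_def vimage_def pull_ord[OF g(2)])
  also have "... = measure (T k) {\<tau>. perm_order k \<tau> \<in> S}" unfolding eq by (simp add: vimage_def)
  finally show ?thesis .
 qed
 let ?e = "%n i. int i - int n - 1"
 have e_mono: "strict_mono_on {1..2 * n} (?e n)" for n by (auto simp: strict_mono_on_def)
 have e_range: "?e n ` {1..2 * n} \<subseteq> ?B n" for n by auto
 have set_p: "set_pmf (p n) \<subseteq> orderings (?B n)" for n
 proof
  fix r assume "r \<in> set_pmf (p n)"
  then obtain \<tau> where \<tau>: "\<tau> permutes {1..2 * n}" "r = ord n \<tau>"
   using perm_familyD[OF PF, of "2 * n"] by (auto simp: p_def)
  have "inj_on (%x. \<tau> (ix n x)) (?B n)"
  proof (rule inj_onI)
   fix x y assume xy: "x \<in> ?B n" "y \<in> ?B n" "\<tau> (ix n x) = \<tau> (ix n y)"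
   then have "ix n x = ix n y" using permutes_inj[OF \<tau>(1)] by (auto dest: injD)
   then show "x = y" using ix_less[OF xy(1,2)] ix_less[OF xy(2,1)] by auto
  qed
  then show "r \<in> orderings (?B n)" unfolding \<tau>(2) ord_def by (rule orderings_less_image)
 qed
 have proj: "map_pmf (%r. r \<inter> (?B n \<times> ?B n)) (p (Suc n)) = p n" for n
 proof (rule pmf_eqI)
  fix b
  show "pmf (map_pmf (%r. r \<inter> (?B n \<times> ?B n)) (p (Suc n))) b = pmf (p n) b"
  proof (cases "b \<subseteq> ?B n \<times> ?B n")
   case True
   have cell: "measure (p k) {r. r \<inter> (?B n \<times> ?B n) = b} = measure (T (2 * n)) {\<tau>. perm_order (2 * n) \<tau> \<in> {pull (2 * n) (?e n) b}}"
    if "n <= k" for k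
   proof -
    have sub: "?e n ` {1..2 * n} \<subseteq> ?B k" using that by auto
    have "{r. r \<inter> (?B n \<times> ?B n) = b} = {r. pull (2 * n) (?e n) r \<in> {pull (2 * n) (?e n) b}}"
     using Z_cell_eq[OF True] by simp
    then show ?thesis by (simp only: law[OF e_mono sub])
   qed
   have "pmf (map_pmf (%r. r \<inter> (?B n \<times> ?B n)) (p (Suc n))) b = measure (p (Suc n)) {r. r \<inter> (?B n \<times> ?B n) = b}"
    by (simp add: pmf_map vimage_def)
   also have "... = measure (p n) {r. r \<inter> (?B n \<times> ?B n) = b}" unfolding cell[OF le_refl] by (rule cell) simp
   also have "... = measure (p n) {b}"
   proof (rule measure_prob_cong_0)
    fix r assume "r \<in> {r. r \<inter> (?B n \<times> ?B n) = b} - {b}"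
    then have "r \<notin> set_pmf (p n)" using set_p[of n] orderings_sub[of r "?B n"] by blast
    then show "pmf (p n) r = 0" by (simp add: pmf_eq_0_set_pmf)
   qed (use True in auto)
   finally show ?thesis by (simp add: measure_pmf_single)
  next
   case False
   then have "b \<notin> set_pmf (map_pmf (%r. r \<inter> (?B n \<times> ?B n)) (p (Suc n)))" "b \<notin> set_pmf (p n)"
    using set_p[of n] orderings_sub[of b "?B n"] by auto
   then show ?thesis by (simp add: pmf_eq_0_set_pmf[THEN iffD2])
  qed
 qed
 obtain P where P: "P \<in> space (prob_algebra Z_orderings)"
  "\<And>n b. measure P {r\<in>orderings UNIV. r \<inter> (?B n \<times> ?B n) = b} = pmf (p n) b"
  using projective_limit_orderings[OF exhausts_int _ set_p proj] by auto
 interpret prob_space P using P(1) by (simp add: space_prob_algebra)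
 have sP: "sets P = sets Z_orderings" using P(1) by (simp add: space_prob_algebra)
 have spP: "space P = orderings UNIV" using sets_eq_imp_space_eq[OF sP] by simp
 have lawP: "measure P (pull_cell k g a) = pmf (T k) (perm_of k a)"
  if g: "strict_mono_on {1..k} g" and a: "a \<in> orderings {1..k}" for k a and g :: "nat => int"
 proof -
  obtain n where n: "g ` {1..k} \<subseteq> ?B n"
  proof -
   have "finite (g ` {1..k})" by simp
   then have "\<exists>n. g ` {1..k} \<subseteq> ?B n"
   proof (induction rule: finite_induct)
    case (insert x F)
    then obtain n where n: "F \<subseteq> ?B n" by auto
    have "?B n \<subseteq> ?B (n + nat \<bar>x\<bar> + 1)" by auto
    with n have "F \<subseteq> ?B (n + nat \<bar>x\<bar> + 1)" by (rule subset_trans)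
    moreover have "x \<in> ?B (n + nat \<bar>x\<bar> + 1)" by auto
    ultimately have "insert x F \<subseteq> ?B (n + nat \<bar>x\<bar> + 1)" by blast
    then show ?case by blast
   qed auto
   then show ?thesis using that by blast
  qed
  have gB: "pull k g (t \<inter> (?B n \<times> ?B n)) = pull k g t" for t using n by (force simp: pull_def)
  let ?F = "{b\<in>orderings (?B n). pull k g b = a}"
  have fin: "finite ?F" using finite_orderings[of "?B n"] by simp
  have "(pull_cell k g a) = (\<Union>b\<in>?F. {t\<in>orderings UNIV. t \<inter> (?B n \<times> ?B n) = b})"
   using gB orderings_Int[of _ UNIV "?B n"] by auto
  then have "measure P (pull_cell k g a) = (\<Sum>b\<in>?F. measure P {t\<in>orderings UNIV. t \<inter> (?B n \<times> ?B n) = b})"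
   using cell_in_sets[OF filtered_Z, of n] fin
   by (simp only:) (intro finite_measure_finite_Union, auto simp: disjoint_family_on_def sP)
  also have "... = (\<Sum>b\<in>?F. pmf (p n) b)" by (simp only: P(2))
  also have "... = measure (p n) ?F" by (rule measure_measure_pmf_finite[symmetric, OF fin])
  also have "... = measure (p n) {r. pull k g r \<in> {a}}"
   using set_p[of n] by (intro measure_prob_cong_0) (auto simp: pmf_eq_0_set_pmf)
  also have "... = measure (T k) {\<tau>. perm_order k \<tau> \<in> {a}}" by (rule law[OF g n])
  also have "... = measure (T k) {perm_of k a}"
  proof (rule measure_prob_cong_0)
   fix \<tau> assume \<tau>: "\<tau> \<in> {\<tau>. perm_order k \<tau> \<in> {a}} - {perm_of k a}"
   then have "\<not> \<tau> permutes {1..k}" using perm_of_order[of \<tau> k] by auto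
   then have "\<tau> \<notin> set_pmf (T k)" using perm_familyD[OF PF, of k] by auto
   then show "pmf (T k) \<tau> = 0" by (simp add: pmf_eq_0_set_pmf)
  qed (use perm_of'[OF a] in auto)
  finally show ?thesis by (simp add: measure_pmf_single)
 qed
 have "represents P T" unfolding represents_def
  using lawP[of _ int] by (simp add: strict_mono_on_def)
 moreover have "I_invariant P" unfolding I_invariant_def
 proof (intro conjI allI impI P(1))
  fix f :: "int => int" assume f: "strict_mono f"
  have hm: "hat_map f \<in> P \<rightarrow>\<^sub>M Z_orderings"
   by (rule measurable_eq_sets[OF sP measurable_hat_map[OF strict_mono_imp_inj_on[OF f]]])
  show "distr P Z_orderings (hat_map f) = P"
  proof (rule I_invariant_eqI[OF _ P(1)])
   show "distr P Z_orderings (hat_map f) \<in> space (prob_algebra Z_orderings)"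
    by (simp add: space_prob_algebra prob_space_distr[OF hm])
   fix n :: nat and a assume a: "a \<in> orderings {1..2 * n}"
   have fe: "strict_mono_on {1..2 * n} (f \<circ> ?e n)" using f by (auto simp: strict_mono_on_def strict_mono_def)
   have "hat_map f -` (pull_cell (2 * n) (?e n) a) \<inter> space P = (pull_cell (2 * n) (f \<circ> ?e n) a)"
    using measurable_space[OF hm] by (auto simp: spP pull_hat_map)
   then show "measure (distr P Z_orderings (hat_map f)) (pull_cell (2 * n) (?e n) a) = measure P (pull_cell (2 * n) (?e n) a)"
    using measure_distr[OF hm sets_pull, of "2 * n" "?e n" a] lawP[OF fe a] lawP[OF e_mono a] by simp
  qed
 qed
 ultimately show ?thesis using that by blast
qed

section \<open>Quasi-uniform measures and conjugate pairs\<close>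

context
 fixes F :: "real set"
 assumes F: "closed F" "F \<subseteq> {0..1}" "0 \<in> F" "1 \<in> F"
begin

lemma gaps_open: "open ({0..1} - F)"
proof -
 have "{0..1} - F = {0<..<1} - F" using F by (auto simp: less_eq_real_def)
 then show ?thesis using F(1) by (simp add: open_Diff)
qed

lemma gaps_Union: "\<Union>(components ({0..1} - F)) = {0..1} - F"
 by (rule Union_components)

lemma gaps_countable: "countable (components ({0..1} - F))"
 by (rule countable_disjoint_open_subsets)
  (use gaps_open open_components pairwise_disjoint_components in \<open>auto simp: pairwise_def disjoint_def disjnt_def components_nonoverlap\<close>)

text \<open>An endpoint outside \<open>F\<close> could be added to the component, contrary to its
  maximality.\<close>

lemma gap_endpoints:
 assumes G: "G \<in> components ({0..1} - F)"
 shows "G = {Inf G<..<Sup G}" "Inf G < Sup G" "Inf G \<in> F" "Sup G \<in> F" "G \<inter> F = {}"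
proof -
 have G1: "G ~= {}" "connected G" "G \<subseteq> {0..1} - F" "open G"
  using in_components_nonempty[OF G] in_components_connected[OF G] in_components_subset[OF G] open_components[OF gaps_open G] by auto
 show disj: "G \<inter> F = {}" using G1 by auto
 have bdd: "bdd_below G" "bdd_above G" using G1(3) by (auto intro!: bdd_belowI[of _ 0] bdd_aboveI[of _ 1])
 have in1: "Inf G < x" "x < Sup G" if "x \<in> G" for x
 proof -
  from G1(4) that obtain e where e: "e > 0" "ball x e \<subseteq> G" by (meson openE)
  have "x - e / 2 \<in> G" "x + e / 2 \<in> G" using e by (auto simp: subset_iff dist_real_def)
  then show "Inf G < x" "x < Sup G" using cInf_lower[OF _ bdd(1), of "x - e/2"] cSup_upper[OF _ bdd(2), of "x + e/2"] e(1) by auto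
 qed
 have in2: "y \<in> G" if "Inf G < y" "y < Sup G" for y
 proof -
  from that(1)[unfolded cInf_less_iff[OF G1(1) bdd(1)]] obtain u where "u \<in> G" "u < y" by (rule bexE)
  moreover from that(2)[unfolded less_cSup_iff[OF G1(1) bdd(2)]] obtain v where "v \<in> G" "y < v" by (rule bexE)
  ultimately show ?thesis using connectedD_interval[OF G1(2), of u v y] by simp
 qed
 show Geq: "G = {Inf G<..<Sup G}" using in1 in2 by auto
 show lt: "Inf G < Sup G" using G1(1) in1 by fastforce
 have rng: "Inf G \<in> {0..1}" "Sup G \<in> {0..1}"
 proof -
  obtain x where x: "x \<in> G" using G1(1) by auto
  have "0 <= Inf G" using G1(1,3) by (intro cInf_greatest) auto
  moreover have "Sup G <= 1" using G1(1,3) by (intro cSup_least) auto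
  ultimately show "Inf G \<in> {0..1}" "Sup G \<in> {0..1}" using lt by auto
 qed
 show "Inf G \<in> F"
 proof (rule ccontr)
  assume n: "Inf G \<notin> F"
  have "insert (Inf G) {Inf G<..<Sup G} \<subseteq> G"
  proof (rule components_maximal[OF G])
   have "insert (Inf G) {Inf G<..<Sup G} = {Inf G..<Sup G}" using lt by auto
   then show "connected (insert (Inf G) {Inf G<..<Sup G})" by simp
   show "insert (Inf G) {Inf G<..<Sup G} \<subseteq> {0..1} - F" using n rng G1(3) Geq by blast
   show "G \<inter> insert (Inf G) {Inf G<..<Sup G} ~= {}" using G1(1) Geq by blast
  qed
  then show False using in1[of "Inf G"] by auto
 qed
 show "Sup G \<in> F"
 proof (rule ccontr)
  assume n: "Sup G \<notin> F"
  have "insert (Sup G) {Inf G<..<Sup G} \<subseteq> G"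
  proof (rule components_maximal[OF G])
   have "insert (Sup G) {Inf G<..<Sup G} = {Inf G<..Sup G}" using lt by auto
   then show "connected (insert (Sup G) {Inf G<..<Sup G})" by simp
   show "insert (Sup G) {Inf G<..<Sup G} \<subseteq> {0..1} - F" using n rng G1(3) Geq by blast
   show "G \<inter> insert (Sup G) {Inf G<..<Sup G} ~= {}" using G1(1) Geq by blast
  qed
  then show False using in1[of "Sup G"] by auto
 qed
qed

lemma gap_exists:
 assumes "w \<in> {0..1}" "w \<notin> F" obtains G where "G \<in> components ({0..1} - F)" "w \<in> G"
 using assms gaps_Union by blast

lemma F_sets: "F \<in> sets unit_borel"
 using F by (intro sets_unit_lebesgueI) auto

lemma gap_sets: "G \<in> components ({0..1} - F) ==> G \<in> sets unit_borel"
 using gap_endpoints(1)[of G] in_components_subset[of G "{0..1} - F"]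
 by (intro sets_unit_lebesgueI borel_open open_components[OF gaps_open]) auto

text \<open>The conjugate law is the image of Lebesgue measure under the map that fixes
  \<open>F\<close> and collapses every gap \<open>G\<close> to a single pair of endpoints: the mass
  of that pair is the length of \<open>G\<close>. All later work with conjugate pairs goes through
  such a map instead of the sum over components.\<close>

lemma component_pushforward:
 fixes c :: "real => real \<times> real" and x :: "real set => real"
 assumes c: "\<And>w. w \<in> F ==> c w = (w, w)"
  "\<And>G w. G \<in> components ({0..1} - F) ==> w \<in> G ==> c w = (x G, other_endpoint G (x G))"
  and A: "A \<in> sets (unit_borel \<Otimes>\<^sub>M unit_borel)"
 shows "{w\<in>{0..1}. c w \<in> A} \<in> sets unit_borel"
  "emeasure unit_lebesgue {w\<in>{0..1}. c w \<in> A} = (\<integral>\<^sup>+t\<in>F. indicator A (t, t) \<partial>unit_lebesgue) +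
    (\<integral>\<^sup>+G. ennreal (Sup G - Inf G) * indicator A (x G, other_endpoint G (x G))
     \<partial>count_space (components ({0..1} - F)))"
proof -
 let ?C = "components ({0..1} - F)"
 let ?C' = "{G\<in>?C. (x G, other_endpoint G (x G)) \<in> A}"
 have U: "{w\<in>{0..1}. c w \<in> A} = {t\<in>F. (t, t) \<in> A} \<union> \<Union>?C'"
 proof
  show "{w\<in>{0..1}. c w \<in> A} \<subseteq> {t\<in>F. (t, t) \<in> A} \<union> \<Union>?C'"
  proof
   fix w assume w: "w \<in> {w\<in>{0..1}. c w \<in> A}"
   show "w \<in> {t\<in>F. (t, t) \<in> A} \<union> \<Union>?C'"
   proof (cases "w \<in> F")
    case True then show ?thesis using c(1) w by simp
   next
    case False
    then obtain G where "G \<in> ?C" "w \<in> G" using gap_exists[of w] w by auto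
    then show ?thesis using c(2) w by auto
   qed
  qed
  have "w \<in> {w\<in>{0..1}. c w \<in> A}" if "G \<in> ?C'" "w \<in> G" for w G
   using c(2)[of G w] that in_components_subset[of G "{0..1} - F"] by auto
  moreover have "w \<in> {w\<in>{0..1}. c w \<in> A}" if "w \<in> F" "(w, w) \<in> A" for w
   using c(1)[of w] that F(2) by auto
  ultimately show "{t\<in>F. (t, t) \<in> A} \<union> \<Union>?C' \<subseteq> {w\<in>{0..1}. c w \<in> A}" by blast
 qed
 have m1: "{t\<in>F. (t, t) \<in> A} \<in> sets unit_borel"
 proof -
  have "(%t. (t, t)) \<in> unit_borel \<rightarrow>\<^sub>M unit_borel \<Otimes>\<^sub>M unit_borel" by simp
  note sets.Int[OF F_sets measurable_sets[OF this A]]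
  moreover have "F \<inter> ((%t. (t, t)) -` A \<inter> space unit_borel) = {t\<in>F. (t, t) \<in> A}"
   unfolding space_unit_borel using F(2) by blast
  ultimately show ?thesis by (simp only:)
 qed
 have cC': "countable ?C'" by (rule countable_subset[OF _ gaps_countable]) auto
 have m2: "\<Union>?C' \<in> sets unit_borel" by (rule sets.countable_Union[OF cC']) (auto intro: gap_sets)
 show "{w\<in>{0..1}. c w \<in> A} \<in> sets unit_borel" unfolding U using m1 m2 by (rule sets.Un)
 have "emeasure unit_lebesgue {w\<in>{0..1}. c w \<in> A} = emeasure unit_lebesgue {t\<in>F. (t, t) \<in> A} + emeasure unit_lebesgue (\<Union>?C')"
  unfolding U
 proof (rule plus_emeasure[symmetric])
  show "{t\<in>F. (t, t) \<in> A} \<inter> \<Union>?C' = {}" using in_components_subset by blast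
 qed (simp_all only: sets_unit_lebesgue m1 m2)
 also have "emeasure unit_lebesgue {t\<in>F. (t, t) \<in> A} = (\<integral>\<^sup>+t. indicator {t\<in>F. (t, t) \<in> A} t \<partial>unit_lebesgue)"
  using m1 by (simp add: sets_unit_lebesgue)
 also have "... = (\<integral>\<^sup>+t\<in>F. indicator A (t, t) \<partial>unit_lebesgue)"
  by (rule nn_integral_cong) (auto simp: indicator_def)
 also have "emeasure unit_lebesgue (\<Union>?C') = emeasure unit_lebesgue (\<Union>G\<in>?C'. G)" by simp
 also have "... = (\<integral>\<^sup>+G. emeasure unit_lebesgue G \<partial>count_space ?C')"
 proof (rule emeasure_UN_countable)
  show "disjoint_family_on (%G. G) ?C'" 
   unfolding disjoint_family_on_def using components_nonoverlap by blast
 qed (auto simp: sets_unit_lebesgue gap_sets cC')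
 also have "... = (\<integral>\<^sup>+G. ennreal (Sup G - Inf G) \<partial>count_space ?C')"
 proof (rule nn_integral_cong)
  fix G assume "G \<in> space (count_space ?C')"
  then have G: "G \<in> ?C" by simp
  have "emeasure unit_lebesgue G = emeasure lborel {Inf G<..<Sup G}"
  proof -
   have "emeasure unit_lebesgue G = emeasure lborel G"
    using in_components_subset[OF G] by (intro emeasure_unit_lebesgue borel_open open_components[OF gaps_open G]) auto
   also have "... = emeasure lborel {Inf G<..<Sup G}" using gap_endpoints(1)[OF G] by (rule arg_cong)
   finally show ?thesis .
  qed
  then show "emeasure unit_lebesgue G = ennreal (Sup G - Inf G)" using gap_endpoints(2)[OF G] by simp
 qed
 also have "... = (\<integral>\<^sup>+G. ennreal (Sup G - Inf G) * indicator A (x G, other_endpoint G (x G)) \<partial>count_space ?C)"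
  by (subst (1 2) nn_integral_count_space_indicator) (auto intro!: nn_integral_cong simp: indicator_def)
 finally show "emeasure unit_lebesgue {w\<in>{0..1}. c w \<in> A} = (\<integral>\<^sup>+t\<in>F. indicator A (t, t) \<partial>unit_lebesgue) +
    (\<integral>\<^sup>+G. ennreal (Sup G - Inf G) * indicator A (x G, other_endpoint G (x G)) \<partial>count_space ?C)" .
qed

end

section \<open>The canonical closed set and the distribution function of a quasi-uniform
  measure\<close>

definition qu_set :: "real measure => real set" where
 "qu_set \<mu> = {x\<in>{0..1}. measure \<mu> {0..<x} <= x & x <= measure \<mu> {0..x}}"

text \<open>On a gap the distribution function is constantly one endpoint, and the quantile function
  is constantly the other. The atom sits at the quantile, so the quantile serves as \<open>X\<close>
  and the distribution function as \<open>Y\<close>.\<close>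

definition qu_fst :: "real measure => real => real" where
 "qu_fst \<mu> w = (if w \<in> qu_set \<mu> then w else Inf {t\<in>{0..1}. w <= measure \<mu> {0..t}})"

definition qu_snd :: "real measure => real => real" where
 "qu_snd \<mu> w = (if w \<in> qu_set \<mu> then w else measure \<mu> {0..w})"

context
 fixes \<mu> :: "real measure" assumes qu: "quasi_uniform \<mu>"
begin

lemma qu_prob: "prob_space \<mu>" and qu_sets: "sets \<mu> = sets unit_borel"
 using qu by (auto simp: quasi_uniform_def space_prob_algebra)

lemma qu_space: "space \<mu> = {0..1}"
 using sets_eq_imp_space_eq[OF qu_sets] by simp

lemma qu_ivl [simp]: "t <= 1 ==> {0..t} \<in> sets \<mu>" "t <= 1 ==> {0..<t} \<in> sets \<mu>"
 unfolding qu_sets by (auto intro!: sets_unit_lebesgueI)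

lemma qu_mono: "s <= t ==> t <= 1 ==> measure \<mu> {0..s} <= measure \<mu> {0..t}"
 by (intro finite_measure.finite_measure_mono prob_space.finite_measure qu_prob) auto

lemma qu_mono': "s < t ==> t <= 1 ==> measure \<mu> {0..s} <= measure \<mu> {0..<t}"
 by (intro finite_measure.finite_measure_mono prob_space.finite_measure qu_prob) auto

lemma qu_mono'': "t <= 1 ==> measure \<mu> {0..<t} <= measure \<mu> {0..t}"
 by (intro finite_measure.finite_measure_mono prob_space.finite_measure qu_prob) auto

lemma qu_total: "measure \<mu> {0..1} = 1"
 using prob_space.prob_space[OF qu_prob] by (simp add: qu_space)

lemma qu_left_le:
 assumes x: "0 <= x" "x <= 1" and le: "\<And>t. 0 <= t ==> t < x ==> measure \<mu> {0..t} <= c" and c: "0 <= c"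
 shows "measure \<mu> {0..<x} <= c"
proof (cases "x = 0")
 case False
 then have x0: "0 < x" using x by simp
 interpret prob_space \<mu> by (rule qu_prob)
 let ?t = "%n::nat. x - x / real (Suc n)"
 have t: "0 <= ?t n" "?t n < x" for n using x0 by (auto simp: field_simps)
 have U: "(\<Union>n. {0..?t n}) = {0..<x}"
 proof
  show "(\<Union>n. {0..?t n}) \<subseteq> {0..<x}"
  proof (intro UN_least subsetI)
   fix n y assume "y \<in> {0..?t n}"
   then have "0 <= y" "y <= ?t n" by (simp_all only: atLeastAtMost_iff)
   with t(2)[of n] show "y \<in> {0..<x}" unfolding atLeastLessThan_iff by linarith
  qed
  show "{0..<x} \<subseteq> (\<Union>n. {0..?t n})"
  proof
   fix y assume y: "y \<in> {0..<x}"
   then obtain n where "x / (x - y) < real n" using reals_Archimedean2 by blast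
   then have "y <= ?t n" using y x0 by (auto simp: field_simps)
   with y show "y \<in> (\<Union>n. {0..?t n})" by auto
  qed
 qed
 have "(%n. measure \<mu> {0..?t n}) \<longlonglongrightarrow> measure \<mu> (\<Union>n. {0..?t n})"
 proof (rule finite_Lim_measure_incseq)
  show "range (%n. {0..?t n}) \<subseteq> sets \<mu>"
  proof (rule image_subsetI)
   fix n
   have "?t n <= 1" using t(2)[of n] x by linarith
   then show "{0..?t n} \<in> sets \<mu>" by (rule qu_ivl(1))
  qed
  have "?t n <= ?t m" if "n <= m" for n m using x0 that by (simp add: frac_le)
  then show "incseq (%n. {0..?t n})" unfolding incseq_def atLeastatMost_subset_iff by blast
 qed
 then show ?thesis unfolding U by (rule LIMSEQ_le_const2) (use le t in auto)
qed (use c in simp)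

lemma qu_right_ge:
 assumes x: "0 <= x" "x <= 1" and le: "\<And>t. x < t ==> t <= 1 ==> c <= measure \<mu> {0..t}" and c: "c <= 1"
 shows "c <= measure \<mu> {0..x}"
proof (cases "x = 1")
 case False
 then have x1: "0 < 1 - x" using x by simp
 interpret prob_space \<mu> by (rule qu_prob)
 let ?t = "%n::nat. x + (1 - x) / real (Suc n)"
 have t: "?t n <= 1" "x < ?t n" for n
 proof -
  have "(1 - x) / real (Suc n) <= (1 - x) / 1" using x1 by (intro divide_left_mono) auto
  then show "?t n <= 1" by simp
  show "x < ?t n" using x1 by simp
 qed
 have U: "(\<Inter>n. {0..?t n}) = {0..x}"
 proof
  show "{0..x} \<subseteq> (\<Inter>n. {0..?t n})"
  proof (intro INT_greatest subsetI)
   fix n y assume "y \<in> {0..x}"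
   then have "0 <= y" "y <= x" by simp_all
   with t(2)[of n] show "y \<in> {0..?t n}" unfolding atLeastAtMost_iff by linarith
  qed
  show "(\<Inter>n. {0..?t n}) \<subseteq> {0..x}"
  proof
   fix y assume y: "y \<in> (\<Inter>n. {0..?t n})"
   then have y0: "0 <= y" and yt: "\<And>n. y <= ?t n" by auto
   have "(%n. ?t n) \<longlonglongrightarrow> x + 0"
    by (intro tendsto_add tendsto_const LIMSEQ_Suc[OF lim_const_over_n])
   then have "y <= x + 0" by (rule LIMSEQ_le_const) (use yt in auto)
   with y0 show "y \<in> {0..x}" by simp
  qed
 qed
 have "(%n. measure \<mu> {0..?t n}) \<longlonglongrightarrow> measure \<mu> (\<Inter>n. {0..?t n})"
 proof (rule finite_Lim_measure_decseq)
  show "range (%n. {0..?t n}) \<subseteq> sets \<mu>" by (rule image_subsetI) (rule qu_ivl(1)[OF t(1)])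
  have "?t m <= ?t n" if "n <= m" for n m using x1 that by (simp add: frac_le)
  then show "decseq (%n. {0..?t n})" unfolding decseq_def atLeastatMost_subset_iff by blast
 qed
 then show ?thesis unfolding U by (rule LIMSEQ_le_const) (use le t in auto)
qed (use c qu_total in simp)

text \<open>The left and right limits in \<open>qu_set\<close> are traded for values of the
  distribution function at other points. These inequalities survive limits in \<open>x\<close>,
  which gives closedness.\<close>

lemma qu_set_iff:
 "x \<in> qu_set \<mu> \<longleftrightarrow> x \<in> {0..1} & (\<forall>t. 0 <= t & t < x --> measure \<mu> {0..t} <= x) & (\<forall>t. x < t & t <= 1 --> x <= measure \<mu> {0..t})"
proof
 assume "x \<in> qu_set \<mu>"
 then have x: "x \<in> {0..1}" "measure \<mu> {0..<x} <= x" "x <= measure \<mu> {0..x}" by (auto simp: qu_set_def)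
 have "measure \<mu> {0..t} <= x" if "t < x" for t using qu_mono'[OF that] x by auto
 moreover have "x <= measure \<mu> {0..t}" if "x < t" "t <= 1" for t using qu_mono[of x t] that x by auto
 ultimately show "x \<in> {0..1} & (\<forall>t. 0 <= t & t < x --> measure \<mu> {0..t} <= x) & (\<forall>t. x < t & t <= 1 --> x <= measure \<mu> {0..t})"
  using x by blast
next
 assume *: "x \<in> {0..1} & (\<forall>t. 0 <= t & t < x --> measure \<mu> {0..t} <= x) & (\<forall>t. x < t & t <= 1 --> x <= measure \<mu> {0..t})"
 then have x: "0 <= x" "x <= 1" by auto
 have "measure \<mu> {0..<x} <= x" by (rule qu_left_le[OF x _ x(1)]) (use * in blast)
 moreover have "x <= measure \<mu> {0..x}" by (rule qu_right_ge[OF x _ x(2)]) (use * in blast)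
 ultimately show "x \<in> qu_set \<mu>" using x by (simp add: qu_set_def)
qed

lemma qu_set_closed: "closed (qu_set \<mu>)"
 unfolding closed_sequential_limits
proof (intro allI impI)
 fix X l assume "(\<forall>n. X n \<in> qu_set \<mu>) & X \<longlonglongrightarrow> l"
 then have X: "\<And>n. X n \<in> qu_set \<mu>" and l: "X \<longlonglongrightarrow> l" by auto
 have X01: "X n \<in> {0..1}" for n using X[of n] by (simp add: qu_set_def)
 have l01: "l \<in> {0..1}" using closed_sequentially[OF closed_atLeastAtMost X01 l] .
 have "measure \<mu> {0..t} <= l" if t: "0 <= t" "t < l" for t
 proof (rule tendsto_lowerbound[OF l])
  have "eventually (%n. t < X n) sequentially" using order_tendstoD(1)[OF l t(2)] .
  then show "eventually (%n. measure \<mu> {0..t} <= X n) sequentially"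
   by eventually_elim (use X qu_set_iff t in blast)
 qed simp
 moreover have "l <= measure \<mu> {0..t}" if t: "l < t" "t <= 1" for t
 proof (rule tendsto_upperbound[OF l])
  have "eventually (%n. X n < t) sequentially" using order_tendstoD(2)[OF l t(1)] .
  then show "eventually (%n. X n <= measure \<mu> {0..t}) sequentially"
   by eventually_elim (use X qu_set_iff t in blast)
 qed simp
 ultimately show "l \<in> qu_set \<mu>" using l01 qu_set_iff by blast
qed

lemma qu_set_facts: "closed (qu_set \<mu>)" "qu_set \<mu> \<subseteq> {0..1}" "0 \<in> qu_set \<mu>" "1 \<in> qu_set \<mu>"
 using qu_set_closed qu_total prob_space.prob_le_1[OF qu_prob] by (auto simp: qu_set_def)

lemma qu_set_full: "measure \<mu> (qu_set \<mu>) = 1"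
 using qu by (simp add: quasi_uniform_def qu_set_def)

lemma qu_gap_null:
 assumes "A \<in> sets \<mu>" "A \<inter> qu_set \<mu> = {}" shows "measure \<mu> A = 0"
proof -
 interpret prob_space \<mu> by (rule qu_prob)
 have s: "qu_set \<mu> \<in> sets \<mu>" unfolding qu_sets by (rule F_sets[OF qu_set_facts])
 have "measure \<mu> A + measure \<mu> (qu_set \<mu>) = measure \<mu> (A \<union> qu_set \<mu>)"
  by (rule finite_measure_Union[symmetric]) (use assms s in auto)
 also have "... <= 1" by (rule prob_le_1)
 finally have "measure \<mu> A <= 0" using qu_set_full by simp
 then show ?thesis using measure_nonneg[of \<mu> A] by linarith
qed

text \<open>The gap carries no mass, so the distribution function is a constant \<open>c\<close> on
  it, and membership of the endpoints in \<open>qu_set\<close> gives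
  \<open>p \<le> c \<le> q\<close>. A value strictly between would itself be a point of
  \<open>qu_set\<close> in the gap. The two remaining values of \<open>c\<close> are the two
  cases.\<close>

lemma qu_gap:
 assumes pq: "p \<in> qu_set \<mu>" "q \<in> qu_set \<mu>" "p < q" "{p<..<q} \<inter> qu_set \<mu> = {}" and w: "p < w" "w < q"
 shows "measure \<mu> {0..w} = p & qu_fst \<mu> w = q & qu_snd \<mu> w = p \<or>
  measure \<mu> {0..w} = q & qu_fst \<mu> w = p & qu_snd \<mu> w = q"
proof -
 interpret prob_space \<mu> by (rule qu_prob)
 have p01: "0 <= p" "q <= 1" using pq(1,2) by (auto simp: qu_set_def)
 have wF: "w \<notin> qu_set \<mu>" using pq(4) w by auto
 have ivl: "{p<..<q} \<in> sets \<mu>" unfolding qu_sets using p01 by (intro sets_unit_lebesgueI) auto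
 have null: "measure \<mu> {p<..<q} = 0" by (rule qu_gap_null[OF ivl pq(4)])
 have const: "measure \<mu> {0..t} = measure \<mu> {0..p}" "measure \<mu> {0..<t'} = measure \<mu> {0..p}" if "p <= t" "t < q" "p < t'" "t' <= q" for t t'
 proof -
  have "measure \<mu> ({0..p} \<union> {p<..<q}) = measure \<mu> {0..p} + measure \<mu> {p<..<q}"
   using p01 ivl pq(3) by (intro finite_measure_Union) auto
  then have le: "measure \<mu> ({0..p} \<union> {p<..<q}) = measure \<mu> {0..p}" using null by simp
  have "measure \<mu> {0..t} <= measure \<mu> ({0..p} \<union> {p<..<q})" "measure \<mu> {0..<t'} <= measure \<mu> ({0..p} \<union> {p<..<q})"
   using that p01 pq(3) ivl by (auto intro!: finite_measure_mono)
  moreover have "measure \<mu> {0..p} <= measure \<mu> {0..t}" "measure \<mu> {0..p} <= measure \<mu> {0..<t'}"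
   using that p01 by (auto intro!: qu_mono qu_mono')
  ultimately show "measure \<mu> {0..t} = measure \<mu> {0..p}" "measure \<mu> {0..<t'} = measure \<mu> {0..p}" using le by auto
 qed
 define c where "c = measure \<mu> {0..p}"
 have cw: "measure \<mu> {0..t} = c" if "p <= t" "t < q" for t using const(1)[OF that pq(3) order_refl] by (simp add: c_def)
 have cw': "measure \<mu> {0..<t} = c" if "p < t" "t <= q" for t using const(2)[OF order_refl pq(3) that] by (simp add: c_def)
 have "p <= c" using pq(1) by (simp add: qu_set_def c_def)
 moreover have "c <= q" using pq(2) cw'[OF pq(3) order_refl] by (simp add: qu_set_def)
 moreover have "\<not> (p < c & c < q)"
 proof
  assume c: "p < c & c < q"
  then have "c \<in> qu_set \<mu>" using cw[of c] cw'[of c] p01 by (simp add: qu_set_def)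
  then show False using pq(4) c by auto
 qed
 ultimately have "c = p \<or> c = q" by auto
 then show ?thesis
 proof
  assume cp: "c = p"
  have "Inf {t\<in>{0..1}. w <= measure \<mu> {0..t}} = q"
  proof (rule cInf_eq_minimum)
   show "q \<in> {t\<in>{0..1}. w <= measure \<mu> {0..t}}" using pq(2) w by (auto simp: qu_set_def)
   fix t assume t: "t \<in> {t\<in>{0..1}. w <= measure \<mu> {0..t}}"
   show "q <= t"
   proof (rule ccontr)
    assume "\<not> q <= t"
    then have "measure \<mu> {0..t} <= measure \<mu> {0..max p t}" using p01 w by (intro qu_mono) auto
    also have "... = p" using cw[of "max p t"] \<open>\<not> q <= t\<close> pq(3) by (simp add: cp)
    finally show False using t w by auto
   qed
  qed
  then show ?thesis using cw[of w] w wF cp by (simp add: qu_fst_def qu_snd_def)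
 next
  assume cq: "c = q"
  have "Inf {t\<in>{0..1}. w <= measure \<mu> {0..t}} = p"
  proof (rule cInf_eq_minimum)
   show "p \<in> {t\<in>{0..1}. w <= measure \<mu> {0..t}}" using cw[of p] pq(3) p01 w by (simp add: cq)
   fix t assume t: "t \<in> {t\<in>{0..1}. w <= measure \<mu> {0..t}}"
   show "p <= t"
   proof (rule ccontr)
    assume "\<not> p <= t"
    then have "measure \<mu> {0..t} <= measure \<mu> {0..<p}" using p01 pq(3) by (intro qu_mono') auto
    also have "... <= p" using pq(1) by (simp add: qu_set_def)
    finally show False using t w by auto
   qed
  qed
  then show ?thesis using cw[of w] w wF cq by (simp add: qu_fst_def qu_snd_def)
 qed
qed

lemma qu_on_set: "w \<in> qu_set \<mu> ==> qu_fst \<mu> w = w" "w \<in> qu_set \<mu> ==> qu_snd \<mu> w = w"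
 by (simp_all add: qu_fst_def qu_snd_def)

lemma qu_gap_cases:
 assumes G: "G \<in> components ({0..1} - qu_set \<mu>)" and w: "w \<in> G"
 shows "measure \<mu> {0..w} = Inf G & qu_fst \<mu> w = Sup G & qu_snd \<mu> w = Inf G \<or>
  measure \<mu> {0..w} = Sup G & qu_fst \<mu> w = Inf G & qu_snd \<mu> w = Sup G"
proof (rule qu_gap)
 note g = gap_endpoints[OF qu_set_facts G]
 show "Inf G \<in> qu_set \<mu>" "Sup G \<in> qu_set \<mu>" "Inf G < Sup G" by (rule g)+
 show "{Inf G<..<Sup G} \<inter> qu_set \<mu> = {}" using g(1,5) by simp
 have "w \<in> {Inf G<..<Sup G}" using w g(1) by blast
 then show "Inf G < w" "w < Sup G" by auto
qed

text \<open>\<open>qu_gap_cases\<close> decides the side separately for each point; constancy of the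
  distribution function makes it the same throughout the gap.\<close>

lemma qu_gap_const:
 assumes G: "G \<in> components ({0..1} - qu_set \<mu>)" and w: "v \<in> G" "w \<in> G"
 shows "qu_fst \<mu> v = qu_fst \<mu> w" "qu_snd \<mu> v = qu_snd \<mu> w"
proof -
 note g = gap_endpoints[OF qu_set_facts G]
 have v01: "v \<in> {0..1}" "w \<in> {0..1}" using in_components_subset[OF G] w by auto
 have "measure \<mu> {0..v} = measure \<mu> {0..w}"
 proof -
  have le: "measure \<mu> {0..b} <= measure \<mu> {0..a}" if ab: "a \<in> G" "b \<in> G" "a <= b" for a b
  proof -
   interpret prob_space \<mu> by (rule qu_prob)
   have sub: "{a<..b} \<subseteq> G"
   proof
    fix z assume "z \<in> {a<..b}"
    moreover have "a \<in> {Inf G<..<Sup G}" "b \<in> {Inf G<..<Sup G}" using ab g(1) by blast+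
    ultimately have "z \<in> {Inf G<..<Sup G}" by auto
    then show "z \<in> G" using g(1) by blast
   qed
   have ab01: "0 <= a" "b <= 1" using ab in_components_subset[OF G] by auto
   have s: "{a<..b} \<in> sets \<mu>" unfolding qu_sets using ab01 by (intro sets_unit_lebesgueI) auto
   have "measure \<mu> {a<..b} = 0" by (rule qu_gap_null[OF s]) (use sub g(5) in auto)
   moreover have "measure \<mu> ({0..a} \<union> {a<..b}) = measure \<mu> {0..a} + measure \<mu> {a<..b}"
    using s ab01 ab by (intro finite_measure_Union) auto
   moreover have "{0..a} \<union> {a<..b} = {0..b}" using ab01 ab by auto
   ultimately show ?thesis by simp
  qed
  have le': "measure \<mu> {0..a} = measure \<mu> {0..b}" if ab: "a \<in> G" "b \<in> G" "a <= b" for a b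
   by (rule antisym[OF qu_mono[OF ab(3)] le[OF ab]]) (use ab(2) in_components_subset[OF G] in auto)
  show ?thesis
  proof (cases "v <= w")
   case True
   show ?thesis by (rule le'[OF w True])
  next
   case False
   then have "w <= v" by simp
   show ?thesis by (rule le'[OF w(2,1) \<open>w <= v\<close>, symmetric])
  qed
 qed
 then show "qu_fst \<mu> v = qu_fst \<mu> w" "qu_snd \<mu> v = qu_snd \<mu> w"
  using qu_gap_cases[OF G w(1)] qu_gap_cases[OF G w(2)] g(2) by auto
qed

end

section \<open>Measurable dependence on the quasi-uniform measure\<close>

lemma measurable_unit_borelI:
 "f \<in> borel_measurable N ==> (\<And>x. x \<in> space N ==> f x \<in> {0..1}) ==> f \<in> N \<rightarrow>\<^sub>M unit_borel"
 unfolding unit_borel_def by (rule measurable_restrict_space2[OF funcsetI])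

lemma sets_unit_borel_eq: "sets unit_borel = sigma_sets {0..1} {{0..t} |t. t <= (1::real)}"
proof
 let ?G = "{{0..t} |t. t <= (1::real)}"
 have G: "?G \<subseteq> Pow {0..1}" by auto
 show "sigma_sets {0..1} ?G \<subseteq> sets unit_borel"
 proof -
  have "?G \<subseteq> sets unit_borel" by (auto intro!: sets_unit_lebesgueI)
  from sets.sigma_sets_subset[OF this] show ?thesis by simp
 qed
 let ?N = "sigma {0..1} ?G"
 have sN: "space ?N = {0..1}" "sets ?N = sigma_sets {0..1} ?G" using G by (simp_all add: space_measure_of sets_measure_of)
 have "(%x. x) \<in> borel_measurable ?N"
  unfolding borel_measurable_iff_le
 proof
  fix a :: real
  have "{w \<in> space ?N. w <= a} = {0..min a 1}" unfolding sN by auto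
  also have "... \<in> sets ?N" unfolding sN by (rule sigma_sets.Basic) auto
  finally show "{w \<in> space ?N. w <= a} \<in> sets ?N" .
 qed
 then have "(%x. x) \<in> ?N \<rightarrow>\<^sub>M unit_borel"
  unfolding unit_borel_def by (intro measurable_restrict_space2) (simp_all only: sN Pi_I)
 then have "sets unit_borel \<subseteq> sets ?N" by (rule sets_le_measurable_id) (simp add: sN)
 then show "sets unit_borel \<subseteq> sigma_sets {0..1} ?G" unfolding sN .
qed

lemma Int_stable_unit: "Int_stable {{0..t} |t. t <= (1::real)}"
proof (rule Int_stableI)
 fix a b :: "real set" assume "a \<in> {{0..t} |t. t <= 1}" "b \<in> {{0..t} |t. t <= 1}"
 then obtain s t where st: "a = {0..s}" "b = {0..t}" "s <= 1" "t <= 1" by blast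
 have "a \<inter> b = {0..min s t}" unfolding st by auto
 then show "a \<inter> b \<in> {{0..t} |t. t <= 1}" using st by (intro CollectI exI[of _ "min s t"]) auto
qed

lemma measure_eq_unit:
 assumes M: "prob_space M" "sets M = sets unit_borel" and N: "prob_space N" "sets N = sets unit_borel"
  and eq: "\<And>t. t \<in> {0..1} ==> measure M {0..t} = measure N {0..t}"
 shows "M = N"
proof -
 interpret M: prob_space M by fact
 interpret N: prob_space N by fact
 show ?thesis
 proof (rule measure_eqI_generator_eq[OF Int_stable_unit, where A="%_. {0..1}"])
  fix X :: "real set" assume "X \<in> {{0..t} |t. t <= 1}"
  then obtain t where t: "X = {0..t}" "t <= 1" by blast
  show "emeasure M X = emeasure N X"
   using eq[of t] t by (cases "0 <= t") (auto simp: M.emeasure_eq_measure N.emeasure_eq_measure)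
 next
  show "sets M = sigma_sets {0..1} {{0..t} |t. t <= 1}" "sets N = sigma_sets {0..1} {{0..t} |t. t <= 1}"
   using M(2) N(2) sets_unit_borel_eq by simp_all
 qed auto
qed

lemma space_QU: "space QU_space = {\<mu>. quasi_uniform \<mu>}"
 and openin_QU: "openin weak_topology_QU V ==> V \<in> sets QU_space"
proof -
 have sub: "{V. openin weak_topology_QU V} \<subseteq> Pow {\<mu>. quasi_uniform \<mu>}"
 proof
  fix V assume "V \<in> {V. openin weak_topology_QU V}"
  then have "V \<subseteq> topspace weak_topology_QU" using openin_subset by auto
  also have "... \<subseteq> {\<mu>. quasi_uniform \<mu>}" unfolding weak_topology_QU_def topology_generated_by_topspace by auto
  finally show "V \<in> Pow {\<mu>. quasi_uniform \<mu>}" by blast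
 qed
 show "space QU_space = {\<mu>. quasi_uniform \<mu>}" unfolding QU_space_def using sub by (rule space_measure_of)
 show "openin weak_topology_QU V ==> V \<in> sets QU_space"
  unfolding QU_space_def using sub by (auto simp: sets_measure_of)
qed

lemma measurable_QU_integral:
 fixes f :: "real => real"
 assumes f: "continuous_on {0..1} f" shows "(%\<mu>. \<integral>x. f x \<partial>\<mu>) \<in> borel_measurable QU_space"
proof (rule borel_measurableI)
 fix S :: "real set" assume S: "open S"
 have "(%\<mu>. \<integral>x. f x \<partial>\<mu>) -` S \<inter> space QU_space = {\<mu>. quasi_uniform \<mu> & (\<integral>x. f x \<partial>\<mu>) \<in> S}"
  by (auto simp: space_QU)
 also have "... \<in> sets QU_space"
  by (rule openin_QU, unfold weak_topology_QU_def, rule topology_generated_by_Basis) (use f S in blast)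
 finally show "(%\<mu>. \<integral>x. f x \<partial>\<mu>) -` S \<inter> space QU_space \<in> sets QU_space" .
qed

text \<open>The weak topology directly provides integrals of continuous functions only. The
  indicator of \<open>{0..t}\<close> is the decreasing limit of the ramps \<open>f n\<close>, which
  equal 1 up to \<open>t\<close> and then fall to 0 with slope n.\<close>

lemma measurable_QU_prob: "(%\<mu>. \<mu>) \<in> QU_space \<rightarrow>\<^sub>M prob_algebra unit_borel"
proof (rule measurable_prob_algebra_generated[OF sets_unit_borel_eq Int_stable_unit])
 show "{{0..t} |t. t <= (1::real)} \<subseteq> Pow {0..1}" by auto
 show "prob_space \<mu>" "sets \<mu> = sets unit_borel" if "\<mu> \<in> space QU_space" for \<mu>
  using that qu_prob qu_sets by (auto simp: space_QU)
 fix A :: "real set" assume "A \<in> {{0..t} |t. t <= 1}"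
 then obtain t where t: "A = {0..t}" "t <= 1" by blast
 define f where "f n x = max 0 (min 1 (1 - real n * (x - t)))" for n :: nat and x :: real
 have cf: "continuous_on {0..1} (f n)" for n unfolding f_def by (intro continuous_intros)
 have "(%\<mu>. measure \<mu> A) \<in> borel_measurable QU_space"
 proof (rule borel_measurable_LIMSEQ_real[OF _ measurable_QU_integral[OF cf]])
  fix \<mu> assume "\<mu> \<in> space QU_space"
  then have q: "quasi_uniform \<mu>" by (simp add: space_QU)
  interpret prob_space \<mu> by (rule qu_prob[OF q])
  have A: "A \<in> sets \<mu>" using t qu_ivl[OF q] by simp
  have "(%n. \<integral>x. f n x \<partial>\<mu>) \<longlonglongrightarrow> (\<integral>x. indicator A x \<partial>\<mu>)"
  proof (rule integral_dominated_convergence[where w="%_. 1"])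
   show "f n \<in> borel_measurable \<mu>" for n
   proof (rule measurable_eq_sets[OF qu_sets[OF q]])
    have "f n \<in> borel_measurable borel" unfolding f_def[abs_def] by measurable
    then show "f n \<in> borel_measurable unit_borel" unfolding unit_borel_def by (rule measurable_restrict_space1)
   qed
   show "AE x in \<mu>. (%n. f n x) \<longlonglongrightarrow> indicator A x"
   proof (rule AE_I2)
    fix x assume "x \<in> space \<mu>"
    then have x: "0 <= x" "x <= 1" by (simp_all add: qu_space[OF q])
    show "(%n. f n x) \<longlonglongrightarrow> indicator A x"
    proof (cases "x <= t")
     case True
     then have "f n x = 1" for n using mult_nonneg_nonpos[of "real n" "x - t"] by (simp add: f_def)
     then show ?thesis using True x t by (simp add: indicator_def)
    next
     case False
     then obtain N where N: "1 / (x - t) < real N" using reals_Archimedean2 by blast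
     have "f n x = 0" if "N <= n" for n
     proof -
      have "1 / (x - t) < real n" using N that by linarith
      then have "1 < real n * (x - t)" using False by (simp add: pos_divide_less_eq)
      then show ?thesis by (simp add: f_def)
     qed
     then have "eventually (%n. f n x = 0) sequentially" by (auto simp: eventually_sequentially)
     then have "(%n. f n x) \<longlonglongrightarrow> 0" by (rule tendsto_eventually)
     then show ?thesis using False t by (simp add: indicator_def)
    qed
   qed
   show "AE x in \<mu>. norm (f n x) <= 1" for n by (rule AE_I2) (auto simp: f_def)
  qed (use A in simp_all)
  moreover have "(\<integral>x. indicator A x \<partial>\<mu>) = measure \<mu> A" using A sets.sets_into_space[OF A] by (simp add: Int_absorb2)
  ultimately show "(%n. \<integral>x. f n x \<partial>\<mu>) \<longlonglongrightarrow> measure \<mu> A" by simp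
 qed
 then have "(%\<mu>. ennreal (measure \<mu> A)) \<in> borel_measurable QU_space"
  by (rule measurable_compose[OF _ measurable_ennreal])
 then show "(%\<mu>. emeasure \<mu> A) \<in> borel_measurable QU_space"
  by (rule measurable_cong[THEN iffD1, rotated])
   (use qu_prob in \<open>simp add: space_QU finite_measure.emeasure_eq_measure prob_space.finite_measure\<close>)
qed

lemma measurable_qu_cdf:
 "(%x. measure (fst x) {0..snd x}) \<in> borel_measurable (QU_space \<Otimes>\<^sub>M unit_borel)"
 "(%x. measure (fst x) {0..<snd x}) \<in> borel_measurable (QU_space \<Otimes>\<^sub>M unit_borel)"
proof -
 let ?M = "QU_space \<Otimes>\<^sub>M unit_borel"
 have L: "fst \<in> ?M \<rightarrow>\<^sub>M subprob_algebra unit_borel"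
  by (rule measurable_compose[OF measurable_fst measurable_prob_algebraD[OF measurable_QU_prob]])
 have id: "(%x. x) \<in> borel_measurable unit_borel" by (rule measurable_unit_borel_borel)
 have a: "(%z. snd z) \<in> borel_measurable (?M \<Otimes>\<^sub>M unit_borel)" using measurable_compose[OF measurable_snd id] by simp
 have b: "(%z. snd (fst z)) \<in> borel_measurable (?M \<Otimes>\<^sub>M unit_borel)"
  using measurable_compose[OF measurable_fst measurable_compose[OF measurable_snd id]] by simp
 have "(SIGMA x:space ?M. {0..snd x}) = {z\<in>space (?M \<Otimes>\<^sub>M unit_borel). snd z <= snd (fst z)}"
  by (auto simp: space_pair_measure)
 also have "... \<in> sets (?M \<Otimes>\<^sub>M unit_borel)" by (rule borel_measurable_le[OF a b])
 finally show "(%x. measure (fst x) {0..snd x}) \<in> borel_measurable ?M"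
  by (rule measure_measurable_subprob_algebra2[OF _ L])
 have "(SIGMA x:space ?M. {0..<snd x}) = {z\<in>space (?M \<Otimes>\<^sub>M unit_borel). snd z < snd (fst z)}"
  by (auto simp: space_pair_measure)
 also have "... \<in> sets (?M \<Otimes>\<^sub>M unit_borel)" by (rule borel_measurable_less[OF a b])
 finally show "(%x. measure (fst x) {0..<snd x}) \<in> borel_measurable ?M"
  by (rule measure_measurable_subprob_algebra2[OF _ L])
qed

lemma measurable_qu_set: "{x\<in>space (QU_space \<Otimes>\<^sub>M unit_borel). snd x \<in> qu_set (fst x)} \<in> sets (QU_space \<Otimes>\<^sub>M unit_borel)"
proof -
 let ?M = "QU_space \<Otimes>\<^sub>M unit_borel"
 have s: "snd \<in> borel_measurable ?M" using measurable_compose[OF measurable_snd measurable_unit_borel_borel] by simp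
 have "{x\<in>space ?M. snd x \<in> qu_set (fst x)} = {x\<in>space ?M. measure (fst x) {0..<snd x} <= snd x} \<inter> {x\<in>space ?M. snd x <= measure (fst x) {0..snd x}}"
  by (auto simp: qu_set_def space_pair_measure)
 also have "... \<in> sets ?M" by (intro sets.Int borel_measurable_le measurable_qu_cdf s)
 finally show ?thesis .
qed

text \<open>The Galois connection between quantile and distribution function; right continuity of
  the latter is what makes the forward direction hold at the infimum itself.\<close>

lemma qu_quantile_le_iff:
 assumes q: "quasi_uniform \<mu>" and w: "w \<in> {0..1}" and a: "a \<in> {0..1}"
 shows "Inf {t\<in>{0..1}. w <= measure \<mu> {0..t}} <= a \<longleftrightarrow> w <= measure \<mu> {0..a}"
proof
 let ?S = "{t\<in>{0..1}. w <= measure \<mu> {0..t}}"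
 have bdd: "bdd_below ?S" by (rule bdd_belowI[of _ 0]) auto
 have ne: "?S ~= {}" using w qu_total[OF q] by (auto intro!: exI[of _ 1])
 show "Inf ?S <= a" if "w <= measure \<mu> {0..a}" by (rule cInf_lower[OF _ bdd]) (use that a in simp)
 assume le: "Inf ?S <= a"
 show "w <= measure \<mu> {0..a}"
 proof (rule qu_right_ge[OF q])
  fix t assume t: "a < t" "t <= 1"
  then have "Inf ?S < t" using le by simp
  then obtain s where s: "s \<in> ?S" "s < t" unfolding cInf_less_iff[OF ne bdd] by (rule bexE)
  then have "w <= measure \<mu> {0..s}" by simp
  also have "... <= measure \<mu> {0..t}" using s t by (intro qu_mono[OF q]) auto
  finally show "w <= measure \<mu> {0..t}" .
 qed (use a w in auto)
qed

lemma qu_quantile_range: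
 assumes q: "quasi_uniform \<mu>" and w: "w \<in> {0..1}"
 shows "Inf {t\<in>{0..1}. w <= measure \<mu> {0..t}} \<in> {0..1}"
proof -
 have ne: "{t\<in>{0..1}. w <= measure \<mu> {0..t}} ~= {}" using w qu_total[OF q] by (auto intro!: exI[of _ 1])
 have "0 <= Inf {t\<in>{0..1}. w <= measure \<mu> {0..t}}" by (rule cInf_greatest[OF ne]) auto
 moreover have "Inf {t\<in>{0..1}. w <= measure \<mu> {0..t}} <= 1" using qu_quantile_le_iff[OF q w, of 1] w qu_total[OF q] by simp
 ultimately show ?thesis by simp
qed

lemma qu_fst_range: "quasi_uniform \<mu> ==> w \<in> {0..1} ==> qu_fst \<mu> w \<in> {0..1}"
 using qu_quantile_range[of \<mu> w] by (simp add: qu_fst_def)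

lemma qu_snd_range: "quasi_uniform \<mu> ==> w \<in> {0..1} ==> qu_snd \<mu> w \<in> {0..1}"
 using prob_space.prob_le_1[OF qu_prob, of \<mu>] by (simp add: qu_snd_def)

lemma measurable_qu_quantile:
 "(%x. Inf {t\<in>{0..1}. snd x <= measure (fst x) {0..t}}) \<in> borel_measurable (QU_space \<Otimes>\<^sub>M unit_borel)"
 unfolding borel_measurable_iff_le
proof
 let ?M = "QU_space \<Otimes>\<^sub>M unit_borel"
 fix a :: real
 let ?S = "{x \<in> space ?M. Inf {t\<in>{0..1}. snd x <= measure (fst x) {0..t}} <= a}"
 have r: "quasi_uniform (fst x)" "snd x \<in> {0..1}" if "x \<in> space ?M" for x using that by (auto simp: space_pair_measure space_QU)
 consider "a < 0" | "1 < a" | "a \<in> {0..1}" by fastforce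
 then show "?S \<in> sets ?M"
 proof cases
  case 1
  have "Inf {t\<in>{0..1}. snd x <= measure (fst x) {0..t}} \<ge> 0" if "x \<in> space ?M" for x
   using qu_quantile_range[OF r[OF that]] by (simp only: atLeastAtMost_iff)
  then have "?S = {}" using 1 by fastforce
  then show ?thesis by (simp only: sets.empty_sets)
 next
  case 2
  have "Inf {t\<in>{0..1}. snd x <= measure (fst x) {0..t}} <= 1" if "x \<in> space ?M" for x
   using qu_quantile_range[OF r[OF that]] by (simp only: atLeastAtMost_iff)
  then have "?S = space ?M" using 2 by fastforce
  then show ?thesis by (simp only: sets.top)
 next
  case 3
  have s: "snd \<in> borel_measurable ?M" using measurable_compose[OF measurable_snd measurable_unit_borel_borel] by simp
  have "(%\<mu>. measure \<mu> {0..a}) \<in> borel_measurable QU_space"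
   by (rule measurable_compose[OF measurable_QU_prob measurable_measure_prob_algebra]) (use 3 in \<open>auto intro: sets_unit_lebesgueI\<close>)
  from measurable_compose[OF measurable_fst this] have m: "(%x. measure (fst x) {0..a}) \<in> borel_measurable ?M" .
  have "?S = {x\<in>space ?M. snd x <= measure (fst x) {0..a}}"
   using qu_quantile_le_iff[OF r 3] by blast
  also have "... \<in> sets ?M" by (rule borel_measurable_le[OF s m])
  finally show ?thesis .
 qed
qed

lemma measurable_qu_fst: "(%x. qu_fst (fst x) (snd x)) \<in> QU_space \<Otimes>\<^sub>M unit_borel \<rightarrow>\<^sub>M unit_borel"
 and measurable_qu_snd: "(%x. qu_snd (fst x) (snd x)) \<in> QU_space \<Otimes>\<^sub>M unit_borel \<rightarrow>\<^sub>M unit_borel"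
proof -
 let ?M = "QU_space \<Otimes>\<^sub>M unit_borel"
 have s: "snd \<in> borel_measurable ?M" using measurable_compose[OF measurable_snd measurable_unit_borel_borel] by simp
 have r: "quasi_uniform (fst x)" "snd x \<in> {0..1}" if "x \<in> space ?M" for x using that by (auto simp: space_pair_measure space_QU)
 have "(%x. qu_fst (fst x) (snd x)) \<in> borel_measurable ?M"
  unfolding qu_fst_def by (rule measurable_If[OF s measurable_qu_quantile measurable_qu_set])
 then show "(%x. qu_fst (fst x) (snd x)) \<in> ?M \<rightarrow>\<^sub>M unit_borel"
  by (rule measurable_unit_borelI) (use r qu_fst_range in blast)
 have "(%x. qu_snd (fst x) (snd x)) \<in> borel_measurable ?M"
  unfolding qu_snd_def by (rule measurable_If[OF s measurable_qu_cdf(1) measurable_qu_set])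
 then show "(%x. qu_snd (fst x) (snd x)) \<in> ?M \<rightarrow>\<^sub>M unit_borel"
  by (rule measurable_unit_borelI) (use r qu_snd_range in blast)
qed

lemma AE_unit_countable:
 assumes "countable C" shows "AE w in unit_lebesgue. w \<notin> C"
proof -
 have "AE w in unit_lebesgue. \<forall>c\<in>C. w ~= c"
  by (rule AE_ball_countable'[OF AE_unit_lebesgue_neq assms])
 then show ?thesis by eventually_elim blast
qed

text \<open>The two differ by definition only on \<open>qu_set\<close>. If the quantile of such a
  \<open>w\<close> lay below \<open>w\<close>, the distribution function would equal
  \<open>w\<close> at every rational in between, and it takes only countably many values at
  rationals.\<close>

lemma qu_fst_eq_quantile:
 assumes q: "quasi_uniform \<mu>"
 shows "AE w in unit_lebesgue. qu_fst \<mu> w = Inf {t\<in>{0..1}. w <= measure \<mu> {0..t}}"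
proof -
 have "countable ((%r. measure \<mu> {0..r}) ` \<rat>)" by (intro countable_image countable_rat)
 from AE_unit_countable[OF this] AE_space show ?thesis
 proof eventually_elim
  case (elim w)
  let ?q = "Inf {t\<in>{0..1}. w <= measure \<mu> {0..t}}"
  have w: "w \<in> {0..1}" using elim(2) by simp
  show ?case
  proof (cases "w \<in> qu_set \<mu>")
   case True
   have qw: "?q <= w" using True qu_quantile_le_iff[OF q w w] by (simp add: qu_set_def)
   have "?q = w"
   proof (rule ccontr)
    assume "?q ~= w"
    then have "?q < w" using qw by simp
    then obtain r where r: "r \<in> \<rat>" "?q < r" "r < w" using Rats_dense_in_real by blast
    have r01: "r \<in> {0..1}" using r qu_quantile_range[OF q w] w by simp
    have "w <= measure \<mu> {0..r}" using qu_quantile_le_iff[OF q w r01] r by simp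
    moreover have "measure \<mu> {0..r} <= measure \<mu> {0..<w}" using r w by (intro qu_mono'[OF q]) auto
    moreover have "measure \<mu> {0..<w} <= w" using True by (simp add: qu_set_def)
    ultimately have "w = measure \<mu> {0..r}" by simp
    then show False using elim(1) r(1) by blast
   qed
   then show ?thesis using True by (simp add: qu_fst_def)
  qed (simp add: qu_fst_def)
 qed
qed

lemma measurable_qu_fst1: "quasi_uniform \<mu> ==> qu_fst \<mu> \<in> unit_borel \<rightarrow>\<^sub>M unit_borel"
 and measurable_qu_snd1: "quasi_uniform \<mu> ==> qu_snd \<mu> \<in> unit_borel \<rightarrow>\<^sub>M unit_borel"
 using measurable_compose[OF measurable_Pair1'[of \<mu> QU_space unit_borel] measurable_qu_fst]
  measurable_compose[OF measurable_Pair1'[of \<mu> QU_space unit_borel] measurable_qu_snd]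
 by (simp_all add: space_QU)

lemma distr_qu_fst:
 assumes q: "quasi_uniform \<mu>" shows "distr unit_lebesgue unit_borel (qu_fst \<mu>) = \<mu>"
proof (rule measure_eq_unit)
 interpret U: prob_space unit_lebesgue by (rule prob_space_unit_lebesgue)
 have m: "qu_fst \<mu> \<in> unit_lebesgue \<rightarrow>\<^sub>M unit_borel"
  by (rule measurable_eq_sets[OF sets_unit_lebesgue measurable_qu_fst1[OF q]])
 show "prob_space (distr unit_lebesgue unit_borel (qu_fst \<mu>))" by (rule U.prob_space_distr[OF m])
 show "prob_space \<mu>" "sets \<mu> = sets unit_borel" by (rule qu_prob[OF q], rule qu_sets[OF q])
 fix t :: real assume t: "t \<in> {0..1}"
 have ts: "{0..t} \<in> sets unit_borel" using t by (intro sets_unit_lebesgueI) auto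
 have G: "0 <= measure \<mu> {0..t}" "measure \<mu> {0..t} <= 1" using prob_space.prob_le_1[OF qu_prob[OF q]] by auto
 have "measure (distr unit_lebesgue unit_borel (qu_fst \<mu>)) {0..t} = measure unit_lebesgue (qu_fst \<mu> -` {0..t} \<inter> space unit_lebesgue)"
  by (rule measure_distr[OF m ts])
 also have "... = measure unit_lebesgue {0..measure \<mu> {0..t}}"
 proof (rule U.finite_measure_eq_AE)
  show "AE w in unit_lebesgue. (w \<in> qu_fst \<mu> -` {0..t} \<inter> space unit_lebesgue) = (w \<in> {0..measure \<mu> {0..t}})"
   using qu_fst_eq_quantile[OF q] AE_space
  proof eventually_elim
   case (elim w)
   then have w: "w \<in> {0..1}" by simp
   show ?case using qu_fst_range[OF q w] qu_quantile_le_iff[OF q w t] w elim(1) by simp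
  qed
  show "qu_fst \<mu> -` {0..t} \<inter> space unit_lebesgue \<in> sets unit_lebesgue" by (rule measurable_sets[OF m ts])
  show "{0..measure \<mu> {0..t}} \<in> sets unit_lebesgue"
   unfolding sets_unit_lebesgue using G by (intro sets_unit_lebesgueI) auto
 qed
 also have "... = measure \<mu> {0..t}"
  using G by (subst measure_def, subst emeasure_unit_lebesgue) auto
 finally show "measure (distr unit_lebesgue unit_borel (qu_fst \<mu>)) {0..t} = measure \<mu> {0..t}" .
qed simp

section \<open>Uniqueness of the decomposition and the conjugate law as an image of Lebesgue
  measure\<close>

definition conj_map :: "real measure => real => real \<times> real" where
 "conj_map \<mu> w = (qu_fst \<mu> w, qu_snd \<mu> w)"

lemma other_endpoint_in:
 assumes F: "closed F" "F \<subseteq> {0..1}" "0 \<in> F" "1 \<in> F" and G: "G \<in> components ({0..1} - F)"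
 shows "other_endpoint G a \<in> {0..1}"
proof -
 have "Inf G \<in> {0..1}" "Sup G \<in> {0..1}" using gap_endpoints(3,4)[OF F G] F(2) by blast+
 then show ?thesis by (simp add: other_endpoint_def)
qed

lemma qu_decomposition_pushforward:
 assumes d: "qu_decomposition \<mu> F x"
  and c: "\<And>w. w \<in> F ==> c w = (w, w)"
  "\<And>G w. G \<in> components ({0..1} - F) ==> w \<in> G ==> c w = (x G, other_endpoint G (x G))"
  and A: "A \<in> sets unit_borel"
 shows "emeasure \<mu> A = emeasure unit_lebesgue {w\<in>{0..1}. fst (c w) \<in> A}"
proof -
 have F: "closed F" "F \<subseteq> {0..1}" "0 \<in> F" "1 \<in> F" using d by (auto simp: qu_decomposition_def)
 have A': "A \<times> {0..1} \<in> sets (unit_borel \<Otimes>\<^sub>M unit_borel)"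
  using A sets.top[of unit_borel] by (intro pair_measureI) simp_all
 have snd01: "snd (c w) \<in> {0..1}" if w: "w \<in> {0..1}" for w
 proof (cases "w \<in> F")
  case False
  then obtain G where G: "G \<in> components ({0..1} - F)" "w \<in> G" using gap_exists[OF F w] by blast
  then show ?thesis using c(2)[OF G] other_endpoint_in[OF F G(1)] by simp
 qed (use c(1) w in simp)
 have "emeasure unit_lebesgue {w\<in>{0..1}. fst (c w) \<in> A} = emeasure unit_lebesgue {w\<in>{0..1}. c w \<in> A \<times> {0..1}}"
  using snd01 by (intro arg_cong[where f="emeasure unit_lebesgue"]) (auto simp: mem_Times_iff)
 also have "... = (\<integral>\<^sup>+t\<in>F. indicator (A \<times> {0..1}) (t, t) \<partial>unit_lebesgue) +
    (\<integral>\<^sup>+G. ennreal (Sup G - Inf G) * indicator (A \<times> {0..1}) (x G, other_endpoint G (x G)) \<partial>count_space (components ({0..1} - F)))"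
  by (rule component_pushforward(2)[OF F c A'])
 also have "(\<integral>\<^sup>+t\<in>F. indicator (A \<times> {0..1}) (t, t) \<partial>unit_lebesgue) = (\<integral>\<^sup>+t. indicator F t * indicator A t \<partial>unit_lebesgue)"
  using F(2) by (intro nn_integral_cong) (auto simp: indicator_def)
 also have "... = emeasure (density unit_lebesgue (indicator F)) A"
  using A F_sets[OF F] by (subst emeasure_density) (auto simp: sets_unit_lebesgue)
 also have "(\<integral>\<^sup>+G. ennreal (Sup G - Inf G) * indicator (A \<times> {0..1}) (x G, other_endpoint G (x G)) \<partial>count_space (components ({0..1} - F))) =
  (\<integral>\<^sup>+G. ennreal (Sup G - Inf G) * indicator A (x G) \<partial>count_space (components ({0..1} - F)))"
  using other_endpoint_in[OF F] by (intro nn_integral_cong) (simp add: indicator_def)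
 finally show ?thesis using d A by (simp add: qu_decomposition_def)
qed

lemma qu_gap_map:
 assumes q: "quasi_uniform \<mu>" and G: "G \<in> components ({0..1} - qu_set \<mu>)" and w: "w \<in> G"
 defines "x \<equiv> %G. qu_fst \<mu> ((Inf G + Sup G) / 2)"
 shows "conj_map \<mu> w = (x G, other_endpoint G (x G))" "x G = Inf G \<or> x G = Sup G"
proof -
 note g = gap_endpoints[OF qu_set_facts[OF q] G]
 have "(Inf G + Sup G) / 2 \<in> {Inf G<..<Sup G}" using g(2) by auto
 then have m: "(Inf G + Sup G) / 2 \<in> G" using g(1) by blast
 have xw: "x G = qu_fst \<mu> w" unfolding x_def by (rule qu_gap_const(1)[OF q G m w])
 from qu_gap_cases[OF q G w] g(2)
 show "conj_map \<mu> w = (x G, other_endpoint G (x G))" "x G = Inf G \<or> x G = Sup G"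
  unfolding xw conj_map_def other_endpoint_def by auto
qed

lemma qu_decomposition_exists:
 assumes q: "quasi_uniform \<mu>"
 shows "qu_decomposition \<mu> (qu_set \<mu>) (%G. qu_fst \<mu> ((Inf G + Sup G) / 2))"
proof -
 let ?F = "qu_set \<mu>" and ?x = "%G. qu_fst \<mu> ((Inf G + Sup G) / 2)"
 note F = qu_set_facts[OF q]
 have c: "conj_map \<mu> w = (w, w)" if "w \<in> ?F" for w using qu_on_set that by (simp add: conj_map_def qu_fst_def qu_snd_def)
 have ends: "?x G = Inf G \<or> ?x G = Sup G" if G: "G \<in> components ({0..1} - ?F)" for G
  using qu_gap_map(2)[OF q G] in_components_nonempty[OF G] by blast
 have "emeasure \<mu> A = emeasure (density unit_lebesgue (indicator ?F)) A +
    (\<integral>\<^sup>+G. ennreal (Sup G - Inf G) * indicator A (?x G) \<partial>count_space (components ({0..1} - ?F)))" if A: "A \<in> sets unit_borel" for A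
 proof -
  have A': "A \<times> {0..1} \<in> sets (unit_borel \<Otimes>\<^sub>M unit_borel)"
   using A sets.top[of unit_borel] by (intro pair_measureI) simp_all
  have m: "qu_fst \<mu> \<in> unit_lebesgue \<rightarrow>\<^sub>M unit_borel"
   by (rule measurable_eq_sets[OF sets_unit_lebesgue measurable_qu_fst1[OF q]])
  have "emeasure \<mu> A = emeasure (distr unit_lebesgue unit_borel (qu_fst \<mu>)) A" by (simp only: distr_qu_fst[OF q])
  also have "... = emeasure unit_lebesgue (qu_fst \<mu> -` A \<inter> space unit_lebesgue)" by (rule emeasure_distr[OF m A])
  also have "qu_fst \<mu> -` A \<inter> space unit_lebesgue = {w\<in>{0..1}. conj_map \<mu> w \<in> A \<times> {0..1}}"
  proof -
   have "conj_map \<mu> w \<in> A \<times> {0..1} \<longleftrightarrow> qu_fst \<mu> w \<in> A" if "w \<in> {0..1}" for w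
    using qu_snd_range[OF q that] by (simp add: conj_map_def)
   then show ?thesis
    unfolding space_unit_lebesgue vimage_def Int_def mem_Collect_eq by (intro Collect_cong) metis
  qed
  also have "emeasure unit_lebesgue \<dots> = (\<integral>\<^sup>+t\<in>?F. indicator (A \<times> {0..1}) (t, t) \<partial>unit_lebesgue) +
    (\<integral>\<^sup>+G. ennreal (Sup G - Inf G) * indicator (A \<times> {0..1}) (?x G, other_endpoint G (?x G)) \<partial>count_space (components ({0..1} - ?F)))"
   by (rule component_pushforward(2)[OF F c qu_gap_map(1)[OF q] A'])
  also have "(\<integral>\<^sup>+t\<in>?F. indicator (A \<times> {0..1}) (t, t) \<partial>unit_lebesgue) = (\<integral>\<^sup>+t. indicator ?F t * indicator A t \<partial>unit_lebesgue)"
   using F(2) by (intro nn_integral_cong) (auto simp: indicator_def)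
  also have "... = emeasure (density unit_lebesgue (indicator ?F)) A"
   using A F_sets[OF F] by (subst emeasure_density) (auto simp: sets_unit_lebesgue)
  also have "(\<integral>\<^sup>+G. ennreal (Sup G - Inf G) * indicator (A \<times> {0..1}) (?x G, other_endpoint G (?x G)) \<partial>count_space (components ({0..1} - ?F))) =
   (\<integral>\<^sup>+G. ennreal (Sup G - Inf G) * indicator A (?x G) \<partial>count_space (components ({0..1} - ?F)))"
   using other_endpoint_in[OF F] by (intro nn_integral_cong) (simp add: indicator_def)
  finally show ?thesis .
 qed
 then show ?thesis unfolding qu_decomposition_def using F ends qu_sets[OF q] by blast
qed

text \<open>Any decomposition makes \<mu> the image of Lebesgue measure under its collapsing map
  \<open>c\<close>. Computing the distribution function through \<open>c\<close> shows that points
  of \<open>F\<close> satisfy the inequalities of \<open>qu_set\<close> and points of gaps violate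
  them, so \<open>F\<close> is the canonical set. The value on a gap then tells which endpoint was
  chosen.\<close>

lemma qu_decomposition_unique:
 assumes q: "quasi_uniform \<mu>" and d: "qu_decomposition \<mu> F x"
  and c: "\<And>w. w \<in> F ==> c w = (w, w)"
  "\<And>G w. G \<in> components ({0..1} - F) ==> w \<in> G ==> c w = (x G, other_endpoint G (x G))"
  and w: "w \<in> {0..1}"
 shows "c w = conj_map \<mu> w"
proof -
 have F: "closed F" "F \<subseteq> {0..1}" "0 \<in> F" "1 \<in> F" using d by (auto simp: qu_decomposition_def)
 have push: "emeasure \<mu> A = emeasure unit_lebesgue {w\<in>{0..1}. fst (c w) \<in> A}" if "A \<in> sets unit_borel" for A
  by (rule qu_decomposition_pushforward[OF d c that])
 have xG: "x G = Inf G \<or> x G = Sup G" if "G \<in> components ({0..1} - F)" for G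
  using d that by (auto simp: qu_decomposition_def)
 \<comment> \<open>In either case no point of \<open>F\<close> lies strictly between
   \<open>w\<close> and its image. This is what compares \<open>c\<close> with the intervals ending
   at a point of \<open>F\<close>.\<close>
 have cases: "w \<in> F & fst (c w) = w \<or> (\<exists>G\<in>components ({0..1} - F). Inf G < w & w < Sup G & (\<forall>t\<in>F. t <= Inf G \<or> Sup G <= t) & fst (c w) = x G & Inf G <= x G & x G <= Sup G)"
  if w: "w \<in> {0..1}" for w
 proof (cases "w \<in> F")
  case False
  then obtain G where G: "G \<in> components ({0..1} - F)" "w \<in> G" using gap_exists[OF F w] by blast
  note g = gap_endpoints[OF F G(1)]
  have "w \<in> {Inf G<..<Sup G}" using G(2) g(1) by blast
  moreover have "t <= Inf G \<or> Sup G <= t" if "t \<in> F" for t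
  proof -
   have "t \<notin> {Inf G<..<Sup G}" using g(1,5) that by blast
   then show ?thesis by auto
  qed
  moreover have "fst (c w) = x G" using c(2)[OF G] by simp
  moreover have "Inf G <= x G" "x G <= Sup G" using xG[OF G(1)] g(2) by auto
  ultimately have "Inf G < w & w < Sup G & (\<forall>t\<in>F. t <= Inf G \<or> Sup G <= t) & fst (c w) = x G & Inf G <= x G & x G <= Sup G"
   by simp
  then show ?thesis using G(1) by blast
 qed (use c(1) in simp)
 have U: "emeasure unit_lebesgue {0..t} = ennreal t" "emeasure unit_lebesgue {0..<t} = ennreal t" if "t \<in> {0..1}" for t
 proof -
  have "{0..t} \<subseteq> {0..1}" "{0..<t} \<subseteq> {0..1}" using that by auto
  then have "emeasure unit_lebesgue {0..t} = emeasure lborel {0..t}" "emeasure unit_lebesgue {0..<t} = emeasure lborel {0..<t}"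
   by (auto intro!: emeasure_unit_lebesgue)
  then show "emeasure unit_lebesgue {0..t} = ennreal t" "emeasure unit_lebesgue {0..<t} = ennreal t" using that by simp_all
 qed
 interpret U: prob_space unit_lebesgue by (rule prob_space_unit_lebesgue)
 interpret M: prob_space \<mu> by (rule qu_prob[OF q])
 have meas: "{w\<in>{0..1}. fst (c w) \<in> A} \<in> sets unit_lebesgue" if A: "A \<in> sets unit_borel" for A
 proof -
  have A': "A \<times> {0..1} \<in> sets (unit_borel \<Otimes>\<^sub>M unit_borel)"
   using A sets.top[of unit_borel] by (intro pair_measureI) simp_all
  have "snd (c w) \<in> {0..1}" if w: "w \<in> {0..1}" for w
  proof (cases "w \<in> F")
   case False
   then obtain G where G: "G \<in> components ({0..1} - F)" "w \<in> G" using gap_exists[OF F w] by blast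
   then show ?thesis using c(2)[OF G] other_endpoint_in[OF F G(1)] by simp
  qed (use c(1) w in simp)
  then have "{w\<in>{0..1}. fst (c w) \<in> A} = {w\<in>{0..1}. c w \<in> A \<times> {0..1}}" by (auto simp: mem_Times_iff)
  moreover have "{w\<in>{0..1}. c w \<in> A \<times> {0..1}} \<in> sets unit_borel" by (rule component_pushforward(1)[OF F c A'])
  ultimately show ?thesis by (simp only: sets_unit_lebesgue)
 qed
 have ivl: "{0..t} \<in> sets unit_borel" "{0..<t} \<in> sets unit_borel" if "t \<in> {0..1}" for t
  using that by (auto intro!: sets_unit_lebesgueI)
 \<comment> \<open>For \<open>t\<close> in \<open>F\<close> the preimage of \<open>{0..<t}\<close>
   lies inside \<open>{0..<t}\<close> and that of \<open>{0..t}\<close> contains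
   \<open>{0..t}\<close>; the two measures then bound \<open>t\<close> as \<open>qu_set\<close>
   requires.\<close>
 have inF: "t \<in> qu_set \<mu>" if t: "t \<in> F" for t
 proof -
  have t01: "t \<in> {0..1}" using t F(2) by blast
  have s1: "{w\<in>{0..1}. fst (c w) \<in> {0..<t}} \<subseteq> {0..<t}"
  proof
   fix w assume w: "w \<in> {w\<in>{0..1}. fst (c w) \<in> {0..<t}}"
   then have "w \<in> {0..1}" by simp
   from cases[OF this] w t show "w \<in> {0..<t}" by fastforce
  qed
  have s2: "{0..t} \<subseteq> {w\<in>{0..1}. fst (c w) \<in> {0..t}}"
  proof
   fix w assume w: "w \<in> {0..t}"
   then have w01: "w \<in> {0..1}" using t01 by simp
   from cases[OF w01] show "w \<in> {w\<in>{0..1}. fst (c w) \<in> {0..t}}"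
   proof
    assume "w \<in> F & fst (c w) = w" then show ?thesis using w w01 by simp
   next
    assume "\<exists>G\<in>components ({0..1} - F). Inf G < w & w < Sup G & (\<forall>t\<in>F. t <= Inf G \<or> Sup G <= t) & fst (c w) = x G & Inf G <= x G & x G <= Sup G"
    then obtain G where G: "G \<in> components ({0..1} - F)" "Inf G < w" "t <= Inf G \<or> Sup G <= t" "fst (c w) = x G" "Inf G <= x G" "x G <= Sup G"
     using t by blast
    moreover have "0 <= Inf G" using gap_endpoints(3)[OF F G(1)] F(2) by auto
    ultimately show ?thesis using w w01 by auto
   qed
  qed
  have "emeasure \<mu> {0..<t} <= ennreal t"
   unfolding push[OF ivl(2)[OF t01]] U(2)[OF t01, symmetric] using s1 by (rule emeasure_mono) (use ivl t01 in \<open>simp add: sets_unit_lebesgue\<close>)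
  moreover have "ennreal t <= emeasure \<mu> {0..t}"
   unfolding push[OF ivl(1)[OF t01]] U(1)[OF t01, symmetric] using s2 by (rule emeasure_mono) (rule meas[OF ivl(1)[OF t01]])
  ultimately show ?thesis using t01 by (simp add: qu_set_def M.emeasure_eq_measure)
 qed
 \<comment> \<open>If the gap collapses to its left end, everything to the left of
   \<open>Sup G\<close> is mapped into \<open>{0..t}\<close>; if it collapses to its right end, only
   the points up to \<open>Inf G\<close> are. Either way the distribution function takes the
   endpoint that carries no atom, on the wrong side of \<open>t\<close>.\<close>
 have gap: "t \<notin> qu_set \<mu> & (x G = Inf G --> measure \<mu> {0..t} = Sup G) & (x G = Sup G --> measure \<mu> {0..t} = Inf G)"
  if G: "G \<in> components ({0..1} - F)" and t: "t \<in> G" for t G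
 proof -
  note g = gap_endpoints[OF F G]
  have tG: "Inf G < t" "t < Sup G" using t g(1) by (metis greaterThanLessThan_iff)+
  have e01: "Inf G \<in> {0..1}" "Sup G \<in> {0..1}" using g(3,4) F(2) by blast+
  have t01: "t \<in> {0..1}" using tG e01 by simp
  \<comment> \<open>A point outside \<open>G\<close> keeps its side of \<open>G\<close> under
    \<open>c\<close>, because \<open>Inf G\<close> and \<open>Sup G\<close> belong to
    \<open>F\<close>.\<close>
  have other: "w <= Inf G & fst (c w) <= Inf G & 0 <= fst (c w) \<or> Sup G <= w & Sup G <= fst (c w) \<or> (Inf G < w & w < Sup G & fst (c w) = x G)"
   if w: "w \<in> {0..1}" for w
  proof (cases "w \<in> G")
   case True
   then have "w \<in> {Inf G<..<Sup G}" using g(1) by blast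
   then show ?thesis using c(2)[OF G True] by simp
  next
   case False
   then have "w \<notin> {Inf G<..<Sup G}" using g(1) by blast
   then have w': "w <= Inf G \<or> Sup G <= w" by auto
   from cases[OF w] show ?thesis
   proof
    assume "w \<in> F & fst (c w) = w" then show ?thesis using w w' by auto
   next
    assume "\<exists>H\<in>components ({0..1} - F). Inf H < w & w < Sup H & (\<forall>t\<in>F. t <= Inf H \<or> Sup H <= t) & fst (c w) = x H & Inf H <= x H & x H <= Sup H"
    then obtain H where H: "H \<in> components ({0..1} - F)" "Inf H < w" "w < Sup H" "\<forall>t\<in>F. t <= Inf H \<or> Sup H <= t" "fst (c w) = x H" "Inf H <= x H" "x H <= Sup H" by blast
    have "0 <= Inf H" using gap_endpoints(3)[OF F H(1)] F(2) by auto
    moreover have "Inf G <= Inf H \<or> Sup H <= Inf G" "Sup G <= Inf H \<or> Sup H <= Sup G" using H(4) g(3,4) by blast+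
    ultimately show ?thesis using w' H by linarith
   qed
  qed
  from xG[OF G] show ?thesis
  proof
   assume x: "x G = Inf G"
   have e1: "{w\<in>{0..1}. fst (c w) \<in> {0..t}} = {0..<Sup G}" "{w\<in>{0..1}. fst (c w) \<in> {0..<t}} = {0..<Sup G}"
   proof -
    have "fst (c w) \<in> {0..t} \<longleftrightarrow> w < Sup G" "fst (c w) \<in> {0..<t} \<longleftrightarrow> w < Sup G" if "w \<in> {0..1}" for w
     using other[OF that] tG x e01 by auto
    then have "{w\<in>{0..1}. fst (c w) \<in> {0..t}} = {w\<in>{0..1}. w < Sup G}" "{w\<in>{0..1}. fst (c w) \<in> {0..<t}} = {w\<in>{0..1}. w < Sup G}"
     by (simp_all only: cong: conj_cong)
    moreover have "{w\<in>{0..1}. w < Sup G} = {0..<Sup G}" using e01 by auto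
    ultimately show "{w\<in>{0..1}. fst (c w) \<in> {0..t}} = {0..<Sup G}" "{w\<in>{0..1}. fst (c w) \<in> {0..<t}} = {0..<Sup G}"
     by (simp_all only:)
   qed
   have "emeasure \<mu> {0..t} = ennreal (Sup G)" "emeasure \<mu> {0..<t} = ennreal (Sup G)"
    unfolding push[OF ivl(1)[OF t01]] push[OF ivl(2)[OF t01]] e1 by (rule U(2)[OF e01(2)])+
   then have "measure \<mu> {0..t} = Sup G" "measure \<mu> {0..<t} = Sup G" using e01(2) by (simp_all add: measure_def)
   then show ?thesis using x tG g(2) by (simp add: qu_set_def)
  next
   assume x: "x G = Sup G"
   have e1: "{w\<in>{0..1}. fst (c w) \<in> {0..t}} = {0..Inf G}"
   proof -
    have "fst (c w) \<in> {0..t} \<longleftrightarrow> w <= Inf G" if "w \<in> {0..1}" for w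
     using other[OF that] tG x e01 by auto
    then have "{w\<in>{0..1}. fst (c w) \<in> {0..t}} = {w\<in>{0..1}. w <= Inf G}" by (simp only: cong: conj_cong)
    also have "... = {0..Inf G}" using e01 by auto
    finally show ?thesis .
   qed
   have "emeasure \<mu> {0..t} = ennreal (Inf G)"
    unfolding push[OF ivl(1)[OF t01]] e1 by (rule U(1)[OF e01(1)])
   then have "measure \<mu> {0..t} = Inf G" using e01(1) by (simp add: measure_def)
   then show ?thesis using x tG g(2) by (simp add: qu_set_def)
  qed
 qed
 have eqF: "F = qu_set \<mu>"
 proof
  show "qu_set \<mu> \<subseteq> F"
  proof
   fix t assume t: "t \<in> qu_set \<mu>"
   show "t \<in> F"
   proof (rule ccontr)
    assume "t \<notin> F"
    moreover have "t \<in> {0..1}" using t by (simp add: qu_set_def)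
    ultimately obtain G where "G \<in> components ({0..1} - F)" "t \<in> G" using gap_exists[OF F] by blast
    then show False using gap t by blast
   qed
  qed
 qed (use inF in blast)
 show ?thesis
 proof (cases "w \<in> F")
  case True
  then show ?thesis using c(1) qu_on_set unfolding eqF by (simp add: conj_map_def qu_fst_def qu_snd_def)
 next
  case False
  then obtain G where G: "G \<in> components ({0..1} - F)" "w \<in> G" using gap_exists[OF F w] by blast
  note g = gap_endpoints[OF F G(1)]
  from qu_gap_cases[OF q G(1)[unfolded eqF] G(2)] gap[OF G] xG[OF G(1)] g(2) c(2)[OF G]
  show ?thesis unfolding conj_map_def other_endpoint_def by auto
 qed
qed

lemma measurable_conj_map: "quasi_uniform \<mu> ==> conj_map \<mu> \<in> unit_lebesgue \<rightarrow>\<^sub>M unit_borel \<Otimes>\<^sub>M unit_borel"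
 unfolding conj_map_def[abs_def]
 by (intro measurable_Pair measurable_eq_sets[OF sets_unit_lebesgue] measurable_qu_fst1 measurable_qu_snd1)

text \<open>Resolves the definite description: the canonical decomposition gives existence, and
  every other decomposition collapses its gaps by the same map. From here on a conjugate pair is
  \<open>conj_map \<mu> V\<close> with \<open>V\<close> uniform.\<close>

lemma conjugate_law_eq:
 assumes q: "quasi_uniform \<mu>"
 shows "conjugate_law \<mu> = distr unit_lebesgue (unit_borel \<Otimes>\<^sub>M unit_borel) (conj_map \<mu>)"
 unfolding conjugate_law_def
proof (rule the_equality)
 let ?B = "unit_borel \<Otimes>\<^sub>M unit_borel"
 let ?D = "distr unit_lebesgue ?B (conj_map \<mu>)"
 note m = measurable_conj_map[OF q]
 have D: "emeasure ?D A = emeasure unit_lebesgue {w\<in>{0..1}. conj_map \<mu> w \<in> A}" if "A \<in> sets ?B" for A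
  using emeasure_distr[OF m that] by (simp add: vimage_def Int_def conj_commute)
 have c: "conj_map \<mu> w = (w, w)" if "w \<in> qu_set \<mu>" for w using that by (simp add: conj_map_def qu_fst_def qu_snd_def)
 have "conjugate_law_of (qu_set \<mu>) (%G. qu_fst \<mu> ((Inf G + Sup G) / 2)) ?D"
  unfolding conjugate_law_of_def
 proof (intro conjI ballI)
  fix A assume A: "A \<in> sets ?B"
  show "emeasure ?D A = (\<integral>\<^sup>+t\<in>qu_set \<mu>. indicator A (t, t) \<partial>unit_lebesgue) +
    (\<integral>\<^sup>+G. ennreal (Sup G - Inf G) * indicator A (qu_fst \<mu> ((Inf G + Sup G) / 2), other_endpoint G (qu_fst \<mu> ((Inf G + Sup G) / 2)))
     \<partial>count_space (components ({0..1} - qu_set \<mu>)))"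
   unfolding D[OF A] by (rule component_pushforward(2)[OF qu_set_facts[OF q] c qu_gap_map(1)[OF q] A])
 qed simp
 then show "\<exists>F x. qu_decomposition \<mu> F x & conjugate_law_of F x ?D"
  using qu_decomposition_exists[OF q] by blast
 fix N assume "\<exists>F x. qu_decomposition \<mu> F x & conjugate_law_of F x N"
 then obtain F x where d: "qu_decomposition \<mu> F x" and N: "conjugate_law_of F x N" by blast
 have F: "closed F" "F \<subseteq> {0..1}" "0 \<in> F" "1 \<in> F" using d by (auto simp: qu_decomposition_def)
 define gap where "gap w = (SOME G. G \<in> components ({0..1} - F) & w \<in> G)" for w
 define c' where "c' w = (if w \<in> F then (w, w) else (x (gap w), other_endpoint (gap w) (x (gap w))))" for w
 have c1: "c' w = (w, w)" if "w \<in> F" for w using that by (simp add: c'_def)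
 have c2: "c' w = (x G, other_endpoint G (x G))" if G: "G \<in> components ({0..1} - F)" "w \<in> G" for G w
 proof -
  have "gap w \<in> components ({0..1} - F) & w \<in> gap w" unfolding gap_def by (rule someI) (use G in blast)
  then have "gap w = G" using G components_nonoverlap[of "gap w" "{0..1} - F" G] by blast
  moreover have "w \<notin> F" using G in_components_subset by blast
  ultimately show ?thesis by (simp add: c'_def)
 qed
 have cc: "c' w = conj_map \<mu> w" if "w \<in> {0..1}" for w by (rule qu_decomposition_unique[OF q d c1 c2 that])
 show "N = ?D"
 proof (rule measure_eqI)
  show "sets N = sets ?D" using N by (simp add: conjugate_law_of_def)
  fix A assume "A \<in> sets N"
  then have A: "A \<in> sets ?B" using N by (simp add: conjugate_law_of_def)
  have "emeasure unit_lebesgue {w\<in>{0..1}. c' w \<in> A} = (\<integral>\<^sup>+t\<in>F. indicator A (t, t) \<partial>unit_lebesgue) +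
    (\<integral>\<^sup>+G. ennreal (Sup G - Inf G) * indicator A (x G, other_endpoint G (x G)) \<partial>count_space (components ({0..1} - F)))"
   by (rule component_pushforward(2)[OF F c1 c2 A])
  then have "emeasure N A = emeasure unit_lebesgue {w\<in>{0..1}. c' w \<in> A}"
   using N A by (simp add: conjugate_law_of_def)
  also have "{w\<in>{0..1}. c' w \<in> A} = {w\<in>{0..1}. conj_map \<mu> w \<in> A}" by (rule Collect_cong) (use cc in auto)
  finally show "emeasure N A = emeasure ?D A" by (simp add: D[OF A])
 qed
qed

section \<open>The coupling of conjugate pairs with uniform variables\<close>

lemma nn_integral_PiM_prod:
 assumes M: "prob_space M" and J: "finite J" "J \<subseteq> I" and g: "\<And>j. j \<in> J ==> g j \<in> borel_measurable M"
 shows "(\<integral>\<^sup>+x. (\<Prod>j\<in>J. g j (x j)) \<partial>PiM I (%_. M)) = (\<Prod>j\<in>J. \<integral>\<^sup>+x. g j x \<partial>M)"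
proof -
 interpret M: prob_space M by fact
 interpret P: product_prob_space "%_. M" I by standard
 have m: "(%x. \<Prod>j\<in>J. g j (x j)) \<in> borel_measurable (PiM J (%_. M))"
  by (rule borel_measurable_prod_ennreal) (rule measurable_compose[OF measurable_component_singleton], assumption, rule g)
 have r: "(%x. restrict x J) \<in> PiM I (%_. M) \<rightarrow>\<^sub>M PiM J (%_. M)" by (rule measurable_restrict_subset[OF J(2)])
 have "(\<integral>\<^sup>+x. (\<Prod>j\<in>J. g j (x j)) \<partial>PiM I (%_. M)) = (\<integral>\<^sup>+x. (\<Prod>j\<in>J. g j (restrict x J j)) \<partial>PiM I (%_. M))"
  by (intro nn_integral_cong prod.cong) auto
 also have "... = (\<integral>\<^sup>+x. (\<Prod>j\<in>J. g j (x j)) \<partial>distr (PiM I (%_. M)) (PiM J (%_. M)) (%x. restrict x J))"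
  by (rule nn_integral_distr[OF r, symmetric]) (simp add: m)
 also have "... = (\<integral>\<^sup>+x. (\<Prod>j\<in>J. g j (x j)) \<partial>PiM J (%_. M))"
  by (simp only: P.distr_PiM_restrict_finite[OF J])
 also have "... = (\<Prod>j\<in>J. \<integral>\<^sup>+x. g j x \<partial>M)" by (rule P.product_nn_integral_prod[OF J(1) g])
 finally show ?thesis .
qed

lemma measurable_pair_seq:
 assumes h: "h \<in> M \<Otimes>\<^sub>M N \<rightarrow>\<^sub>M L"
 shows "(%(x, y). \<lambda>i\<in>I. h (x i, y i)) \<in> PiM I (%_. M) \<Otimes>\<^sub>M PiM I (%_. N) \<rightarrow>\<^sub>M PiM I (%_. L)"
proof -
 have "(%z. \<lambda>i\<in>I. h (fst z i, snd z i)) \<in> PiM I (%_. M) \<Otimes>\<^sub>M PiM I (%_. N) \<rightarrow>\<^sub>M PiM I (%_. L)"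
 proof (rule measurable_restrict)
  fix i assume i: "i \<in> I"
  show "(%z. h (fst z i, snd z i)) \<in> PiM I (%_. M) \<Otimes>\<^sub>M PiM I (%_. N) \<rightarrow>\<^sub>M L"
   by (rule measurable_compose[OF measurable_Pair h])
    (rule measurable_compose[OF measurable_fst measurable_component_singleton[OF i]],
    rule measurable_compose[OF measurable_snd measurable_component_singleton[OF i]])
 qed
 then show ?thesis by (simp add: split_beta')
qed

text \<open>For a fixed first sequence, the preimage of a box is a box in the second sequence. Its
  probability is a product of functions of single coordinates, which integrates to the product of
  the coordinate integrals.\<close>

lemma distr_pair_PiM:
 assumes M: "prob_space M" and N: "prob_space N" and h: "h \<in> M \<Otimes>\<^sub>M N \<rightarrow>\<^sub>M L"
 shows "distr (PiM I (%_. M) \<Otimes>\<^sub>M PiM I (%_. N)) (PiM I (%_. L)) (%(x, y). \<lambda>i\<in>I. h (x i, y i))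
  = PiM I (%_. distr (M \<Otimes>\<^sub>M N) L h)" (is "?D = ?R")
proof (rule measure_eqI_PiM_infinite[where M="%_. distr (M \<Otimes>\<^sub>M N) L h", symmetric])
 interpret N: prob_space N by fact
 have prob: "prob_space (distr (M \<Otimes>\<^sub>M N) L h)" by (rule prob_space.prob_space_distr[OF prob_space_pair[OF M N] h])
 have PM: "prob_space (PiM I (%_. M))" and PN: "prob_space (PiM I (%_. N))" by (rule prob_space_PiM, rule M, rule prob_space_PiM, rule N)
 interpret PNs: prob_space "PiM I (%_. N)" by (rule PN)
 interpret PPN: product_prob_space "%_. N" I by standard
 note hm = measurable_pair_seq[OF h, of I]
 show "finite_measure ?R" by (intro prob_space.finite_measure prob_space_PiM prob)
 show "sets ?R = sets (PiM I (%_. distr (M \<Otimes>\<^sub>M N) L h))" by simp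
 show "sets ?D = sets (PiM I (%_. distr (M \<Otimes>\<^sub>M N) L h))"
  by (simp add: sets_PiM_cong[OF refl, of I "%_. L" "%_. distr (M \<Otimes>\<^sub>M N) L h"])
 fix A J assume J: "finite J" "J \<subseteq> I" and A': "\<And>i. i \<in> J ==> A i \<in> sets (distr (M \<Otimes>\<^sub>M N) L h)"
 have A: "A i \<in> sets L" if "i \<in> J" for i using A'[OF that] by simp
 define B where "B i = h -` A i \<inter> space (M \<Otimes>\<^sub>M N)" for i
 have B: "B i \<in> sets (M \<Otimes>\<^sub>M N)" if "i \<in> J" for i unfolding B_def by (rule measurable_sets[OF h A[OF that]])
 let ?E = "prod_emb I (%_. distr (M \<Otimes>\<^sub>M N) L h) J (Pi\<^sub>E J A)"
 have E: "?E \<in> sets (PiM I (%_. L))"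
 proof -
  have "?E = prod_emb I (%_. L) J (Pi\<^sub>E J A)" by (simp add: prod_emb_def)
  also have "... \<in> sets (PiM I (%_. L))" by (intro sets_PiM_I ballI J A)
  finally show ?thesis .
 qed
 let ?S = "PiM I (%_. M) \<Otimes>\<^sub>M PiM I (%_. N)"
 let ?X = "(%(x, y). \<lambda>i\<in>I. h (x i, y i)) -` ?E \<inter> space ?S"
 have X: "?X \<in> sets ?S" by (rule measurable_sets[OF hm E])
 have sec: "emeasure (PiM I (%_. N)) (Pair x -` ?X) = (\<Prod>j\<in>J. emeasure N (Pair (x j) -` B j))" if x: "x \<in> space (PiM I (%_. M))" for x
 proof -
  have xj: "x j \<in> space M" if "j \<in> I" for j using x that by (auto simp: space_PiM)
  have mem: "(x, y) \<in> ?X \<longleftrightarrow> (\<forall>j\<in>J. y j \<in> Pair (x j) -` B j)" if y: "y \<in> space (PiM I (%_. N))" for y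
  proof -
   have yj: "y j \<in> space N" if "j \<in> I" for j using y that by (auto simp: space_PiM)
   have hL: "h (x j, y j) \<in> space L" if "j \<in> I" for j
    using measurable_space[OF h, of "(x j, y j)"] xj[OF that] yj[OF that] by (simp add: space_pair_measure)
   have "(x, y) \<in> ?X \<longleftrightarrow> (\<lambda>i\<in>I. h (x i, y i)) \<in> ?E" using x y by (simp add: space_pair_measure)
   also have "... \<longleftrightarrow> (\<forall>j\<in>J. h (x j, y j) \<in> A j)"
    using J(2) hL by (auto simp: prod_emb_def PiE_iff subset_iff)
   also have "... \<longleftrightarrow> (\<forall>j\<in>J. y j \<in> Pair (x j) -` B j)"
    using J(2) xj yj by (auto simp: B_def space_pair_measure subset_iff)
   finally show ?thesis .
  qed
  have "Pair x -` ?X = {y\<in>space (PiM I (%_. N)). \<forall>j\<in>J. y j \<in> Pair (x j) -` B j}"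
   using mem by (auto simp: space_pair_measure)
  also have "emeasure (PiM I (%_. N)) \<dots> = (\<Prod>j\<in>J. emeasure N (Pair (x j) -` B j))"
   by (rule PPN.emeasure_PiM_Collect[OF J(2,1)]) (rule sets_Pair1[OF B])
  finally show ?thesis .
 qed
 have gm: "(%x. emeasure N (Pair x -` B j)) \<in> borel_measurable M" if "j \<in> J" for j
  by (rule N.measurable_emeasure_Pair[OF B[OF that]])
 have "emeasure ?D ?E = emeasure ?S ?X" by (rule emeasure_distr[OF hm E])
 also have "... = (\<integral>\<^sup>+x. emeasure (PiM I (%_. N)) (Pair x -` ?X) \<partial>PiM I (%_. M))"
  by (rule PNs.emeasure_pair_measure_alt[OF X])
 also have "... = (\<integral>\<^sup>+x. (\<Prod>j\<in>J. emeasure N (Pair (x j) -` B j)) \<partial>PiM I (%_. M))"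
  by (rule nn_integral_cong) (rule sec)
 also have "... = (\<Prod>j\<in>J. \<integral>\<^sup>+x. emeasure N (Pair x -` B j) \<partial>M)"
  by (rule nn_integral_PiM_prod[OF M J gm])
 also have "... = (\<Prod>j\<in>J. emeasure (distr (M \<Otimes>\<^sub>M N) L h) (A j))"
 proof (rule prod.cong[OF refl])
  fix j assume j: "j \<in> J"
  show "(\<integral>\<^sup>+x. emeasure N (Pair x -` B j) \<partial>M) = emeasure (distr (M \<Otimes>\<^sub>M N) L h) (A j)"
   unfolding emeasure_distr[OF h A[OF j]] B_def[symmetric] by (rule N.emeasure_pair_measure_alt[OF B[OF j], symmetric])
 qed
 also have "... = emeasure ?R ?E"
  by (rule emeasure_PiM_emb[symmetric, OF prob J(2,1) A'])
 finally show "emeasure ?R ?E = emeasure ?D ?E" by (rule sym)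
qed

lemma distr_PiM_iid:
 assumes M: "prob_space M" and f: "f \<in> M \<rightarrow>\<^sub>M L"
 shows "distr (PiM I (%_. M)) (PiM I (%_. L)) (%x. \<lambda>i\<in>I. f (x i)) = PiM I (%_. distr M L f)"
proof -
 let ?P = "PiM I (%_. M)"
 have PP: "prob_space ?P" by (rule prob_space_PiM) (rule M)
 interpret P: prob_space ?P by (rule PP)
 have h: "(%z. f (fst z)) \<in> M \<Otimes>\<^sub>M M \<rightarrow>\<^sub>M L" by (rule measurable_compose[OF measurable_fst f])
 have fm: "(%x. \<lambda>i\<in>I. f (x i)) \<in> ?P \<rightarrow>\<^sub>M PiM I (%_. L)"
  by (rule measurable_restrict) (rule measurable_compose[OF measurable_component_singleton], assumption, rule f)
 have "distr ?P (PiM I (%_. L)) (%x. \<lambda>i\<in>I. f (x i)) = distr (distr (?P \<Otimes>\<^sub>M ?P) ?P fst) (PiM I (%_. L)) (%x. \<lambda>i\<in>I. f (x i))"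
  by (simp only: P.distr_pair_fst)
 also have "... = distr (?P \<Otimes>\<^sub>M ?P) (PiM I (%_. L)) (%(x, y). \<lambda>i\<in>I. f (fst (x i, y i)))"
  by (subst distr_distr[OF fm measurable_fst]) (simp add: comp_def split_beta')
 also have "... = PiM I (%_. distr (M \<Otimes>\<^sub>M M) L (%z. f (fst z)))" by (rule distr_pair_PiM[OF M M h])
 also have "distr (M \<Otimes>\<^sub>M M) L (%z. f (fst z)) = distr (distr (M \<Otimes>\<^sub>M M) M fst) L f"
  by (subst distr_distr[OF f measurable_fst]) (simp add: comp_def)
 also have "... = distr M L f" by (simp only: prob_space.distr_pair_fst[OF M])
 finally show ?thesis .
qed

section \<open>Comparing mixtures of conjugate pairs\<close>

definition wmix :: "real => real \<times> real => real" where
 "wmix u p = u * fst p + (1 - u) * snd p"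

text \<open>Convex combinations stay in the hulls of the pairs, which touch in at most one point. As
  the weights are interior and the pairs differ, some inequality between the terms is
  strict.\<close>

lemma wmix_separated:
 assumes le: "max (fst p) (snd p) <= min (fst p') (snd p')" and ne: "p ~= p'"
  and u: "0 < u" "u < 1" and u': "0 < u'" "u' < 1"
 shows "wmix u p < wmix u' p'" "pair_less p p'" "\<not> pair_less p' p"
proof -
 obtain x y x' y' where p: "p = (x, y)" "p' = (x', y')" by (cases p, cases p') blast
 have le': "x <= x'" "x <= y'" "y <= x'" "y <= y'" using le by (simp_all add: p)
 have ne': "x ~= x' \<or> y ~= y'" using ne by (simp add: p)
 show "pair_less p p'" "\<not> pair_less p' p" using le' ne' by (auto simp: pair_less_def p)
 define m where "m = max x y"
 have m: "x <= m" "y <= m" "m <= x'" "m <= y'" using le' by (auto simp: m_def)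
 have a: "u * x <= u * m" "(1 - u) * y <= (1 - u) * m" "u' * m <= u' * x'" "(1 - u') * m <= (1 - u') * y'"
  using m u u' by (auto intro!: mult_left_mono)
 have "x < m \<or> y < m \<or> m < x' \<or> m < y'" using ne' m by auto
 then have "u * x < u * m \<or> (1 - u) * y < (1 - u) * m \<or> u' * m < u' * x' \<or> (1 - u') * m < (1 - u') * y'"
  using u u' by auto
 then have "u * x + (1 - u) * y < u' * x' + (1 - u') * y'" using a by (simp add: algebra_simps) linarith
 then show "wmix u p < wmix u' p'" by (simp add: wmix_def p)
qed

text \<open>For a repeated pair the mixture is affine in the weight with slope \<open>X - Y\<close>.
  This is the origin of the tie-breaking clause of \<open>pair_less\<close>: with increasing
  weights, the earlier index comes first exactly if \<open>X > Y\<close>.\<close>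

lemma wmix_same:
 assumes ne: "fst p ~= snd p" and u: "u < u'"
 shows "wmix u p < wmix u' p \<longleftrightarrow> snd p < fst p" "wmix u p ~= wmix u' p" "pair_less p p \<longleftrightarrow> snd p < fst p"
proof -
 have d: "wmix u' p - wmix u p = (u' - u) * (fst p - snd p)" by (simp add: wmix_def algebra_simps)
 have "0 < (u' - u) * (fst p - snd p) \<longleftrightarrow> snd p < fst p" using u by (simp add: zero_less_mult_iff)
 then show "wmix u p < wmix u' p \<longleftrightarrow> snd p < fst p" using d by linarith
 have "(u' - u) * (fst p - snd p) ~= 0" using u ne by simp
 then show "wmix u p ~= wmix u' p" using d by linarith
 show "pair_less p p \<longleftrightarrow> snd p < fst p" by (simp add: pair_less_def split_beta')
qed

lemma conj_map_cases:
 assumes q: "quasi_uniform \<mu>" and w: "w \<in> {0..1}"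
 obtains "w \<in> qu_set \<mu>" "conj_map \<mu> w = (w, w)"
 | G where "w \<notin> qu_set \<mu>" "G \<in> components ({0..1} - qu_set \<mu>)" "w \<in> G" "Inf G < w" "w < Sup G"
  "conj_map \<mu> w = (Inf G, Sup G) \<or> conj_map \<mu> w = (Sup G, Inf G)"
  "\<And>t. t \<in> qu_set \<mu> ==> t <= Inf G \<or> Sup G <= t" "Inf G \<in> qu_set \<mu>" "Sup G \<in> qu_set \<mu>"
proof (cases "w \<in> qu_set \<mu>")
 case True
 then show ?thesis using that(1) by (simp add: conj_map_def qu_fst_def qu_snd_def)
next
 case False
 note F = qu_set_facts[OF q]
 from gap_exists[OF F w False] obtain G where G: "G \<in> components ({0..1} - qu_set \<mu>)" "w \<in> G" by blast
 note g = gap_endpoints[OF F G(1)]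
 have w': "w \<in> {Inf G<..<Sup G}" using G(2) g(1) by blast
 have t: "t <= Inf G \<or> Sup G <= t" if "t \<in> qu_set \<mu>" for t
 proof -
  have "t \<notin> {Inf G<..<Sup G}" using g(1,5) that by blast
  then show ?thesis by auto
 qed
 have c: "conj_map \<mu> w = (Inf G, Sup G) \<or> conj_map \<mu> w = (Sup G, Inf G)"
  using qu_gap_cases[OF q G] by (auto simp: conj_map_def)
 show ?thesis by (rule that(2)[OF False G _ _ c t g(3,4)]) (use w' in auto)
qed

text \<open>Either both points lie in one gap and share their pair, or a point of
  \<open>qu_set\<close> separates their pairs.\<close>

lemma conj_map_order:
 assumes q: "quasi_uniform \<mu>" and v: "v \<in> {0..1}" "v' \<in> {0..1}" "v < v'"
 shows "conj_map \<mu> v = conj_map \<mu> v' & fst (conj_map \<mu> v) ~= snd (conj_map \<mu> v) \<or>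
  max (fst (conj_map \<mu> v)) (snd (conj_map \<mu> v)) <= min (fst (conj_map \<mu> v')) (snd (conj_map \<mu> v')) & conj_map \<mu> v ~= conj_map \<mu> v'"
proof (cases rule: conj_map_cases[OF q v(1)])
 case 1
 show ?thesis
 proof (cases rule: conj_map_cases[OF q v(2)])
  case a: 1
  then show ?thesis using 1 v(3) by simp
 next
  case (2 G')
  have "v <= Inf G'" using 2(7)[OF 1(1)] 2(5) v(3) by linarith
  then show ?thesis using 1 2(4,5,6) by auto
 qed
next
 case (2 G)
 show ?thesis
 proof (cases rule: conj_map_cases[OF q v(2)])
  case 1
  have "Sup G <= v'" using 2(7)[OF 1(1)] 2(4) v(3) by linarith
  then show ?thesis using 1 2(4,5,6) by auto
 next
  case b: (2 G')
  show ?thesis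
  proof (cases "v' \<in> G")
   case True
   have "conj_map \<mu> v = conj_map \<mu> v'" using qu_gap_const[OF q 2(2) 2(3) True] by (simp add: conj_map_def)
   then show ?thesis using 2(4,5,6) by auto
  next
   case False
   then have "v' \<notin> {Inf G<..<Sup G}" using gap_endpoints(1)[OF qu_set_facts[OF q] 2(2)] by blast
   then have "Sup G <= v'" using 2(4) v(3) by auto
   then have "Sup G <= Inf G'" using b(7)[OF 2(9)] b(5) by linarith
   then show ?thesis using 2(4,5,6) b(4,5,6) by auto
  qed
 qed
qed

text \<open>Comparing conjugate pairs, the earlier index first, is comparing the real numbers
  obtained by mixing them with weights that increase along the indices. All uses of the rule for
  \<lhd> rest on this identity.\<close>

lemma wmix_conj_order:
 assumes q: "quasi_uniform \<mu>" and v: "v \<in> {0..1}" "v' \<in> {0..1}" "v ~= v'"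
  and u: "0 < u" "u < u'" "u' < 1"
 shows "wmix u (conj_map \<mu> v) ~= wmix u' (conj_map \<mu> v')"
  "pair_less (conj_map \<mu> v) (conj_map \<mu> v') \<longleftrightarrow> wmix u (conj_map \<mu> v) < wmix u' (conj_map \<mu> v')"
proof -
 have u01: "u < 1" "0 < u'" using u by auto
 consider "conj_map \<mu> v = conj_map \<mu> v'" "fst (conj_map \<mu> v) ~= snd (conj_map \<mu> v)"
  | "max (fst (conj_map \<mu> v)) (snd (conj_map \<mu> v)) <= min (fst (conj_map \<mu> v')) (snd (conj_map \<mu> v'))" "conj_map \<mu> v ~= conj_map \<mu> v'"
  | "max (fst (conj_map \<mu> v')) (snd (conj_map \<mu> v')) <= min (fst (conj_map \<mu> v)) (snd (conj_map \<mu> v))" "conj_map \<mu> v' ~= conj_map \<mu> v"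
  using conj_map_order[OF q v(1,2)] conj_map_order[OF q v(2,1)] v(3) by (metis linorder_neqE_linordered_idom)
 then have "wmix u (conj_map \<mu> v) ~= wmix u' (conj_map \<mu> v') \<and>
  (pair_less (conj_map \<mu> v) (conj_map \<mu> v') \<longleftrightarrow> wmix u (conj_map \<mu> v) < wmix u' (conj_map \<mu> v'))"
 proof cases
  case 1
  then show ?thesis using wmix_same[OF 1(2) u(2)] by simp
 next
  case 2
  then show ?thesis using wmix_separated[OF 2 u(1) u01(1) u01(2) u(3)] by simp
 next
  case 3
  then show ?thesis using wmix_separated[OF 3 u01(2) u(3) u(1) u01(1)] by simp
 qed
 then show "wmix u (conj_map \<mu> v) ~= wmix u' (conj_map \<mu> v')"
  "pair_less (conj_map \<mu> v) (conj_map \<mu> v') \<longleftrightarrow> wmix u (conj_map \<mu> v) < wmix u' (conj_map \<mu> v')" by blast+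
qed

text \<open>The relation of \<open>Z_relation\<close> for pairs indexed by a linearly ordered type; the positive integers
  are needed next to the integers.\<close>

definition conj_rel :: "real measure => ('i::linorder => real) => 'i rel" where
 "conj_rel \<mu> v = {(i, j). (i < j & pair_less (conj_map \<mu> (v i)) (conj_map \<mu> (v j))) \<or> (j < i & \<not> pair_less (conj_map \<mu> (v j)) (conj_map \<mu> (v i)))}"

lemma Z_relation_conj: "Z_relation (%i. conj_map \<mu> (v i)) = conj_rel \<mu> v"
 by (simp add: Z_relation_def conj_rel_def)

lemma conj_rel_iff:
 assumes q: "quasi_uniform \<mu>" and v: "v i \<in> {0..1}" "v j \<in> {0..1}" "v i ~= v j"
  and u: "\<And>k. k \<in> {i, j} ==> 0 < u k & u k < 1" "u i < u j \<longleftrightarrow> i < j" "u j < u i \<longleftrightarrow> j < i"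
 shows "(i, j) \<in> conj_rel \<mu> v \<longleftrightarrow> wmix (u i) (conj_map \<mu> (v i)) < wmix (u j) (conj_map \<mu> (v j))"
  "wmix (u i) (conj_map \<mu> (v i)) ~= wmix (u j) (conj_map \<mu> (v j))"
proof -
 have ij: "i ~= j" using v(3) by auto
 have u01: "0 < u i" "u i < 1" "0 < u j" "u j < 1" using u(1) by auto
 have "((i, j) \<in> conj_rel \<mu> v \<longleftrightarrow> wmix (u i) (conj_map \<mu> (v i)) < wmix (u j) (conj_map \<mu> (v j))) \<and>
  wmix (u i) (conj_map \<mu> (v i)) ~= wmix (u j) (conj_map \<mu> (v j))"
 proof (cases "i < j")
  case True
  then have lt: "u i < u j" using u(2) by simp
  from True have "\<not> j < i" by simp
  from wmix_conj_order[OF q v u01(1) lt u01(4)] True \<open>\<not> j < i\<close> show ?thesis by (simp add: conj_rel_def)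
 next
  case False
  then have ji: "j < i" using ij by simp
  then have "u j < u i" using u(3) by simp
  from wmix_conj_order[OF q v(2,1) v(3)[symmetric] u01(3) this u01(2)] ji False
  show ?thesis by (auto simp: conj_rel_def)
 qed
 then show "(i, j) \<in> conj_rel \<mu> v \<longleftrightarrow> wmix (u i) (conj_map \<mu> (v i)) < wmix (u j) (conj_map \<mu> (v j))"
  "wmix (u i) (conj_map \<mu> (v i)) ~= wmix (u j) (conj_map \<mu> (v j))" by blast+
qed

lemma conj_rel_ordering:
 fixes v :: "int => real"
 assumes q: "quasi_uniform \<mu>" and v: "\<And>i. v i \<in> {0..1}" "inj v"
 shows "conj_rel \<mu> v \<in> orderings UNIV"
proof -
 \<comment> \<open>Any strictly increasing map of the integers into the open unit interval would do.
   It realises the relation by comparing the numbers \<open>W i\<close>, which gives transitivity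
   and totality at once.\<close>
 define u where "u i = (arctan (real_of_int i) + pi / 2) / pi" for i
 have u01: "0 < u i" "u i < 1" for i
  using arctan_lbound[of "real_of_int i"] arctan_ubound[of "real_of_int i"] pi_gt_zero by (auto simp: u_def field_simps)
 have um: "u i < u j \<longleftrightarrow> i < j" for i j
  using pi_gt_zero by (simp add: u_def divide_less_cancel arctan_less_iff)
 define W where "W i = wmix (u i) (conj_map \<mu> (v i))" for i
 have iff: "(i, j) \<in> conj_rel \<mu> v \<longleftrightarrow> W i < W j" "W i ~= W j" if "i ~= j" for i j
 proof -
  have "v i ~= v j" using v(2) that by (auto dest: injD)
  from conj_rel_iff[OF q, of v i j u, OF v(1) v(1) this] u01 um
  show "(i, j) \<in> conj_rel \<mu> v \<longleftrightarrow> W i < W j" "W i ~= W j" by (simp_all add: W_def)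
 qed
 have "conj_rel \<mu> v = {(i, j) \<in> UNIV \<times> UNIV. W i < W j}"
 proof -
  have "(i, j) \<in> conj_rel \<mu> v \<longleftrightarrow> W i < W j" for i j
   using iff(1)[of i j] by (cases "i = j") (auto simp: conj_rel_def)
  then show ?thesis by auto
 qed
 moreover have "inj_on W UNIV" using iff(2) by (meson injI)
 ultimately show ?thesis using orderings_less_image[of W UNIV] by simp
qed

section \<open>The law of the ordering of the integers as an image of uniform variables\<close>

definition conj_order :: "real measure => (int => real) => int rel" where
 "conj_order \<mu> v = to_ordering UNIV (conj_rel \<mu> v)"

lemma measurable_qu_borel:
 assumes f: "f \<in> N \<rightarrow>\<^sub>M QU_space" and g: "g \<in> N \<rightarrow>\<^sub>M unit_borel"
 shows "(%x. fst (conj_map (f x) (g x))) \<in> borel_measurable N" "(%x. snd (conj_map (f x) (g x))) \<in> borel_measurable N"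
proof -
 have p: "(%x. (f x, g x)) \<in> N \<rightarrow>\<^sub>M QU_space \<Otimes>\<^sub>M unit_borel" using f g by (rule measurable_Pair)
 show "(%x. fst (conj_map (f x) (g x))) \<in> borel_measurable N"
  unfolding conj_map_def fst_conv snd_conv by (rule measurable_compose[OF measurable_compose[OF p measurable_qu_fst] measurable_unit_borel_borel, unfolded fst_conv snd_conv])
 show "(%x. snd (conj_map (f x) (g x))) \<in> borel_measurable N"
  unfolding conj_map_def fst_conv snd_conv by (rule measurable_compose[OF measurable_compose[OF p measurable_qu_snd] measurable_unit_borel_borel, unfolded fst_conv snd_conv])
qed

lemma sets_conj_rel:
 fixes v :: "'x => 'i::linorder => real"
 assumes f: "f \<in> N \<rightarrow>\<^sub>M QU_space" and i: "(%x. v x i) \<in> N \<rightarrow>\<^sub>M unit_borel" and j: "(%x. v x j) \<in> N \<rightarrow>\<^sub>M unit_borel"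
 shows "{x\<in>space N. (i, j) \<in> conj_rel (f x) (v x)} \<in> sets N"
proof -
 note m = measurable_qu_borel[OF f i] measurable_qu_borel[OF f j]
 have pl: "{x\<in>space N. pair_less (conj_map (f x) (a x)) (conj_map (f x) (b x))} \<in> sets N"
  if "a \<in> N \<rightarrow>\<^sub>M unit_borel" "b \<in> N \<rightarrow>\<^sub>M unit_borel" for a b
 proof -
  note A = measurable_qu_borel[OF f that(1)] and B = measurable_qu_borel[OF f that(2)]
  have "{x\<in>space N. pair_less (conj_map (f x) (a x)) (conj_map (f x) (b x))} =
   {x\<in>space N. fst (conj_map (f x) (a x)) < fst (conj_map (f x) (b x))} \<union> {x\<in>space N. snd (conj_map (f x) (a x)) < snd (conj_map (f x) (b x))} \<union>
   ({x\<in>space N. fst (conj_map (f x) (a x)) = fst (conj_map (f x) (b x))} \<inter> {x\<in>space N. snd (conj_map (f x) (a x)) = snd (conj_map (f x) (b x))} \<inter>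
    {x\<in>space N. snd (conj_map (f x) (a x)) < fst (conj_map (f x) (a x))})"
   by (auto simp: pair_less_def split_beta')
  also have "... \<in> sets N" by (intro sets.Un sets.Int borel_measurable_less borel_measurable_eq A B)
  finally show ?thesis .
 qed
 have eq: "{x\<in>space N. (i, j) \<in> conj_rel (f x) (v x)} = (if i < j then {x\<in>space N. pair_less (conj_map (f x) (v x i)) (conj_map (f x) (v x j))}
  else if j < i then space N - {x\<in>space N. pair_less (conj_map (f x) (v x j)) (conj_map (f x) (v x i))} else {})"
  by (auto simp: conj_rel_def)
 show ?thesis unfolding eq using pl[OF i j] pl[OF j i] by (simp add: sets.compl_sets)
qed

lemma measurable_unit_seq_unit: "i \<in> I ==> (%x. x i) \<in> unit_seq I \<rightarrow>\<^sub>M unit_borel"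
 using measurable_component_singleton[of i I "%_. unit_lebesgue"] measurable_cong_sets[OF refl sets_unit_lebesgue] by blast

lemma measurable_conj_order: "(%x. conj_order (fst x) (snd x)) \<in> QU_space \<Otimes>\<^sub>M unit_seq UNIV \<rightarrow>\<^sub>M Z_orderings"
 unfolding conj_order_def
proof (rule measurable_to_ordering)
 fix p :: "int \<times> int"
 show "{x \<in> space (QU_space \<Otimes>\<^sub>M unit_seq UNIV). p \<in> conj_rel (fst x) (snd x)} \<in> sets (QU_space \<Otimes>\<^sub>M unit_seq UNIV)"
  using sets_conj_rel[of fst "QU_space \<Otimes>\<^sub>M unit_seq UNIV" snd "fst p" "snd p"]
   measurable_compose[OF measurable_snd measurable_unit_seq_unit[of _ UNIV]] by simp
qed auto

lemma measurable_conj_order1: "quasi_uniform \<mu> ==> conj_order \<mu> \<in> unit_seq UNIV \<rightarrow>\<^sub>M Z_orderings"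
 using measurable_compose[OF measurable_Pair1'[of \<mu> QU_space "unit_seq UNIV"] measurable_conj_order] by (simp add: space_QU)

lemma P_mu_eq:
 assumes q: "quasi_uniform \<mu>" shows "P_mu \<mu> = distr (unit_seq UNIV) Z_orderings (conj_order \<mu>)"
proof -
 let ?B = "unit_borel \<Otimes>\<^sub>M unit_borel"
 note m = measurable_conj_map[OF q]
 have s: "(%x. \<lambda>i\<in>UNIV. conj_map \<mu> (x i)) \<in> unit_seq UNIV \<rightarrow>\<^sub>M PiM (UNIV :: int set) (%_. ?B)"
  by (rule measurable_restrict) (rule measurable_compose[OF measurable_component_singleton], assumption, rule m)
 have pb: "{x \<in> space (PiM UNIV (%_. ?B)). pair_less (x i) (x j)} \<in> sets (PiM (UNIV :: int set) (%_. ?B))" for i j :: int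
 proof -
  let ?P = "PiM (UNIV :: int set) (%_. ?B)"
  have c: "(%x. x k) \<in> ?P \<rightarrow>\<^sub>M ?B" for k :: int by (rule measurable_component_singleton) simp
  have f: "(%x. fst (x k)) \<in> borel_measurable ?P" "(%x. snd (x k)) \<in> borel_measurable ?P" for k :: int
   by (rule measurable_compose[OF measurable_compose[OF c measurable_fst] measurable_unit_borel_borel])
    (rule measurable_compose[OF measurable_compose[OF c measurable_snd] measurable_unit_borel_borel])
  have "{x \<in> space ?P. pair_less (x i) (x j)} = {x\<in>space ?P. fst (x i) < fst (x j)} \<union> {x\<in>space ?P. snd (x i) < snd (x j)} \<union>
   ({x\<in>space ?P. fst (x i) = fst (x j)} \<inter> {x\<in>space ?P. snd (x i) = snd (x j)} \<inter> {x\<in>space ?P. snd (x i) < fst (x i)})"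
   by (auto simp: pair_less_def split_beta')
  also have "... \<in> sets ?P" by (intro sets.Un sets.Int borel_measurable_less borel_measurable_eq f)
  finally show ?thesis .
 qed
 have z: "(%\<omega>. to_ordering UNIV (Z_relation \<omega>)) \<in> PiM UNIV (%_. ?B) \<rightarrow>\<^sub>M Z_orderings"
 proof (rule measurable_to_ordering)
  fix p :: "int \<times> int"
  let ?P = "PiM (UNIV :: int set) (%_. ?B)"
  have eq: "{x \<in> space ?P. p \<in> Z_relation x} = (if fst p < snd p then {x \<in> space ?P. pair_less (x (fst p)) (x (snd p))}
   else if snd p < fst p then space ?P - {x \<in> space ?P. pair_less (x (snd p)) (x (fst p))} else {})"
   by (cases p) (auto simp: Z_relation_def)
  show "{x \<in> space ?P. p \<in> Z_relation x} \<in> sets ?P" unfolding eq using pb by (simp add: sets.compl_sets)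
 qed auto
 have "P_mu \<mu> = distr (distr (unit_seq UNIV) (PiM UNIV (%_. ?B)) (%x. \<lambda>i\<in>UNIV. conj_map \<mu> (x i))) Z_orderings (%\<omega>. to_ordering UNIV (Z_relation \<omega>))"
  unfolding P_mu_def conjugate_law_eq[OF q] distr_PiM_iid[OF prob_space_unit_lebesgue m] ..
 also have "... = distr (unit_seq UNIV) Z_orderings (conj_order \<mu>)"
  by (subst distr_distr[OF z s]) (simp add: comp_def conj_order_def[abs_def] Z_relation_conj restrict_UNIV)
 finally show ?thesis .
qed

lemma P_mu_prob: "quasi_uniform \<mu> ==> P_mu \<mu> \<in> space (prob_algebra Z_orderings)"
 by (simp add: P_mu_eq space_prob_algebra prob_space.prob_space_distr[OF prob_space_unit_seq measurable_conj_order1])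

lemma measurable_P_mu: "P_mu \<in> QU_space \<rightarrow>\<^sub>M prob_algebra Z_orderings"
proof (rule measurable_cong[THEN iffD2])
 show "(%\<mu>. distr (unit_seq UNIV) Z_orderings (conj_order \<mu>)) \<in> QU_space \<rightarrow>\<^sub>M prob_algebra Z_orderings"
 proof (rule measurable_distr_prob_space2)
  show "(%\<mu>. unit_seq UNIV) \<in> QU_space \<rightarrow>\<^sub>M prob_algebra (unit_seq (UNIV :: int set))"
   by (rule measurable_const) (simp add: space_prob_algebra prob_space_unit_seq)
  show "(%(x, y). conj_order x y) \<in> QU_space \<Otimes>\<^sub>M unit_seq UNIV \<rightarrow>\<^sub>M Z_orderings"
   using measurable_conj_order by (simp add: split_beta')
 qed
qed (simp add: space_QU P_mu_eq)

lemma unit_seq_range: "x \<in> space (unit_seq I) ==> i \<in> I ==> x i \<in> {0..1}"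
 using PiE_mem[of x I "%_. {0..1}" i] by (simp add: space_PiM)

text \<open>The relation uses indices only through their order, which an increasing \<open>f\<close>
  preserves, and an i.i.d. sequence keeps its law when reindexed injectively.\<close>

lemma P_mu_invariant:
 assumes q: "quasi_uniform \<mu>" shows "I_invariant (P_mu \<mu>)"
 unfolding I_invariant_def
proof (intro conjI allI impI P_mu_prob[OF q])
 fix f :: "int => int" assume f: "strict_mono f"
 let ?U = "unit_seq (UNIV :: int set)"
 let ?r = "%\<omega>. \<lambda>n\<in>UNIV. \<omega> (f n)"
 note m = measurable_conj_order1[OF q]
 have inj: "inj f" by (rule strict_mono_imp_inj_on[OF f])
 note hm = measurable_hat_map[OF inj]
 have rm: "?r \<in> ?U \<rightarrow>\<^sub>M ?U" by (rule measurable_restrict) (rule measurable_component_singleton, simp)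
 have re: "distr ?U ?U ?r = ?U"
  using distr_PiM_reindex[of UNIV "%_. unit_lebesgue" f UNIV] inj prob_space_unit_lebesgue by simp
 have "distr (P_mu \<mu>) Z_orderings (hat_map f) = distr ?U Z_orderings (hat_map f \<circ> conj_order \<mu>)"
  unfolding P_mu_eq[OF q] by (rule distr_distr[OF hm m])
 also have "... = distr ?U Z_orderings (conj_order \<mu> \<circ> ?r)"
 proof (rule distr_cong_AE[OF refl refl])
  show "AE v in ?U. (hat_map f \<circ> conj_order \<mu>) v = (conj_order \<mu> \<circ> ?r) v"
   using AE_unit_seq_inj[of "UNIV :: int set", OF countableI_type] AE_space[of ?U]
  proof (elim AE_mp, intro AE_I2 impI)
   fix v assume v: "v \<in> space ?U" and i: "inj v"
   have v01: "v i \<in> {0..1}" for i by (rule unit_seq_range[OF v]) simp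
   have iv: "inj (%n. v (f n))" using i inj by (auto simp: inj_def)
   have o1: "conj_order \<mu> v = conj_rel \<mu> v" unfolding conj_order_def by (rule to_ordering_id[OF conj_rel_ordering[OF q v01 i]])
   have o2: "conj_order \<mu> (%n. v (f n)) = conj_rel \<mu> (%n. v (f n))"
    unfolding conj_order_def by (rule to_ordering_id[OF conj_rel_ordering[OF q v01 iv]])
   have "hat_map f (conj_rel \<mu> v) = conj_rel \<mu> (%n. v (f n))"
    using strict_mono_less[OF f] by (simp add: hat_map_def conj_rel_def)
   then show "(hat_map f \<circ> conj_order \<mu>) v = (conj_order \<mu> \<circ> ?r) v" by (simp add: restrict_UNIV o1 o2)
  qed
  show "hat_map f \<circ> conj_order \<mu> \<in> ?U \<rightarrow>\<^sub>M Z_orderings" by (rule measurable_comp[OF m hm])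
  show "conj_order \<mu> \<circ> ?r \<in> ?U \<rightarrow>\<^sub>M Z_orderings" by (rule measurable_comp[OF rm m])
 qed
 also have "... = distr (distr ?U ?U ?r) Z_orderings (conj_order \<mu>)" by (rule distr_distr[OF m rm, symmetric])
 also have "... = P_mu \<mu>" by (simp only: re P_mu_eq[OF q])
 finally show "distr (P_mu \<mu>) Z_orderings (hat_map f) = P_mu \<mu>" .
qed

section \<open>The kernels of quasi-uniform measures\<close>

lemma measurable_unit_lebesgue_unit_borel: "f \<in> N \<rightarrow>\<^sub>M unit_lebesgue ==> f \<in> N \<rightarrow>\<^sub>M unit_borel"
 using measurable_cong_sets[OF refl sets_unit_lebesgue] by blast

lemma wmix_range:
 assumes a: "u \<in> {0..1}" "fst p \<in> {0..1}" "snd p \<in> {0..1}"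
 shows "wmix u p \<in> {0..1}"
proof -
 have "u * fst p + (1 - u) * snd p <= u * 1 + (1 - u) * 1" using a by (intro add_mono mult_left_mono) simp_all
 moreover have "0 <= u * fst p + (1 - u) * snd p" using a by simp
 ultimately show ?thesis by (simp add: wmix_def)
qed

lemma measurable_wmix_unit:
 assumes f: "f \<in> N \<rightarrow>\<^sub>M unit_borel" and p: "p \<in> N \<rightarrow>\<^sub>M unit_borel \<Otimes>\<^sub>M unit_borel"
 shows "(%z. wmix (f z) (p z)) \<in> N \<rightarrow>\<^sub>M unit_borel"
proof (rule measurable_unit_borelI)
 note fb = measurable_compose[OF f measurable_unit_borel_borel]
 note p1 = measurable_compose[OF measurable_compose[OF p measurable_fst] measurable_unit_borel_borel]
 note p2 = measurable_compose[OF measurable_compose[OF p measurable_snd] measurable_unit_borel_borel]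
 show "(%z. wmix (f z) (p z)) \<in> borel_measurable N"
  unfolding wmix_def by (intro borel_measurable_add borel_measurable_times borel_measurable_diff borel_measurable_const fb p1 p2)
 fix z assume z: "z \<in> space N"
 show "wmix (f z) (p z) \<in> {0..1}"
  using measurable_space[OF f z] measurable_space[OF p z] by (intro wmix_range) (auto simp: space_pair_measure)
qed

lemma measurable_nu_wmix:
 assumes q: "quasi_uniform \<mu>"
 shows "(%z. (wmix (fst z) (conj_map \<mu> (snd z)), fst z)) \<in> unit_lebesgue \<Otimes>\<^sub>M unit_lebesgue \<rightarrow>\<^sub>M unit_borel \<Otimes>\<^sub>M unit_borel"
proof -
 have f: "fst \<in> unit_lebesgue \<Otimes>\<^sub>M unit_lebesgue \<rightarrow>\<^sub>M unit_borel"
  by (rule measurable_unit_lebesgue_unit_borel[OF measurable_fst])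
 show ?thesis
  by (rule measurable_Pair[OF measurable_wmix_unit[OF f measurable_compose[OF measurable_snd measurable_conj_map[OF q]]] f])
qed

lemma nu_upper_wmix:
 assumes q: "quasi_uniform \<mu>"
 shows "nu_upper \<mu> = distr (unit_lebesgue \<Otimes>\<^sub>M unit_lebesgue) (unit_borel \<Otimes>\<^sub>M unit_borel)
  (%z. (wmix (fst z) (conj_map \<mu> (snd z)), fst z))"
proof -
 let ?U = unit_lebesgue
 let ?B = "unit_borel \<Otimes>\<^sub>M unit_borel"
 note m = measurable_conj_map[OF q]
 have ps: "prob_space (distr ?U ?B (conj_map \<mu>))" by (rule prob_space.prob_space_distr[OF prob_space_unit_lebesgue m])
 have pair: "?U \<Otimes>\<^sub>M distr ?U ?B (conj_map \<mu>) = distr (?U \<Otimes>\<^sub>M ?U) (?U \<Otimes>\<^sub>M ?B) (%(x, y). (x, conj_map \<mu> y))"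
  using pair_measure_distr[OF measurable_ident_sets[OF refl, of ?U] m prob_space_imp_sigma_finite[OF ps]] by (simp only: distr_id)
 have g1: "(%(x, y). (x, conj_map \<mu> y)) \<in> ?U \<Otimes>\<^sub>M ?U \<rightarrow>\<^sub>M ?U \<Otimes>\<^sub>M ?B"
  by (simp only: split_beta') (rule measurable_Pair[OF measurable_fst measurable_compose[OF measurable_snd m]])
 have f: "fst \<in> ?U \<Otimes>\<^sub>M ?B \<rightarrow>\<^sub>M unit_borel" by (rule measurable_unit_lebesgue_unit_borel[OF measurable_fst])
 have g2': "(%z. (fst z, wmix (fst z) (snd z))) \<in> ?U \<Otimes>\<^sub>M ?B \<rightarrow>\<^sub>M ?B"
  by (rule measurable_Pair[OF f measurable_wmix_unit[OF f measurable_snd]])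
 have g2: "(%(u, (x, y)). (u, u * x + (1 - u) * y)) \<in> ?U \<Otimes>\<^sub>M ?B \<rightarrow>\<^sub>M ?B"
  using g2' by (simp add: wmix_def split_beta')
 have g3: "(%(x, y). (y, x)) \<in> ?B \<rightarrow>\<^sub>M ?B" by (rule measurable_pair_swap')
 have "nu_upper \<mu> = distr (?U \<Otimes>\<^sub>M ?U) ?B ((%(x, y). (y, x)) \<circ> ((%(u, (x, y)). (u, u * x + (1 - u) * y)) \<circ> (%(x, y). (x, conj_map \<mu> y))))"
  unfolding nu_upper_def nu_lower_def conjugate_law_eq[OF q] pair
  by (simp only: distr_distr[OF g2 g1] distr_distr[OF g3 measurable_comp[OF g1 g2]])
 also have "(%(x, y). (y, x)) \<circ> ((%(u, (x, y)). (u, u * x + (1 - u) * y)) \<circ> (%(x, y). (x, conj_map \<mu> y))) =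
  (%z. (wmix (fst z) (conj_map \<mu> (snd z)), fst z))"
  by (rule ext) (simp add: comp_def split_beta' wmix_def)
 finally show ?thesis .
qed

text \<open>Turns real-valued maps that are known to lie in the unit interval only on the relevant
  set into total measurable maps into \<open>unit_borel\<close>.\<close>

definition clamp01 :: "real => real" where
 "clamp01 t = max 0 (min 1 t)"

lemma clamp01_id: "t \<in> {0..1} ==> clamp01 t = t"
 by (simp add: clamp01_def)

lemma clamp01_range: "0 <= clamp01 t" "clamp01 t <= 1"
 unfolding clamp01_def max_def min_def by simp_all

lemma measurable_clamp01:
 assumes f: "f \<in> borel_measurable N" shows "(%x. clamp01 (f x)) \<in> N \<rightarrow>\<^sub>M unit_borel"
proof (rule measurable_unit_borelI)
 have "clamp01 \<in> borel_measurable borel"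
  unfolding clamp01_def[abs_def] by (intro borel_measurable_continuous_onI continuous_intros)
 then show "(%x. clamp01 (f x)) \<in> borel_measurable N" by (rule measurable_compose[OF f])
 show "clamp01 (f x) \<in> {0..1}" for x by (simp only: atLeastAtMost_iff clamp01_range)
qed

text \<open>If \<open>W\<close> and \<open>\<xi>\<close> are independent and uniform, then \<open>(W, hat_coord \<mu> W \<xi>)\<close> has the law \<open>nu_upper \<mu>\<close>: on a
  component of the complement of \<open>F\<close> the equation \<open>W = U X + (1 - U) Y\<close> determines \<open>U\<close>.\<close>

definition hat_coord :: "real measure => real => real => real" where
 "hat_coord \<mu> w \<xi> = (if w \<in> qu_set \<mu> then \<xi> else (w - qu_snd \<mu> w) / (qu_fst \<mu> w - qu_snd \<mu> w))"

lemma measurable_hat_coord: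
 assumes f: "f \<in> N \<rightarrow>\<^sub>M QU_space" and g: "g \<in> N \<rightarrow>\<^sub>M unit_borel" and h: "h \<in> borel_measurable N"
 shows "(%z. hat_coord (f z) (g z) (h z)) \<in> borel_measurable N"
proof -
 have p: "(%z. (f z, g z)) \<in> N \<rightarrow>\<^sub>M QU_space \<Otimes>\<^sub>M unit_borel" using f g by (rule measurable_Pair)
 have eq: "{z\<in>space N. g z \<in> qu_set (f z)} = (%z. (f z, g z)) -` {x\<in>space (QU_space \<Otimes>\<^sub>M unit_borel). snd x \<in> qu_set (fst x)} \<inter> space N"
  using measurable_space[OF p] by auto
 have s: "{z\<in>space N. g z \<in> qu_set (f z)} \<in> sets N" unfolding eq by (rule measurable_sets[OF p measurable_qu_set])
 have m: "(%z. qu_fst (f z) (g z)) \<in> borel_measurable N" "(%z. qu_snd (f z) (g z)) \<in> borel_measurable N"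
  by (rule measurable_compose[OF measurable_compose[OF p measurable_qu_fst] measurable_unit_borel_borel, unfolded fst_conv snd_conv],
   rule measurable_compose[OF measurable_compose[OF p measurable_qu_snd] measurable_unit_borel_borel, unfolded fst_conv snd_conv])
 note gb = measurable_compose[OF g measurable_unit_borel_borel]
 show ?thesis unfolding hat_coord_def
  by (rule measurable_If) (intro h borel_measurable_divide borel_measurable_diff m gb s)+
qed

lemma hat_coord_range:
 assumes q: "quasi_uniform \<mu>" and w: "w \<in> {0..1}" and x: "\<xi> \<in> {0..1}"
 shows "hat_coord \<mu> w \<xi> \<in> {0..1}"
proof (cases rule: conj_map_cases[OF q w])
 case 1
 then show ?thesis using x by (simp add: hat_coord_def)
next
 case (2 G)
 then show ?thesis by (auto simp: hat_coord_def conj_map_def divide_simps)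
qed

lemma measurable_nu_hat:
 assumes q: "quasi_uniform \<mu>"
 shows "(%z. (fst z, hat_coord \<mu> (fst z) (snd z))) \<in> unit_lebesgue \<Otimes>\<^sub>M unit_lebesgue \<rightarrow>\<^sub>M unit_borel \<Otimes>\<^sub>M unit_borel"
proof -
 let ?N = "unit_lebesgue \<Otimes>\<^sub>M unit_lebesgue"
 have f: "fst \<in> ?N \<rightarrow>\<^sub>M unit_borel" and s: "snd \<in> ?N \<rightarrow>\<^sub>M unit_borel"
  by (rule measurable_unit_lebesgue_unit_borel[OF measurable_fst], rule measurable_unit_lebesgue_unit_borel[OF measurable_snd])
 have c: "(%_. \<mu>) \<in> ?N \<rightarrow>\<^sub>M QU_space" by (rule measurable_const) (simp add: space_QU q)
 have sb: "snd \<in> borel_measurable ?N" using measurable_compose[OF s measurable_unit_borel_borel] by simp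
 have "(%z. hat_coord \<mu> (fst z) (snd z)) \<in> ?N \<rightarrow>\<^sub>M unit_borel"
 proof (rule measurable_unit_borelI)
  show "(%z. hat_coord \<mu> (fst z) (snd z)) \<in> borel_measurable ?N" by (rule measurable_hat_coord[OF c f sb])
  fix z assume "z \<in> space ?N"
  then show "hat_coord \<mu> (fst z) (snd z) \<in> {0..1}" by (intro hat_coord_range[OF q]) (auto simp: space_pair_measure)
 qed
 then show ?thesis by (rule measurable_Pair[OF f])
qed

text \<open>The unit interval splits into \<open>F\<close> and countably many gaps. Pointwise
  equality is asked on \<open>F\<close> only; on a gap equality of the integrals suffices, which
  leaves room for a change of variables there.\<close>

lemma nn_integral_unit_cong_gaps:
 assumes F: "closed F" "F \<subseteq> {0..1}" "0 \<in> F" "1 \<in> F"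
  and m: "f \<in> borel_measurable unit_lebesgue" "g \<in> borel_measurable unit_lebesgue"
  and eqF: "\<And>w. w \<in> F ==> f w = g w"
  and eqG: "\<And>G. G \<in> components ({0..1} - F) ==>
   (\<integral>\<^sup>+w. f w * indicator G w \<partial>unit_lebesgue) = (\<integral>\<^sup>+w. g w * indicator G w \<partial>unit_lebesgue)"
 shows "(\<integral>\<^sup>+w. f w \<partial>unit_lebesgue) = (\<integral>\<^sup>+w. g w \<partial>unit_lebesgue)"
proof -
 let ?U = unit_lebesgue
 let ?C = "components ({0..1} - F)"
 have s: "F \<in> sets ?U" "\<And>G. G \<in> ?C ==> G \<in> sets ?U" using F_sets[OF F] gap_sets[OF F] by (simp_all add: sets_unit_lebesgue)
 have un: "\<Union>?C = {0..1} - F" by (rule Union_components)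
 have split: "(\<integral>\<^sup>+w. h w \<partial>?U) = (\<integral>\<^sup>+w. h w * indicator F w \<partial>?U) + (\<integral>\<^sup>+G. (\<integral>\<^sup>+w. h w * indicator G w \<partial>?U) \<partial>count_space ?C)"
  if h: "h \<in> borel_measurable ?U" for h :: "real => ennreal"
 proof -
  let ?D = "density ?U h"
  have sp: "space ?U = F \<union> \<Union>?C" using F(2) un by auto
  have cU: "\<Union>?C \<in> sets ?D" using sets.countable_Union[OF gaps_countable[OF F], of ?D] s(2) by auto
  have df: "disjoint_family_on (%G. G) ?C" unfolding disjoint_family_on_def using components_nonoverlap by blast
  have "(\<integral>\<^sup>+w. h w \<partial>?U) = emeasure ?D (space ?U)"
   by (subst emeasure_density[OF h sets.top]) (rule nn_integral_cong, simp)
  also have "... = emeasure ?D F + emeasure ?D (\<Union>?C)"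
   unfolding sp by (rule plus_emeasure[symmetric]) (use s(1) cU un in auto)
  also have "emeasure ?D (\<Union>?C) = (\<integral>\<^sup>+G. emeasure ?D G \<partial>count_space ?C)"
   using emeasure_UN_countable[OF _ gaps_countable[OF F] df, of ?D] s(2) by simp
  also have "... = (\<integral>\<^sup>+G. (\<integral>\<^sup>+w. h w * indicator G w \<partial>?U) \<partial>count_space ?C)"
   by (rule nn_integral_cong) (simp add: emeasure_density[OF h s(2)])
  also have "emeasure ?D F = (\<integral>\<^sup>+w. h w * indicator F w \<partial>?U)" by (rule emeasure_density[OF h s(1)])
  finally show ?thesis .
 qed
 have "(\<integral>\<^sup>+w. f w * indicator F w \<partial>?U) = (\<integral>\<^sup>+w. g w * indicator F w \<partial>?U)"
  by (rule nn_integral_cong) (simp add: eqF indicator_def)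
 moreover have "(\<integral>\<^sup>+G. (\<integral>\<^sup>+w. f w * indicator G w \<partial>?U) \<partial>count_space ?C) = (\<integral>\<^sup>+G. (\<integral>\<^sup>+w. g w * indicator G w \<partial>?U) \<partial>count_space ?C)"
  by (rule nn_integral_cong) (simp add: eqG)
 ultimately show ?thesis by (simp only: split[OF m(1)] split[OF m(2)])
qed

lemma affine_mem_open_interval:
 fixes a b :: real
 assumes ab: "a < b" and xy: "x = b & y = a \<or> x = a & y = b"
 shows "y + (x - y) * u \<in> {a<..<b} \<longleftrightarrow> u \<in> {0<..<1}"
proof -
 have d: "0 < b - a" using ab by simp
 have k: "0 < (b - a) * u \<longleftrightarrow> 0 < u" "(b - a) * u < (b - a) \<longleftrightarrow> u < 1"
  using d mult_less_cancel_left_pos[OF d, of u 1] by (simp_all add: zero_less_mult_iff)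
 have n: "(a - b) * u = - ((b - a) * u)" by (simp add: algebra_simps)
 have "y + (x - y) * u \<in> {a<..<b} \<longleftrightarrow> 0 < (b - a) * u & (b - a) * u < (b - a)"
  using xy
 proof (elim disjE conjE)
  assume "x = b" "y = a"
  then show ?thesis unfolding greaterThanLessThan_iff by (simp only:) (safe; linarith)
 next
  assume "x = a" "y = b"
  then show ?thesis unfolding greaterThanLessThan_iff by (simp only: n) (safe; linarith)
 qed
 then show ?thesis using k by simp
qed

text \<open>The substitution \<open>w = y + (x - y) * u\<close> carries the unit interval onto the
  gap, reversing it when the atom is the left endpoint, and has Jacobian \<open>b - a\<close> in
  both cases.\<close>

lemma gap_integral_affine:
 assumes ab: "a < b" "0 <= a" "b <= 1" and xy: "x = b & y = a \<or> x = a & y = b"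
  and A: "A \<in> sets (unit_borel \<Otimes>\<^sub>M unit_borel)"
 shows "(\<integral>\<^sup>+w. indicator A (w, (w - y) / (x - y)) * indicator {a<..<b} w \<partial>unit_lebesgue) =
  (\<integral>\<^sup>+u. indicator A (wmix u (x, y), u) \<partial>unit_lebesgue) * ennreal (b - a)"
proof -
 have xy': "x ~= y" "\<bar>x - y\<bar> = b - a" using xy ab(1) by auto
 \<comment> \<open>Clamping makes the integrand a Borel function on the whole line, as the
   substitution rule requires; on the gap it changes nothing.\<close>
 define f :: "real => ennreal" where "f w = indicator A (clamp01 w, clamp01 ((w - y) / (x - y))) * indicator {a<..<b} w" for w
 have pm: "(%w. (clamp01 w, clamp01 ((w - y) / (x - y)))) \<in> borel \<rightarrow>\<^sub>M unit_borel \<Otimes>\<^sub>M unit_borel"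
  by (intro measurable_Pair measurable_clamp01 borel_measurable_divide borel_measurable_diff borel_measurable_const measurable_ident_sets refl)
 have fm: "f \<in> borel_measurable borel"
  unfolding f_def[abs_def]
  by (intro borel_measurable_times_ennreal measurable_compose[OF pm borel_measurable_indicator[OF A]] borel_measurable_indicator) simp
 have sp: "{0..1::real} \<inter> space lborel \<in> sets lborel" by simp
 have cl: "clamp01 w = w" "clamp01 ((w - y) / (x - y)) = (w - y) / (x - y)" if w: "w \<in> {a<..<b}" for w
 proof -
  show "clamp01 w = w" using w ab by (intro clamp01_id) auto
  show "clamp01 ((w - y) / (x - y)) = (w - y) / (x - y)" using w xy by (intro clamp01_id) (auto simp: divide_simps)
 qed
 have "(\<integral>\<^sup>+w. indicator A (w, (w - y) / (x - y)) * indicator {a<..<b} w \<partial>unit_lebesgue) = (\<integral>\<^sup>+w. f w \<partial>lborel)"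
  unfolding unit_lebesgue_def nn_integral_restrict_space[OF sp]
 proof (rule nn_integral_cong)
  fix w :: real
  show "indicator A (w, (w - y) / (x - y)) * indicator {a<..<b} w * indicator {0..1} w = f w"
  proof (cases "w \<in> {a<..<b}")
   case True
   then have "w \<in> {0..1}" using ab by auto
   then show ?thesis using True by (simp only: f_def cl[OF True] indicator_simps mult_1_right)
  next
   case False
   then show ?thesis by (simp add: f_def del: greaterThanLessThan_iff)
  qed
 qed
 also have "... = ennreal (b - a) * (\<integral>\<^sup>+u. f (y + (x - y) * u) \<partial>lborel)"
  using nn_integral_real_affine[OF fm, of "x - y" y] xy' by simp
 also have "(\<integral>\<^sup>+u. f (y + (x - y) * u) \<partial>lborel) = (\<integral>\<^sup>+u. indicator A (wmix u (x, y), u) * indicator {0..1} u \<partial>lborel)"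
 proof (rule nn_integral_cong_AE)
  show "AE u in lborel. f (y + (x - y) * u) = indicator A (wmix u (x, y), u) * indicator {0..1} u"
   using AE_lborel_singleton[of 0] AE_lborel_singleton[of 1]
  proof (eventually_elim)
   fix u :: real assume u: "u ~= 0" "u ~= 1"
   have w: "y + (x - y) * u = wmix u (x, y)" by (simp add: wmix_def algebra_simps)
   have v: "(y + (x - y) * u - y) / (x - y) = u" using xy'(1) by simp
   show "f (y + (x - y) * u) = indicator A (wmix u (x, y), u) * indicator {0..1} u"
   proof (cases "u \<in> {0<..<1}")
    case True
    then have m: "y + (x - y) * u \<in> {a<..<b}" using affine_mem_open_interval[OF ab(1) xy] by simp
    have "u \<in> {0..1}" using True by auto
    then show ?thesis unfolding f_def cl(1)[OF m] cl(2)[OF m] unfolding v using m by (simp only: indicator_simps w)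
   next
    case False
    then have m: "y + (x - y) * u \<notin> {a<..<b}" using affine_mem_open_interval[OF ab(1) xy] by simp
    have "u \<notin> {0..1}" using False u by auto
    then show ?thesis using m by (simp only: f_def indicator_simps mult_zero_right not_False_eq_True)
   qed
  qed
 qed
 also have "... = (\<integral>\<^sup>+u. indicator A (wmix u (x, y), u) \<partial>unit_lebesgue)"
  unfolding unit_lebesgue_def nn_integral_restrict_space[OF sp] ..
 finally show ?thesis by (simp only: mult.commute)
qed

text \<open>Disintegrates the law over its first coordinate, starting from the description by a
  weight and a conjugate pair in \<open>nu_upper_wmix\<close>. On \<open>F\<close> the mixture is
  the point itself and the weight is free. On a gap the pair is fixed and the weight determines the
  mixture affinely, so the two descriptions agree after integration over the gap.\<close>

lemma nu_upper_hat:
 assumes q: "quasi_uniform \<mu>"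
 shows "nu_upper \<mu> = distr (unit_lebesgue \<Otimes>\<^sub>M unit_lebesgue) (unit_borel \<Otimes>\<^sub>M unit_borel)
  (%z. (fst z, hat_coord \<mu> (fst z) (snd z)))"
 unfolding nu_upper_wmix[OF q]
proof (rule measure_eqI)
 let ?U = unit_lebesgue
 let ?B = "unit_borel \<Otimes>\<^sub>M unit_borel"
 let ?h = "%z. (wmix (fst z) (conj_map \<mu> (snd z)), fst z)"
 let ?k = "%z. (fst z, hat_coord \<mu> (fst z) (snd z))"
 interpret U: prob_space ?U by (rule prob_space_unit_lebesgue)
 interpret UU: pair_sigma_finite ?U ?U by standard
 note m1 = measurable_nu_wmix[OF q] and m2 = measurable_nu_hat[OF q]
 show "sets (distr (?U \<Otimes>\<^sub>M ?U) ?B ?h) = sets (distr (?U \<Otimes>\<^sub>M ?U) ?B ?k)" by simp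
 fix A assume "A \<in> sets (distr (?U \<Otimes>\<^sub>M ?U) ?B ?h)"
 then have A: "A \<in> sets ?B" by simp
 define f :: "real => ennreal" where "f v = (\<integral>\<^sup>+u. indicator A (wmix u (conj_map \<mu> v), u) \<partial>?U)" for v
 define g :: "real => ennreal" where "g w = (\<integral>\<^sup>+x. indicator A (w, hat_coord \<mu> w x) \<partial>?U)" for w
 have i1: "(%z. indicator A (?h z) :: ennreal) \<in> borel_measurable (?U \<Otimes>\<^sub>M ?U)" by (rule measurable_compose[OF m1 borel_measurable_indicator[OF A]])
 have i2: "(%z. indicator A (?k z) :: ennreal) \<in> borel_measurable (?U \<Otimes>\<^sub>M ?U)" by (rule measurable_compose[OF m2 borel_measurable_indicator[OF A]])
 have e: "emeasure (distr (?U \<Otimes>\<^sub>M ?U) ?B h) A = (\<integral>\<^sup>+z. indicator A (h z) \<partial>(?U \<Otimes>\<^sub>M ?U))"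
  if h: "h \<in> ?U \<Otimes>\<^sub>M ?U \<rightarrow>\<^sub>M ?B" for h
 proof -
  have "emeasure (distr (?U \<Otimes>\<^sub>M ?U) ?B h) A = (\<integral>\<^sup>+x. indicator A x \<partial>distr (?U \<Otimes>\<^sub>M ?U) ?B h)" using A by simp
  also have "... = (\<integral>\<^sup>+z. indicator A (h z) \<partial>(?U \<Otimes>\<^sub>M ?U))" by (rule nn_integral_distr[OF h]) (simp add: borel_measurable_indicator[OF A])
  finally show ?thesis .
 qed
 have fm: "f \<in> borel_measurable ?U"
  using U.borel_measurable_nn_integral_fst[OF measurable_compose[OF measurable_pair_swap' i1]] by (simp add: f_def[abs_def])
 have gm: "g \<in> borel_measurable ?U"
  using U.borel_measurable_nn_integral_fst[OF i2] by (simp add: g_def[abs_def])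
 have ef: "emeasure (distr (?U \<Otimes>\<^sub>M ?U) ?B ?h) A = (\<integral>\<^sup>+v. f v \<partial>?U)"
  unfolding e[OF m1] f_def using UU.nn_integral_snd[OF i1] by simp
 have eg: "emeasure (distr (?U \<Otimes>\<^sub>M ?U) ?B ?k) A = (\<integral>\<^sup>+w. g w \<partial>?U)"
  unfolding e[OF m2] g_def using U.nn_integral_fst[OF i2] by simp
 have "(\<integral>\<^sup>+v. f v \<partial>?U) = (\<integral>\<^sup>+w. g w \<partial>?U)"
 proof (rule nn_integral_unit_cong_gaps[OF qu_set_facts[OF q] fm gm])
  fix w assume w: "w \<in> qu_set \<mu>"
  then have c: "conj_map \<mu> w = (w, w)" by (simp add: conj_map_def qu_fst_def qu_snd_def)
  have "wmix u (w, w) = w" for u by (simp add: wmix_def algebra_simps)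
  then show "f w = g w" by (simp add: f_def g_def c hat_coord_def w)
 next
  fix G assume G: "G \<in> components ({0..1} - qu_set \<mu>)"
  note ge = gap_endpoints[OF qu_set_facts[OF q] G]
  have le: "0 <= Inf G" "Sup G <= 1" using ge(3,4) qu_set_facts(2)[OF q] by auto
  obtain x where x: "x = Inf G \<or> x = Sup G" and c: "\<And>w. w \<in> G ==> conj_map \<mu> w = (x, other_endpoint G x)"
  proof -
   have "(Inf G + Sup G) / 2 \<in> {Inf G<..<Sup G}" using ge(2) by auto
   then have "(Inf G + Sup G) / 2 \<in> G" using ge(1) by blast
   from qu_gap_map(2)[OF q G this] show ?thesis using that qu_gap_map(1)[OF q G] by blast
  qed
  define y where "y = other_endpoint G x"
  have xy: "x = Sup G & y = Inf G \<or> x = Inf G & y = Sup G"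
   using x ge(2) by (auto simp: y_def other_endpoint_def)
  have qs: "qu_fst \<mu> w = x" "qu_snd \<mu> w = y" if "w \<in> G" for w
   using c[OF that] by (simp_all add: conj_map_def y_def)
  have "(\<integral>\<^sup>+v. f v * indicator G v \<partial>?U) = (\<integral>\<^sup>+v. (\<integral>\<^sup>+u. indicator A (wmix u (x, y), u) \<partial>?U) * indicator G v \<partial>?U)"
   by (rule nn_integral_cong) (simp add: f_def c y_def split: split_indicator)
  also have "... = (\<integral>\<^sup>+u. indicator A (wmix u (x, y), u) \<partial>?U) * emeasure ?U G"
   by (rule nn_integral_cmult_indicator) (simp add: sets_unit_lebesgue gap_sets[OF qu_set_facts[OF q] G])
  also have "emeasure ?U G = ennreal (Sup G - Inf G)"
  proof -
   have "emeasure ?U {Inf G<..<Sup G} = emeasure lborel {Inf G<..<Sup G}"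
    by (rule emeasure_unit_lebesgue) (use le in auto)
   also have "... = ennreal (Sup G - Inf G)" using ge(2) by simp
   finally show ?thesis by (simp only: ge(1)[symmetric])
  qed
  also have "(\<integral>\<^sup>+u. indicator A (wmix u (x, y), u) \<partial>?U) * ennreal (Sup G - Inf G) =
   (\<integral>\<^sup>+w. indicator A (w, (w - y) / (x - y)) * indicator {Inf G<..<Sup G} w \<partial>?U)"
   by (rule gap_integral_affine[OF ge(2) le xy A, symmetric])
  also have "... = (\<integral>\<^sup>+w. g w * indicator G w \<partial>?U)"
  proof (rule nn_integral_cong)
   fix w
   show "indicator A (w, (w - y) / (x - y)) * indicator {Inf G<..<Sup G} w = g w * indicator G w"
   proof (cases "w \<in> G")
    case True
    have w: "w \<notin> qu_set \<mu>" using ge(5) True by blast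
    have "g w = (\<integral>\<^sup>+x'. indicator A (w, (w - y) / (x - y)) \<partial>?U)"
     unfolding g_def hat_coord_def using w qs[OF True] by simp
    also have "... = indicator A (w, (w - y) / (x - y))" using U.emeasure_space_1 by simp
    finally show ?thesis by (simp only: ge(1)[symmetric])
   next
    case False
    then have "w \<notin> {Inf G<..<Sup G}" using ge(1) by blast
    then show ?thesis using False by (simp only: indicator_simps mult_zero_right not_False_eq_True)
   qed
  qed
  finally show "(\<integral>\<^sup>+w. f w * indicator G w \<partial>?U) = (\<integral>\<^sup>+w. g w * indicator G w \<partial>?U)" .
 qed
 then show "emeasure (distr (?U \<Otimes>\<^sub>M ?U) ?B ?h) A = emeasure (distr (?U \<Otimes>\<^sub>M ?U) ?B ?k) A"
  by (simp only: ef eg)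
qed

section \<open>The joint law of the two rank orders of i.i.d. pairs\<close>

lemma rank_order_cong:
 assumes "\<And>k. k \<in> {1..} ==> u k = v k" shows "rank_order u = rank_order v"
proof -
 have "N_relation u = N_relation v" unfolding N_relation_def by (intro set_eqI) (auto simp: assms)
 then show ?thesis by (simp only: rank_order_def)
qed

lemma rank_pair_law:
 fixes \<nu> :: "(real \<times> real) measure"
 assumes h: "h \<in> unit_lebesgue \<Otimes>\<^sub>M unit_lebesgue \<rightarrow>\<^sub>M unit_borel \<Otimes>\<^sub>M unit_borel"
  and \<nu>: "\<nu> = distr (unit_lebesgue \<Otimes>\<^sub>M unit_lebesgue) (unit_borel \<Otimes>\<^sub>M unit_borel) h"
 shows "prob_space (PiM {1..} (%_::nat. \<nu>))"
  "(%\<omega>. (rank_order (%k. fst (\<omega> k)), rank_order (%k. snd (\<omega> k)))) \<in> PiM {1..} (%_. \<nu>) \<rightarrow>\<^sub>M N_orderings \<Otimes>\<^sub>M N_orderings"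
  "(%z. (rank_order (%k. fst (h (fst z k, snd z k))), rank_order (%k. snd (h (fst z k, snd z k))))) \<in>
   unit_seq {1..} \<Otimes>\<^sub>M unit_seq {1..} \<rightarrow>\<^sub>M N_orderings \<Otimes>\<^sub>M N_orderings"
  "distr (PiM {1..} (%_. \<nu>)) (N_orderings \<Otimes>\<^sub>M N_orderings) (%\<omega>. (rank_order (%k. fst (\<omega> k)), rank_order (%k. snd (\<omega> k)))) =
  distr (unit_seq {1..} \<Otimes>\<^sub>M unit_seq {1..}) (N_orderings \<Otimes>\<^sub>M N_orderings)
   (%z. (rank_order (%k. fst (h (fst z k, snd z k))), rank_order (%k. snd (h (fst z k, snd z k)))))"
proof -
 let ?U = unit_lebesgue
 let ?B = "unit_borel \<Otimes>\<^sub>M unit_borel"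
 let ?P = "PiM {1::nat..} (%_. ?B)"
 let ?S = "unit_seq {1::nat..}"
 let ?H = "%(x, y). \<lambda>i\<in>{1::nat..}. h (x i, y i)"
 let ?R = "%\<omega>. (rank_order (%k. fst (\<omega> k)), rank_order (%k. snd (\<omega> k)))"
 let ?Q = "%z. (rank_order (%k. fst (h (fst z k, snd z k))), rank_order (%k. snd (h (fst z k, snd z k))))"
 note pU = prob_space_unit_lebesgue
 have "prob_space \<nu>" unfolding \<nu> by (rule prob_space.prob_space_distr[OF prob_space_pair[OF pU pU] h])
 then show "prob_space (PiM {1..} (%_::nat. \<nu>))" by (rule prob_space_PiM)
 have Meq: "PiM {1..} (%_. \<nu>) = distr (?S \<Otimes>\<^sub>M ?S) ?P ?H"
  unfolding \<nu> by (rule distr_pair_PiM[OF pU pU h, symmetric])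
 have c: "(%\<omega>. \<omega> i) \<in> ?P \<rightarrow>\<^sub>M ?B" if "i \<in> {1..}" for i by (rule measurable_component_singleton[OF that])
 have RP: "?R \<in> ?P \<rightarrow>\<^sub>M N_orderings \<Otimes>\<^sub>M N_orderings"
 proof (rule measurable_Pair; rule measurable_rank_order)
  fix i :: nat assume i: "i \<in> {1..}"
  show "(%\<omega>. fst (\<omega> i)) \<in> borel_measurable ?P"
   by (rule measurable_compose[OF measurable_compose[OF c[OF i] measurable_fst] measurable_unit_borel_borel])
  show "(%\<omega>. snd (\<omega> i)) \<in> borel_measurable ?P"
   by (rule measurable_compose[OF measurable_compose[OF c[OF i] measurable_snd] measurable_unit_borel_borel])
 qed
 have HM: "?H \<in> ?S \<Otimes>\<^sub>M ?S \<rightarrow>\<^sub>M ?P" by (rule measurable_pair_seq[OF h])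
 show "?R \<in> PiM {1..} (%_. \<nu>) \<rightarrow>\<^sub>M N_orderings \<Otimes>\<^sub>M N_orderings"
  unfolding Meq measurable_distr_eq1 by (rule RP)
 have RH: "?R \<circ> ?H = ?Q"
 proof (rule ext)
  fix z
  have "rank_order (%k. fst (?H z k)) = rank_order (%k. fst (h (fst z k, snd z k)))"
   by (rule rank_order_cong) (simp add: split_beta')
  moreover have "rank_order (%k. snd (?H z k)) = rank_order (%k. snd (h (fst z k, snd z k)))"
   by (rule rank_order_cong) (simp add: split_beta')
  ultimately show "(?R \<circ> ?H) z = ?Q z" by (simp only: comp_def)
 qed
 show "?Q \<in> ?S \<Otimes>\<^sub>M ?S \<rightarrow>\<^sub>M N_orderings \<Otimes>\<^sub>M N_orderings"
  using measurable_comp[OF HM RP] by (simp only: RH)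
 show "distr (PiM {1..} (%_. \<nu>)) (N_orderings \<Otimes>\<^sub>M N_orderings) ?R = distr (?S \<Otimes>\<^sub>M ?S) (N_orderings \<Otimes>\<^sub>M N_orderings) ?Q"
  unfolding Meq distr_distr[OF RP HM] RH ..
qed

definition hat_law :: "real measure => nat rel set => nat rel set => real" where
 "hat_law \<mu> B A = measure (PiM {1..} (%_::nat. nu_upper \<mu>))
  {w\<in>space (PiM {1..} (%_. nu_upper \<mu>)). rank_order (%k. fst (w k)) \<in> B & rank_order (%k. snd (w k)) \<in> A}"

text \<open>The map \<open>h\<close> is left open because two representations are used:
  \<open>nu_upper_wmix\<close> links the joint law to \<open>P_mu\<close>, and
  \<open>nu_upper_hat\<close> exhibits the conditional law.\<close>

lemma hat_law_eq:
 assumes h: "h \<in> unit_lebesgue \<Otimes>\<^sub>M unit_lebesgue \<rightarrow>\<^sub>M unit_borel \<Otimes>\<^sub>M unit_borel"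
  and \<nu>: "nu_upper \<mu> = distr (unit_lebesgue \<Otimes>\<^sub>M unit_lebesgue) (unit_borel \<Otimes>\<^sub>M unit_borel) h"
  and B: "B \<in> sets N_orderings" and A: "A \<in> sets N_orderings"
 shows "hat_law \<mu> B A = measure (unit_seq {1..} \<Otimes>\<^sub>M unit_seq {1..})
  {z\<in>space (unit_seq {1..} \<Otimes>\<^sub>M unit_seq {1..}). rank_order (%k. fst (h (fst z k, snd z k))) \<in> B & rank_order (%k. snd (h (fst z k, snd z k))) \<in> A}"
proof -
 note L = rank_pair_law[OF h \<nu>]
 have BA: "B \<times> A \<in> sets (N_orderings \<Otimes>\<^sub>M N_orderings)" using B A by (rule pair_measureI)
 have "hat_law \<mu> B A = measure (distr (PiM {1..} (%_. nu_upper \<mu>)) (N_orderings \<Otimes>\<^sub>M N_orderings)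
  (%\<omega>. (rank_order (%k. fst (\<omega> k)), rank_order (%k. snd (\<omega> k))))) (B \<times> A)"
  unfolding hat_law_def measure_distr[OF L(2) BA] by (rule arg_cong[where f="measure _"]) auto
 also have "... = measure (unit_seq {1..} \<Otimes>\<^sub>M unit_seq {1..})
  {z\<in>space (unit_seq {1..} \<Otimes>\<^sub>M unit_seq {1..}). rank_order (%k. fst (h (fst z k, snd z k))) \<in> B & rank_order (%k. snd (h (fst z k, snd z k))) \<in> A}"
  unfolding L(4) measure_distr[OF L(3) BA] by (rule arg_cong[where f="measure _"]) auto
 finally show ?thesis .
qed

lemma distr_pair_snd_prob:
 assumes M: "prob_space M" shows "distr (M \<Otimes>\<^sub>M M) M snd = M"
proof -
 interpret M: prob_space M by fact
 interpret P: pair_sigma_finite M M by standard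
 have "distr (M \<Otimes>\<^sub>M M) M fst = distr (distr (M \<Otimes>\<^sub>M M) (M \<Otimes>\<^sub>M M) (%(x, y). (y, x))) M fst"
  by (simp only: P.distr_pair_swap[symmetric])
 also have "... = distr (M \<Otimes>\<^sub>M M) M (fst \<circ> (%(x, y). (y, x)))"
  by (rule distr_distr[OF measurable_fst measurable_pair_swap'])
 also have "... = distr (M \<Otimes>\<^sub>M M) M snd"
  by (rule arg_cong[where f="distr _ _"]) (simp add: fun_eq_iff)
 finally show ?thesis unfolding M.distr_pair_fst by (rule sym)
qed

text \<open>By \<open>nu_upper_hat\<close> the first coordinates are i.i.d. uniform, so the ordering
  conditioned on is \<open>uniform_ordering\<close>, and the kernel condition becomes an integral
  identity against it.\<close>

lemma hat_kernel_iff: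
 assumes q: "quasi_uniform \<mu>"
 shows "is_hat_kernel (nu_upper \<mu>) K \<longleftrightarrow> is_kernel K \<and>
  (\<forall>B\<in>sets N_orderings. \<forall>A\<in>sets N_orderings. hat_law \<mu> B A = (\<integral>r. indicator B r * measure (K r) A \<partial>uniform_ordering))"
proof -
 let ?M = "PiM {1..} (%_::nat. nu_upper \<mu>)"
 let ?S = "unit_seq {1::nat..}"
 let ?R = "%\<omega>. rank_order (%k. fst (\<omega> k :: real \<times> real))"
 let ?R' = "%\<omega>. rank_order (%k. snd (\<omega> k :: real \<times> real))"
 note L = rank_pair_law[OF measurable_nu_hat[OF q] nu_upper_hat[OF q]]
 have R: "?R \<in> ?M \<rightarrow>\<^sub>M N_orderings" using measurable_compose[OF L(2) measurable_fst] by simp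
 have R': "?R' \<in> ?M \<rightarrow>\<^sub>M N_orderings" using measurable_compose[OF L(2) measurable_snd] by simp
 have id: "(%r. r) \<in> N_orderings \<rightarrow>\<^sub>M N_orderings" by (rule measurable_ident_sets[OF refl])
 have law: "distr ?M N_orderings ?R = uniform_ordering"
 proof -
  have "distr ?M N_orderings ?R = distr (distr ?M (N_orderings \<Otimes>\<^sub>M N_orderings) (%\<omega>. (?R \<omega>, ?R' \<omega>))) N_orderings fst"
   by (subst distr_distr[OF measurable_fst L(2)]) (simp only: comp_def fst_conv)
  also have "... = distr (?S \<Otimes>\<^sub>M ?S) N_orderings (rank_order \<circ> fst)"
   unfolding L(4) by (subst distr_distr[OF measurable_fst L(3)]) (simp only: comp_def fst_conv)
  also have "... = distr (distr (?S \<Otimes>\<^sub>M ?S) ?S fst) N_orderings rank_order"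
   by (rule distr_distr[OF measurable_rank_order_unit_seq measurable_fst, symmetric])
  also have "... = uniform_ordering"
   by (simp only: prob_space.distr_pair_fst[OF prob_space_unit_seq] uniform_ordering_eq)
  finally show ?thesis .
 qed
 have int: "(\<integral>\<omega>. indicator B (?R \<omega>) * measure (K (?R \<omega>)) A \<partial>?M) = (\<integral>r. indicator B r * measure (K r) A \<partial>uniform_ordering)"
  if K: "is_kernel K" and B: "B \<in> sets N_orderings" and A: "A \<in> sets N_orderings" for B A
 proof -
  have m: "(%r. indicator B r * measure (K r) A :: real) \<in> borel_measurable N_orderings"
   by (intro borel_measurable_times borel_measurable_indicator B measurable_compose[OF K[unfolded is_kernel_def] measurable_measure_prob_algebra[OF A]])
  show ?thesis unfolding law[symmetric] by (rule integral_distr[OF R m, symmetric])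
 qed
 have "is_hat_kernel (nu_upper \<mu>) K \<longleftrightarrow> conditional_kernel ?M N_orderings ?R ?R ?R' K"
  unfolding is_hat_kernel_def Let_def rank_order_def ..
 also have "... \<longleftrightarrow> is_kernel K & (\<forall>B\<in>sets N_orderings. \<forall>A\<in>sets N_orderings. hat_law \<mu> B A = (\<integral>\<omega>. indicator B (?R \<omega>) * measure (K (?R \<omega>)) A \<partial>?M))"
  unfolding hat_law_def by (rule conditional_kernel_iff[OF L(1) R R' id refl])
 also have "... \<longleftrightarrow> is_kernel K & (\<forall>B\<in>sets N_orderings. \<forall>A\<in>sets N_orderings. hat_law \<mu> B A = (\<integral>r. indicator B r * measure (K r) A \<partial>uniform_ordering))"
 proof (rule conj_cong[OF refl])
  assume K: "is_kernel K"
  show "(\<forall>B\<in>sets N_orderings. \<forall>A\<in>sets N_orderings. hat_law \<mu> B A = (\<integral>\<omega>. indicator B (?R \<omega>) * measure (K (?R \<omega>)) A \<partial>?M)) \<longleftrightarrow>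
   (\<forall>B\<in>sets N_orderings. \<forall>A\<in>sets N_orderings. hat_law \<mu> B A = (\<integral>r. indicator B r * measure (K r) A \<partial>uniform_ordering))"
   by (intro ball_cong refl) (simp only: int[OF K])
 qed
 finally show ?thesis .
qed

text \<open>Index \<open>k\<close> is moved to the place \<beta> k, its rank among the weights.
  Along the places the weights increase, so \<open>conj_rel_iff\<close> identifies the order of the
  mixtures with the relation of the moved conjugate pairs.\<close>

lemma conj_rel_rank:
 fixes u v :: "nat => real"
 assumes q: "quasi_uniform \<mu>" and b: "\<beta> permutes {1..n}"
  and u: "\<And>k. k \<in> {1..} ==> 0 < u k & u k < 1" "inj_on u {1..}"
  and v: "\<And>k. k \<in> {1..} ==> v k \<in> {0..1}" "inj_on v {1..}"
  and r: "restr n (rank_order u) = perm_order n \<beta>"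
 shows "restr n (rank_order (%k. wmix (u k) (conj_map \<mu> (v k)))) = pull n \<beta> (conj_rel \<mu> (v \<circ> inv \<beta>))"
proof -
 define W where "W k = wmix (u k) (conj_map \<mu> (v k))" for k
 have nW: "W i ~= W j" if ij: "i \<in> {1..}" "j \<in> {1..}" "i ~= j" "u i < u j" for i j
 proof -
  have "v i ~= v j" using inj_onD[OF v(2) _ ij(1,2)] ij(3) by blast
  moreover have "0 < u i" "u j < 1" using u(1)[OF ij(1)] u(1)[OF ij(2)] by simp_all
  ultimately show ?thesis unfolding W_def by (intro wmix_conj_order(1)[OF q v(1)[OF ij(1)] v(1)[OF ij(2)]] ij(4))
 qed
 have iW: "inj_on W {1..}"
 proof (rule inj_onI, rule ccontr)
  fix i j assume ij: "i \<in> {1..}" "j \<in> {1..}" "W i = W j" "i ~= j"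
  have "u i ~= u j" using inj_onD[OF u(2) _ ij(1,2)] ij(4) by blast
  then consider "u i < u j" | "u j < u i" by linarith
  then show False using nW[OF ij(1,2,4)] nW[OF ij(2,1) ij(4)[symmetric]] ij(3) by cases simp_all
 qed
 have rel: "u i < u j \<longleftrightarrow> \<beta> i < \<beta> j" if "i \<in> {1..n}" "j \<in> {1..n}" for i j
  using r[unfolded rank_order_restr_iff[OF u(2)]] that by blast
 have key: "(\<beta> i, \<beta> j) \<in> conj_rel \<mu> (v \<circ> inv \<beta>) \<longleftrightarrow> W i < W j" if ij: "i \<in> {1..n}" "j \<in> {1..n}" for i j
 proof (cases "i = j")
  case True
  then show ?thesis by (simp add: conj_rel_def)
 next
  case False
  have i1: "i \<in> {1..}" "j \<in> {1..}" using ij by auto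
  have ne: "v i ~= v j" using inj_onD[OF v(2) _ i1] False by blast
  have s: "(v \<circ> inv \<beta>) (\<beta> k) = v k" "(u \<circ> inv \<beta>) (\<beta> k) = u k" for k using permutes_inverses(2)[OF b] by simp_all
  have u01: "0 < (u \<circ> inv \<beta>) k & (u \<circ> inv \<beta>) k < 1" if "k \<in> {\<beta> i, \<beta> j}" for k
   using that u(1)[OF i1(1)] u(1)[OF i1(2)] s(2) by auto
  have "(\<beta> i, \<beta> j) \<in> conj_rel \<mu> (v \<circ> inv \<beta>) \<longleftrightarrow>
   wmix ((u \<circ> inv \<beta>) (\<beta> i)) (conj_map \<mu> ((v \<circ> inv \<beta>) (\<beta> i))) < wmix ((u \<circ> inv \<beta>) (\<beta> j)) (conj_map \<mu> ((v \<circ> inv \<beta>) (\<beta> j)))"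
  proof (rule conj_rel_iff(1)[OF q])
   show "(v \<circ> inv \<beta>) (\<beta> i) \<in> {0..1}" "(v \<circ> inv \<beta>) (\<beta> j) \<in> {0..1}" "(v \<circ> inv \<beta>) (\<beta> i) ~= (v \<circ> inv \<beta>) (\<beta> j)"
    unfolding s by (rule v(1)[OF i1(1)], rule v(1)[OF i1(2)], rule ne)
   show "((u \<circ> inv \<beta>) (\<beta> i) < (u \<circ> inv \<beta>) (\<beta> j)) = (\<beta> i < \<beta> j)" "((u \<circ> inv \<beta>) (\<beta> j) < (u \<circ> inv \<beta>) (\<beta> i)) = (\<beta> j < \<beta> i)"
    unfolding s by (rule rel[OF ij], rule rel[OF ij(2,1)])
  qed (rule u01)
  then show ?thesis unfolding s W_def .
 qed
 have "restr n (rank_order W) = {(i, j) \<in> {1..n} \<times> {1..n}. W i < W j}"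
  unfolding rank_order_eq[OF iW] restr_def by auto
 also have "... = pull n \<beta> (conj_rel \<mu> (v \<circ> inv \<beta>))" unfolding pull_def using key by blast
 finally show ?thesis unfolding W_def .
qed

lemma sets_pull_conj_rel:
 assumes q: "quasi_uniform \<mu>" and b: "\<beta> permutes {1..n}" and a: "a \<in> orderings {1..n}"
 shows "{v\<in>space (unit_seq {1::nat..}). pull n \<beta> (conj_rel \<mu> (v \<circ> inv \<beta>)) = a} \<in> sets (unit_seq {1..})"
proof -
 let ?S = "unit_seq {1::nat..}"
 have sub: "a \<subseteq> {1..n} \<times> {1..n}" using a by (simp add: orderings_def)
 have s: "(v \<circ> inv \<beta>) (\<beta> k) = v k" for v :: "nat => real" and k using permutes_inverses(2)[OF b] by simp
 have c: "(%_. \<mu>) \<in> ?S \<rightarrow>\<^sub>M QU_space" by (rule measurable_const) (simp add: space_QU q)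
 have m: "{v\<in>space ?S. (\<beta> i, \<beta> j) \<in> conj_rel \<mu> (v \<circ> inv \<beta>)} \<in> sets ?S" if ij: "i \<in> {1..n}" "j \<in> {1..n}" for i j
 proof (rule sets_conj_rel[OF c])
  show "(%v. (v \<circ> inv \<beta>) (\<beta> i)) \<in> ?S \<rightarrow>\<^sub>M unit_borel" unfolding s by (rule measurable_unit_seq_unit) (use ij in auto)
  show "(%v. (v \<circ> inv \<beta>) (\<beta> j)) \<in> ?S \<rightarrow>\<^sub>M unit_borel" unfolding s by (rule measurable_unit_seq_unit) (use ij in auto)
 qed
 have eq: "{v\<in>space ?S. pull n \<beta> (conj_rel \<mu> (v \<circ> inv \<beta>)) = a} =
  {v\<in>space ?S. \<forall>p\<in>{1..n} \<times> {1..n}. ((\<beta> (fst p), \<beta> (snd p)) \<in> conj_rel \<mu> (v \<circ> inv \<beta>)) \<longleftrightarrow> p \<in> a}"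
  using sub by (auto simp: pull_def)
 show ?thesis unfolding eq
 proof (rule sets.sets_Collect_finite_All)
  fix p :: "nat \<times> nat" assume p: "p \<in> {1..n} \<times> {1..n}"
  have pm: "{v\<in>space ?S. (\<beta> (fst p), \<beta> (snd p)) \<in> conj_rel \<mu> (v \<circ> inv \<beta>)} \<in> sets ?S"
   by (rule m) (use p in \<open>simp_all add: mem_Times_iff\<close>)
  show "{v\<in>space ?S. ((\<beta> (fst p), \<beta> (snd p)) \<in> conj_rel \<mu> (v \<circ> inv \<beta>)) \<longleftrightarrow> p \<in> a} \<in> sets ?S"
  proof (cases "p \<in> a")
   case True
   then show ?thesis using pm by simp
  next
   case False
   then show ?thesis using sets.sets_Collect_neg[OF pm] by simp
  qed
 qed simp
qed

text \<open>Both events concern uniform variables placed at \<beta> 1, ..., \<beta> n. Reindexing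
  along \<open>int \<circ> \<beta>\<close> passes from variables indexed by integers to variables
  indexed by positive integers without changing the law.\<close>

lemma measure_pull_conj_rel:
 assumes q: "quasi_uniform \<mu>" and b: "\<beta> permutes {1..n}" and a: "a \<in> orderings {1..n}"
 shows "measure (unit_seq {1..}) {v\<in>space (unit_seq {1::nat..}). pull n \<beta> (conj_rel \<mu> (v \<circ> inv \<beta>)) = a} =
  measure (P_mu \<mu>) (pull_cell n (int \<circ> \<beta>) a)"
proof -
 let ?S = "unit_seq {1::nat..}"
 let ?Z = "unit_seq (UNIV :: int set)"
 let ?r = "%\<omega>. \<lambda>k\<in>{1::nat..}. \<omega> ((int \<circ> \<beta>) k)"
 have inj: "inj_on (int \<circ> \<beta>) {1..}" using permutes_inj[OF b] by (auto simp: inj_on_def)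
 have re: "distr ?Z ?S ?r = ?S"
  by (rule distr_PiM_reindex[where M="%_. unit_lebesgue", OF prob_space_unit_lebesgue inj]) simp
 have rm: "?r \<in> ?Z \<rightarrow>\<^sub>M ?S" by (rule measurable_restrict) (rule measurable_component_singleton, simp)
 note cm = measurable_conj_order1[OF q]
 let ?Y = "{v\<in>space ?S. pull n \<beta> (conj_rel \<mu> (v \<circ> inv \<beta>)) = a}"
 let ?T = "(pull_cell n (int \<circ> \<beta>) a)"
 note Y = sets_pull_conj_rel[OF q b a]
 have "measure ?S ?Y = measure (distr ?Z ?S ?r) ?Y" by (simp only: re)
 also have "... = measure ?Z (?r -` ?Y \<inter> space ?Z)" by (rule measure_distr[OF rm Y])
 also have "... = measure ?Z (conj_order \<mu> -` ?T \<inter> space ?Z)"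
 proof (rule measure_eq_AE)
  show "?r -` ?Y \<inter> space ?Z \<in> sets ?Z" by (rule measurable_sets[OF rm Y])
  show "conj_order \<mu> -` ?T \<inter> space ?Z \<in> sets ?Z" by (rule measurable_sets[OF cm sets_pull])
  show "AE w in ?Z. (w \<in> ?r -` ?Y \<inter> space ?Z) = (w \<in> conj_order \<mu> -` ?T \<inter> space ?Z)"
   using AE_unit_seq_inj[of "UNIV :: int set", OF countableI_type] AE_space[of ?Z]
  proof (eventually_elim)
   fix w assume i: "inj w" and w: "w \<in> space ?Z"
   have w01: "w k \<in> {0..1}" for k by (rule unit_seq_range[OF w]) simp
   note o = conj_rel_ordering[OF q w01 i]
   have co: "conj_order \<mu> w = conj_rel \<mu> w" unfolding conj_order_def by (rule to_ordering_id[OF o])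
   have s: "(?r w \<circ> inv \<beta>) (\<beta> k) = w (int (\<beta> k))" if "k \<in> {1..n}" for k
    using permutes_inverses(2)[OF b] that by simp
   have "pull n \<beta> (conj_rel \<mu> (?r w \<circ> inv \<beta>)) = pull n (int \<circ> \<beta>) (conj_rel \<mu> w)"
   proof (rule set_eqI)
    fix p :: "nat \<times> nat"
    obtain i j where p: "p = (i, j)" by (cases p)
    show "p \<in> pull n \<beta> (conj_rel \<mu> (?r w \<circ> inv \<beta>)) \<longleftrightarrow> p \<in> pull n (int \<circ> \<beta>) (conj_rel \<mu> w)"
    proof (cases "i \<in> {1..n} & j \<in> {1..n}")
     case True
     then show ?thesis unfolding p pull_def conj_rel_def mem_Collect_eq case_prod_conv s[of i, OF conjunct1[OF True]] s[of j, OF conjunct2[OF True]]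
      by simp
    next
     case False
     then show ?thesis unfolding p pull_def by auto
    qed
   qed
   then show "(w \<in> ?r -` ?Y \<inter> space ?Z) = (w \<in> conj_order \<mu> -` ?T \<inter> space ?Z)"
    using w measurable_space[OF rm w] o co by simp
  qed
 qed
 also have "... = measure (P_mu \<mu>) ?T" unfolding P_mu_eq[OF q] by (rule measure_distr[OF cm sets_pull, symmetric])
 finally show ?thesis .
qed

lemma AE_unit_seq_interior: "countable I ==> AE x in unit_seq I. \<forall>k\<in>I. 0 < x k & x k < 1"
proof (rule AE_ball_countable')
 fix k assume k: "k \<in> I"
 have "AE u in unit_lebesgue. 0 < u & u < 1"
  using AE_unit_lebesgue_neq[of 0] AE_unit_lebesgue_neq[of 1] AE_space[of unit_lebesgue] by eventually_elim auto
 then show "AE x in unit_seq I. 0 < x k & x k < 1"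
  by (rule AE_PiM_component[OF prob_space_unit_lebesgue k])
qed

text \<open>The second ordering is the order of the weights, which are independent of the pairs.
  Once it restricts to \<open>b\<close>, the restriction of the first is decided by the pairs alone,
  through \<open>conj_rel_rank\<close>. The probability is thus a product, with factor
  \<open>1 / fact n\<close> from the weights.\<close>

lemma hat_law_cell:
 assumes q: "quasi_uniform \<mu>" and a: "a \<in> orderings {1..n}" and b: "b \<in> orderings {1..n}"
 shows "hat_law \<mu> (cell n a) (cell n b) =
  measure (P_mu \<mu>) (pull_cell n (int \<circ> perm_of n b) a) / fact n"
proof -
 let ?S = "unit_seq {1::nat..}"
 interpret S: prob_space ?S by (rule prob_space_unit_seq)
 define \<beta> where "\<beta> = perm_of n b"
 have bp: "\<beta> permutes {1..n}" "perm_order n \<beta> = b" unfolding \<beta>_def by (rule perm_of'[OF b])+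
 let ?W = "%z :: (nat => real) \<times> (nat => real). rank_order (%k. wmix (fst z k) (conj_map \<mu> (snd z k)))"
 let ?c = "%v. pull n \<beta> (conj_rel \<mu> (v \<circ> inv \<beta>))"
 let ?X = "{u\<in>space ?S. restr n (rank_order u) = b}"
 let ?Y = "{v\<in>space ?S. ?c v = a}"
 let ?A = "(cell n a)" and ?B = "(cell n b)"
 note Y = sets_pull_conj_rel[OF q bp(1) a]
 have X: "?X \<in> sets ?S"
  using measurable_sets[OF measurable_compose[OF measurable_rank_order_unit_seq measurable_restr], of "{b}" n]
  by (simp add: vimage_def Int_def conj_commute)
 note h = measurable_nu_wmix[OF q]
 have E: "{z\<in>space (?S \<Otimes>\<^sub>M ?S). ?W z \<in> ?A & rank_order (fst z) \<in> ?B} \<in> sets (?S \<Otimes>\<^sub>M ?S)" (is "?E \<in> _")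
 proof -
  have "(%z. (?W z, rank_order (fst z))) \<in> ?S \<Otimes>\<^sub>M ?S \<rightarrow>\<^sub>M N_orderings \<Otimes>\<^sub>M N_orderings"
   using rank_pair_law(3)[OF h nu_upper_wmix[OF q]] by simp
  from measurable_sets[OF this pair_measureI[OF sets_restr[of n a] sets_restr[of n b]]] show ?thesis
   by (simp add: vimage_def Int_def conj_commute)
 qed
 have "hat_law \<mu> ?A ?B = measure (?S \<Otimes>\<^sub>M ?S) ?E"
  using hat_law_eq[OF h nu_upper_wmix[OF q] sets_restr[of n a] sets_restr[of n b]] by simp
 also have "... = measure (?S \<Otimes>\<^sub>M ?S) (?X \<times> ?Y)"
 proof (rule measure_eq_AE[OF _ E pair_measureI[OF X Y]])
  have "AE x in ?S. (\<forall>k\<in>{1..}. 0 < x k & x k < 1) & inj_on x {1..}"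
   using AE_unit_seq_interior[of "{1::nat..}"] AE_unit_seq_inj[of "{1::nat..}"] by simp
  then have "AE x in distr (?S \<Otimes>\<^sub>M ?S) ?S fst. (\<forall>k\<in>{1..}. 0 < x k & x k < 1) & inj_on x {1..}"
   by (simp only: S.distr_pair_fst)
  from AE_distrD[OF measurable_fst this]
  have a1: "AE z in ?S \<Otimes>\<^sub>M ?S. (\<forall>k\<in>{1..}. 0 < fst z k & fst z k < 1) & inj_on (fst z) {1..}" .
  have "AE x in distr (?S \<Otimes>\<^sub>M ?S) ?S snd. inj_on x {1..}"
   using AE_unit_seq_inj[of "{1::nat..}"] by (simp only: distr_pair_snd_prob[OF prob_space_unit_seq]) simp
  from AE_distrD[OF measurable_snd this]
  have a2: "AE z in ?S \<Otimes>\<^sub>M ?S. inj_on (snd z) {1..}" .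
  show "AE z in ?S \<Otimes>\<^sub>M ?S. (z \<in> ?E) = (z \<in> ?X \<times> ?Y)"
   using a1 a2 AE_space[of "?S \<Otimes>\<^sub>M ?S"]
  proof (eventually_elim)
   fix z assume u: "(\<forall>k\<in>{1..}. 0 < fst z k & fst z k < 1) & inj_on (fst z) {1..}" and v: "inj_on (snd z) {1..}"
    and z: "z \<in> space (?S \<Otimes>\<^sub>M ?S)"
   have zs: "fst z \<in> space ?S" "snd z \<in> space ?S" using z by (auto simp: space_pair_measure)
   have key: "restr n (?W z) = ?c (snd z)" if "restr n (rank_order (fst z)) = b"
   proof (rule conj_rel_rank[OF q bp(1)])
    show "restr n (rank_order (fst z)) = perm_order n \<beta>" using that bp(2) by simp
    show "0 < fst z k & fst z k < 1" if "k \<in> {1..}" for k using u that by blast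
    show "snd z k \<in> {0..1}" if "k \<in> {1..}" for k by (rule unit_seq_range[OF zs(2) that])
   qed (use u v in auto)
   have "z \<in> ?E \<longleftrightarrow> restr n (rank_order (fst z)) = b & restr n (?W z) = a"
    using z rank_order_in by auto
   also have "... \<longleftrightarrow> restr n (rank_order (fst z)) = b & ?c (snd z) = a"
    by (rule conj_cong[OF refl]) (simp only: key)
   also have "... \<longleftrightarrow> z \<in> ?X \<times> ?Y" using zs by (simp add: mem_Times_iff)
   finally show "(z \<in> ?E) = (z \<in> ?X \<times> ?Y)" .
  qed
 qed
 also have "... = measure ?S ?X * measure ?S ?Y"
  unfolding measure_def S.emeasure_pair_measure_Times[OF X Y] by (rule enn2real_mult)
 also have "measure ?S ?X = 1 / fact n" by (rule measure_rank_order[OF b])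
 also have "measure ?S ?Y = measure (P_mu \<mu>) (pull_cell n (int \<circ> perm_of n b) a)"
  unfolding \<beta>_def[symmetric] by (rule measure_pull_conj_rel[OF q bp(1) a])
 finally show ?thesis by simp
qed

section \<open>Recovering uniform variables from their order\<close>

lemma integral_unit_lebesgue_indicator:
 assumes t: "t \<in> {0..1}"
 shows "(\<integral>y. indicator {..t} y \<partial>unit_lebesgue) = (t::real)"
proof -
 have "(\<integral>y. indicator {..t} y \<partial>unit_lebesgue) = (\<integral>y. indicator {0..t} y \<partial>unit_lebesgue)"
  by (rule Bochner_Integration.integral_cong) (auto simp: indicator_def)
 also have "... = measure unit_lebesgue {0..t}"
 proof -
  have "{0..t} \<in> sets unit_lebesgue" unfolding sets_unit_lebesgue by (rule sets_unit_lebesgueI) (use t in auto)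
  then show ?thesis using t by (simp add: Int_absorb2)
 qed
 also have "... = t"
  using t emeasure_unit_lebesgue[of "{0..t}"] by (simp add: measure_def)
 finally show ?thesis .
qed

text \<open>The centred indicators are uncorrelated, so the average of \<open>N\<close> of them has
  second moment at most \<open>1 / N\<close>. Along the squares these bounds are summable.\<close>

lemma strong_law_unit:
 assumes t: "t \<in> {0..1}"
 shows "AE x in unit_seq {1::nat..}. (%j. (\<Sum>i\<in>{1..(Suc j)\<^sup>2}. indicator {..t} (x i)) / real ((Suc j)\<^sup>2)) \<longlonglongrightarrow> t"
proof -
 let ?U = unit_lebesgue
 let ?S = "unit_seq {1::nat..}"
 interpret U: prob_space ?U by (rule prob_space_unit_lebesgue)
 interpret S: prob_space ?S by (rule prob_space_unit_seq)
 interpret UU: pair_prob_space ?U ?U by standard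
 define g :: "real => real" where "g y = indicator {..t} y - t" for y
 have gb: "\<bar>g y\<bar> <= 1" for y using t by (auto simp: g_def indicator_def)
 have gB: "g \<in> borel_measurable borel" unfolding g_def[abs_def] by measurable
 have idU: "(%x. x) \<in> borel_measurable ?U"
  by (rule measurable_eq_sets[OF sets_unit_lebesgue measurable_unit_borel_borel])
 have gU: "g \<in> borel_measurable ?U" by (rule measurable_compose[OF idU gB])
 have gint: "integrable ?U g" by (rule U.integrable_const_bound[where B=1, OF AE_I2 gU]) (simp add: gb)
 have indint: "integrable ?U (indicator {..t} :: real => real)"
  by (rule U.integrable_const_bound[where B=1])
   (auto intro!: measurable_compose[OF idU borel_measurable_indicator])
 have g0: "(\<integral>y. g y \<partial>?U) = 0"
 proof -
  have "(\<integral>y. indicator {..t} y - t \<partial>?U) = (\<integral>y. indicator {..t} y \<partial>?U) - (\<integral>y. t \<partial>?U)"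
   by (rule Bochner_Integration.integral_diff[OF indint]) simp
  also have "... = 0"
   by (simp only: integral_unit_lebesgue_indicator[OF t] lebesgue_integral_const U.prob_space scaleR_one diff_self)
  finally show ?thesis unfolding g_def .
 qed
 have pair0: "(\<integral>p. g (fst p) * g (snd p) \<partial>(?U \<Otimes>\<^sub>M ?U)) = 0"
 proof -
  have ii: "integrable (?U \<Otimes>\<^sub>M ?U) (%p. g (fst p) * g (snd p))"
  proof (rule UU.P.integrable_const_bound[where B=1])
   show "AE p in ?U \<Otimes>\<^sub>M ?U. norm (g (fst p) * g (snd p)) <= 1"
    by (rule AE_I2) (simp add: abs_mult mult_le_one gb)
   show "(%p. g (fst p) * g (snd p)) \<in> borel_measurable (?U \<Otimes>\<^sub>M ?U)"
    by (intro borel_measurable_times measurable_compose[OF measurable_fst gU] measurable_compose[OF measurable_snd gU])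
  qed
  show ?thesis using UU.integral_fst'[OF ii] g0 by simp
 qed
 have cm: "(%x. g (x i)) \<in> borel_measurable ?S" if "i \<in> {1..}" for i
  by (rule measurable_compose[OF measurable_component_singleton[OF that] gU])
 have int: "integrable ?S (%x. g (x i) * g (x k))" if "i \<in> {1..}" "k \<in> {1..}" for i k
 proof (rule S.integrable_const_bound[where B=1])
  show "AE x in ?S. norm (g (x i) * g (x k)) <= 1" by (rule AE_I2) (simp add: abs_mult mult_le_one gb)
 qed (intro borel_measurable_times cm that)
 have cov: "(\<integral>x. g (x i) * g (x k) \<partial>?S) <= (if i = k then 1 else 0)" if ik: "i \<in> {1..}" "k \<in> {1..}" for i k
 proof (cases "i = k")
  case True
  have "(\<integral>x. g (x i) * g (x k) \<partial>?S) <= (\<integral>x. 1 \<partial>?S)"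
  proof (rule integral_mono[OF int[OF ik]])
   show "g (x i) * g (x k) <= 1" for x
    using gb[of "x i"] gb[of "x k"] abs_le_D1[of "g (x i) * g (x k)" 1] by (simp add: abs_mult mult_le_one)
  qed simp
  then show ?thesis using True by (simp add: S.prob_space)
 next
  case False
  have pm: "(%x. (x i, x k)) \<in> ?S \<rightarrow>\<^sub>M ?U \<Otimes>\<^sub>M ?U"
   by (rule measurable_Pair[OF measurable_component_singleton[OF ik(1)] measurable_component_singleton[OF ik(2)]])
  have fm: "(%p. g (fst p) * g (snd p)) \<in> borel_measurable (?U \<Otimes>\<^sub>M ?U)"
   by (intro borel_measurable_times measurable_compose[OF measurable_fst gU] measurable_compose[OF measurable_snd gU])
  have "(\<integral>x. g (x i) * g (x k) \<partial>?S) = (\<integral>p. g (fst p) * g (snd p) \<partial>distr ?S (?U \<Otimes>\<^sub>M ?U) (%x. (x i, x k)))"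
   by (subst integral_distr[OF pm fm]) simp
  also have "... = 0" unfolding distr_PiM_pair[OF prob_space_unit_lebesgue ik False] by (rule pair0)
  finally show ?thesis using False by simp
 qed
 have sqint: "integrable ?S (%x. (\<Sum>i\<in>I. g (x i))\<^sup>2)" and sqle: "(\<integral>x. (\<Sum>i\<in>I. g (x i))\<^sup>2 \<partial>?S) <= real (card I)"
  if I: "finite I" "I \<subseteq> {1..}" for I
 proof -
  have e: "(\<Sum>i\<in>I. g (x i))\<^sup>2 = (\<Sum>i\<in>I. \<Sum>k\<in>I. g (x i) * g (x k))" for x by (simp add: power2_eq_square sum_product)
  have in1: "integrable ?S (%x. g (x i) * g (x k))" if "i \<in> I" "k \<in> I" for i k by (rule int) (use that I(2) in auto)
  show "integrable ?S (%x. (\<Sum>i\<in>I. g (x i))\<^sup>2)"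
   unfolding e by (intro Bochner_Integration.integrable_sum in1)
  have "(\<integral>x. (\<Sum>i\<in>I. g (x i))\<^sup>2 \<partial>?S) = (\<Sum>i\<in>I. \<integral>x. (\<Sum>k\<in>I. g (x i) * g (x k)) \<partial>?S)"
   unfolding e by (rule Bochner_Integration.integral_sum) (intro Bochner_Integration.integrable_sum in1)
  also have "... = (\<Sum>i\<in>I. \<Sum>k\<in>I. \<integral>x. g (x i) * g (x k) \<partial>?S)"
   by (rule sum.cong[OF refl]) (rule Bochner_Integration.integral_sum, rule in1)
  also have "... <= (\<Sum>i\<in>I. \<Sum>k\<in>I. if i = k then 1 else 0)"
   by (intro sum_mono cov) (use I(2) in auto)
  also have "... = real (card I)" using I(1) by (simp add: sum.delta)
  finally show "(\<integral>x. (\<Sum>i\<in>I. g (x i))\<^sup>2 \<partial>?S) <= real (card I)" .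
 qed
 define N where "N j = (Suc j)\<^sup>2" for j :: nat
 have Npos: "0 < real (N j)" for j by (simp add: N_def)
 define Z where "Z j x = (\<Sum>i\<in>{1..N j}. g (x i)) / real (N j)" for j and x :: "nat => real"
 have Z2: "(Z j x)\<^sup>2 = (\<Sum>i\<in>{1..N j}. g (x i))\<^sup>2 / (real (N j))\<^sup>2" for j x by (simp add: Z_def power_divide)
 have sub: "finite {1..N j}" "{1..N j} \<subseteq> {1..}" for j by auto
 have Zint: "integrable ?S (%x. (Z j x)\<^sup>2)" for j unfolding Z2 by (rule integrable_divide) (rule sqint[OF sub])
 have Zle: "(\<integral>x. (Z j x)\<^sup>2 \<partial>?S) <= 1 / real (N j)" for j
 proof -
  have "(\<integral>x. (Z j x)\<^sup>2 \<partial>?S) = (\<integral>x. (\<Sum>i\<in>{1..N j}. g (x i))\<^sup>2 \<partial>?S) / (real (N j))\<^sup>2" unfolding Z2 by (rule integral_divide_zero)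
  also have "... <= real (card {1..N j}) / (real (N j))\<^sup>2" by (intro divide_right_mono sqle sub) simp
  also have "... = 1 / real (N j)" using Npos[of j] by (simp add: power2_eq_square)
  finally show ?thesis .
 qed
 have sm: "summable (%j. 1 / real (N j))"
 proof -
  have "summable (%n. inverse ((real n)\<^sup>2))" by (rule inverse_power_summable) simp
  then have "summable (%n. inverse ((real (Suc n))\<^sup>2))" by (subst summable_Suc_iff)
  then show ?thesis by (simp add: N_def inverse_eq_divide)
 qed
 \<comment> \<open>The series of squares has finite expectation, hence is almost surely finite, and
   its terms tend to 0.\<close>
 have "(\<integral>\<^sup>+x. (\<Sum>j. ennreal ((Z j x)\<^sup>2)) \<partial>?S) = (\<Sum>j. \<integral>\<^sup>+x. ennreal ((Z j x)\<^sup>2) \<partial>?S)"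
  by (rule nn_integral_suminf) (rule measurable_compose[OF borel_measurable_integrable[OF Zint] measurable_ennreal])
 also have "... <= (\<Sum>j. ennreal (1 / real (N j)))"
 proof (rule suminf_le)
  fix j
  have "(\<integral>\<^sup>+x. ennreal ((Z j x)\<^sup>2) \<partial>?S) = ennreal (\<integral>x. (Z j x)\<^sup>2 \<partial>?S)" by (rule nn_integral_eq_integral[OF Zint]) simp
  also have "... <= ennreal (1 / real (N j))" by (rule ennreal_leI[OF Zle])
  finally show "(\<integral>\<^sup>+x. ennreal ((Z j x)\<^sup>2) \<partial>?S) <= ennreal (1 / real (N j))" .
 qed auto
 also have "... < top"
 proof -
  have "(\<Sum>j. ennreal (1 / real (N j))) ~= top"
   by (rule ennreal_suminf_neq_top[OF sm]) (rule divide_nonneg_pos[OF zero_le_one Npos])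
  then show ?thesis by (rule less_top[THEN iffD1])
 qed
 finally have fin: "(\<integral>\<^sup>+x. (\<Sum>j. ennreal ((Z j x)\<^sup>2)) \<partial>?S) ~= \<infinity>" by simp
 have "AE x in ?S. (\<Sum>j. ennreal ((Z j x)\<^sup>2)) ~= \<infinity>"
  by (rule nn_integral_noteq_infinite[OF _ fin])
   (rule borel_measurable_suminf_order, rule measurable_compose[OF borel_measurable_integrable[OF Zint] measurable_ennreal])
 then show ?thesis
 proof (eventually_elim)
  fix x assume "(\<Sum>j. ennreal ((Z j x)\<^sup>2)) ~= \<infinity>"
  then have "summable (%j. (Z j x)\<^sup>2)" by (intro summable_suminf_not_top) auto
  then have "(%j. (Z j x)\<^sup>2) \<longlonglongrightarrow> 0" by (rule summable_LIMSEQ_zero)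
  then have "(%j. Z j x) \<longlonglongrightarrow> 0" by (simp add: power_tendsto_0_iff)
  then have l: "(%j. Z j x + t) \<longlonglongrightarrow> 0 + t" by (intro tendsto_add tendsto_const)
  have e: "Z j x + t = (\<Sum>i\<in>{1..(Suc j)\<^sup>2}. indicator {..t} (x i)) / real ((Suc j)\<^sup>2)" for j
  proof -
   have "(\<Sum>i\<in>{1..N j}. g (x i)) = (\<Sum>i\<in>{1..N j}. indicator {..t} (x i)) - real (N j) * t"
    by (simp add: g_def sum_subtractf)
   then have "Z j x + t = (\<Sum>i\<in>{1..N j}. indicator {..t} (x i)) / real (N j)"
    using Npos[of j] by (simp add: Z_def field_simps)
   then show ?thesis by (simp only: N_def)
  qed
  show "(%j. (\<Sum>i\<in>{1..(Suc j)\<^sup>2}. indicator {..t} (x i)) / real ((Suc j)\<^sup>2)) \<longlonglongrightarrow> t"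
   using l by (simp only: e add_0)
 qed
qed

text \<open>Proportion of predecessors of \<open>k\<close> among the first indices, along the
  squares of \<open>strong_law_unit\<close>. It is a function of the ordering alone.\<close>

definition rank_freq :: "nat => nat rel => nat => real" where
 "rank_freq k r j = (\<Sum>i\<in>{1..(Suc j)\<^sup>2}. if (i, k) \<in> r then 1 else 0) / real ((Suc j)\<^sup>2)"

definition rank_limit :: "nat => nat rel => real" where
 "rank_limit k r = lim (rank_freq k r)"

lemma measurable_rank_limit: 
 assumes k: "k \<in> {1..}" shows "rank_limit k \<in> borel_measurable N_orderings"
proof -
 have "(%r. rank_freq k r j) \<in> borel_measurable N_orderings" for j
  unfolding rank_freq_def
 proof (intro borel_measurable_divide borel_measurable_const borel_measurable_sum)
  fix i assume "i \<in> {1..(Suc j)\<^sup>2}"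
  have "{r\<in>space N_orderings. (i, k) \<in> r} \<in> sets N_orderings" using sets_mem_ordering[of "{1..}" "(i, k)"] by simp
  then show "(%r. if (i, k) \<in> r then 1 else 0 :: real) \<in> borel_measurable N_orderings" by (intro measurable_If) auto
 qed
 then have "(%r. lim (%j. rank_freq k r j)) \<in> borel_measurable N_orderings" by (rule borel_measurable_lim_metric)
 then show ?thesis unfolding rank_limit_def[abs_def] .
qed

text \<open>The law of large numbers holds for each fixed level, whereas the level
  \<open>x k\<close> is random and belongs to the sample. It is applied to all rational levels at
  once, and \<open>x k\<close> is squeezed between rationals by monotonicity.\<close>

lemma AE_rank_limit: "AE x in unit_seq {1::nat..}. \<forall>k\<in>{1..}. rank_limit k (rank_order x) = x k"
proof -
 let ?S = "unit_seq {1::nat..}"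
 let ?Q = "\<rat> \<inter> {0..1} :: real set"
 let ?f = "%t x j. (\<Sum>i\<in>{1..(Suc j)\<^sup>2}. indicator {..t} (x i :: real)) / real ((Suc j)\<^sup>2)"
 have "AE x in ?S. \<forall>t\<in>?Q. ?f t x \<longlonglongrightarrow> t"
 proof (rule AE_ball_countable')
  show "AE x in ?S. ?f t x \<longlonglongrightarrow> t" if "t \<in> ?Q" for t
   by (rule strong_law_unit) (use that in blast)
  show "countable ?Q" by (rule countable_subset[OF _ countable_rat]) blast
 qed
 moreover have "AE x in ?S. inj_on x {1..}" by (rule AE_unit_seq_inj) simp
 moreover have "AE x in ?S. \<forall>k\<in>{1..}. 0 < x k & x k < 1" by (rule AE_unit_seq_interior) simp
 ultimately show ?thesis
 proof (eventually_elim)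
  fix x :: "nat => real"
  assume lim: "\<forall>t\<in>?Q. ?f t x \<longlonglongrightarrow> t" and inj: "inj_on x {1..}" and int: "\<forall>k\<in>{1..}. 0 < x k & x k < 1"
  show "\<forall>k\<in>{1..}. rank_limit k (rank_order x) = x k"
  proof
   fix k :: nat assume k: "k \<in> {1..}"
   have mem: "(i, k) \<in> rank_order x \<longleftrightarrow> x i < x k" if "i \<in> {1..}" for i
    unfolding rank_order_eq[OF inj] using that k by simp
   have x01: "0 < x k" "x k < 1" using int k by blast+
   have lower: "?f t x j <= rank_freq k (rank_order x) j" if t: "t < x k" for t j
    unfolding rank_freq_def by (intro divide_right_mono sum_mono) (use t mem in \<open>auto simp: indicator_def\<close>)
   have upper: "rank_freq k (rank_order x) j <= ?f t x j" if t: "x k < t" for t j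
    unfolding rank_freq_def by (intro divide_right_mono sum_mono) (use t mem in \<open>auto simp: indicator_def\<close>)
   have "rank_freq k (rank_order x) \<longlonglongrightarrow> x k"
   proof (rule order_tendstoI)
    fix a assume a: "a < x k"
    then have "max a 0 < x k" using x01 by simp
    from Rats_dense_in_real[OF this] obtain t where t: "t \<in> \<rat>" "max a 0 < t" "t < x k" by blast
    have "t \<in> ?Q" using t x01 by auto
    then have l: "?f t x \<longlonglongrightarrow> t" using lim by blast
    have "eventually (%j. a < ?f t x j) sequentially" by (rule order_tendstoD(1)[OF l]) (use t(2) in simp)
    then show "eventually (%j. a < rank_freq k (rank_order x) j) sequentially"
     by (rule eventually_mono) (rule less_le_trans[OF _ lower[OF t(3)]])
   next
    fix a assume a: "x k < a"
    then have "x k < min a 1" using x01 by simp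
    from Rats_dense_in_real[OF this] obtain t where t: "t \<in> \<rat>" "x k < t" "t < min a 1" by blast
    have "t \<in> ?Q" using t x01 by auto
    then have l: "?f t x \<longlonglongrightarrow> t" using lim by blast
    have "eventually (%j. ?f t x j < a) sequentially" by (rule order_tendstoD(2)[OF l]) (use t(3) in simp)
    then show "eventually (%j. rank_freq k (rank_order x) j < a) sequentially"
     by (rule eventually_mono) (rule le_less_trans[OF upper[OF t(2)]])
   qed
   then show "rank_limit k (rank_order x) = x k" unfolding rank_limit_def by (rule limI)
  qed
 qed
qed

section \<open>A jointly measurable version of the kernels\<close>

text \<open>\<open>rank_limit\<close> recovers the uniform variables behind \<open>r\<close>. The
  fresh variables \<xi> supply the randomness that \<open>hat_coord\<close> needs on
  \<open>qu_set\<close>; in the gaps the second coordinate is a function of the first.\<close>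

definition hat_order :: "real measure => nat rel => (nat => real) => nat rel" where
 "hat_order \<mu> r \<xi> = rank_order (%k. hat_coord \<mu> (clamp01 (rank_limit k r)) (\<xi> k))"

definition hat_version :: "real measure => nat rel => nat rel measure" where
 "hat_version \<mu> r = distr (unit_seq {1..}) N_orderings (hat_order \<mu> r)"

lemma measurable_hat_order:
 "(%z. hat_order (fst (fst z)) (snd (fst z)) (snd z)) \<in> (QU_space \<Otimes>\<^sub>M N_orderings) \<Otimes>\<^sub>M unit_seq {1..} \<rightarrow>\<^sub>M N_orderings"
 unfolding hat_order_def
proof (rule measurable_rank_order)
 fix k :: nat assume k: "k \<in> {1..}"
 let ?M = "(QU_space \<Otimes>\<^sub>M N_orderings) \<Otimes>\<^sub>M unit_seq {1::nat..}"
 have f: "(%z. fst (fst z)) \<in> ?M \<rightarrow>\<^sub>M QU_space" by (rule measurable_compose[OF measurable_fst measurable_fst])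
 have g: "(%z. clamp01 (rank_limit k (snd (fst z)))) \<in> ?M \<rightarrow>\<^sub>M unit_borel"
  by (rule measurable_clamp01[OF measurable_compose[OF measurable_compose[OF measurable_fst measurable_snd] measurable_rank_limit[OF k]]])
 have h: "(%z. snd z k) \<in> borel_measurable ?M"
  by (rule measurable_compose[OF measurable_compose[OF measurable_snd measurable_unit_seq_unit[OF k]] measurable_unit_borel_borel])
 show "(%z. hat_coord (fst (fst z)) (clamp01 (rank_limit k (snd (fst z)))) (snd z k)) \<in> borel_measurable ?M"
  by (rule measurable_hat_coord[OF f g h])
qed

lemma measurable_hat_version: "(%(\<mu>, r). hat_version \<mu> r) \<in> QU_space \<Otimes>\<^sub>M N_orderings \<rightarrow>\<^sub>M prob_algebra N_orderings"
proof -
 have "(%x. distr (unit_seq {1..}) N_orderings (hat_order (fst x) (snd x))) \<in> QU_space \<Otimes>\<^sub>M N_orderings \<rightarrow>\<^sub>M prob_algebra N_orderings"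
 proof (rule measurable_distr_prob_space2[where M="unit_seq {1..}"])
  show "(%_. unit_seq {1::nat..}) \<in> QU_space \<Otimes>\<^sub>M N_orderings \<rightarrow>\<^sub>M prob_algebra (unit_seq {1..})"
   by (rule measurable_const) (simp add: space_prob_algebra prob_space_unit_seq)
  show "(%(x, y). hat_order (fst x) (snd x) y) \<in> (QU_space \<Otimes>\<^sub>M N_orderings) \<Otimes>\<^sub>M unit_seq {1..} \<rightarrow>\<^sub>M N_orderings"
   using measurable_hat_order by (simp only: split_beta')
 qed
 then show ?thesis by (simp only: hat_version_def split_beta')
qed

lemma measurable_hat_order1:
 assumes q: "quasi_uniform \<mu>" and r: "r \<in> orderings {1..}"
 shows "hat_order \<mu> r \<in> unit_seq {1..} \<rightarrow>\<^sub>M N_orderings"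
proof -
 have "(\<mu>, r) \<in> space (QU_space \<Otimes>\<^sub>M N_orderings)" using q r by (simp add: space_pair_measure space_QU)
 from measurable_compose[OF measurable_Pair1'[OF this] measurable_hat_order] show ?thesis by simp
qed

lemma hat_version_kernel:
 assumes q: "quasi_uniform \<mu>" shows "is_kernel (hat_version \<mu>)"
 unfolding is_kernel_def
 using measurable_compose[OF measurable_Pair1'[of \<mu> QU_space N_orderings] measurable_hat_version] by (simp add: space_QU q)

text \<open>Integrate over \<xi> first. Almost surely \<open>rank_limit\<close> returns the original
  variables, so the conditional probability given \<open>x\<close> is a function of
  \<open>rank_order x\<close> alone, namely the one defined by \<open>hat_version\<close>.\<close>

lemma hat_version_is_hat_kernel:
 assumes q: "quasi_uniform \<mu>" shows "is_hat_kernel (nu_upper \<mu>) (hat_version \<mu>)"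
 unfolding hat_kernel_iff[OF q]
proof (intro conjI ballI hat_version_kernel[OF q])
 fix B A assume B: "B \<in> sets N_orderings" and A: "A \<in> sets N_orderings"
 let ?S = "unit_seq {1::nat..}"
 interpret S: prob_space ?S by (rule prob_space_unit_seq)
 note h = measurable_nu_hat[OF q]
 let ?R = "%z :: (nat => real) \<times> (nat => real). rank_order (%k. hat_coord \<mu> (fst z k) (snd z k))"
 let ?E = "{z\<in>space (?S \<Otimes>\<^sub>M ?S). rank_order (fst z) \<in> B & ?R z \<in> A}"
 have E: "?E \<in> sets (?S \<Otimes>\<^sub>M ?S)"
 proof -
  have "(%z. (rank_order (fst z), ?R z)) \<in> ?S \<Otimes>\<^sub>M ?S \<rightarrow>\<^sub>M N_orderings \<Otimes>\<^sub>M N_orderings"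
   using rank_pair_law(3)[OF h nu_upper_hat[OF q]] by simp
  from measurable_sets[OF this pair_measureI[OF B A]] show ?thesis
   by (simp add: vimage_def Int_def conj_commute)
 qed
 have mK: "(%r. indicator B r * measure (hat_version \<mu> r) A :: real) \<in> borel_measurable N_orderings"
  by (intro borel_measurable_times borel_measurable_indicator B
   measurable_compose[OF hat_version_kernel[OF q, unfolded is_kernel_def] measurable_measure_prob_algebra[OF A]])
 have mE: "(%x. measure ?S (Pair x -` ?E)) \<in> borel_measurable ?S"
  unfolding measure_def by (rule borel_measurable_enn2real[OF S.measurable_emeasure_Pair[OF E]])
 have "hat_law \<mu> B A = measure (?S \<Otimes>\<^sub>M ?S) ?E"
  using hat_law_eq[OF h nu_upper_hat[OF q] B A] by simp
 also have "... = enn2real (\<integral>\<^sup>+x. ennreal (measure ?S (Pair x -` ?E)) \<partial>?S)"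
  unfolding measure_def[of "?S \<Otimes>\<^sub>M ?S"] S.emeasure_pair_measure_alt[OF E] S.emeasure_eq_measure ..
 also have "... = (\<integral>x. measure ?S (Pair x -` ?E) \<partial>?S)" by (rule integral_eq_nn_integral[OF mE, symmetric]) simp
 also have "... = (\<integral>x. indicator B (rank_order x) * measure (hat_version \<mu> (rank_order x)) A \<partial>?S)"
 proof (rule integral_cong_AE[OF mE measurable_compose[OF measurable_rank_order_unit_seq mK]])
  show "AE x in ?S. measure ?S (Pair x -` ?E) = indicator B (rank_order x) * measure (hat_version \<mu> (rank_order x)) A"
   using AE_rank_limit AE_space[of ?S]
  proof (eventually_elim)
   fix x assume rl: "\<forall>k\<in>{1..}. rank_limit k (rank_order x) = x k" and x: "x \<in> space ?S"
   have o: "hat_order \<mu> (rank_order x) \<xi> = ?R (x, \<xi>)" for \<xi>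
    unfolding hat_order_def fst_conv snd_conv
   proof (rule rank_order_cong)
    fix k :: nat assume k: "k \<in> {1..}"
    have "rank_limit k (rank_order x) = x k" using rl k by blast
    then show "hat_coord \<mu> (clamp01 (rank_limit k (rank_order x))) (\<xi> k) = hat_coord \<mu> (x k) (\<xi> k)"
     by (simp only: clamp01_id[OF unit_seq_range[OF x k]])
   qed
   have "measure (hat_version \<mu> (rank_order x)) A = measure ?S (hat_order \<mu> (rank_order x) -` A \<inter> space ?S)"
    unfolding hat_version_def by (rule measure_distr[OF measurable_hat_order1[OF q rank_order_in] A])
   also have "hat_order \<mu> (rank_order x) -` A \<inter> space ?S = {\<xi>\<in>space ?S. ?R (x, \<xi>) \<in> A}"
    by (auto simp only: o vimage_eq Int_iff mem_Collect_eq)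
   finally have m: "measure (hat_version \<mu> (rank_order x)) A = measure ?S {\<xi>\<in>space ?S. ?R (x, \<xi>) \<in> A}" .
   have p: "Pair x -` ?E = (if rank_order x \<in> B then {\<xi>\<in>space ?S. ?R (x, \<xi>) \<in> A} else {})"
    using x by (auto simp: space_pair_measure)
   show "measure ?S (Pair x -` ?E) = indicator B (rank_order x) * measure (hat_version \<mu> (rank_order x)) A"
    unfolding p m by simp
  qed
 qed
 also have "... = (\<integral>r. indicator B r * measure (hat_version \<mu> r) A \<partial>uniform_ordering)"
  unfolding uniform_ordering_eq by (rule integral_distr[OF measurable_rank_order_unit_seq mK, symmetric])
 finally show "hat_law \<mu> B A = (\<integral>r. indicator B r * measure (hat_version \<mu> r) A \<partial>uniform_ordering)" .
qed

lemma hat_version_jointly_measurable: "jointly_measurable_version hat_version"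
 unfolding jointly_measurable_version_def using measurable_hat_version hat_version_is_hat_kernel by blast

section \<open>The correspondence\<close>

text \<open>A backward step from \<open>b\<close> composes \<tau> with the ranks of
  \<open>b\<close>, and \<tau> has the law of the order of the integers 1, ..., n.\<close>

lemma pmf_step_represents:
 assumes P: "P \<in> space (prob_algebra Z_orderings)" and T: "perm_family T" and rep: "represents P T"
  and a: "a \<in> orderings {1..n}" and b: "b \<in> orderings {1..n}"
 shows "pmf (step T n b) a = measure P (pull_cell n (int \<circ> perm_of n b) a)"
proof -
 let ?\<beta> = "perm_of n b"
 have bp: "?\<beta> permutes {1..n}" by (rule perm_of'(1)[OF b])
 have im: "?\<beta> ` {1..n} \<subseteq> {1..n}" by (simp add: permutes_image[OF bp])
 have "pmf (step T n b) a = measure (T n) {\<tau>. perm_order n (\<tau> \<circ> ?\<beta>) = a}"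
  by (simp add: step_def pmf_map vimage_def)
 also have "{\<tau>. perm_order n (\<tau> \<circ> ?\<beta>) = a} = {\<tau>. perm_order n \<tau> \<in> {r. pull n ?\<beta> r = a}}"
  by (simp only: pull_perm_order[OF im] mem_Collect_eq)
 also have "measure (T n) \<dots> = measure P {t\<in>orderings UNIV. pull n int t \<in> {r. pull n ?\<beta> r = a}}"
  by (rule represents_measure[OF P T, symmetric]) (use rep in \<open>auto simp: represents_def inj_on_def\<close>)
 also have "... = measure P (pull_cell n (int \<circ> ?\<beta>) a)"
  by (simp only: pull_pull[OF im] mem_Collect_eq)
 finally show ?thesis .
qed

lemma I_invariant_mixture:
 assumes \<theta>: "\<theta> \<in> space (prob_algebra QU_space)" shows "I_invariant (\<theta> \<bind> P_mu)"
 unfolding I_invariant_def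
proof (intro conjI allI impI)
 have p: "prob_space (\<theta> \<bind> P_mu)" and s: "sets (\<theta> \<bind> P_mu) = sets Z_orderings"
  by (rule prob_space_bind'[OF \<theta> measurable_P_mu], rule sets_bind'[OF \<theta> measurable_P_mu])
 then show "\<theta> \<bind> P_mu \<in> space (prob_algebra Z_orderings)" by (simp add: space_prob_algebra)
 have s\<theta>: "sets \<theta> = sets QU_space" and p\<theta>: "prob_space \<theta>" using \<theta> by (simp_all add: space_prob_algebra)
 have q: "quasi_uniform \<mu>" if "\<mu> \<in> space \<theta>" for \<mu> using that sets_eq_imp_space_eq[OF s\<theta>] by (simp add: space_QU)
 fix f :: "int => int" assume f: "strict_mono f"
 have hm: "hat_map f \<in> Z_orderings \<rightarrow>\<^sub>M Z_orderings" by (rule measurable_hat_map[OF strict_mono_imp_inj_on[OF f]])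
 have K: "P_mu \<in> \<theta> \<rightarrow>\<^sub>M subprob_algebra Z_orderings"
  by (rule measurable_eq_sets[OF s\<theta> measurable_prob_algebraD[OF measurable_P_mu]])
 have "distr (\<theta> \<bind> P_mu) Z_orderings (hat_map f) = \<theta> \<bind> (%\<mu>. distr (P_mu \<mu>) Z_orderings (hat_map f))"
  by (rule distr_bind[OF K prob_space.not_empty[OF p\<theta>] hm])
 also have "... = \<theta> \<bind> P_mu"
  by (rule bind_cong[OF refl]) (use P_mu_invariant[OF q] f in \<open>simp add: I_invariant_def\<close>)
 finally show "distr (\<theta> \<bind> P_mu) Z_orderings (hat_map f) = \<theta> \<bind> P_mu" .
qed

lemma mixture_kernel:
 assumes \<theta>: "\<theta> \<in> space (prob_algebra QU_space)" and \<kappa>: "jointly_measurable_version \<kappa>"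
 shows "is_kernel (%r. \<theta> \<bind> (%\<mu>. \<kappa> \<mu> r))"
 unfolding is_kernel_def
proof (rule measurable_bind_prob_space2)
 show "(%_. \<theta>) \<in> N_orderings \<rightarrow>\<^sub>M prob_algebra QU_space" by (rule measurable_const[OF \<theta>])
 have j: "(%(\<mu>, r). \<kappa> \<mu> r) \<in> QU_space \<Otimes>\<^sub>M N_orderings \<rightarrow>\<^sub>M prob_algebra N_orderings"
  using \<kappa> by (simp add: jointly_measurable_version_def)
 show "(%(r, \<mu>). \<kappa> \<mu> r) \<in> N_orderings \<Otimes>\<^sub>M QU_space \<rightarrow>\<^sub>M prob_algebra N_orderings"
  using measurable_compose[OF measurable_pair_swap' j] by (simp add: split_beta')
qed

text \<open>Fubini exchanges the mixture with the integral over the uniform ordering. For each \<mu>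
  the inner integral is \<open>hat_law_cell\<close>, and integrating that value over \<theta> gives
  the mixed ordering law of the same event, up to \<open>fact n\<close>.\<close>

lemma mixture_corresponds:
 assumes \<theta>: "\<theta> \<in> space (prob_algebra QU_space)" and \<kappa>: "jointly_measurable_version \<kappa>"
  and T: "perm_family T" and rep: "represents (\<theta> \<bind> P_mu) T"
 shows "corresponds T (%r. \<theta> \<bind> (%\<mu>. \<kappa> \<mu> r))"
 unfolding corresponds_def
proof (intro conjI allI ballI mixture_kernel[OF \<theta> \<kappa>])
 fix n :: nat and a b assume a: "a \<in> orderings {1..n}" and b: "b \<in> orderings {1..n}"
 let ?A = "(cell n a)" and ?B = "(cell n b)"
 let ?L = uniform_ordering
 let ?T = "(pull_cell n (int \<circ> perm_of n b) a)"
 have AN: "?A \<in> sets N_orderings" and BN: "?B \<in> sets N_orderings" by (rule sets_restr)+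
 have s\<theta>: "sets \<theta> = sets QU_space" and p\<theta>: "prob_space \<theta>" using \<theta> by (simp_all add: space_prob_algebra)
 have sL: "sets ?L = sets N_orderings" and pL: "prob_space ?L" using uniform_ordering_prob by (simp_all add: space_prob_algebra)
 have spL: "space ?L = orderings {1..}" using sets_eq_imp_space_eq[OF sL] by simp
 interpret \<theta>: prob_space \<theta> by (rule p\<theta>)
 interpret L: prob_space ?L by (rule pL)
 interpret \<theta>L: pair_prob_space \<theta> ?L by standard
 have q: "quasi_uniform \<mu>" if "\<mu> \<in> space \<theta>" for \<mu> using that sets_eq_imp_space_eq[OF s\<theta>] by (simp add: space_QU)
 have j: "(%(\<mu>, r). \<kappa> \<mu> r) \<in> QU_space \<Otimes>\<^sub>M N_orderings \<rightarrow>\<^sub>M prob_algebra N_orderings"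
  and hk: "\<And>\<mu>. quasi_uniform \<mu> ==> is_hat_kernel (nu_upper \<mu>) (\<kappa> \<mu>)"
  using \<kappa> by (simp_all add: jointly_measurable_version_def)
 have sp: "sets (\<theta> \<Otimes>\<^sub>M ?L) = sets (QU_space \<Otimes>\<^sub>M N_orderings)" by (rule sets_pair_measure_cong[OF s\<theta> sL])
 have jm: "(%z. measure (\<kappa> (fst z) (snd z)) ?B) \<in> borel_measurable (\<theta> \<Otimes>\<^sub>M ?L)"
  using measurable_compose[OF measurable_eq_sets[OF sp j] measurable_measure_prob_algebra[OF BN]] unfolding split_beta' .
 have pk: "prob_space (\<kappa> \<mu> r)" if "\<mu> \<in> space \<theta>" "r \<in> space ?L" for \<mu> r
  using measurable_space[OF j, of "(\<mu>, r)"] that sets_eq_imp_space_eq[OF s\<theta>] spL by (simp add: space_pair_measure space_prob_algebra)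
 define f :: "real measure \<times> nat rel => real" where "f z = indicator ?A (snd z) * measure (\<kappa> (fst z) (snd z)) ?B" for z
 have AL: "?A \<in> sets ?L" using AN by (simp only: sL)
 have fi: "integrable (\<theta> \<Otimes>\<^sub>M ?L) f"
 proof (rule \<theta>L.P.integrable_const_bound[where B=1])
  show "AE z in \<theta> \<Otimes>\<^sub>M ?L. norm (f z) <= 1"
  proof (rule AE_I2)
   fix z assume "z \<in> space (\<theta> \<Otimes>\<^sub>M ?L)"
   then have "fst z \<in> space \<theta>" "snd z \<in> space ?L" by (auto simp: space_pair_measure)
   from prob_space.prob_le_1[OF pk[OF this], of ?B] show "norm (f z) <= 1" by (auto simp: f_def indicator_def)
  qed
  show "f \<in> borel_measurable (\<theta> \<Otimes>\<^sub>M ?L)"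
   unfolding f_def[abs_def] by (intro borel_measurable_times jm measurable_compose[OF measurable_snd borel_measurable_indicator[OF AL]])
 qed
 have mix: "measure (\<theta> \<bind> (%\<mu>. \<kappa> \<mu> r)) ?B = (\<integral>\<mu>. measure (\<kappa> \<mu> r) ?B \<partial>\<theta>)" if r: "r \<in> space ?L" for r
 proof (rule \<theta>.measure_bind[OF _ BN])
  have "(%\<mu>. \<kappa> \<mu> r) \<in> QU_space \<rightarrow>\<^sub>M prob_algebra N_orderings"
   using measurable_compose[OF measurable_Pair2'[of r N_orderings QU_space] j] r spL by simp
  then show "(%\<mu>. \<kappa> \<mu> r) \<in> \<theta> \<rightarrow>\<^sub>M subprob_algebra N_orderings"
   by (rule measurable_eq_sets[OF s\<theta> measurable_prob_algebraD])
 qed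
 have "(\<integral>r. indicator ?A r * measure (\<theta> \<bind> (%\<mu>. \<kappa> \<mu> r)) ?B \<partial>?L) = (\<integral>r. (\<integral>\<mu>. f (\<mu>, r) \<partial>\<theta>) \<partial>?L)"
  by (rule Bochner_Integration.integral_cong[OF refl]) (simp add: f_def mix)
 also have "... = (\<integral>\<mu>. (\<integral>r. f (\<mu>, r) \<partial>?L) \<partial>\<theta>)"
  using \<theta>L.Fubini_integral[of "%\<mu> r. f (\<mu>, r)"] fi by simp
 also have "... = (\<integral>\<mu>. measure (P_mu \<mu>) ?T / fact n \<partial>\<theta>)"
 proof (rule Bochner_Integration.integral_cong[OF refl])
  fix \<mu> assume m: "\<mu> \<in> space \<theta>"
  have "(\<integral>r. f (\<mu>, r) \<partial>?L) = hat_law \<mu> ?A ?B"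
   using hk[OF q[OF m], unfolded hat_kernel_iff[OF q[OF m]]] AN BN by (simp add: f_def)
  then show "(\<integral>r. f (\<mu>, r) \<partial>?L) = measure (P_mu \<mu>) ?T / fact n" by (simp only: hat_law_cell[OF q[OF m] a b])
 qed
 also have "... = (\<integral>\<mu>. measure (P_mu \<mu>) ?T \<partial>\<theta>) / fact n" by (rule integral_divide_zero)
 also have "(\<integral>\<mu>. measure (P_mu \<mu>) ?T \<partial>\<theta>) = measure (\<theta> \<bind> P_mu) ?T"
  by (rule \<theta>.measure_bind[OF measurable_eq_sets[OF s\<theta> measurable_prob_algebraD[OF measurable_P_mu]] sets_pull, symmetric])
 also have "... = pmf (step T n b) a"
  by (rule pmf_step_represents[OF _ T rep a b, symmetric]) (use I_invariant_mixture[OF \<theta>] in \<open>simp add: I_invariant_def\<close>)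
 finally show "(\<integral>r. indicator ?A r * measure (\<theta> \<bind> (%\<mu>. \<kappa> \<mu> r)) ?B \<partial>?L) = pmf (step T n b) a / fact n" .
qed

text \<open>Collecting all kernels that share their family with \<open>P\<close> avoids choosing one
  of them; \<open>shuffle_class_eq\<close> shows that they form one class of
  \<open>kernel_eq\<close>.\<close>

definition shuffle_class :: "int rel measure => (nat rel => nat rel measure) set" where
 "shuffle_class P = {K. \<exists>T. consistent T & represents P T & corresponds T K}"

lemma shuffle_class_eq:
 assumes T: "consistent T" and rep: "represents P T" and K: "corresponds T K"
 shows "shuffle_class P = kernel_eq `` {K}"
proof (intro set_eqI iffI)
 fix K' assume "K' \<in> shuffle_class P"
 then obtain T' where T': "consistent T'" "represents P T'" "corresponds T' K'" unfolding shuffle_class_def by blast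
 have "T' = T" by (rule ext) (rule represents_inj[OF consistent_set[OF T'(1)] consistent_set[OF T] T'(2) rep])
 then have "corresponds T K'" using T'(3) by simp
 then show "K' \<in> kernel_eq `` {K}" using corresponds_unique[OF K] by blast
next
 fix K' assume "K' \<in> kernel_eq `` {K}"
 then have "corresponds T K'" using corresponds_cong[OF K] by blast
 then show "K' \<in> shuffle_class P" unfolding shuffle_class_def using T rep by blast
qed

text \<open>Both sides are parametrised by consistent families. For injectivity, a common kernel
  determines the family by \<open>corresponds_inj\<close>, and the family determines the invariant
  law by \<open>represents_unique\<close>.\<close>

lemma bij_shuffle_class: "bij_betw shuffle_class {P. I_invariant P} ({K. type2_shuffle K} // kernel_eq)"
proof (rule bij_betwI')
 fix P Q assume "P \<in> {P. I_invariant P}" "Q \<in> {P. I_invariant P}"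
 then have P: "I_invariant P" and Q: "I_invariant Q" by simp_all
 show "shuffle_class P = shuffle_class Q \<longleftrightarrow> P = Q"
 proof
  assume eq: "shuffle_class P = shuffle_class Q"
  obtain T where T: "consistent T" "represents P T" by (rule I_invariant_represents[OF P])
  obtain K where K: "corresponds T K" by (rule exists_corresponds[OF T(1)])
  have "K \<in> shuffle_class P" unfolding shuffle_class_def using T K by blast
  then have "K \<in> shuffle_class Q" by (simp only: eq)
  then obtain T' where T': "consistent T'" "represents Q T'" "corresponds T' K" unfolding shuffle_class_def by blast
  have "T' = T" by (rule ext) (rule corresponds_inj[OF consistent_set[OF T'(1)] consistent_set[OF T(1)] T'(3) K])
  then show "P = Q" using T'(2) by (intro represents_unique[OF P Q T(2)]) simp
 qed simp
next
 fix P assume "P \<in> {P. I_invariant P}"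
 then have P: "I_invariant P" by simp
 obtain T where T: "consistent T" "represents P T" by (rule I_invariant_represents[OF P])
 obtain K where K: "corresponds T K" by (rule exists_corresponds[OF T(1)])
 have "K \<in> {K. type2_shuffle K}" using corresponds_type2_shuffle[OF T(1) K] by simp
 then show "shuffle_class P \<in> {K. type2_shuffle K} // kernel_eq"
  unfolding shuffle_class_eq[OF T K] by (rule quotientI)
next
 fix C assume "C \<in> {K. type2_shuffle K} // kernel_eq"
 then obtain K where C: "C = kernel_eq `` {K}" and K: "type2_shuffle K" by (auto elim: quotientE)
 obtain T where T: "consistent T" "corresponds T K" by (rule type2_shuffle_corresponds[OF K])
 obtain P where P: "I_invariant P" "represents P T" by (rule exists_represented[OF T(1)])
 have "C = shuffle_class P" unfolding C by (rule shuffle_class_eq[OF T(1) P(2) T(2), symmetric])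
 then show "\<exists>P\<in>{P. I_invariant P}. C = shuffle_class P" using P(1) by blast
qed

theorem proposition4p9:
  shows "(\<exists>\<kappa>. jointly_measurable_version \<kappa>) \<and>
    (\<exists>\<Phi>. bij_betw \<Phi> {P. I_invariant P} ({K. type2_shuffle K} // kernel_eq) \<and>
      (\<forall>\<theta> \<kappa>. \<theta> \<in> space (prob_algebra QU_space) \<longrightarrow> jointly_measurable_version \<kappa> \<longrightarrow>
         I_invariant (\<theta> \<bind> P_mu) \<and>
         type2_shuffle (\<lambda>r. \<theta> \<bind> (\<lambda>\<mu>. \<kappa> \<mu> r)) \<and>
         \<Phi> (\<theta> \<bind> P_mu) = kernel_eq `` {\<lambda>r. \<theta> \<bind> (\<lambda>\<mu>. \<kappa> \<mu> r)}))"
proof (intro conjI exI[of _ hat_version] exI[of _ shuffle_class] hat_version_jointly_measurable bij_shuffle_class allI impI)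
 fix \<theta> \<kappa> assume \<theta>: "\<theta> \<in> space (prob_algebra QU_space)" and \<kappa>: "jointly_measurable_version \<kappa>"
 show I: "I_invariant (\<theta> \<bind> P_mu)" by (rule I_invariant_mixture[OF \<theta>])
 obtain T where T: "consistent T" "represents (\<theta> \<bind> P_mu) T" by (rule I_invariant_represents[OF I])
 have K: "corresponds T (%r. \<theta> \<bind> (%\<mu>. \<kappa> \<mu> r))" by (rule mixture_corresponds[OF \<theta> \<kappa> consistent_set[OF T(1)] T(2)])
 show "type2_shuffle (%r. \<theta> \<bind> (%\<mu>. \<kappa> \<mu> r))" by (rule corresponds_type2_shuffle[OF T(1) K])
 show "shuffle_class (\<theta> \<bind> P_mu) = kernel_eq `` {%r. \<theta> \<bind> (%\<mu>. \<kappa> \<mu> r)}" by (rule shuffle_class_eq[OF T K])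
qed

end
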